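(* Let $k$ be any natural number and $H$ any positive real number. Then $$\sum_{p\le x}|c_{p-1}(k)|=A\prod_{q\mid k}\Big(1+\frac{\nu_q(k)(q-1)^2}{q^2-q-1}\Big)\mathrm{Li}(x)+O\Big(\frac{x}{\log^Hx}\Big),$$ where $p$ runs over primes, $q$ over primes dividing $k$, and the implied constant depends at most on $k$ and $H$.
   Context: $c_n(m)=\sum_{1\le j\le n,\,(j,n)=1}e^{2\pi ijm/n}$ is the Ramanujan sum; $\nu_q(k)$ is the exponent of the prime $q$ in $k$; $A=\prod_p(1-\frac1{p(p-1)})$ is Artin's constant; $\mathrm{Li}(x)=\int_2^x dt/\log t$. *)

theory Defs
  imports
    "HOL-Analysis.Analysis"
    "HOL-Library.Landau_Symbols"
    "HOL-Computational_Algebra.Primes"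
begin

definition ramanujan_sum :: "nat \<Rightarrow> nat \<Rightarrow> complex" where
  "ramanujan_sum n m =
     (\<Sum>j | 1 \<le> j \<and> j \<le> n \<and> coprime j n.
        exp (2 * of_real pi * \<i> * of_nat j * of_nat m / of_nat n))"

text \<open>The product over primes is written as a product over all naturals with
  factor 1 at non-primes; no factor vanishes.\<close>

definition artin_constant :: real where
  "artin_constant =
     (\<Prod>p. if prime p then 1 - 1 / (real p * (real p - 1)) else 1)"

definition Li :: "real \<Rightarrow> real" where
  "Li x = integral {2..x} (\<lambda>t. 1 / ln t)"

end

theory Submission
  imports
    Defs
    "HOL-Number_Theory.Number_Theory"
    "HOL-Complex_Analysis.Complex_Analysis"
    "HOL-Probability.Probability"
    "HOL-Real_Asymp.Real_Asymp"
begin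

text \<open>Write \<open>|c\<^sub>n(k)| = \<Sum>\<^bsub>d | n\<^esub> h(d)\<close>. The function \<open>h\<close> is multiplicative with
  \<open>h(p) = 0\<close> for \<open>p\<close> not dividing \<open>k\<close>, so that \<open>\<Sum> |h(d)| d\<^bsup>-2/3\<^esup>\<close> converges, and
  \<open>\<Sum> h(d)/\<phi>(d)\<close> has the Euler product of the theorem. It remains to count the primes
  \<open>p \<equiv> 1 (mod d)\<close> with \<open>d\<close> up to a power of \<open>log x\<close>, with an error \<open>O(d\<^sup>2 x / log\<^sup>m x)\<close>;
  larger \<open>d\<close> are negligible by the trivial bound \<open>x/d\<close>.

  The count avoids zero-free regions. Siegel's theorem at \<open>s = 1\<close> (by Estermann's argument) and
  the 3-4-1 inequality bound \<open>1/L(s,\<chi>)\<close> on \<open>1 < Re s \<le> 2\<close> by arbitrarily small powers of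
  \<open>q(|Im s| + 2)\<close>. Hence every derivative of \<open>L'/L\<close> is
  \<open>O((q(|Im s| + 2))\<^bsup>1/2\<^esup>)\<close> uniformly up to the line \<open>Re s = 1\<close>. Fourier inversion with the weight \<open>log(x/n)\<close>
  on \<open>Re s = 1 + 1/log x\<close> bounds the sums of \<open>\<Lambda>(n)\<chi>(n) log\<^sup>r n log(x/n)\<close> by \<open>O(q x)\<close>
  for every \<open>r\<close>; removing the factor \<open>log\<^sup>r n\<close> gains an arbitrary power of \<open>log x\<close>.\<close>

section \<open>Dirichlet characters\<close>

text \<open>Only points with Re s > 1 enter the inversion integral, so the saving cannot come from
  moving a contour: on Re s = 1 + 1/log x the factor x^s already has size x. It comes from
  differentiating. If every derivative of L'/L stays bounded up to the line, the sum with weight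
  log^r n has size x, although termwise it is of size x log^r x, and dividing the weight out again
  leaves a gain of powers of log x. Each derivative costs one more factor 1/L, so 1/L must be
  bounded by arbitrarily small powers; the power is fixed after r, and any total exponent below 1
  survives against the kernel 1/s^2. The obstacle is a real character near t = 0: its square is
  principal, the 3-4-1 inequality meets the pole of zeta, and Siegel's theorem takes over. It makes
  the constants ineffective but keeps the dependence on the modulus polynomial, which suffices for d
  up to a power of log x. The exponent 2/3 lies between 1/2, forced by h(p^2) = -1 for p not
  dividing k, and 3/4, the exponent of an elementary lower bound for the totient.\<close>

definition dchar :: "nat \<Rightarrow> (nat \<Rightarrow> complex) \<Rightarrow> bool" where
  "dchar q \<phi> \<longleftrightarrow> q > 0 \<and> (\<forall>a b. \<phi> (a * b) = \<phi> a * \<phi> b) \<and>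
     (\<forall>a. \<phi> (a mod q) = \<phi> a) \<and> (\<forall>a. \<phi> a \<noteq> 0 \<longleftrightarrow> coprime a q)"

definition principal_char :: "nat \<Rightarrow> nat \<Rightarrow> complex" where
  "principal_char q a = (if coprime a q then 1 else 0)"

text \<open>Unnormalised projection onto the functions with f (a * x) = w * f x, where w = exp(2 pi
  i/r) raised to the given index. The exponent \<open>r - j\<close> stands for the inverse of a^j,
  since a^r = 1 modulo q in every use.\<close>

definition eigenproj :: "nat \<Rightarrow> nat \<Rightarrow> nat \<Rightarrow> (nat \<Rightarrow> complex) \<Rightarrow> nat \<Rightarrow> complex" where
  "eigenproj r a i f x =
     (\<Sum>j<r. exp (2 * of_real pi * \<i> * of_nat i / of_nat r) ^ j * f (a ^ (r - j) * x))"

text \<open>Multiplying x by a shifts the summation index by one; the two boundary terms agree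
  because w^r = 1 and a^r = 1 modulo q.\<close>

lemma eigenproj_eigen:
  assumes per: "\<And>x y. [x = y] (mod q) \<Longrightarrow> f x = f y" and a: "[a ^ r = 1] (mod q)" and r: "r > 0"
  shows "eigenproj r a i f (a * x) = exp (2 * of_real pi * \<i> * of_nat i / of_nat r) * eigenproj r a i f x"
proof -
  define w where "w = exp (2 * of_real pi * \<i> * of_nat i / of_nat r :: complex)"
  have wr: "w ^ r = 1"
  proof -
    have "w ^ r = exp (of_nat r * (2 * of_real pi * \<i> * of_nat i / of_nat r))"
      unfolding w_def by (metis exp_of_nat_mult)
    also have "of_nat r * (2 * of_real pi * \<i> * of_nat i / of_nat r :: complex) = 2 * of_real pi * \<i> * of_nat i"
      using r by simp
    also have "exp \<dots> = 1"
      using exp_integer_2pi[of "of_nat i"] by (simp add: algebra_simps)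
    finally show ?thesis .
  qed
  define g where "g = (\<lambda>j. w ^ j * f (a ^ (r + 1 - j) * x))"
  have "eigenproj r a i f (a * x) = (\<Sum>j<r. g j)"
    unfolding eigenproj_def w_def[symmetric] g_def
  proof (rule sum.cong)
    fix j assume "j \<in> {..<r}"
    hence "a ^ (r - j) * (a * x) = a ^ (r + 1 - j) * x"
      by (simp add: Suc_diff_le mult_ac)
    thus "w ^ j * f (a ^ (r - j) * (a * x)) = w ^ j * f (a ^ (r + 1 - j) * x)" by (simp only:)
  qed simp
  also have "(\<Sum>j<r. g j) + g r = g 0 + (\<Sum>j<r. g (Suc j))"
    by (metis sum.lessThan_Suc sum.lessThan_Suc_shift)
  moreover have "g r = g 0"
  proof -
    have "[a ^ r * (a * x) = 1 * (a * x)] (mod q)" using a by (rule cong_scalar_right)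
    hence "f (a * x) = f (a ^ r * (a * x))" using per by (metis mult_1 cong_sym)
    thus ?thesis unfolding g_def using wr by (simp add: mult_ac)
  qed
  ultimately have "eigenproj r a i f (a * x) = (\<Sum>j<r. g (Suc j))" by simp
  also have "\<dots> = w * eigenproj r a i f x"
    unfolding eigenproj_def w_def[symmetric] g_def by (simp add: sum_distrib_left mult_ac)
  finally show ?thesis unfolding w_def .
qed

text \<open>Orthogonality of roots of unity kills every j except 0. So the eigencomponents of f add
  up to r times f, and a nonzero f has a nonzero component.\<close>

lemma sum_eigenproj:
  assumes per: "\<And>x y. [x = y] (mod q) \<Longrightarrow> f x = f y" and a: "[a ^ r = 1] (mod q)" and r: "r > 0"
  shows "(\<Sum>i<r. eigenproj r a i f x) = of_nat r * f x"
proof -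
  define w where "w = (\<lambda>i. exp (2 * of_real pi * \<i> * of_nat i / of_nat r :: complex))"
  have *: "(\<Sum>i<r. w i ^ j) = (if j = 0 then of_nat r else 0)" if "j < r" for j
  proof (cases "j = 0")
    case False
    have wij: "w i ^ j = w j ^ i" for i
      unfolding w_def by (subst (1 2) exp_of_nat_mult[symmetric]) (simp add: algebra_simps)
    have "w j \<noteq> 1"
    proof
      assume "w j = 1"
      hence "exp (2 * of_real pi * \<i> * of_nat j / of_nat r) = (1::complex)" by (simp add: w_def)
      hence "r dvd j" using complex_root_unity_eq_1[of r j] r by simp
      thus False using that False by (simp add: nat_dvd_not_less)
    qed
    moreover have "w j ^ r = 1"
      unfolding w_def by (subst exp_of_nat_mult[symmetric])
        (use r exp_integer_2pi[of "of_nat j"] in \<open>simp add: algebra_simps\<close>)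
    ultimately have "(\<Sum>i<r. w j ^ i) = 0"
      by (subst geometric_sum) auto
    thus ?thesis using False by (simp add: wij)
  qed simp
  have "(\<Sum>i<r. eigenproj r a i f x) = (\<Sum>j<r. (\<Sum>i<r. w i ^ j) * f (a ^ (r - j) * x))"
    unfolding eigenproj_def w_def sum_distrib_right by (rule sum.swap)
  also have "\<dots> = (\<Sum>j<r. if j = 0 then of_nat r * f (a ^ r * x) else 0)"
    by (intro sum.cong) (auto simp: *)
  also have "\<dots> = of_nat r * f (a ^ r * x)" using r by (simp add: sum.delta)
  also have "[a ^ r * x = 1 * x] (mod q)" using a by (rule cong_scalar_right)
  hence "f (a ^ r * x) = f x" using per by (metis mult_1)
  finally show ?thesis .
qed

lemma eigenproj_per:
  assumes per: "\<And>x y. [x = y] (mod q) \<Longrightarrow> f x = f y" and "[x = y] (mod q)"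
  shows "eigenproj r a i f x = eigenproj r a i f y"
  unfolding eigenproj_def
  by (intro sum.cong refl arg_cong2[of _ _ _ _ "(*)"] per) (use assms(2) in \<open>auto intro: cong_scalar_left\<close>)

text \<open>Translations commute, so an eigenvalue already arranged for b survives the projection
  for a. This drives the induction over the residues.\<close>

lemma eigenproj_commute:
  assumes "\<And>x. f (b * x) = z * f x"
  shows "eigenproj r a i f (b * x) = z * eigenproj r a i f x"
proof -
  have "f (a ^ k * (b * x)) = z * f (a ^ k * x)" for k
    using assms[of "a ^ k * x"] by (simp add: mult_ac)
  thus ?thesis unfolding eigenproj_def by (simp add: sum_distrib_left mult_ac)
qed

lemma cong_power_totient:
  fixes a q :: nat
  assumes "coprime a q" shows "[a ^ totient q = 1] (mod q)"
  using euler_theorem[OF assms] .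

text \<open>A character separating \<open>n\<close> from \<open>1\<close> is read off a simultaneous eigenfunction of all
  translations \<open>f x \<mapsto> f (a * x)\<close>, obtained by projecting the indicator of the class of \<open>1\<close>.\<close>

lemma simultaneous_eigenfunction:
  fixes q n :: nat
  assumes q: "q > 0" and n: "coprime n q" "\<not> [n = 1] (mod q)"
    and A: "finite A" "\<And>a. a \<in> A \<Longrightarrow> coprime a q"
  shows "\<exists>f z0. (\<forall>x y. [x = y] (mod q) \<longrightarrow> f x = f y) \<and> (\<forall>x. \<not> coprime x q \<longrightarrow> f x = 0) \<and>
     (\<exists>x. f x \<noteq> 0) \<and> (\<forall>x. f (n * x) = z0 * f x) \<and> z0 \<noteq> 1 \<and>
     (\<forall>a\<in>A. \<exists>z. \<forall>x. f (a * x) = z * (f x :: complex))"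
  using A
proof (induction A rule: finite_induct)
  case empty
  define r where "r = totient q"
  have r: "r > 0" using q by (simp add: r_def)
  have nr: "[n ^ r = 1] (mod q)" using cong_power_totient[OF n(1)] by (simp add: r_def)
  define f where "f = (\<lambda>x. if [x = 1] (mod q) then 1 else 0 :: complex)"
  have per: "f x = f y" if "[x = y] (mod q)" for x y
    using that unfolding f_def by (auto intro: cong_trans cong_sym)
  have f0: "f x = 0" if "\<not> coprime x q" for x
    using that cong_imp_coprime[of 1 x q] unfolding f_def by (auto dest: cong_sym)
  \<comment> \<open>If only the eigenvalue 1 occurred, f would be invariant under translation by n,
    although f 1 = 1 and f n = 0.\<close>
  have "\<exists>i<r. i \<noteq> 0 \<and> (\<exists>x. eigenproj r n i f x \<noteq> 0)"
  proof (rule ccontr)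
    assume "\<not> ?thesis"
    hence z: "eigenproj r n i f x = 0" if "i < r" "i \<noteq> 0" for i x using that by blast
    have e: "of_nat r * f x = eigenproj r n 0 f x" for x
    proof -
      have "of_nat r * f x = (\<Sum>i<r. eigenproj r n i f x)"
        using sum_eigenproj[OF per nr r] by simp
      also have "\<dots> = (\<Sum>i<r. if i = 0 then eigenproj r n 0 f x else 0)"
        by (intro sum.cong) (auto simp: z)
      finally show ?thesis using r by simp
    qed
    have "of_nat r * f (n * 1) = of_nat r * f 1"
      unfolding e using eigenproj_eigen[OF per nr r, where i = 0 and x = 1] by simp
    hence "f (n * 1) = f 1" using r by simp
    thus False using n(2) by (simp add: f_def)
  qed
  then obtain i where i: "i < r" "i \<noteq> 0" "\<exists>x. eigenproj r n i f x \<noteq> 0" by blast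
  define g where "g = eigenproj r n i f"
  define z0 where "z0 = exp (2 * of_real pi * \<i> * of_nat i / of_nat r :: complex)"
  have z0: "z0 \<noteq> 1"
  proof
    assume "z0 = 1"
    hence "r dvd i" using complex_root_unity_eq_1[of r i] r by (simp add: z0_def)
    thus False using i by (simp add: nat_dvd_not_less)
  qed
  have "g x = 0" if "\<not> coprime x q" for x
    unfolding g_def eigenproj_def using that by (intro sum.neutral ballI) (auto simp: f0)
  moreover have "g x = g y" if "[x = y] (mod q)" for x y
    unfolding g_def by (rule eigenproj_per[of q f, OF per that])
  moreover have "g (n * x) = z0 * g x" for x
    unfolding g_def z0_def by (rule eigenproj_eigen[OF per nr r])
  ultimately show ?case using z0 i(3) unfolding g_def[symmetric] by blast
next
  case (insert a A)
  define r where "r = totient q"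
  have r: "r > 0" using q by (simp add: r_def)
  have a: "coprime a q" using insert by auto
  have ar: "[a ^ r = 1] (mod q)" using cong_power_totient[OF a] by (simp add: r_def)
  have IH: "\<exists>f z0. (\<forall>x y. [x = y] (mod q) \<longrightarrow> f x = f y) \<and> (\<forall>x. \<not> coprime x q \<longrightarrow> f x = 0) \<and>
     (\<exists>x. f x \<noteq> 0) \<and> (\<forall>x. f (n * x) = z0 * f x) \<and> z0 \<noteq> 1 \<and>
     (\<forall>a\<in>A. \<exists>z. \<forall>x. f (a * x) = z * (f x :: complex))"
    by (rule insert.IH) (use insert.prems in auto)
  obtain f z0 where f: "\<And>x y. [x = y] (mod q) \<Longrightarrow> f x = f y" "\<And>x. \<not> coprime x q \<Longrightarrow> f x = 0"
     "\<exists>x. f x \<noteq> 0" "\<And>x. f (n * x) = z0 * f x" "z0 \<noteq> 1"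
     "\<And>a. a \<in> A \<Longrightarrow> \<exists>z. \<forall>x. f (a * x) = z * (f x :: complex)"
    using IH by blast
  obtain x0 where x0: "f x0 \<noteq> 0" using f(3) by blast
  have "\<exists>i<r. eigenproj r a i f x0 \<noteq> 0"
  proof (rule ccontr)
    assume "\<not> ?thesis"
    hence "(\<Sum>i<r. eigenproj r a i f x0) = 0" by simp
    thus False using sum_eigenproj[OF f(1) ar r, where x = x0] x0 r by simp
  qed
  then obtain i where i: "i < r" "eigenproj r a i f x0 \<noteq> 0" by blast
  define g where "g = eigenproj r a i f"
  have "g x = 0" if "\<not> coprime x q" for x
    unfolding g_def eigenproj_def using that by (intro sum.neutral ballI) (auto simp: f(2))
  moreover have "g x = g y" if "[x = y] (mod q)" for x y
    unfolding g_def by (rule eigenproj_per[of q f, OF f(1) that])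
  moreover have "g (n * x) = z0 * g x" for x
    unfolding g_def by (rule eigenproj_commute) (rule f(4))
  moreover have "\<exists>z. \<forall>x. g (b * x) = z * g x" if bA: "b \<in> A" for b
  proof -
    obtain z where "\<forall>x. f (b * x) = z * f x" using f(6)[OF bA] by blast
    thus ?thesis unfolding g_def by (intro exI[of _ z] allI eigenproj_commute) auto
  qed
  moreover have "\<exists>z. \<forall>x. g (a * x) = z * g x"
    unfolding g_def using eigenproj_eigen[of q f a r i, OF f(1) ar r] by blast
  moreover have "\<exists>x. g x \<noteq> 0" using i(2) unfolding g_def by blast
  ultimately show ?case using f(5) by blast
qed

text \<open>With A the set of all residues prime to q, each a acts on the simultaneous eigenfunction
  by the scalar \<open>f (a * x0) / f x0\<close>. This eigenvalue is multiplicative in a, and for n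
  it is z0, which differs from 1.\<close>

lemma dchar_separates:
  fixes q n :: nat
  assumes q: "q > 0" and n: "coprime n q" "\<not> [n = 1] (mod q)"
  shows "\<exists>\<phi>. dchar q \<phi> \<and> \<phi> n \<noteq> 1"
proof -
  define A where "A = {a. a < q \<and> coprime a q}"
  have A: "finite A" "\<And>a. a \<in> A \<Longrightarrow> coprime a q" by (auto simp: A_def)
  obtain f z0 where f: "\<And>x y. [x = y] (mod q) \<Longrightarrow> f x = f y" "\<And>x. \<not> coprime x q \<Longrightarrow> f x = 0"
     "\<exists>x. f x \<noteq> 0" "\<And>x. f (n * x) = z0 * f x" "z0 \<noteq> 1"
     "\<And>a. a \<in> A \<Longrightarrow> \<exists>z. \<forall>x. f (a * x) = z * (f x :: complex)"
    using simultaneous_eigenfunction[OF q n A] by blast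
  obtain x0 where x0: "f x0 \<noteq> 0" using f(3) by blast
  have x0c: "coprime x0 q" using f(2) x0 by blast
  define \<phi> where "\<phi> = (\<lambda>a. f (a * x0) / f x0)"
  have eig: "f (a * x) = \<phi> a * f x" if "coprime a q" for a x
  proof -
    have "a mod q \<in> A" using that q by (auto simp: A_def coprime_mod_left_iff)
    then obtain z where z: "\<And>x. f (a mod q * x) = z * f x" using f(6) by blast
    have eq: "f (a mod q * x) = f (a * x)" for x
      by (intro f(1) cong_scalar_right) simp
    have "\<phi> a = z" using z[of x0] x0 by (simp add: \<phi>_def eq)
    thus ?thesis using z[of x] by (simp add: eq)
  qed
  have mult: "\<phi> (a * b) = \<phi> a * \<phi> b" for a b
  proof (cases "coprime a q")
    case True
    have "f (a * (b * x0)) = \<phi> a * f (b * x0)" by (rule eig[OF True])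
    thus ?thesis by (simp add: \<phi>_def mult_ac)
  next
    case False
    hence "f (a * x0) = 0" "f (a * b * x0) = 0" by (auto intro!: f(2))
    thus ?thesis by (simp add: \<phi>_def)
  qed
  have "\<phi> a \<noteq> 0 \<longleftrightarrow> coprime a q" for a
  proof
    assume "coprime a q"
    have pow: "\<phi> (a ^ k) = \<phi> a ^ k" for k
      by (induction k) (auto simp: mult, simp add: \<phi>_def x0)
    have "[a ^ totient q * x0 = 1 * x0] (mod q)"
      by (intro cong_scalar_right cong_power_totient) fact
    hence "\<phi> (a ^ totient q) = 1" using f(1) x0 by (simp add: \<phi>_def)
    hence "\<phi> a ^ totient q = 1" by (simp add: pow)
    thus "\<phi> a \<noteq> 0" using q by (auto simp: power_0_left split: if_splits)
  next
    assume "\<phi> a \<noteq> 0" thus "coprime a q" using f(2)[of "a * x0"] by (auto simp: \<phi>_def)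
  qed
  moreover have "\<phi> (a mod q) = \<phi> a" for a
    unfolding \<phi>_def by (intro arg_cong2[of _ _ _ _ "(/)"] f(1) cong_scalar_right) auto
  ultimately have "dchar q \<phi>" using mult q by (auto simp: dchar_def)
  moreover have "\<phi> n \<noteq> 1" using f(4)[of x0] f(5) x0 by (simp add: \<phi>_def)
  ultimately show ?thesis by blast
qed

lemma dchar_pos: "dchar q \<phi> \<Longrightarrow> q > 0"
  and dchar_mult: "dchar q \<phi> \<Longrightarrow> \<phi> (a * b) = \<phi> a * \<phi> b"
  and dchar_mod: "dchar q \<phi> \<Longrightarrow> \<phi> (a mod q) = \<phi> a"
  and dchar_eq_0_iff: "dchar q \<phi> \<Longrightarrow> \<phi> a = 0 \<longleftrightarrow> \<not> coprime a q"
  by (auto simp: dchar_def)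

lemma dchar_cong: "dchar q \<phi> \<Longrightarrow> [a = b] (mod q) \<Longrightarrow> \<phi> a = \<phi> b"
  by (metis cong_def dchar_mod)

lemma dchar_1: "dchar q \<phi> \<Longrightarrow> \<phi> 1 = 1"
  using dchar_mult[of q \<phi> 1 1] dchar_eq_0_iff[of q \<phi> 1] by simp

lemma dchar_power: "dchar q \<phi> \<Longrightarrow> \<phi> (a ^ k) = \<phi> a ^ k"
  using dchar_1 by (induction k) (auto simp: dchar_mult)

lemma dchar_root_of_unity: "dchar q \<phi> \<Longrightarrow> coprime a q \<Longrightarrow> \<phi> a ^ totient q = 1"
  using dchar_power[of q \<phi> a "totient q"] dchar_cong[OF _ cong_power_totient, of q \<phi> a] dchar_1[of q \<phi>]
  by auto

lemma norm_dchar: "dchar q \<phi> \<Longrightarrow> norm (\<phi> a) = (if coprime a q then 1 else 0)"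
proof (cases "coprime a q")
  case True
  assume \<phi>: "dchar q \<phi>"
  have "norm (\<phi> a) ^ totient q = 1"
    using dchar_root_of_unity[OF \<phi> True] by (metis norm_one norm_power)
  thus ?thesis using True dchar_pos[OF \<phi>] power_eq_1_iff[of "norm (\<phi> a)" "totient q"] by auto
qed (auto simp: dchar_eq_0_iff)

lemma norm_dchar_le: "dchar q \<phi> \<Longrightarrow> norm (\<phi> a) \<le> 1"
  by (simp add: norm_dchar)

lemma dchar_principal: "q > 0 \<Longrightarrow> dchar q (principal_char q)"
  by (auto simp: dchar_def principal_char_def)

lemma dchar_prod:
  assumes "dchar q \<phi>" "dchar r \<psi>"
  shows "dchar (q * r) (\<lambda>n. \<phi> n * \<psi> n)"
proof -
  have "\<phi> (a mod (q * r)) = \<phi> a" for a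
    by (metis assms(1) dchar_mod mod_mod_cancel dvd_triv_left)
  moreover have "\<psi> (a mod (q * r)) = \<psi> a" for a
    by (metis assms(2) dchar_mod mod_mod_cancel dvd_triv_right)
  ultimately show ?thesis using assms by (auto simp: dchar_def)
qed

lemma dchar_mult_same:
  assumes "dchar q \<phi>" "dchar q \<psi>"
  shows "dchar q (\<lambda>n. \<phi> n * \<psi> n)"
  using assms by (auto simp: dchar_def)

text \<open>A character is determined by its values below q, and each value is 0 or a root of unity
  of order dividing \<open>totient q\<close>.\<close>

lemma finite_dchars: "finite {\<phi>. dchar q \<phi>}"
proof (cases "q = 0")
  case False
  define R where "R = insert 0 {z::complex. z ^ totient q = 1}"
  have R: "finite R" unfolding R_def
    using finite_roots_unity[of "totient q"] False by (auto simp: Suc_le_eq)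
  have "finite (PiE {..<q} (\<lambda>_. R))" using R by (intro finite_PiE) auto
  moreover have "(\<lambda>\<phi>. restrict \<phi> {..<q}) ` {\<phi>. dchar q \<phi>} \<subseteq> PiE {..<q} (\<lambda>_. R)"
  proof (clarify)
    fix \<phi> :: "nat \<Rightarrow> complex" assume \<phi>: "dchar q \<phi>"
    have "\<phi> a \<in> R" for a
      using dchar_root_of_unity[OF \<phi>, of a] dchar_eq_0_iff[OF \<phi>, of a] by (auto simp: R_def)
    thus "restrict \<phi> {..<q} \<in> PiE {..<q} (\<lambda>_. R)" by simp
  qed
  moreover have "inj_on (\<lambda>\<phi>. restrict \<phi> {..<q}) {\<phi>. dchar q \<phi>}"
  proof (rule inj_onI, rule ext)
    fix \<phi> \<psi> :: "nat \<Rightarrow> complex" and a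
    assume *: "\<phi> \<in> {\<phi>. dchar q \<phi>}" "\<psi> \<in> {\<phi>. dchar q \<phi>}" "restrict \<phi> {..<q} = restrict \<psi> {..<q}"
    have "\<phi> (a mod q) = \<psi> (a mod q)" using *(3) False by (metis lessThan_iff mod_less_divisor neq0_conv restrict_apply')
    thus "\<phi> a = \<psi> a" using *(1,2) by (simp add: dchar_mod)
  qed
  ultimately show ?thesis by (metis (no_types) finite_imageD finite_subset)
qed (auto simp: dchar_def)

section \<open>Orthogonality relations\<close>

lemma sum_dchar_period:
  assumes \<phi>: "dchar q \<phi>" and np: "\<phi> \<noteq> principal_char q"
  shows "(\<Sum>a<q. \<phi> a) = 0"
proof -
  obtain b where b: "coprime b q" "\<phi> b \<noteq> 1"
  proof -
    obtain b where "\<phi> b \<noteq> principal_char q b" using np by blast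
    thus thesis using dchar_eq_0_iff[OF \<phi>, of b] by (intro that[of b]) (auto simp: principal_char_def split: if_splits)
  qed
  have q: "q > 0" using dchar_pos[OF \<phi>] .
  have inj: "inj_on (\<lambda>a. b * a mod q) {..<q}"
  proof (rule inj_onI)
    fix x y assume *: "x \<in> {..<q}" "y \<in> {..<q}" "b * x mod q = b * y mod q"
    hence "[b * x = b * y] (mod q)" by (simp add: cong_def)
    hence "[x = y] (mod q)" using b(1) cong_mult_lcancel_nat[of b q x y] by simp
    thus "x = y" using * by (simp add: cong_def)
  qed
  have "(\<lambda>a. b * a mod q) ` {..<q} = {..<q}"
    by (rule endo_inj_surj) (use q inj in auto)
  hence "(\<Sum>a<q. \<phi> a) = (\<Sum>a<q. \<phi> (b * a mod q))"
    using sum.reindex[OF inj, of \<phi>] by simp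
  also have "\<dots> = \<phi> b * (\<Sum>a<q. \<phi> a)"
    by (simp add: dchar_mod[OF \<phi>] dchar_mult[OF \<phi>] sum_distrib_left)
  finally show ?thesis using b(2) by auto
qed

lemma sum_principal_period: "q > 0 \<Longrightarrow> (\<Sum>a<q. principal_char q a) = of_nat (totient q)"
proof -
  assume q: "q > 0"
  have "(\<Sum>a<q. principal_char q a) = of_nat (card {a. a < q \<and> coprime a q})"
    unfolding principal_char_def by (subst sum.If_cases) (auto simp: Int_def)
  \<comment> \<open>\<open>totatives q\<close> takes representatives from 1 to q while the sum runs
    over a < q; the two sets differ only for q = 1, and reduction modulo q reconciles them.\<close>
  also have "{a. a < q \<and> coprime a q} = (\<lambda>a. a mod q) ` totatives q"
  proof (cases "q = 1")
    case False
    hence "q > 1" using q by simp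
    have "totatives q = {a. a < q \<and> coprime a q}"
      using \<open>q > 1\<close> by (auto simp: totatives_def intro: Nat.gr0I le_neq_implies_less)
    thus ?thesis by simp
  qed auto
  also have "card \<dots> = totient q"
    unfolding totient_def
  proof (rule card_image, rule inj_onI)
    fix x y assume "x \<in> totatives q" "y \<in> totatives q" "x mod q = y mod q"
    thus "x = y" by (cases "x = q"; cases "y = q") (auto simp: totatives_def le_less)
  qed
  finally show ?thesis .
qed

text \<open>Multiplication by a character \<psi> with \<psi> n \<noteq> 1 permutes the characters
  and multiplies the sum by \<psi> n.\<close>

lemma sum_over_dchars_eq_0:
  assumes q: "q > 0" and n: "coprime n q" "\<not> [n = 1] (mod q)"
  shows "(\<Sum>\<phi> | dchar q \<phi>. \<phi> n) = 0"
proof -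
  obtain \<psi> where \<psi>: "dchar q \<psi>" "\<psi> n \<noteq> 1" using dchar_separates[OF assms] by blast
  have inj: "inj_on (\<lambda>\<phi> a. \<psi> a * \<phi> a) {\<phi>. dchar q \<phi>}"
  proof (rule inj_onI, rule ext)
    fix \<phi> \<phi>' :: "nat \<Rightarrow> complex" and a
    assume *: "\<phi> \<in> {\<phi>. dchar q \<phi>}" "\<phi>' \<in> {\<phi>. dchar q \<phi>}" "(\<lambda>a. \<psi> a * \<phi> a) = (\<lambda>a. \<psi> a * \<phi>' a)"
    show "\<phi> a = \<phi>' a"
    proof (cases "coprime a q")
      case True
      have "\<psi> a * \<phi> a = \<psi> a * \<phi>' a" using *(3) by meson
      thus ?thesis using True \<psi>(1) by (simp add: dchar_eq_0_iff)
    next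
      case False
      thus ?thesis using * dchar_eq_0_iff[of q _ a] by (metis mem_Collect_eq)
    qed
  qed
  have "(\<lambda>\<phi> a. \<psi> a * \<phi> a) ` {\<phi>. dchar q \<phi>} = {\<phi>. dchar q \<phi>}"
    by (rule endo_inj_surj[OF finite_dchars _ inj]) (auto intro: dchar_mult_same \<psi>)
  hence "(\<Sum>\<phi> | dchar q \<phi>. \<phi> n) = (\<Sum>\<phi> | dchar q \<phi>. \<psi> n * \<phi> n)"
    using sum.reindex[OF inj, of "\<lambda>\<phi>. \<phi> n"] by simp
  also have "\<dots> = \<psi> n * (\<Sum>\<phi> | dchar q \<phi>. \<phi> n)" by (simp add: sum_distrib_left)
  finally show ?thesis using \<psi>(2) by auto
qed

text \<open>Double count of \<phi> a over all characters and residues: summed over a first, only the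
  principal character contributes; summed over \<phi> first, only the class of 1.\<close>

lemma card_dchars:
  assumes q: "q > 0"
  shows "card {\<phi>. dchar q \<phi>} = totient q"
proof -
  have "(\<Sum>\<phi> | dchar q \<phi>. \<Sum>a<q. \<phi> a) = (\<Sum>\<phi> | dchar q \<phi>. if \<phi> = principal_char q then of_nat (totient q) else 0)"
    using sum_dchar_period sum_principal_period[OF q] by (intro sum.cong) auto
  also have "\<dots> = of_nat (totient q)"
    using finite_dchars dchar_principal[OF q] by simp
  finally have 1: "(\<Sum>\<phi> | dchar q \<phi>. \<Sum>a<q. \<phi> a) = of_nat (totient q)" .
  have "(\<Sum>\<phi> | dchar q \<phi>. \<Sum>a<q. \<phi> a) = (\<Sum>a<q. \<Sum>\<phi> | dchar q \<phi>. \<phi> a)"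
    by (rule sum.swap)
  \<comment> \<open>\<open>1 mod q\<close> represents the class of 1 among the a < q also when q =
    1.\<close>
  also have "\<dots> = (\<Sum>a<q. if a = 1 mod q then of_nat (card {\<phi>. dchar q \<phi>}) else 0)"
  proof (rule sum.cong)
    fix a assume a: "a \<in> {..<q}"
    show "(\<Sum>\<phi> | dchar q \<phi>. \<phi> a) = (if a = 1 mod q then of_nat (card {\<phi>. dchar q \<phi>}) else 0)"
    proof (cases "a = 1 mod q")
      case True
      hence "[a = 1] (mod q)" by (simp add: cong_def)
      hence "\<phi> a = 1" if "dchar q \<phi>" for \<phi> using dchar_cong[OF that] dchar_1[OF that] by metis
      hence "(\<Sum>\<phi> | dchar q \<phi>. \<phi> a) = (\<Sum>\<phi> | dchar q \<phi>. 1)" by (intro sum.cong) auto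
      thus ?thesis unfolding True by simp
    next
      case False
      hence "\<not> [a = 1] (mod q)" using a by (simp add: cong_def)
      thus ?thesis using False sum_over_dchars_eq_0[OF q, of a] dchar_eq_0_iff[of q _ a]
        by (cases "coprime a q") (auto intro!: sum.neutral)
    qed
  qed simp
  also have "\<dots> = of_nat (card {\<phi>. dchar q \<phi>})" using q by simp
  finally show ?thesis using 1 of_nat_eq_iff by metis
qed

lemma sum_over_dchars:
  assumes q: "q > 0"
  shows "(\<Sum>\<phi> | dchar q \<phi>. \<phi> n) = (if [n = 1] (mod q) then of_nat (totient q) else 0)"
proof (cases "[n = 1] (mod q)")
  case True
  hence "\<phi> n = 1" if "dchar q \<phi>" for \<phi> using dchar_cong[OF that True] dchar_1[OF that] by metis
  hence "(\<Sum>\<phi> | dchar q \<phi>. \<phi> n) = (\<Sum>\<phi> | dchar q \<phi>. 1)" by (intro sum.cong) auto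
  thus ?thesis using True card_dchars[OF q] by simp
next
  case False
  thus ?thesis using sum_over_dchars_eq_0[OF q, of n] dchar_eq_0_iff[of q _ n]
    by (cases "coprime n q") (auto intro!: sum.neutral)
qed

text \<open>Whole periods contribute nothing, so at most q terms of absolute value at most 1
  remain.\<close>

lemma norm_sum_periodic_le:
  fixes g :: "nat \<Rightarrow> complex"
  assumes per: "\<And>n. g (n + q) = g n" and zero: "(\<Sum>n<q. g n) = 0" and g: "\<And>n. norm (g n) \<le> 1" and q: "q > 0"
  shows "norm (\<Sum>n<N. g n) \<le> real q"
proof (induction N rule: less_induct)
  case (less N)
  show ?case
  proof (cases "N \<le> q")
    case True
    have "norm (\<Sum>n<N. g n) \<le> (\<Sum>n<N. 1)"
      by (intro sum_norm_le) (use g in auto)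
    thus ?thesis using True by simp
  next
    case False
    have "(\<Sum>n<N. g n) = (\<Sum>n<q. g n) + (\<Sum>n\<in>{q..<N}. g n)"
      using False by (metis atLeast0LessThan linorder_le_cases sum.atLeastLessThan_concat zero_le)
    also have "(\<Sum>n\<in>{q..<N}. g n) = (\<Sum>n<N-q. g (n + q))"
      using False by (intro sum.reindex_bij_witness[of _ "\<lambda>n. n + q" "\<lambda>n. n - q"]) auto
    finally show ?thesis
      using less.IH[of "N - q"] zero q False by (simp add: per)
  qed
qed

lemma norm_sum_dchar_le:
  assumes \<phi>: "dchar q \<phi>" and np: "\<phi> \<noteq> principal_char q"
  shows "norm (\<Sum>n<N. \<phi> n) \<le> real q"
proof (rule norm_sum_periodic_le)
  show "\<phi> (n + q) = \<phi> n" for n by (rule dchar_cong[OF \<phi>]) (simp add: cong_def)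
  show "(\<Sum>n<q. \<phi> n) = 0" by (rule sum_dchar_period[OF assms])
  show "norm (\<phi> n) \<le> 1" for n by (rule norm_dchar_le[OF \<phi>])
  show "q > 0" by (rule dchar_pos[OF \<phi>])
qed

lemma dchar_real_of_sq:
  assumes \<phi>: "dchar q \<phi>" and sq: "(\<lambda>n. \<phi> n * \<phi> n) = principal_char q"
  shows "\<phi> n \<in> {-1, 0, 1}"
proof -
  have "\<phi> n * \<phi> n = 1 \<or> \<phi> n * \<phi> n = 0"
    using fun_cong[OF sq, of n] by (auto simp: principal_char_def)
  thus ?thesis by (auto simp: square_eq_1_iff)
qed

section \<open>Dirichlet series\<close>

text \<open>Because \<open>0 powr z = 0\<close>, the term n = 0 vanishes and a series over all
  naturals effectively starts at 1.\<close>

definition nps :: "nat \<Rightarrow> complex \<Rightarrow> complex" where "nps n s = of_nat n powr (-s)"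

definition DS :: "(nat \<Rightarrow> complex) \<Rightarrow> complex \<Rightarrow> complex" where
  "DS a s = (\<Sum>n. a n * nps n s)"

definition abs_conv :: "(nat \<Rightarrow> complex) \<Rightarrow> bool" where
  "abs_conv a \<longleftrightarrow> (\<forall>\<sigma>>1. summable (\<lambda>n. norm (a n) * real n powr (-\<sigma>)))"

lemma nps_0 [simp]: "nps 0 s = 0"
  and nps_1 [simp]: "nps 1 s = 1" "nps (Suc 0) s = 1"
  by (auto simp: nps_def)

lemma nps_exp: "n > 0 \<Longrightarrow> nps n s = exp (- s * of_real (ln (real n)))"
  by (simp add: nps_def powr_def Ln_of_nat)

lemma norm_nps: "norm (nps n s) = real n powr (- Re s)"
  by (cases "n = 0") (simp_all add: nps_exp powr_def)

lemma nps_mult: "nps (m * n) s = nps m s * nps n s"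
  by (cases "m = 0"; cases "n = 0") (auto simp: nps_exp ln_mult exp_add[symmetric] algebra_simps)

lemma nps_add: "n > 0 \<Longrightarrow> nps n (s + w) = nps n s * nps n w"
  by (simp add: nps_exp exp_add[symmetric] algebra_simps)

lemma nps_of_real: "nps n (of_real x) = of_real (real n powr (-x))"
  by (cases "n = 0") (simp_all add: nps_exp powr_def exp_of_real[symmetric])

lemma has_field_derivative_nps [derivative_intros]:
  "(nps n has_field_derivative (- of_real (ln (real n)) * nps n s)) (at s within S)"
proof (cases "n = 0")
  case False
  have "((\<lambda>s. exp (- s * of_real (ln (real n)))) has_field_derivative
     (- of_real (ln (real n)) * nps n s)) (at s within S)"
    using False by (auto intro!: derivative_eq_intros simp: nps_exp)
  moreover have "nps n = (\<lambda>s. exp (- s * of_real (ln (real n))))"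
    using False by (auto simp: nps_exp)
  ultimately show ?thesis by simp
next
  case True
  hence "nps n = (\<lambda>_. 0)" by auto
  thus ?thesis using True by auto
qed

lemma holomorphic_nps [holomorphic_intros]:
  "f holomorphic_on A \<Longrightarrow> (\<lambda>s. nps n (f s)) holomorphic_on A"
proof -
  assume f: "f holomorphic_on A"
  have "nps n holomorphic_on UNIV"
    unfolding holomorphic_on_def field_differentiable_def using has_field_derivative_nps by blast
  from holomorphic_on_compose_gen[OF f this] show ?thesis by (simp add: o_def)
qed

lemma abs_conv_le:
  assumes "abs_conv a" "\<And>n. norm (b n) \<le> C * norm (a n)"
  shows "abs_conv b"
  unfolding abs_conv_def
proof (intro allI impI)
  fix \<sigma> :: real assume "\<sigma> > 1"
  hence "summable (\<lambda>n. C * (norm (a n) * real n powr (-\<sigma>)))"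
    using assms(1) unfolding abs_conv_def by (intro summable_mult) auto
  thus "summable (\<lambda>n. norm (b n) * real n powr (-\<sigma>))"
    by (rule summable_comparison_test'[where N = 0])
       (use assms(2) in \<open>auto simp: abs_mult mult.assoc[symmetric] intro!: mult_right_mono\<close>)
qed

lemma abs_conv_bounded:
  assumes "\<And>n. norm (a n) \<le> C"
  shows "abs_conv a"
proof (rule abs_conv_le)
  show "abs_conv (\<lambda>_. 1)"
    unfolding abs_conv_def by (auto simp: summable_real_powr_iff)
  show "norm (a n) \<le> C * norm (1 :: complex)" for n using assms by simp
qed

lemma abs_conv_add: "abs_conv a \<Longrightarrow> abs_conv b \<Longrightarrow> abs_conv (\<lambda>n. a n + b n)"
  unfolding abs_conv_def
proof (intro allI impI)
  fix \<sigma> :: real assume *: "\<forall>\<sigma>>1. summable (\<lambda>n. norm (a n) * real n powr (-\<sigma>))"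
      "\<forall>\<sigma>>1. summable (\<lambda>n. norm (b n) * real n powr (-\<sigma>))" "\<sigma> > 1"
  hence "summable (\<lambda>n. norm (a n) * real n powr (-\<sigma>) + norm (b n) * real n powr (-\<sigma>))"
    by (intro summable_add) auto
  thus "summable (\<lambda>n. norm (a n + b n) * real n powr (-\<sigma>))"
    by (rule summable_comparison_test'[where N = 0])
       (auto simp: abs_mult distrib_right[symmetric] intro!: mult_right_mono norm_triangle_ineq)
qed

lemma abs_conv_cmult: "abs_conv a \<Longrightarrow> abs_conv (\<lambda>n. c * a n)"
  by (rule abs_conv_le[of a _ "norm c"]) (auto simp: norm_mult)

lemma abs_conv_uminus: "abs_conv a \<Longrightarrow> abs_conv (\<lambda>n. - a n)"
  by (rule abs_conv_le[of a _ 1]) auto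

lemma abs_conv_diff: "abs_conv a \<Longrightarrow> abs_conv b \<Longrightarrow> abs_conv (\<lambda>n. a n - b n)"
  using abs_conv_add[OF _ abs_conv_uminus, of a b] by simp

lemma abs_conv_sum: "(\<And>i. i \<in> I \<Longrightarrow> abs_conv (a i)) \<Longrightarrow> abs_conv (\<lambda>n. \<Sum>i\<in>I. a i n)"
  by (induction I rule: infinite_finite_induct) (auto intro: abs_conv_add abs_conv_bounded[of _ 0])

lemma ln_le_powr: "\<alpha> > 0 \<Longrightarrow> x \<ge> 1 \<Longrightarrow> ln x \<le> x powr \<alpha> / \<alpha>" for x \<alpha> :: real
proof -
  assume *: "\<alpha> > 0" "x \<ge> 1"
  have "\<alpha> * ln x = ln (x powr \<alpha>)" using * by (simp add: ln_powr)
  also have "\<dots> \<le> x powr \<alpha>" using * ln_bound[of "x powr \<alpha>"] by simp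
  finally show ?thesis using * by (simp add: field_simps)
qed

text \<open>The logarithm is absorbed by n^\<alpha>, where \<alpha> is half the distance of \<sigma>
  from 1.\<close>

lemma abs_conv_ln:
  assumes "abs_conv a"
  shows "abs_conv (\<lambda>n. of_real (ln (real n)) * a n)"
  unfolding abs_conv_def
proof (intro allI impI)
  fix \<sigma> :: real assume \<sigma>: "\<sigma> > 1"
  define \<alpha> where "\<alpha> = (\<sigma> - 1) / 2"
  have \<alpha>: "\<alpha> > 0" "\<sigma> - \<alpha> > 1" using \<sigma> by (auto simp: \<alpha>_def field_simps)
  have "summable (\<lambda>n. 1 / \<alpha> * (norm (a n) * real n powr (-(\<sigma>-\<alpha>))))"
    using assms \<alpha> unfolding abs_conv_def by (intro summable_mult) auto
  thus "summable (\<lambda>n. norm (of_real (ln (real n)) * a n) * real n powr (-\<sigma>))"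
  proof (rule summable_comparison_test'[where N = 1])
    fix n :: nat assume n: "n \<ge> 1"
    have "ln (real n) * real n powr (-\<sigma>) \<le> real n powr \<alpha> / \<alpha> * real n powr (-\<sigma>)"
      using n \<alpha> by (intro mult_right_mono ln_le_powr) auto
    also have "\<dots> = 1 / \<alpha> * real n powr (-(\<sigma>-\<alpha>))"
      by (simp add: powr_add[symmetric])
    finally have "norm (a n) * (ln (real n) * real n powr (-\<sigma>)) \<le> norm (a n) * (1 / \<alpha> * real n powr (-(\<sigma>-\<alpha>)))"
      by (rule mult_left_mono) auto
    thus "norm (norm (of_real (ln (real n)) * a n) * real n powr (-\<sigma>)) \<le>
        1 / \<alpha> * (norm (a n) * real n powr (-(\<sigma>-\<alpha>)))"
      using n by (simp add: norm_mult abs_mult mult_ac)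
  qed
qed

lemma abs_conv_ln_power:
  assumes "abs_conv a"
  shows "abs_conv (\<lambda>n. of_real (ln (real n)) ^ k * a n)"
proof (induction k)
  case (Suc k)
  from abs_conv_ln[OF this] show ?case by (simp add: mult.assoc)
qed (use assms in auto)

lemma abs_conv_summable_norm:
  "abs_conv a \<Longrightarrow> Re s > 1 \<Longrightarrow> summable (\<lambda>n. norm (a n * nps n s))"
  by (simp add: abs_conv_def norm_mult norm_nps)

lemma abs_conv_summable: "abs_conv a \<Longrightarrow> Re s > 1 \<Longrightarrow> summable (\<lambda>n. a n * nps n s)"
  by (rule summable_norm_cancel) (rule abs_conv_summable_norm)

lemma DS_add: "abs_conv a \<Longrightarrow> abs_conv b \<Longrightarrow> Re s > 1 \<Longrightarrow> DS (\<lambda>n. a n + b n) s = DS a s + DS b s"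
  unfolding DS_def by (subst suminf_add) (auto intro: abs_conv_summable simp: algebra_simps)

lemma DS_cmult: "abs_conv a \<Longrightarrow> Re s > 1 \<Longrightarrow> DS (\<lambda>n. c * a n) s = c * DS a s"
  unfolding DS_def by (subst suminf_mult[symmetric]) (auto intro: abs_conv_summable simp: algebra_simps)

lemma DS_uminus: "abs_conv a \<Longrightarrow> Re s > 1 \<Longrightarrow> DS (\<lambda>n. - a n) s = - DS a s"
  using DS_cmult[of a s "-1"] by simp

lemma DS_diff: "abs_conv a \<Longrightarrow> abs_conv b \<Longrightarrow> Re s > 1 \<Longrightarrow> DS (\<lambda>n. a n - b n) s = DS a s - DS b s"
  using DS_add[of a "\<lambda>n. - b n" s] DS_uminus[of b s] abs_conv_uminus[of b] by simp

lemma DS_sum: "(\<And>i. i \<in> I \<Longrightarrow> abs_conv (a i)) \<Longrightarrow> Re s > 1 \<Longrightarrow>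
   DS (\<lambda>n. \<Sum>i\<in>I. a i n) s = (\<Sum>i\<in>I. DS (a i) s)"
proof (induction I rule: infinite_finite_induct)
  case (insert x I)
  have "DS (\<lambda>n. \<Sum>i\<in>insert x I. a i n) s = DS (\<lambda>n. a x n + (\<Sum>i\<in>I. a i n)) s"
    using insert by simp
  also have "\<dots> = DS (a x) s + DS (\<lambda>n. \<Sum>i\<in>I. a i n) s"
    using insert by (intro DS_add abs_conv_sum) auto
  finally show ?case using insert by simp
qed (auto simp: DS_def)

lemma norm_DS_le:
  assumes "abs_conv a" "Re s > 1"
  shows "norm (DS a s) \<le> (\<Sum>n. norm (a n) * real n powr (- Re s))"
  unfolding DS_def using summable_norm[OF abs_conv_summable_norm[OF assms]]
  by (simp add: norm_mult norm_nps)

lemma DS_deriv: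
  assumes a: "abs_conv a" and s: "Re s > 1"
  shows "(DS a has_field_derivative DS (\<lambda>n. - (of_real (ln (real n)) * a n)) s) (at s)"
proof -
  define \<sigma> where "\<sigma> = (1 + Re s) / 2"
  have \<sigma>: "\<sigma> > 1" "\<sigma> < Re s" using s by (auto simp: \<sigma>_def)
  define S where "S = {z. Re z \<ge> \<sigma>}"
  define f' where "f' = (\<lambda>n z. - of_real (ln (real n)) * nps n z * a n)"
  have "((\<lambda>z. \<Sum>n. a n * nps n z) has_field_derivative (\<Sum>n. f' n s)) (at s)"
  proof (rule has_field_derivative_series')
    show "convex S" unfolding S_def by (rule convex_halfspace_Re_ge)
    show "((\<lambda>z. a n * nps n z) has_field_derivative f' n z) (at z within S)" for n z
      unfolding f'_def by (auto intro!: derivative_eq_intros)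
    show "uniformly_convergent_on S (\<lambda>n x. \<Sum>i<n. f' i x)"
    proof (rule Weierstrass_m_test')
      show "summable (\<lambda>n. norm (of_real (ln (real n)) * a n) * real n powr (-\<sigma>))"
        using abs_conv_ln[OF a] \<sigma> unfolding abs_conv_def by blast
      fix n z assume "z \<in> S"
      hence "real n powr (- Re z) \<le> real n powr (-\<sigma>)"
        by (cases "n = 0") (auto simp: S_def intro!: powr_mono)
      hence "\<bar>ln (real n)\<bar> * norm (a n) * real n powr (- Re z) \<le> \<bar>ln (real n)\<bar> * norm (a n) * real n powr (-\<sigma>)"
        by (intro mult_left_mono) auto
      thus "norm (f' n z) \<le> norm (of_real (ln (real n)) * a n) * real n powr (-\<sigma>)"
        by (simp add: f'_def norm_mult norm_nps mult_ac)
    qed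
    show "s \<in> S" using \<sigma> by (simp add: S_def)
    show "summable (\<lambda>n. a n * nps n s)" by (rule abs_conv_summable) fact+
    have "s \<in> {z. Re z > \<sigma>}" using \<sigma> by simp
    moreover have "{z. Re z > \<sigma>} \<subseteq> interior S"
      by (rule interior_maximal) (auto simp: S_def open_halfspace_Re_gt)
    ultimately show "s \<in> interior S" by blast
  qed
  thus ?thesis unfolding DS_def[abs_def] f'_def by (simp add: mult_ac)
qed

lemma DS_holomorphic: "abs_conv a \<Longrightarrow> DS a holomorphic_on {s. Re s > 1}"
  unfolding holomorphic_on_def field_differentiable_def
  using DS_deriv by (blast intro: has_field_derivative_at_within)

lemma DS_higher_deriv:
  assumes a: "abs_conv a" and s: "Re s > 1"
  shows "(deriv ^^ k) (DS a) s = (-1) ^ k * DS (\<lambda>n. of_real (ln (real n)) ^ k * a n) s"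
  using s
proof (induction k arbitrary: s)
  case (Suc k)
  have ac: "abs_conv (\<lambda>n. of_real (ln (real n)) ^ k * a n)" by (rule abs_conv_ln_power[OF a])
  define b where "b = (\<lambda>n. (-1) ^ k * (of_real (ln (real n)) ^ k * a n))"
  have b: "abs_conv b" unfolding b_def by (rule abs_conv_cmult[OF ac])
  have "(deriv ^^ Suc k) (DS a) s = deriv ((deriv ^^ k) (DS a)) s" by simp
  also have "\<dots> = deriv (DS b) s"
  proof (rule complex_derivative_transform_within_open)
    show "(deriv ^^ k) (DS a) holomorphic_on {s. Re s > 1}"
      by (intro holomorphic_higher_deriv DS_holomorphic a open_halfspace_Re_gt)
    show "DS b holomorphic_on {s. Re s > 1}" by (intro DS_holomorphic b)
    show "(deriv ^^ k) (DS a) w = DS b w" if "w \<in> {s. Re s > 1}" for w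
      using Suc.IH[of w] that DS_cmult[OF ac, of w "(-1)^k"] by (simp add: b_def)
    show "open {s. Re s > 1}" by (rule open_halfspace_Re_gt)
    show "s \<in> {s. Re s > 1}" using Suc.prems by simp
  qed
  also have "\<dots> = DS (\<lambda>n. - (of_real (ln (real n)) * b n)) s"
    by (rule DERIV_imp_deriv[OF DS_deriv[OF b Suc.prems]])
  also have "(\<lambda>n. - (of_real (ln (real n)) * b n)) = (\<lambda>n. (-1)^Suc k * (of_real (ln (real n)) ^ Suc k * a n))"
    by (auto simp: b_def fun_eq_iff)
  also have "DS \<dots> s = (-1)^Suc k * DS (\<lambda>n. of_real (ln (real n)) ^ Suc k * a n) s"
    by (rule DS_cmult[OF abs_conv_ln_power[OF a] Suc.prems])
  finally show ?case .
qed auto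

text \<open>Dirichlet convolution. The double family is absolutely summable, so it may be regrouped
  along the bijection that sends a number n with a divisor d to the pair of factors d and
  \<open>n div d\<close>.\<close>

lemma DS_mult:
  assumes a: "abs_conv a" and b: "abs_conv b" and s: "Re s > 1"
    and c: "\<And>n. n > 0 \<Longrightarrow> c n = (\<Sum>d | d dvd n. a d * b (n div d))"
  shows "DS a s * DS b s = DS c s"
proof -
  define f g where "f = (\<lambda>n. a n * nps n s)" and "g = (\<lambda>n. b n * nps n s)"
  have f: "(\<lambda>n. norm (f n)) summable_on UNIV" and g: "(\<lambda>n. norm (g n)) summable_on UNIV"
    using abs_conv_summable_norm[OF a s] abs_conv_summable_norm[OF b s]
    by (simp_all add: f_def g_def summable_on_UNIV_nonneg_real_iff)
  have inf: "DS u s = infsum (\<lambda>n. u n * nps n s) {0<..}" if "(\<lambda>n. norm (u n * nps n s)) summable_on UNIV" for u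
  proof -
    have "(\<lambda>n. u n * nps n s) summable_on UNIV" using that by (rule abs_summable_summable)
    hence "DS u s = infsum (\<lambda>n. u n * nps n s) UNIV"
      unfolding DS_def by (metis has_sum_imp_sums has_sum_infsum sums_unique)
    also have "\<dots> = infsum (\<lambda>n. u n * nps n s) {0<..}"
      by (rule infsum_cong_neutral) auto
    finally show ?thesis .
  qed
  define h where "h = (\<lambda>(m, n). f m * g n)"
  have habs: "(\<lambda>x. norm (h x)) summable_on (UNIV \<times> UNIV)"
  proof -
    have "(\<lambda>x. norm ((\<lambda>(m, n). norm (f m) * norm (g n)) x)) summable_on (UNIV \<times> UNIV)"
    proof (subst Infinite_Sum.abs_summable_on_Sigma_iff, intro conjI ballI)
      show "(\<lambda>n. norm (case (m, n) of (m, n) \<Rightarrow> norm (f m) * norm (g n))) summable_on UNIV" for m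
        using g by (auto intro!: summable_on_cmult_right)
      have "(\<lambda>m. norm (f m) * (\<Sum>\<^sub>\<infinity>n. norm (g n))) summable_on UNIV"
        using f by (intro summable_on_cmult_left)
      thus "(\<lambda>m. norm (\<Sum>\<^sub>\<infinity>n. norm (case (m, n) of (m, n) \<Rightarrow> norm (f m) * norm (g n)))) summable_on UNIV"
        by (simp add: infsum_cmult_right' infsum_nonneg abs_mult)
    qed
    thus ?thesis by (simp add: h_def case_prod_unfold norm_mult)
  qed
  hence hs: "h summable_on (UNIV \<times> UNIV)" by (rule abs_summable_summable)
  have hs': "h summable_on ({0<..} \<times> {0<..})" by (rule summable_on_subset_banach[OF hs]) auto
  have hs'': "(\<lambda>(n, d). h (d, n div d)) summable_on (Sigma {0<..} (\<lambda>n. {d. d dvd n}))"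
  proof -
    have "bij_betw (\<lambda>(n, d). (d, n div d)) (Sigma {0<..} (\<lambda>n. {d. d dvd n})) ({0<..} \<times> ({0<..} :: nat set))"
      by (rule bij_betwI[where g = "\<lambda>(d, e). (d * e, d)"]) (auto elim!: dvdE)
    from summable_on_reindex_bij_betw[OF this, of h] show ?thesis using hs' by (simp add: case_prod_unfold)
  qed
  have fiber: "infsum (\<lambda>d. h (d, n div d)) {d. d dvd n} = c n * nps n s" if "n \<in> {0<..}" for n
  proof -
    have n: "n > 0" using that by simp
    have "infsum (\<lambda>d. h (d, n div d)) {d. d dvd n} = (\<Sum>d | d dvd n. h (d, n div d))"
      using n by (intro infsum_finite) auto
    also have "\<dots> = (\<Sum>d | d dvd n. a d * b (n div d) * nps n s)"
      using n by (intro sum.cong) (auto simp: h_def f_def g_def nps_mult elim!: dvdE)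
    finally show ?thesis using c n by (simp add: sum_distrib_right)
  qed
  have "DS a s * DS b s = infsum f {0<..} * infsum g {0<..}"
    using inf[of a] inf[of b] f g unfolding f_def g_def by simp
  also have "\<dots> = infsum (\<lambda>m. infsum (\<lambda>n. h (m, n)) {0<..}) {0<..}"
    unfolding h_def by (simp add: infsum_cmult_right' infsum_cmult_left')
  also have "\<dots> = infsum h ({0<..} \<times> {0<..})"
    by (rule infsum_Sigma_banach[OF hs'])
  also have "\<dots> = infsum (\<lambda>(n, d). h (d, n div d)) (Sigma {0<..} (\<lambda>n. {d. d dvd n}))"
    by (rule infsum_reindex_bij_witness[where i = "\<lambda>(n, d). (d, n div d)" and j = "\<lambda>(d, e). (d * e, d)"])
       (auto elim!: dvdE)
  also have eq: "\<dots> = infsum (\<lambda>n. infsum (\<lambda>d. h (d, n div d)) {d. d dvd n}) {0<..}"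
    using infsum_Sigma'_banach[of "\<lambda>n d. h (d, n div d)"] hs'' by simp
  also have "\<dots> = infsum (\<lambda>n. c n * nps n s) {0<..}"
    by (rule infsum_cong) (rule fiber)
  also have "\<dots> = DS c s"
  proof (rule inf[symmetric])
    have "(\<lambda>n. infsum (\<lambda>d. h (d, n div d)) {d. d dvd n}) summable_on {0<..}"
      using summable_on_Sigma_banach[of "\<lambda>n d. h (d, n div d)"] hs'' by simp
    hence "(\<lambda>n. c n * nps n s) summable_on {0<..}"
      using fiber by (subst summable_on_cong[where g = "\<lambda>n. infsum (\<lambda>d. h (d, n div d)) {d. d dvd n}"]) auto
    hence "(\<lambda>n. c n * nps n s) summable_on UNIV"
      by (subst summable_on_cong_neutral[where g = "\<lambda>n. c n * nps n s" and S = UNIV and T = "{0<..}"]) auto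
    \<comment> \<open>For complex families unconditional and absolute summability coincide, so the
      grouped series converges absolutely as well.\<close>
    thus "(\<lambda>n. norm (c n * nps n s)) summable_on UNIV"
      by (simp only: summable_on_iff_abs_summable_on_complex[symmetric])
  qed
  finally show ?thesis .
qed

text \<open>For n \<ge> 2 and x \<ge> 2 one has n^(-x) \<le> 2^(2-x) n^(-2), so everything but the
  term n = 1 decays. The limit fixes a constant of integration in the exponential formula
  below.\<close>

lemma DS_real_tendsto:
  assumes a: "abs_conv a"
  shows "((\<lambda>x. DS a (of_real x)) \<longlongrightarrow> a 1) at_top"
proof -
  define C where "C = (\<Sum>n. norm (a n) * real n powr (-2))"
  have sm: "summable (\<lambda>n. norm (a n) * real n powr (-2))"
    using a unfolding abs_conv_def by auto
  have bd: "norm (DS a (of_real x) - a 1) \<le> 2 powr (2 - x) * C" if x: "x \<ge> 2" for x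
  proof -
    have sx: "summable (\<lambda>n. a n * nps n (of_real x))"
      by (rule abs_conv_summable[OF a]) (use x in auto)
    have "DS a (of_real x) = (\<Sum>n. a (n + 2) * nps (n + 2) (of_real x)) + (\<Sum>n<2. a n * nps n (of_real x))"
      unfolding DS_def by (rule suminf_split_initial_segment[OF sx])
    also have "(\<Sum>n<2. a n * nps n (of_real x)) = a 1"
      by (simp add: numeral_2_eq_2)
    finally have eq: "DS a (of_real x) - a 1 = (\<Sum>n. a (n + 2) * nps (n + 2) (of_real x))" by simp
    have sm2: "summable (\<lambda>n. norm (a (n+2)) * real (n+2) powr (-2))"
      by (rule summable_ignore_initial_segment[OF sm])
    have le: "norm (a (n + 2) * nps (n + 2) (of_real x)) \<le> 2 powr (2 - x) * (norm (a (n+2)) * real (n+2) powr (-2))" for n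
    proof -
      have "real (n+2) powr (-x) = real (n+2) powr (2 - x) * real (n+2) powr (-2)"
        by (simp add: powr_add[symmetric])
      also have "\<dots> \<le> 2 powr (2 - x) * real (n+2) powr (-2)"
        using x by (intro mult_right_mono powr_mono2') auto
      finally have "norm (a (n+2)) * real (n+2) powr (-x) \<le> norm (a (n+2)) * (2 powr (2 - x) * real (n+2) powr (-2))"
        by (rule mult_left_mono) auto
      thus ?thesis by (simp add: norm_mult norm_nps mult_ac)
    qed
    have "norm (DS a (of_real x) - a 1) \<le> (\<Sum>n. 2 powr (2 - x) * (norm (a (n+2)) * real (n+2) powr (-2)))"
      unfolding eq by (rule norm_suminf_le[OF le summable_mult[OF sm2]])
    also have "\<dots> = 2 powr (2 - x) * (\<Sum>n. norm (a (n+2)) * real (n+2) powr (-2))"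
      by (rule suminf_mult[OF sm2])
    also have "\<dots> \<le> 2 powr (2 - x) * C"
      unfolding C_def suminf_split_initial_segment[OF sm, of 2] by (intro mult_left_mono) (auto intro!: sum_nonneg)
    finally show ?thesis .
  qed
  have "((\<lambda>x::real. 2 powr (2 - x) * C) \<longlongrightarrow> 0) at_top"
    by real_asymp
  hence "((\<lambda>x. DS a (of_real x) - a 1) \<longlongrightarrow> 0) at_top"
    by (rule Lim_null_comparison[rotated]) (use bd in \<open>auto simp: eventually_at_top_linorder\<close>)
  thus ?thesis by (simp add: LIM_zero_iff)
qed

section \<open>Logarithms of Dirichlet series with completely multiplicative coefficients\<close>

definition cmult_fun :: "(nat \<Rightarrow> complex) \<Rightarrow> bool" where
  "cmult_fun f \<longleftrightarrow> f 1 = 1 \<and> (\<forall>m n. f (m * n) = f m * f n) \<and> (\<forall>n. norm (f n) \<le> 1)"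

text \<open>Coefficients of the logarithm of \<open>DS f\<close>: the value at a prime power p^j is
  f(p^j)/j. At n \<le> 1 the value is 0 since \<open>mangoldt\<close> vanishes there.\<close>

definition logc :: "(nat \<Rightarrow> complex) \<Rightarrow> nat \<Rightarrow> complex" where
  "logc f n = f n * of_real (mangoldt n / ln (real n))"

lemma mangoldt_over_ln: "0 \<le> mangoldt n / ln (real n)" "mangoldt n / ln (real n) \<le> (1::real)"
proof -
  show "0 \<le> mangoldt n / ln (real n)"
    by (cases "n = 0") (auto intro!: divide_nonneg_nonneg mangoldt_nonneg)
  show "mangoldt n / ln (real n) \<le> 1"
  proof (cases "n \<le> 1")
    case True
    hence "n = 0 \<or> n = 1" by auto
    thus ?thesis by auto
  next
    case False
    hence "mangoldt n \<le> ln (real n)" by (intro mangoldt_le) auto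
    moreover have "ln (real n) > 0" using False by simp
    ultimately show ?thesis by simp
  qed
qed

lemma norm_logc_le: "(\<And>n. norm (f n) \<le> C) \<Longrightarrow> norm (logc f n) \<le> C"
proof -
  assume f: "\<And>n. norm (f n) \<le> C"
  have "norm (logc f n) = norm (f n) * (mangoldt n / ln (real n))"
    unfolding logc_def norm_mult norm_of_real using mangoldt_over_ln(1)[of n] by (simp only: abs_of_nonneg)
  also have "\<dots> \<le> C * 1"
    using f[of n] mangoldt_over_ln[of n] norm_ge_zero[of "f n"] by (intro mult_mono) (auto simp del: norm_ge_zero)
  finally show ?thesis by simp
qed

lemma abs_conv_logc: "(\<And>n. norm (f n) \<le> C) \<Longrightarrow> abs_conv (logc f)"
  by (rule abs_conv_bounded[of _ C], rule norm_logc_le)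

lemma ln_times_logc: "of_real (ln (real n)) * logc f n = f n * mangoldt n"
proof (cases "n \<le> 1")
  case True
  hence "n = 0 \<or> n = 1" by auto
  thus ?thesis by (auto simp: logc_def)
next
  case False
  hence "ln (real n) > 0" by simp
  thus ?thesis by (simp add: logc_def)
qed

lemma abs_conv_mangoldt: "(\<And>n. norm (f n) \<le> C) \<Longrightarrow> abs_conv (\<lambda>n. f n * mangoldt n)"
proof -
  assume f: "\<And>n. norm (f n) \<le> C"
  have "abs_conv (\<lambda>n. of_real (ln (real n)) * logc f n)"
    by (intro abs_conv_ln abs_conv_logc[OF f])
  thus ?thesis by (simp only: ln_times_logc)
qed

lemma cmult_fun_abs_conv: "cmult_fun f \<Longrightarrow> abs_conv f"
  by (rule abs_conv_bounded[of _ 1]) (auto simp: cmult_fun_def)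

text \<open>The identity log n = sum of \<Lambda>(d) over d | n, twisted by f, which passes through
  the divisor sum by complete multiplicativity. Its analytic content is the formula for
  -L'/L.\<close>

lemma DS_mangoldt_mult:
  assumes f: "cmult_fun f" and s: "Re s > 1"
  shows "DS (\<lambda>n. f n * mangoldt n) s * DS f s = DS (\<lambda>n. of_real (ln (real n)) * f n) s"
proof (rule DS_mult[OF _ _ s])
  show "abs_conv (\<lambda>n. f n * mangoldt n)" by (rule abs_conv_mangoldt[of _ 1]) (use f in \<open>auto simp: cmult_fun_def\<close>)
  show "abs_conv f" by (rule cmult_fun_abs_conv[OF f])
  fix n :: nat assume n: "n > 0"
  have "(\<Sum>d | d dvd n. f d * mangoldt d * f (n div d)) = (\<Sum>d | d dvd n. f n * mangoldt d)"
  proof (intro sum.cong refl)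
    fix d assume "d \<in> {d. d dvd n}"
    hence "f n = f d * f (n div d)" using f by (metis cmult_fun_def dvd_mult_div_cancel mem_Collect_eq)
    thus "f d * mangoldt d * f (n div d) = f n * mangoldt d" by simp
  qed
  also have "\<dots> = f n * (\<Sum>d | d dvd n. mangoldt d)" by (simp add: sum_distrib_left)
  also have "\<dots> = of_real (ln (real n)) * f n" using mangoldt_sum[of n, where ?'a = complex] n by simp
  finally show "of_real (ln (real n)) * f n = (\<Sum>d | d dvd n. f d * mangoldt d * f (n div d))" by simp
qed

text \<open>The quotient of the two sides has derivative 0, because both logarithmic derivatives are
  minus the series of f \<Lambda>, and it tends to 1 along the real axis. In particular
  \<open>DS f\<close> has no zero with Re s > 1.\<close>

lemma DS_eq_exp_logc:
  assumes f: "cmult_fun f" and s: "Re s > 1"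
  shows "DS f s = exp (DS (logc f) s)"
proof -
  have bd: "\<And>n. norm (f n) \<le> 1" using f by (auto simp: cmult_fun_def)
  have af: "abs_conv f" by (rule cmult_fun_abs_conv[OF f])
  have al: "abs_conv (logc f)" by (rule abs_conv_logc[OF bd])
  have am: "abs_conv (\<lambda>n. f n * mangoldt n)" by (rule abs_conv_mangoldt[OF bd])
  define S where "S = {s. Re s > 1}"
  define Q where "Q = (\<lambda>s. DS f s * exp (- DS (logc f) s))"
  have "\<exists>c. \<forall>z\<in>S. Q z = c"
  proof (rule has_field_derivative_zero_constant)
    show "convex S" unfolding S_def by (rule convex_halfspace_Re_gt)
    fix z assume "z \<in> S" hence z: "Re z > 1" by (simp add: S_def)
    have e1: "DS (\<lambda>n. - (of_real (ln (real n)) * f n)) z = - (DS (\<lambda>n. f n * mangoldt n) z * DS f z)"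
      using DS_mangoldt_mult[OF f z] DS_uminus[OF abs_conv_ln[OF af] z] by simp
    have e2: "DS (\<lambda>n. - (of_real (ln (real n)) * logc f n)) z = - DS (\<lambda>n. f n * mangoldt n) z"
      unfolding ln_times_logc using DS_uminus[OF am z] by simp
    have "(Q has_field_derivative (DS (\<lambda>n. - (of_real (ln (real n)) * f n)) z * exp (- DS (logc f) z) +
       (exp (- DS (logc f) z) * (- DS (\<lambda>n. - (of_real (ln (real n)) * logc f n)) z)) * DS f z)) (at z)"
      unfolding Q_def
      by (intro DERIV_mult' DERIV_mult DERIV_fun_exp DERIV_minus DS_deriv af al z)
    also have "DS (\<lambda>n. - (of_real (ln (real n)) * f n)) z * exp (- DS (logc f) z) +
       (exp (- DS (logc f) z) * (- DS (\<lambda>n. - (of_real (ln (real n)) * logc f n)) z)) * DS f z = 0"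
      unfolding e1 e2 by (simp add: algebra_simps)
    finally show "(Q has_field_derivative 0) (at z within S)" by (rule has_field_derivative_at_within)
  qed
  then obtain c where c: "\<And>z. z \<in> S \<Longrightarrow> Q z = c" by blast
  have "((\<lambda>x. Q (of_real x)) \<longlongrightarrow> f 1 * exp (- logc f 1)) at_top"
    unfolding Q_def by (intro tendsto_intros DS_real_tendsto af al)
  moreover have "f 1 * exp (- logc f 1) = 1" using f by (simp add: cmult_fun_def logc_def)
  ultimately have "((\<lambda>x. Q (of_real x)) \<longlongrightarrow> 1) at_top" by simp
  moreover have "eventually (\<lambda>x. Q (of_real x) = c) at_top"
    using eventually_gt_at_top[of 1] by eventually_elim (auto intro!: c simp: S_def)
  hence "((\<lambda>x. Q (of_real x)) \<longlongrightarrow> c) at_top" by (rule tendsto_eventually)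
  ultimately have "c = 1" using tendsto_unique trivial_limit_at_top_linorder by blast
  hence "Q s = 1" using c[of s] s by (simp add: S_def)
  hence "DS f s * exp (- DS (logc f) s) * exp (DS (logc f) s) = exp (DS (logc f) s)"
    by (simp add: Q_def)
  thus ?thesis by (simp add: mult.assoc exp_add[symmetric])
qed

section \<open>Continuation to the right half-plane\<close>

text \<open>Mean value inequality along the real segment; for Re s \<ge> -1 the derivative is
  largest at the left end.\<close>

lemma norm_powr_diff_le:
  fixes a b :: real and s :: complex
  assumes ab: "0 < a" "a \<le> b" and s: "Re s \<ge> -1"
  shows "norm (of_real b powr (-s) - of_real a powr (-s)) \<le> norm s * a powr (- Re s - 1) * (b - a)"
proof -
  define S where "S = closed_segment (of_real a :: complex) (of_real b)"
  have S: "\<exists>u. z = of_real u \<and> a \<le> u \<and> u \<le> b" if "z \<in> S" for z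
    using that ab unfolding S_def closed_segment_of_real by (auto simp: closed_segment_eq_real_ivl)
  have "norm (of_real b powr (-s) - of_real a powr (-s)) \<le>
          norm s * a powr (- Re s - 1) * norm (of_real b - of_real a :: complex)"
  proof (rule field_differentiable_bound)
    show "convex S" unfolding S_def by (rule convex_closed_segment)
    fix z assume z: "z \<in> S"
    then obtain u where u: "z = of_real u" "a \<le> u" "u \<le> b" using S by blast
    hence "z \<notin> \<real>\<^sub>\<le>\<^sub>0" using ab by (auto simp: complex_nonpos_Reals_iff)
    from has_field_derivative_powr[OF this, of "-s"]
    show "((\<lambda>z. z powr (-s)) has_field_derivative (- s * z powr (- s - 1))) (at z within S)"
      by (rule has_field_derivative_at_within)
    have "norm (z powr (- s - 1)) = u powr (- Re s - 1)"
      using u ab by (simp add: norm_powr_real_powr)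
    also have "\<dots> \<le> a powr (- Re s - 1)" using u ab s by (intro powr_mono2') auto
    finally show "norm (- s * z powr (- s - 1)) \<le> norm s * a powr (- Re s - 1)"
      by (simp add: norm_mult mult_left_mono)
  qed (auto simp: S_def)
  also have "norm (of_real b - of_real a :: complex) = b - a"
    using ab by (metis abs_of_nonneg diff_ge_0_iff_ge norm_of_real of_real_diff)
  finally show ?thesis .
qed

lemma norm_nps_diff_le:
  assumes "n > 0" "Re s \<ge> -1"
  shows "norm (nps n s - nps (Suc n) s) \<le> norm s * real n powr (- Re s - 1)"
  using norm_powr_diff_le[of "real n" "real (Suc n)" s] assms
  by (simp add: nps_def norm_minus_commute)

text \<open>This is (s - 1) times the integral of n^(-s) - u^(-s) over u in [n, n+1]. The integrand
  gains a factor 1/n over each of its parts, so the series converges for Re s > 0; the integrals of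
  u^(-s) telescope, and the sum is (s - 1) zeta(s) - 1.\<close>

definition zterm :: "nat \<Rightarrow> complex \<Rightarrow> complex" where
  "zterm n s = (if n = 0 then 0 else (s - 1) * nps n s - (nps n (s - 1) - nps (Suc n) (s - 1)))"

lemma norm_zterm_le:
  assumes s: "Re s \<ge> -1"
  shows "norm (zterm n s) \<le> norm (s - 1) * norm s * real n powr (- Re s - 1)"
proof (cases "n = 0")
  case False
  define a b where "a = real n" and "b = real (Suc n)"
  have ab: "0 < a" "a \<le> b" "b - a = 1" using False by (auto simp: a_def b_def)
  define S where "S = closed_segment (of_real a :: complex) (of_real b)"
  have S: "\<exists>u. z = of_real u \<and> a \<le> u \<and> u \<le> b" if "z \<in> S" for z
    using that ab unfolding S_def closed_segment_of_real by (auto simp: closed_segment_eq_real_ivl)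
  \<comment> \<open>The increment of f from n to n + 1 is \<open>zterm n s\<close>, and the
    derivative of f is again a difference of two powers, so the mean value inequality is used
    twice.\<close>
  define f where "f = (\<lambda>z. z powr (1 - s) + (s - 1) * z * of_real a powr (-s))"
  have "norm (f (of_real b) - f (of_real a)) \<le>
          norm (s - 1) * (norm s * a powr (- Re s - 1)) * norm (of_real b - of_real a :: complex)"
  proof (rule field_differentiable_bound)
    show "convex S" unfolding S_def by (rule convex_closed_segment)
    fix z assume z: "z \<in> S"
    then obtain u where u: "z = of_real u" "a \<le> u" "u \<le> b" using S by blast
    hence "z \<notin> \<real>\<^sub>\<le>\<^sub>0" using ab by (auto simp: complex_nonpos_Reals_iff)
    note d = has_field_derivative_powr[OF this, of "1 - s"]
    have "(f has_field_derivative ((1 - s) * z powr (1 - s - 1) + (s - 1) * of_real a powr (-s))) (at z within S)"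
      unfolding f_def by (rule derivative_eq_intros has_field_derivative_at_within[OF d] refl | simp)+
    also have "(1 - s) * z powr (1 - s - 1) + (s - 1) * of_real a powr (-s) =
       - (s - 1) * (z powr (-s) - of_real a powr (-s))" by (simp add: algebra_simps)
    finally show "(f has_field_derivative (- (s - 1) * (z powr (-s) - of_real a powr (-s)))) (at z within S)" .
    have "norm (z powr (-s) - of_real a powr (-s)) \<le> norm s * a powr (- Re s - 1) * (u - a)"
      unfolding u(1) using u ab s by (intro norm_powr_diff_le) auto
    also have "\<dots> \<le> norm s * a powr (- Re s - 1) * 1"
      using u ab by (intro mult_left_mono) auto
    finally show "norm (- (s - 1) * (z powr (-s) - of_real a powr (-s))) \<le> norm (s - 1) * (norm s * a powr (- Re s - 1))"
      by (simp add: norm_mult norm_minus_commute mult_left_mono)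
  qed (auto simp: S_def)
  also have "norm (of_real b - of_real a :: complex) = 1"
    using ab by (metis norm_one of_real_1 of_real_diff)
  also have "f (of_real b) - f (of_real a) = zterm n s"
    using False ab(3) unfolding f_def zterm_def nps_def a_def b_def
    by (simp add: algebra_simps)
  finally show ?thesis by (simp add: a_def mult.assoc)
qed (auto simp: zterm_def)

lemma summable_powr_shift: "\<sigma> > 0 \<Longrightarrow> summable (\<lambda>n. real n powr (-\<sigma> - 1))"
  by (simp add: summable_real_powr_iff)

lemma holomorphic_series_halfplane:
  fixes h :: "nat \<Rightarrow> complex \<Rightarrow> complex"
  assumes hol: "\<And>n. h n holomorphic_on {s. Re s > 0}"
    and bd: "\<And>n s. Re s > 0 \<Longrightarrow> norm (h n s) \<le> C * (1 + norm s)^2 * real n powr (- Re s - 1)"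
  shows "(\<lambda>s. \<Sum>n. h n s) holomorphic_on {s. Re s > 0}"
proof (rule holomorphic_uniform_sequence[where f = "\<lambda>N s. \<Sum>n<N. h n s"])
  show "open {s. Re s > 0}" by (rule open_halfspace_Re_gt)
  show "(\<lambda>s. \<Sum>n<N. h n s) holomorphic_on {s. Re s > 0}" for N
    by (intro holomorphic_intros hol)
  fix z :: complex assume "z \<in> {s. Re s > 0}"
  hence z: "Re z > 0" by simp
  define d where "d = Re z / 2"
  have d: "d > 0" "d < Re z" using z by (auto simp: d_def)
  have Re: "Re w \<ge> d" if "w \<in> cball z d" for w
  proof -
    have "\<bar>Re (z - w)\<bar> \<le> d" using that abs_Re_le_cmod[of "z - w"] by (simp add: dist_norm)
    thus ?thesis unfolding d_def minus_complex.sel by linarith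
  qed
  have nw: "norm w \<le> norm z + d" if "w \<in> cball z d" for w
    using that norm_triangle_ineq2[of w z] by (simp add: dist_norm norm_minus_commute)
  define M where "M = (\<lambda>n. \<bar>C\<bar> * (1 + (norm z + d))^2 * real n powr (- d - 1))"
  have "uniform_limit (cball z d) (\<lambda>N s. \<Sum>n<N. h n s) (\<lambda>s. \<Sum>n. h n s) sequentially"
  proof (rule Weierstrass_m_test[of _ _ M])
    show "summable M" unfolding M_def using d by (intro summable_mult summable_powr_shift)
    fix n w assume w: "w \<in> cball z d"
    have "norm (h n w) \<le> C * (1 + norm w)^2 * real n powr (- Re w - 1)"
      using Re[OF w] d by (intro bd) auto
    also have "\<dots> \<le> \<bar>C\<bar> * (1 + norm w)^2 * real n powr (- Re w - 1)"
      by (intro mult_right_mono) auto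
    also have "\<dots> \<le> \<bar>C\<bar> * (1 + (norm z + d))^2 * real n powr (- d - 1)"
    proof (intro mult_mono power_mono)
      show "real n powr (- Re w - 1) \<le> real n powr (- d - 1)"
        using Re[OF w] by (cases "n = 0") (auto intro!: powr_mono)
    qed (use nw[OF w] d in auto)
    finally show "norm (h n w) \<le> M n" by (simp add: M_def)
  qed
  moreover have "cball z d \<subseteq> {s. Re s > 0}" using Re d by force
  ultimately show "\<exists>d>0. cball z d \<subseteq> {s. 0 < Re s} \<and>
      uniform_limit (cball z d) (\<lambda>N s. \<Sum>n<N. h n s) (\<lambda>s. \<Sum>n. h n s) sequentially"
    using d by blast
qed

definition psum :: "(nat \<Rightarrow> complex) \<Rightarrow> nat \<Rightarrow> complex" where "psum b n = (\<Sum>k=1..n. b k)"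

text \<open>The Dirichlet series of b after summation by parts. Bounded partial sums make it
  converge for Re s > 0, so it continues L-functions there.\<close>

definition Lc :: "(nat \<Rightarrow> complex) \<Rightarrow> complex \<Rightarrow> complex" where
  "Lc b s = (\<Sum>n. psum b n * (nps n s - nps (Suc n) s))"

text \<open>The continuation of (s - 1) zeta(s) to Re s > 0; the factor s - 1 removes the
  pole.\<close>

definition zetaF :: "complex \<Rightarrow> complex" where "zetaF s = 1 + (\<Sum>n. zterm n s)"

lemma psum_0 [simp]: "psum b 0 = 0" and psum_Suc: "psum b (Suc n) = psum b n + b (Suc n)"
  by (auto simp: psum_def)

lemma norm_Lc_term_le:
  assumes "\<And>n. norm (psum b n) \<le> Q" "Re s > 0"
  shows "norm (psum b n * (nps n s - nps (Suc n) s)) \<le> Q * norm s * real n powr (- Re s - 1)"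
proof (cases "n = 0")
  case False
  have Q: "Q \<ge> 0" using assms(1)[of 0] by simp
  have "norm (psum b n) * norm (nps n s - nps (Suc n) s) \<le> Q * (norm s * real n powr (- Re s - 1))"
    using False assms Q by (intro mult_mono norm_nps_diff_le) auto
  thus ?thesis by (simp add: norm_mult mult_ac)
qed auto

lemma Lc_holomorphic:
  assumes "\<And>n. norm (psum b n) \<le> Q"
  shows "Lc b holomorphic_on {s. Re s > 0}"
  unfolding Lc_def[abs_def]
proof (rule holomorphic_series_halfplane[where C = Q])
  fix n :: nat and s :: complex assume s: "Re s > 0"
  have Q: "Q \<ge> 0" using assms(1)[of 0] by simp
  have "norm s \<le> (1 + norm s)^2" by (simp add: power2_eq_square algebra_simps)
  hence "Q * norm s * real n powr (- Re s - 1) \<le> Q * (1 + norm s)^2 * real n powr (- Re s - 1)"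
    using Q by (intro mult_right_mono mult_left_mono) auto
  thus "norm (psum b n * (nps n s - nps (Suc n) s)) \<le> Q * (1 + norm s)^2 * real n powr (- Re s - 1)"
    using norm_Lc_term_le[OF assms s, of n] by linarith
qed (intro holomorphic_intros)

lemma zetaF_holomorphic: "zetaF holomorphic_on {s. Re s > 0}"
  unfolding zetaF_def[abs_def]
proof (intro holomorphic_intros, rule holomorphic_series_halfplane[where C = 1])
  fix n
  show "zterm n holomorphic_on {s. Re s > 0}"
    unfolding zterm_def[abs_def] by (cases "n = 0") (auto intro!: holomorphic_intros)
  fix s :: complex assume s: "Re s > 0"
  have "norm (s - 1) * norm s \<le> (1 + norm s) * (1 + norm s)"
    using norm_triangle_ineq4[of s 1] by (intro mult_mono) auto
  hence "norm (s - 1) * norm s * real n powr (- Re s - 1) \<le> 1 * (1 + norm s)^2 * real n powr (- Re s - 1)"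
    by (intro mult_right_mono) (auto simp: power2_eq_square)
  thus "norm (zterm n s) \<le> 1 * (1 + norm s)^2 * real n powr (- Re s - 1)"
    using norm_zterm_le[of s n] s by linarith
qed

lemma abel_partial:
  "(\<Sum>n=1..N. b n * nps n s) = (\<Sum>n<Suc N. psum b n * (nps n s - nps (Suc n) s)) + psum b N * nps (Suc N) s"
proof (induction N)
  case (Suc N)
  show ?case
    using Suc by (simp add: psum_Suc algebra_simps)
qed auto

lemma zterm_partial:
  "(\<Sum>n<Suc N. zterm n s) = (s - 1) * (\<Sum>n=1..N. nps n s) - 1 + nps (Suc N) (s - 1)"
proof (induction N)
  case (Suc N)
  thus ?case by (simp add: zterm_def algebra_simps)
qed (auto simp: zterm_def)

lemma summable_Lc:
  assumes "\<And>n. norm (psum b n) \<le> Q" "Re s > 0"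
  shows "summable (\<lambda>n. psum b n * (nps n s - nps (Suc n) s))"
  by (rule summable_comparison_test'[OF summable_mult[OF summable_powr_shift[of "Re s"], of "Q * norm s"]])
     (use norm_Lc_term_le[OF assms] assms in auto)

lemma summable_zterm:
  assumes "Re s > 0"
  shows "summable (\<lambda>n. zterm n s)"
  by (rule summable_comparison_test'[OF summable_mult[OF summable_powr_shift[of "Re s"], of "norm (s-1) * norm s"]])
     (use norm_zterm_le[of s] assms in auto)

section \<open>Growth slightly to the left of Re s = 1\<close>

lemma Lc_truncate:
  assumes "\<And>n. norm (psum b n) \<le> Q" "Re s > 0"
  shows "Lc b s = (\<Sum>n=1..N. b n * nps n s) - psum b N * nps (Suc N) s +
     (\<Sum>n. psum b (n + Suc N) * (nps (n + Suc N) s - nps (Suc (n + Suc N)) s))"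
  unfolding Lc_def suminf_split_initial_segment[OF summable_Lc[OF assms], of "Suc N"] abel_partial
  by simp

lemma zetaF_truncate:
  assumes "Re s > 0"
  shows "zetaF s = (s - 1) * (\<Sum>n=1..N. nps n s) + nps (Suc N) (s - 1) + (\<Sum>n. zterm (n + Suc N) s)"
  unfolding zetaF_def suminf_split_initial_segment[OF summable_zterm[OF assms], of "Suc N"] zterm_partial
  by simp

lemma DS_partial_tendsto:
  assumes "abs_conv b" "Re s > 1"
  shows "(\<lambda>N. \<Sum>n=1..N. b n * nps n s) \<longlonglongrightarrow> DS b s"
proof -
  have "(\<lambda>N. \<Sum>n\<le>N. b n * nps n s) \<longlonglongrightarrow> DS b s"
    unfolding DS_def by (rule summable_LIMSEQ'[OF abs_conv_summable[OF assms]])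
  moreover have "(\<Sum>n\<le>N. b n * nps n s) = (\<Sum>n=1..N. b n * nps n s)" for N
    by (rule sum.mono_neutral_right) (auto simp: not_le)
  ultimately show ?thesis by simp
qed

lemma nps_tendsto_0: "Re s > 0 \<Longrightarrow> (\<lambda>n. nps (Suc n) s) \<longlonglongrightarrow> 0"
proof -
  assume s: "Re s > 0"
  have "(\<lambda>n. real (Suc n) powr (- Re s)) \<longlonglongrightarrow> 0"
    using s by real_asymp
  thus ?thesis by (intro tendsto_norm_zero_cancel[of "\<lambda>n. nps (Suc n) s"]) (simp add: norm_nps)
qed

lemma Lc_eq_DS:
  assumes Q: "\<And>n. norm (psum b n) \<le> Q" and b: "abs_conv b" and s: "Re s > 1"
  shows "Lc b s = DS b s"
proof -
  have s0: "Re s > 0" using s by simp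
  have "(\<lambda>N. \<Sum>n<Suc N. psum b n * (nps n s - nps (Suc n) s)) \<longlonglongrightarrow> Lc b s"
    using summable_LIMSEQ[OF summable_Lc[OF Q s0]] unfolding Lc_def by (rule LIMSEQ_Suc)
  moreover have "(\<lambda>N. psum b N * nps (Suc N) s) \<longlonglongrightarrow> 0"
  proof (rule tendsto_norm_zero_cancel, rule Lim_null_comparison[of _ "\<lambda>N. Q * norm (nps (Suc N) s)"])
    show "\<forall>\<^sub>F N in sequentially. norm (norm (psum b N * nps (Suc N) s)) \<le> Q * norm (nps (Suc N) s)"
      using Q by (intro always_eventually) (auto simp: norm_mult intro!: mult_right_mono)
    show "(\<lambda>N. Q * norm (nps (Suc N) s)) \<longlonglongrightarrow> 0"
      using tendsto_norm_zero[OF nps_tendsto_0[OF s0]] tendsto_mult_right_zero by blast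
  qed
  ultimately have "(\<lambda>N. \<Sum>n=1..N. b n * nps n s) \<longlonglongrightarrow> Lc b s + 0"
    unfolding abel_partial by (rule tendsto_add)
  with DS_partial_tendsto[OF b s] show ?thesis using LIMSEQ_unique by fastforce
qed

lemma abs_conv_1: "abs_conv (\<lambda>_. 1)"
  by (rule abs_conv_bounded[of _ 1]) auto

lemma zetaF_eq_DS:
  assumes s: "Re s > 1"
  shows "zetaF s = (s - 1) * DS (\<lambda>_. 1) s"
proof -
  have s0: "Re s > 0" "Re (s - 1) > 0" using s by auto
  have 1: "(\<lambda>N. \<Sum>n<Suc N. zterm n s) \<longlonglongrightarrow> zetaF s - 1"
    using LIMSEQ_Suc[OF summable_LIMSEQ[OF summable_zterm[OF s0(1)]]] by (simp add: zetaF_def del: sum.lessThan_Suc)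
  have "(\<lambda>N. (s - 1) * (\<Sum>n=1..N. nps n s) - 1 + nps (Suc N) (s - 1)) \<longlonglongrightarrow> (s - 1) * DS (\<lambda>_. 1) s - 1 + 0"
    using DS_partial_tendsto[OF abs_conv_1 s] nps_tendsto_0[OF s0(2)] by (intro tendsto_intros) auto
  with 1 have "zetaF s - 1 = (s - 1) * DS (\<lambda>_. 1) s - 1 + 0"
    unfolding zterm_partial by (rule LIMSEQ_unique)
  thus ?thesis by simp
qed

lemma zetaF_1: "zetaF 1 = 1"
proof -
  have "zterm n 1 = 0" for n by (auto simp: zterm_def nps_exp)
  thus ?thesis by (simp add: zetaF_def)
qed

text \<open>The identity n^(\<eta>-1) = n^(2\<eta>) n^(-\<eta>-1) trades the divergent head for
  N^(2\<eta>) times a convergent series.\<close>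

lemma head_sum_le:
  assumes \<eta>: "0 < \<eta>" "\<eta> \<le> 1/2" and s: "Re s \<ge> 1 - \<eta>"
  shows "(\<Sum>n=1..N. norm (nps n s)) \<le> real N powr (2 * \<eta>) * (\<Sum>n. real n powr (- \<eta> - 1))"
proof -
  have "(\<Sum>n=1..N. norm (nps n s)) \<le> (\<Sum>n=1..N. real N powr (2 * \<eta>) * real n powr (- \<eta> - 1))"
  proof (rule sum_mono)
    fix n assume n: "n \<in> {1..N}"
    have "norm (nps n s) \<le> real n powr (2 * \<eta> + (- \<eta> - 1))"
      unfolding norm_nps using n s by (intro powr_mono) auto
    also have "\<dots> = real n powr (2 * \<eta>) * real n powr (- \<eta> - 1)" by (rule powr_add)
    also have "\<dots> \<le> real N powr (2 * \<eta>) * real n powr (- \<eta> - 1)"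
      using n \<eta> by (intro mult_right_mono powr_mono2) auto
    finally show "norm (nps n s) \<le> real N powr (2 * \<eta>) * real n powr (- \<eta> - 1)" .
  qed
  also have "\<dots> = real N powr (2 * \<eta>) * (\<Sum>n=1..N. real n powr (- \<eta> - 1))"
    by (simp add: sum_distrib_left)
  also have "\<dots> \<le> real N powr (2 * \<eta>) * (\<Sum>n. real n powr (- \<eta> - 1))"
    using \<eta> by (intro mult_left_mono sum_le_suminf summable_powr_shift) auto
  finally show ?thesis .
qed

text \<open>With Re s \<ge> 1/2 the terms are at most n^(-3/2) = n^(-1/4) n^(-5/4); the first factor
  gives the saving in N, the second converges.\<close>

lemma tail_sum_le:
  assumes s: "Re s \<ge> 1/2" and N: "N > 0"
  shows "summable (\<lambda>n. real (n + Suc N) powr (- Re s - 1))"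
    "(\<Sum>n. real (n + Suc N) powr (- Re s - 1)) \<le> real N powr (-1/4) * (\<Sum>n. real n powr (- (1/4) - 1))"
proof -
  have sm: "summable (\<lambda>n. real n powr (- (1/4) - 1))" by (rule summable_powr_shift) auto
  show 1: "summable (\<lambda>n. real (n + Suc N) powr (- Re s - 1))"
    by (rule summable_ignore_initial_segment) (rule summable_powr_shift, use s in auto)
  have sm2: "summable (\<lambda>n. real (n + Suc N) powr (- (1/4) - 1))"
    by (rule summable_ignore_initial_segment[OF sm])
  have "(\<Sum>n. real (n + Suc N) powr (- Re s - 1)) \<le> (\<Sum>n. real N powr (-1/4) * real (n + Suc N) powr (- (1/4) - 1))"
  proof (rule suminf_le[OF _ 1 summable_mult[OF sm2]])
    fix n
    have "real (n + Suc N) powr (- Re s - 1) \<le> real (n + Suc N) powr (-1/4 + (- (1/4) - 1))"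
      using s by (intro powr_mono) auto
    also have "\<dots> = real (n + Suc N) powr (-1/4) * real (n + Suc N) powr (- (1/4) - 1)" by (rule powr_add)
    also have "\<dots> \<le> real N powr (-1/4) * real (n + Suc N) powr (- (1/4) - 1)"
      using N by (intro mult_right_mono powr_mono2') auto
    finally show "real (n + Suc N) powr (- Re s - 1) \<le> real N powr (-1/4) * real (n + Suc N) powr (- (1/4) - 1)" .
  qed
  also have "\<dots> = real N powr (-1/4) * (\<Sum>n. real (n + Suc N) powr (- (1/4) - 1))"
    by (rule suminf_mult[OF sm2])
  also have "\<dots> \<le> real N powr (-1/4) * (\<Sum>n. real n powr (- (1/4) - 1))"
    unfolding suminf_split_initial_segment[OF sm, of "Suc N"]
    by (intro mult_left_mono) (auto intro!: sum_nonneg simp del: sum.lessThan_Suc)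
  finally show "(\<Sum>n. real (n + Suc N) powr (- Re s - 1)) \<le> real N powr (-1/4) * (\<Sum>n. real n powr (- (1/4) - 1))" .
qed

text \<open>The cut-off \<open>N \<approx> y\<^sup>4\<close> makes the tail estimated by partial summation bounded, so only the trivially
  estimated head contributes.\<close>

lemma cutoff:
  fixes y :: real assumes y: "y \<ge> 1"
  obtains N :: nat where "N > 0" "y * real N powr (-1/4) \<le> 1" "real (Suc N) \<le> 3 * y ^ 4"
proof
  define N where "N = nat \<lceil>y ^ 4\<rceil>"
  have y4: "y ^ 4 \<ge> 1" using y by simp
  have N: "real N \<ge> y ^ 4" "real N \<le> y ^ 4 + 1" using y4 unfolding N_def by linarith+
  show "N > 0" using N y4 by (cases N) auto
  have "real N powr (-1/4) \<le> (y ^ 4) powr (-1/4)" using N y4 by (intro powr_mono2') auto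
  also have "(y ^ 4) powr (-1/4) = (y powr 4) powr (-1/4)" using y by simp
  also have "\<dots> = y powr (-1)" by (subst powr_powr) simp
  finally show "y * real N powr (-1/4) \<le> 1" using y by (simp add: powr_minus field_simps)
  show "real (Suc N) \<le> 3 * y ^ 4" using N y4 by simp
qed

text \<open>The exponent 8\<eta> is the exponent 4 of the cut-off times the exponent 2\<eta> of the
  head. The constant is uniform in b, which later ranges over all characters of all moduli.\<close>

lemma Lc_bound:
  assumes \<eta>: "0 < \<eta>" "\<eta> \<le> 1/2"
  obtains C where "C > 0" "\<And>b Q s. Q \<ge> 1 \<Longrightarrow> (\<And>n. norm (b n) \<le> 2) \<Longrightarrow> (\<And>n. norm (psum b n) \<le> Q) \<Longrightarrow>
     Re s \<ge> 1 - \<eta> \<Longrightarrow> norm (Lc b s) \<le> C * (Q * (norm s + 1)) powr (8 * \<eta>)"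
proof -
  define Z1 Z2 where "Z1 = (\<Sum>n. real n powr (- \<eta> - 1))" and "Z2 = (\<Sum>n. real n powr (- (1/4) - 1))"
  have Z: "Z1 \<ge> 0" "Z2 \<ge> 0" unfolding Z1_def Z2_def using \<eta> summable_powr_shift[of "1/4"] by (auto intro!: suminf_nonneg summable_powr_shift)
  define C where "C = 2 * 3 powr (2 * \<eta>) * Z1 + 1 + Z2"
  show ?thesis
  proof (rule that[of C])
    show "C > 0" unfolding C_def using Z by (intro add_nonneg_pos add_pos_nonneg) auto
    fix b Q s assume Q: "Q \<ge> (1::real)" and b: "\<And>n. norm (b n) \<le> 2" and S: "\<And>n. norm (psum b n) \<le> Q"
      and s: "Re s \<ge> 1 - \<eta>"
    define y where "y = Q * (norm s + 1)"
    have y: "y \<ge> 1" "Q \<le> y" "Q * norm s \<le> y"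
      using Q mult_mono[of 1 Q 1 "norm s + 1"] mult_left_mono[of 1 "norm s + 1" Q] by (auto simp: y_def algebra_simps)
    have s12: "Re s \<ge> 1/2" using s \<eta> by simp
    hence s0: "Re s > 0" by simp
    obtain N where N: "N > 0" "y * real N powr (-1/4) \<le> 1" "real (Suc N) \<le> 3 * y ^ 4" using cutoff[OF y(1)] by blast
    have "norm (\<Sum>n=1..N. b n * nps n s) \<le> (\<Sum>n=1..N. 2 * norm (nps n s))"
      using b by (intro sum_norm_le) (auto simp: norm_mult intro!: mult_right_mono)
    also have "\<dots> = 2 * (\<Sum>n=1..N. norm (nps n s))" by (simp add: sum_distrib_left)
    also have "\<dots> \<le> 2 * (real N powr (2 * \<eta>) * Z1)"
      unfolding Z1_def by (intro mult_left_mono head_sum_le \<eta> s) auto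
    also have "real N powr (2 * \<eta>) \<le> (3 * y powr 4) powr (2 * \<eta>)"
      using N \<eta> y by (intro powr_mono2) auto
    also have "(3 * y powr 4) powr (2 * \<eta>) = 3 powr (2 * \<eta>) * y powr (8 * \<eta>)"
      using y by (simp only: powr_mult powr_powr) simp
    finally have h1: "norm (\<Sum>n=1..N. b n * nps n s) \<le> 2 * 3 powr (2 * \<eta>) * Z1 * y powr (8 * \<eta>)"
      using Z by (simp add: mult_ac mult_left_mono mult_right_mono)
    have "norm (psum b N * nps (Suc N) s) \<le> Q * real N powr (-1/4)"
    proof -
      have "real (Suc N) powr (- Re s) \<le> real (Suc N) powr (-1/4)" using s12 by (intro powr_mono) auto
      also have "\<dots> \<le> real N powr (-1/4)" using N by (intro powr_mono2') auto
      finally show ?thesis unfolding norm_mult norm_nps using S[of N] Q by (intro mult_mono) auto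
    qed
    also have "\<dots> \<le> y * real N powr (-1/4)" using y by (intro mult_right_mono) auto
    finally have h2: "norm (psum b N * nps (Suc N) s) \<le> 1" using N by linarith
    have "norm (\<Sum>n. psum b (n + Suc N) * (nps (n + Suc N) s - nps (Suc (n + Suc N)) s)) \<le>
        (\<Sum>n. Q * norm s * real (n + Suc N) powr (- Re s - 1))"
      by (rule norm_suminf_le[OF norm_Lc_term_le[OF S s0] summable_mult[OF tail_sum_le(1)[OF s12 N(1)]]])
    also have "\<dots> = Q * norm s * (\<Sum>n. real (n + Suc N) powr (- Re s - 1))"
      by (rule suminf_mult[OF tail_sum_le(1)[OF s12 N(1)]])
    also have "\<dots> \<le> Q * norm s * (real N powr (-1/4) * Z2)"
      unfolding Z2_def using tail_sum_le(2)[OF s12 N(1)] Q by (intro mult_left_mono) auto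
    also have "\<dots> \<le> y * (real N powr (-1/4) * Z2)" using y Z by (intro mult_right_mono) auto
    also have "\<dots> = y * real N powr (-1/4) * Z2" by simp
    also have "\<dots> \<le> 1 * Z2" using N Z by (intro mult_right_mono) auto
    finally have h3: "norm (\<Sum>n. psum b (n + Suc N) * (nps (n + Suc N) s - nps (Suc (n + Suc N)) s)) \<le> Z2" by simp
    have y8: "y powr (8 * \<eta>) \<ge> 1" using y \<eta> by (simp add: ge_one_powr_ge_zero)
    have "norm (Lc b s) \<le> 2 * 3 powr (2 * \<eta>) * Z1 * y powr (8 * \<eta>) + 1 + Z2"
      unfolding Lc_truncate[OF S s0, of N]
      using h1 h2 h3 by (smt (verit) norm_triangle_ineq norm_triangle_ineq4)
    also have "\<dots> \<le> 2 * 3 powr (2 * \<eta>) * Z1 * y powr (8 * \<eta>) + 1 * y powr (8 * \<eta>) + Z2 * y powr (8 * \<eta>)"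
      using y8 Z by (intro add_mono mult_left_mono[of 1 "y powr (8*\<eta>)" Z2, simplified]) auto
    also have "\<dots> = C * y powr (8 * \<eta>)" by (simp add: C_def algebra_simps)
    finally show "norm (Lc b s) \<le> C * (Q * (norm s + 1)) powr (8 * \<eta>)" by (simp add: y_def)
  qed
qed

text \<open>The argument for \<open>Lc\<close> with y = |s| + 1; the additional exponent 1 comes
  from the factor s - 1.\<close>

lemma zetaF_bound:
  assumes \<eta>: "0 < \<eta>" "\<eta> \<le> 1/2"
  obtains C where "C > 0" "\<And>s. Re s \<ge> 1 - \<eta> \<Longrightarrow> norm (zetaF s) \<le> C * (norm s + 1) powr (1 + 8 * \<eta>)"
proof -
  define Z1 Z2 where "Z1 = (\<Sum>n. real n powr (- \<eta> - 1))" and "Z2 = (\<Sum>n. real n powr (- (1/4) - 1))"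
  have Z: "Z1 \<ge> 0" "Z2 \<ge> 0" unfolding Z1_def Z2_def using \<eta> summable_powr_shift[of "1/4"] by (auto intro!: suminf_nonneg summable_powr_shift)
  define C where "C = 3 powr (2 * \<eta>) * Z1 + 3 powr (2 * \<eta>) + Z2"
  show ?thesis
  proof (rule that[of C])
    show "C > 0" unfolding C_def using Z by (intro add_nonneg_pos add_pos_nonneg) auto
    fix s assume s: "Re s \<ge> 1 - \<eta>"
    define y where "y = norm s + 1"
    have y: "y \<ge> 1" "norm s \<le> y" "norm (s - 1) \<le> y"
      using norm_triangle_ineq4[of s 1] by (auto simp: y_def)
    have s12: "Re s \<ge> 1/2" using s \<eta> by simp
    hence s0: "Re s > 0" by simp
    obtain N where N: "N > 0" "y * real N powr (-1/4) \<le> 1" "real (Suc N) \<le> 3 * y ^ 4" using cutoff[OF y(1)] by blast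
    have e: "(3 * y powr 4) powr (2 * \<eta>) = 3 powr (2 * \<eta>) * y powr (8 * \<eta>)"
      using y by (simp only: powr_mult powr_powr) simp
    have e1: "y powr (1 + 8 * \<eta>) = y * y powr (8 * \<eta>)" using y by (simp add: powr_add)
    have y8: "y powr (8 * \<eta>) \<ge> 1" using y \<eta> by (simp add: ge_one_powr_ge_zero)
    have "norm (\<Sum>n=1..N. nps n s) \<le> (\<Sum>n=1..N. norm (nps n s))" by (rule norm_sum)
    also have "\<dots> \<le> real N powr (2 * \<eta>) * Z1"
      unfolding Z1_def by (intro head_sum_le \<eta> s)
    also have "\<dots> \<le> (3 * y powr 4) powr (2 * \<eta>) * Z1"
      using N \<eta> y Z by (intro powr_mono2 mult_right_mono) auto
    finally have "norm ((s - 1) * (\<Sum>n=1..N. nps n s)) \<le> y * (3 powr (2 * \<eta>) * y powr (8 * \<eta>) * Z1)"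
      unfolding e norm_mult using y by (intro mult_mono) auto
    hence h1: "norm ((s - 1) * (\<Sum>n=1..N. nps n s)) \<le> 3 powr (2 * \<eta>) * Z1 * y powr (1 + 8 * \<eta>)"
      unfolding e1 by (simp only: mult_ac)
    have "norm (nps (Suc N) (s - 1)) \<le> real (Suc N) powr (2 * \<eta>)"
      unfolding norm_nps using s \<eta> by (intro powr_mono) auto
    also have "\<dots> \<le> (3 * y powr 4) powr (2 * \<eta>)" using N \<eta> y by (intro powr_mono2) auto
    also have "\<dots> \<le> 3 powr (2 * \<eta>) * y powr (1 + 8 * \<eta>)"
      unfolding e using y by (intro mult_left_mono powr_mono) auto
    finally have h2: "norm (nps (Suc N) (s - 1)) \<le> 3 powr (2 * \<eta>) * y powr (1 + 8 * \<eta>)" .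
    have "norm (\<Sum>n. zterm (n + Suc N) s) \<le> (\<Sum>n. norm (s - 1) * norm s * real (n + Suc N) powr (- Re s - 1))"
      by (rule norm_suminf_le[OF norm_zterm_le summable_mult[OF tail_sum_le(1)[OF s12 N(1)]]]) (use s12 in auto)
    also have "\<dots> = norm (s - 1) * norm s * (\<Sum>n. real (n + Suc N) powr (- Re s - 1))"
      by (rule suminf_mult[OF tail_sum_le(1)[OF s12 N(1)]])
    also have "\<dots> \<le> (y * y) * (real N powr (-1/4) * Z2)"
      unfolding Z2_def using tail_sum_le(2)[OF s12 N(1)] y
      by (intro mult_mono suminf_nonneg[OF tail_sum_le(1)[OF s12 N(1)]]) auto
    also have "\<dots> = y * Z2 * (y * real N powr (-1/4))" by simp
    also have "\<dots> \<le> y * Z2 * 1" using N Z y by (intro mult_left_mono) auto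
    also have "\<dots> \<le> Z2 * y powr (1 + 8 * \<eta>)" unfolding e1 using y8 y Z
      by (simp add: mult.commute mult_left_mono mult_le_cancel_left1)
    finally have h3: "norm (\<Sum>n. zterm (n + Suc N) s) \<le> Z2 * y powr (1 + 8 * \<eta>)" .
    have "norm (zetaF s) \<le> 3 powr (2 * \<eta>) * Z1 * y powr (1 + 8 * \<eta>) + 3 powr (2 * \<eta>) * y powr (1 + 8 * \<eta>) + Z2 * y powr (1 + 8 * \<eta>)"
      unfolding zetaF_truncate[OF s0, of N]
      using h1 h2 h3 by (smt (verit) norm_triangle_ineq)
    also have "\<dots> = C * y powr (1 + 8 * \<eta>)" by (simp add: C_def algebra_simps)
    finally show "norm (zetaF s) \<le> C * (norm s + 1) powr (1 + 8 * \<eta>)" by (simp add: y_def)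
  qed
qed

section \<open>Siegel's theorem\<close>

lemma dchar_cmult_fun: "dchar q \<phi> \<Longrightarrow> cmult_fun \<phi>"
  using dchar_1 dchar_mult norm_dchar_le by (auto simp: cmult_fun_def)

lemma cmult_fun_1: "cmult_fun (\<lambda>_. 1)"
  by (simp add: cmult_fun_def)

lemma norm_psum_le:
  assumes "\<And>N. norm (\<Sum>k<N. b k) \<le> Q" "norm (b 0) \<le> 1" "Q \<ge> 1"
  shows "norm (psum b n) \<le> 2 * Q"
proof -
  have "(\<Sum>k<Suc n. b k) = b 0 + psum b n"
    unfolding psum_def by (subst sum.lessThan_Suc_shift) (simp add: sum.atLeast1_atMost_eq)
  hence "norm (psum b n) \<le> norm (\<Sum>k<Suc n. b k) + norm (b 0)"
    by (metis add_diff_cancel_left' norm_triangle_ineq4)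
  also have "\<dots> \<le> Q + 1" using assms by (intro add_mono)
  finally show ?thesis using assms(3) by simp
qed

lemma norm_psum_dchar_le:
  assumes "dchar q \<phi>" "\<phi> \<noteq> principal_char q"
  shows "norm (psum \<phi> n) \<le> 2 * real q"
  using norm_sum_dchar_le[OF assms] norm_dchar_le[OF assms(1)] dchar_pos[OF assms(1)]
  by (intro norm_psum_le) auto

definition npchar :: "nat \<Rightarrow> (nat \<Rightarrow> complex) \<Rightarrow> bool" where
  "npchar q \<phi> \<longleftrightarrow> dchar q \<phi> \<and> \<phi> \<noteq> principal_char q"

text \<open>Quadratic characters, primitive or not.\<close>

definition rchar :: "nat \<Rightarrow> (nat \<Rightarrow> complex) \<Rightarrow> bool" where
  "rchar q \<phi> \<longleftrightarrow> npchar q \<phi> \<and> (\<forall>n. \<phi> n \<in> {-1, 0, 1})"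

lemma npchar_holomorphic: "npchar q \<phi> \<Longrightarrow> Lc \<phi> holomorphic_on {s. Re s > 0}"
  unfolding npchar_def using Lc_holomorphic norm_psum_dchar_le by blast

lemma npchar_Lc_eq_DS: "npchar q \<phi> \<Longrightarrow> Re s > 1 \<Longrightarrow> Lc \<phi> s = DS \<phi> s"
  unfolding npchar_def using Lc_eq_DS norm_psum_dchar_le cmult_fun_abs_conv dchar_cmult_fun by blast

lemma npchar_bound:
  assumes "0 < \<eta>" "\<eta> \<le> 1/2"
  obtains C where "C > 0" "\<And>q \<phi> s. npchar q \<phi> \<Longrightarrow> Re s \<ge> 1 - \<eta> \<Longrightarrow>
     norm (Lc \<phi> s) \<le> C * (real q * (norm s + 1)) powr (8 * \<eta>)"
proof -
  obtain C where C: "C > 0" "\<And>b Q s. Q \<ge> 1 \<Longrightarrow> (\<And>n. norm (b n) \<le> 2) \<Longrightarrow> (\<And>n. norm (psum b n) \<le> Q) \<Longrightarrow>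
     Re s \<ge> 1 - \<eta> \<Longrightarrow> norm (Lc b s) \<le> C * (Q * (norm s + 1)) powr (8 * \<eta>)"
    using Lc_bound[OF assms] by blast
  show ?thesis
  proof (rule that[of "C * 2 powr (8 * \<eta>)"])
    show "C * 2 powr (8 * \<eta>) > 0" using C by simp
    fix q \<phi> s assume \<phi>: "npchar q \<phi>" and s: "Re s \<ge> 1 - \<eta>"
    have q: "q > 0" using \<phi> dchar_pos by (auto simp: npchar_def)
    have "norm (Lc \<phi> s) \<le> C * (2 * real q * (norm s + 1)) powr (8 * \<eta>)"
    proof (rule C(2))
      show "2 * real q \<ge> 1" using q by simp
      show "norm (\<phi> n) \<le> 2" for n
        using \<phi> norm_dchar_le[of q \<phi> n] by (simp add: npchar_def)
      show "norm (psum \<phi> n) \<le> 2 * real q" for n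
        using \<phi> norm_psum_dchar_le[of q \<phi>] by (simp add: npchar_def)
    qed fact
    also have "(2 * real q * (norm s + 1)) powr (8 * \<eta>) = 2 powr (8 * \<eta>) * (real q * (norm s + 1)) powr (8 * \<eta>)"
      by (simp add: powr_mult mult.assoc)
    finally show "norm (Lc \<phi> s) \<le> C * 2 powr (8 * \<eta>) * (real q * (norm s + 1)) powr (8 * \<eta>)"
      by (simp add: mult.assoc)
  qed
qed

text \<open>What Estermann's argument asks of zeta L(\<phi>) and of zeta L(\<phi>) L(\<psi>)
  L(\<phi>\<psi>): a product with at most a simple pole at 1 whose logarithm has nonnegative
  coefficients. \<Phi> is that product times s - 1.\<close>

locale nonneg_exp =
  fixes c :: "nat \<Rightarrow> real" and B :: real and \<Phi> :: "complex \<Rightarrow> complex"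
  assumes c0: "\<And>n. c n \<ge> 0" and cB: "\<And>n. c n \<le> B"
    and hol: "\<Phi> holomorphic_on {s. Re s > 0}"
    and eq: "\<And>s. Re s > 1 \<Longrightarrow> \<Phi> s = (s - 1) * exp (DS (\<lambda>n. of_real (c n)) s)"
begin

definition P where "P = DS (\<lambda>n. of_real (c n))"
text \<open>Up to the sign (-1)^m, \<open>p m\<close> and \<open>F m\<close> are the m-th
  derivatives at 2 of P and of exp P; with that sign both turn out to be nonnegative.\<close>

definition p where "p m = (\<Sum>n. c n * ln (real n) ^ m * real n powr (-2))"
definition F where "F m = Re ((-1) ^ m * (deriv ^^ m) (\<lambda>s. exp (P s)) 2)"

lemma abs_conv_c: "abs_conv (\<lambda>n. of_real (c n))"
  by (rule abs_conv_bounded[of _ B]) (use c0 cB in auto)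

lemma summable_p: "summable (\<lambda>n. c n * ln (real n) ^ m * real n powr (-2))"
proof -
  have "summable (\<lambda>n. norm (of_real (ln (real n)) ^ m * complex_of_real (c n)) * real n powr (-2))"
    using abs_conv_ln_power[OF abs_conv_c, of m] unfolding abs_conv_def by auto
  also have "(\<lambda>n. norm (of_real (ln (real n)) ^ m * complex_of_real (c n)) * real n powr (-2)) =
     (\<lambda>n. c n * ln (real n) ^ m * real n powr (-2))"
  proof
    fix n show "norm (of_real (ln (real n)) ^ m * complex_of_real (c n)) * real n powr (-2) =
     c n * ln (real n) ^ m * real n powr (-2)"
      using c0[of n] by (cases "n = 0") (auto simp: norm_mult norm_power)
  qed
  finally show ?thesis .
qed

lemma p_nonneg: "p m \<ge> 0"
  unfolding p_def
proof (rule suminf_nonneg[OF summable_p])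
  fix n show "0 \<le> c n * ln (real n) ^ m * real n powr - 2"
    using c0[of n] by (cases "n = 0") auto
qed

lemma P_deriv: "(deriv ^^ m) P 2 = (-1) ^ m * of_real (p m)"
proof -
  have "(deriv ^^ m) P 2 = (-1) ^ m * DS (\<lambda>n. of_real (ln (real n)) ^ m * of_real (c n)) 2"
    unfolding P_def by (rule DS_higher_deriv[OF abs_conv_c]) auto
  also have "DS (\<lambda>n. of_real (ln (real n)) ^ m * of_real (c n)) 2 =
     (\<Sum>n. of_real (c n * ln (real n) ^ m * real n powr (-2)))"
    unfolding DS_def using nps_of_real[of _ 2] by (intro suminf_cong) (auto simp: mult_ac)
  also have "\<dots> = of_real (p m)" unfolding p_def by (rule suminf_of_real[OF summable_p, symmetric])
  finally show ?thesis .
qed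

lemma hol_P: "P holomorphic_on {s. Re s > 1}"
  unfolding P_def by (rule DS_holomorphic[OF abs_conv_c])

text \<open>Leibniz' rule for (exp P)' = P' exp P writes F (k+1) as a sum over i of binomial
  coefficients times p (i+1) F (k-i), so nonnegativity propagates by induction. The term i = k
  together with F 0 \<ge> 1 gives F m \<ge> p m.\<close>

lemma exp_P_deriv:
  "(-1) ^ m * (deriv ^^ m) (\<lambda>s. exp (P s)) 2 = of_real (F m) \<and> F m \<ge> 0 \<and> (m > 0 \<longrightarrow> F m \<ge> p m) \<and> (m = 0 \<longrightarrow> F m \<ge> 1)"
proof (induction m rule: less_induct)
  case (less m)
  define f where "f = (\<lambda>s. exp (P s))"
  have op: "open {s. Re s > 1}" by (rule open_halfspace_Re_gt)
  have hf: "f holomorphic_on {s. Re s > 1}" unfolding f_def by (intro holomorphic_intros hol_P)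
  show ?case
  proof (cases m)
    case 0
    have "P 2 = of_real (p 0)" using P_deriv[of 0] by simp
    hence "exp (P 2) = of_real (exp (p 0))" by (simp add: exp_of_real)
    thus ?thesis using p_nonneg[of 0] by (simp add: F_def 0)
  next
    case (Suc k)
    have "(deriv ^^ m) f 2 = (deriv ^^ k) (deriv f) 2" by (simp add: Suc funpow_swap1)
    also have "\<dots> = (deriv ^^ k) (\<lambda>s. deriv P s * f s) 2"
    proof (rule higher_deriv_transform_within_open[OF _ _ op])
      show "deriv f holomorphic_on {s. Re s > 1}" by (intro holomorphic_deriv hf op)
      show "(\<lambda>s. deriv P s * f s) holomorphic_on {s. Re s > 1}"
        by (intro holomorphic_intros holomorphic_deriv hf hol_P op)
      fix w assume w: "w \<in> {s. Re s > 1}"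
      have "(P has_field_derivative deriv P w) (at w)"
        using hol_P op w holomorphic_derivI by blast
      hence "(f has_field_derivative (exp (P w) * deriv P w)) (at w)"
        unfolding f_def by (intro DERIV_fun_exp)
      thus "deriv f w = deriv P w * f w" by (simp add: DERIV_imp_deriv f_def mult.commute)
    qed auto
    also have "\<dots> = (\<Sum>i = 0..k. of_nat (k choose i) * (deriv ^^ i) (deriv P) 2 * (deriv ^^ (k - i)) f 2)"
      by (rule higher_deriv_mult[OF _ hf op]) (auto intro!: holomorphic_deriv hol_P op)
    also have "\<dots> = (\<Sum>i = 0..k. (-1) ^ m * of_real (real (k choose i) * p (Suc i) * F (k - i)))"
    proof (rule sum.cong[OF refl])
      fix i assume i: "i \<in> {0..k}"
      have d1: "(deriv ^^ i) (deriv P) 2 = (-1) ^ Suc i * of_real (p (Suc i))"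
        using P_deriv[of "Suc i"] by (simp add: funpow_swap1)
      have "(-1) ^ (k - i) * (deriv ^^ (k - i)) f 2 = of_real (F (k - i))"
        using less[of "k - i"] Suc unfolding f_def by simp
      hence "(-1) ^ (k - i) * ((-1) ^ (k - i) * (deriv ^^ (k - i)) f 2) = (-1) ^ (k - i) * of_real (F (k - i))" by simp
      hence d2: "(deriv ^^ (k - i)) f 2 = (-1) ^ (k - i) * of_real (F (k - i))"
        by (simp add: mult.assoc[symmetric] power_mult_distrib[symmetric])
      have sg: "(-1 :: complex) ^ m = (-1) ^ Suc i * (-1) ^ (k - i)"
        using i by (simp add: Suc power_add[symmetric])
      show "of_nat (k choose i) * (deriv ^^ i) (deriv P) 2 * (deriv ^^ (k - i)) f 2 =
          (-1) ^ m * of_real (real (k choose i) * p (Suc i) * F (k - i))"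
        unfolding d1 d2 sg by simp
    qed
    also have "\<dots> = (-1) ^ m * of_real (\<Sum>i = 0..k. real (k choose i) * p (Suc i) * F (k - i))"
      by (simp add: sum_distrib_left)
    finally have e: "(deriv ^^ m) f 2 = (-1) ^ m * of_real (\<Sum>i = 0..k. real (k choose i) * p (Suc i) * F (k - i))" .
    hence e2: "(-1) ^ m * (deriv ^^ m) f 2 = of_real (\<Sum>i = 0..k. real (k choose i) * p (Suc i) * F (k - i))"
      by (simp add: mult.assoc[symmetric] power_mult_distrib[symmetric])
    have "F m = Re ((-1) ^ m * (deriv ^^ m) f 2)" by (simp only: F_def f_def)
    hence Fm: "F m = (\<Sum>i = 0..k. real (k choose i) * p (Suc i) * F (k - i))"
      by (simp only: e2 Re_complex_of_real)
    have nn: "real (k choose i) * p (Suc i) * F (k - i) \<ge> 0" for i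
    proof -
      have "F (k - i) \<ge> 0" using less[of "k - i"] Suc by simp
      thus ?thesis using p_nonneg[of "Suc i"] by (intro mult_nonneg_nonneg) auto
    qed
    have F0: "F 0 \<ge> 1" using less[of 0] Suc by simp
    have "p m * 1 \<le> p m * F 0" by (rule mult_left_mono[OF F0 p_nonneg])
    also have "\<dots> = (\<Sum>i\<in>{k}. real (k choose i) * p (Suc i) * F (k - i))" by (simp add: Suc)
    also have "\<dots> \<le> F m" unfolding Fm by (rule sum_mono2) (use nn in auto)
    finally have "p m \<le> F m" by simp
    thus ?thesis using e2 Fm p_nonneg[of m] Suc unfolding f_def by auto
  qed
qed

text \<open>This is exp P minus the polar part \<Phi> 1 / (s - 1), written so that it is holomorphic
  at 1 as well.\<close>

definition h where "h z = (if z = 1 then deriv \<Phi> 1 else (\<Phi> z - \<Phi> 1) / (z - 1))"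

lemma hol_h: "h holomorphic_on {s. Re s > 0}"
proof -
  have "1 \<in> interior {s. Re s > 0}" using open_halfspace_Re_gt[of 0] by (simp add: interior_open)
  from pole_lemma[OF hol this] show ?thesis unfolding h_def .
qed

lemma higher_deriv_inverse_shift:
  "Re s > 1 \<Longrightarrow> (deriv ^^ m) (\<lambda>z. 1 / (z - 1)) s = (-1) ^ m * fact m * inverse (s - 1) ^ Suc m"
proof (induction m arbitrary: s)
  case (Suc m)
  have op: "open {s. Re s > 1}" by (rule open_halfspace_Re_gt)
  have ne: "w - 1 \<noteq> 0" if "Re w > 1" for w using that by auto
  have "(deriv ^^ Suc m) (\<lambda>z. 1 / (z - 1)) s = deriv ((deriv ^^ m) (\<lambda>z. 1 / (z - 1))) s" by simp
  also have "\<dots> = deriv (\<lambda>s. (-1) ^ m * fact m * inverse (s - 1) ^ Suc m) s"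
  proof (rule complex_derivative_transform_within_open)
    show "(deriv ^^ m) (\<lambda>z. 1 / (z - 1)) holomorphic_on {s. Re s > 1}"
      by (intro holomorphic_higher_deriv holomorphic_intros op) (use ne in auto)
    show "(\<lambda>s. (-1) ^ m * fact m * inverse (s - 1) ^ Suc m) holomorphic_on {s. Re s > 1}"
      by (intro holomorphic_intros) (use ne in auto)
    show "s \<in> {s. Re s > 1}" using Suc.prems by simp
  qed (use Suc.IH op in auto)
  also have "\<dots> = (-1) ^ Suc m * fact (Suc m) * inverse (s - 1) ^ Suc (Suc m)"
  proof (rule DERIV_imp_deriv)
    show "((\<lambda>s. (-1) ^ m * fact m * inverse (s - 1) ^ Suc m) has_field_derivative
        (-1) ^ Suc m * fact (Suc m) * inverse (s - 1) ^ Suc (Suc m)) (at s)"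
      using ne[OF Suc.prems] by (auto intro!: derivative_eq_intros simp del: power_Suc) (simp add: algebra_simps)
  qed
  finally show ?case .
qed (auto simp: field_simps)

text \<open>At 2 the polar part l0/(s - 1) has Taylor coefficients (-1)^m l0, so those of exp P are
  merely shifted by l0. Moving the sign into (2 - w)^m leaves positive powers for real w <
  2.\<close>

lemma h_coeff:
  assumes "\<Phi> 1 = of_real l0"
  shows "(deriv ^^ m) h 2 / fact m * (w - 2) ^ m = of_real (F m / fact m - l0) * (2 - w) ^ m"
proof -
  have op: "open {s. Re s > 1}" by (rule open_halfspace_Re_gt)
  have hP: "(\<lambda>s. exp (P s)) holomorphic_on {s. Re s > 1}" by (intro holomorphic_intros hol_P)
  have hi: "(\<lambda>s. 1 / (s - 1)) holomorphic_on {s. Re s > 1}" by (intro holomorphic_intros) auto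
  have h': "h holomorphic_on {s. Re s > 1}" by (rule holomorphic_on_subset[OF hol_h]) auto
  have "(deriv ^^ m) h 2 = (deriv ^^ m) (\<lambda>s. exp (P s) - of_real l0 * (1 / (s - 1))) 2"
  proof (rule higher_deriv_transform_within_open[OF h' _ op])
    show "(\<lambda>s. exp (P s) - of_real l0 * (1 / (s - 1))) holomorphic_on {s. Re s > 1}"
      by (intro holomorphic_on_diff hP holomorphic_on_mult hi holomorphic_on_const)
    fix w assume w: "w \<in> {s. Re s > 1}"
    hence "w \<noteq> 1" by auto
    thus "h w = exp (P w) - of_real l0 * (1 / (w - 1))"
      unfolding h_def using eq[of w] w by (simp add: assms P_def field_simps)
  qed auto
  also have "\<dots> = (deriv ^^ m) (\<lambda>s. exp (P s)) 2 - (deriv ^^ m) (\<lambda>s. of_real l0 * (1 / (s - 1))) 2"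
    by (rule higher_deriv_diff[OF hP _ op]) (auto intro!: holomorphic_intros)
  also have "(deriv ^^ m) (\<lambda>s. of_real l0 * (1 / (s - 1))) (2::complex) = of_real l0 * (deriv ^^ m) (\<lambda>s. 1 / (s - 1)) 2"
    by (rule higher_deriv_cmult[OF hi _ op]) auto
  also have "(deriv ^^ m) (\<lambda>s. 1 / (s - 1)) 2 = ((-1) ^ m * fact m :: complex)"
    by (subst higher_deriv_inverse_shift) auto
  finally have D: "(deriv ^^ m) h 2 = (deriv ^^ m) (\<lambda>s. exp (P s)) 2 - of_real l0 * ((-1) ^ m * fact m)" .
  have "(-1) ^ m * (deriv ^^ m) h 2 = (-1) ^ m * (deriv ^^ m) (\<lambda>s. exp (P s)) 2 - of_real l0 * fact m * ((-1) ^ m * (-1) ^ m)"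
    unfolding D by (simp only: algebra_simps)
  also have "(-1) ^ m * (-1) ^ m = (1 :: complex)" by (simp add: power_mult_distrib[symmetric])
  also have "(-1) ^ m * (deriv ^^ m) (\<lambda>s. exp (P s)) 2 - of_real l0 * fact m * 1 = of_real (F m - l0 * fact m)" using exp_P_deriv[of m] by simp
  finally have "(-1) ^ m * (deriv ^^ m) h 2 / fact m = of_real ((F m - l0 * fact m) / fact m)"
    by simp
  also have "(F m - l0 * fact m) / fact m = F m / fact m - l0" by (simp add: field_simps)
  finally have *: "(-1) ^ m * (deriv ^^ m) h 2 / fact m = of_real (F m / fact m - l0)" .
  have "(w - 2) ^ m = (-1) ^ m * (2 - w) ^ m" by (simp add: power_mult_distrib[symmetric])
  thus ?thesis unfolding *[symmetric] by simp
qed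

lemma h_real_sums:
  assumes "\<Phi> 1 = of_real l0" "0 < x" "x < 2" 
  shows "(\<lambda>m. (F m / fact m - l0) * (2 - x) ^ m) sums Re (h (of_real x))"
proof -
  have "h holomorphic_on ball 2 2"
  proof (rule holomorphic_on_subset[OF hol_h], safe)
    fix w :: complex assume "w \<in> ball 2 2"
    thus "Re w > 0" using abs_Re_le_cmod[of "2 - w"] by (auto simp: dist_norm)
  qed
  moreover have "complex_of_real x \<in> ball 2 2"
  proof -
    have "dist 2 (complex_of_real x) = norm (complex_of_real (2 - x))" by (simp add: dist_norm)
    also have "\<dots> = \<bar>2 - x\<bar>" by (rule norm_of_real)
    finally show ?thesis using assms by simp
  qed
  ultimately have "(\<lambda>m. (deriv ^^ m) h 2 / fact m * (of_real x - 2) ^ m) sums h (of_real x)"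
    by (rule holomorphic_power_series)
  from sums_Re[OF this] have "(\<lambda>m. Re (of_real (F m / fact m - l0) * (2 - of_real x) ^ m)) sums Re (h (of_real x))"
    unfolding h_coeff[OF assms(1)] .
  moreover have "Re (of_real (F m / fact m - l0) * (2 - of_real x) ^ m) = (F m / fact m - l0) * (2 - x) ^ m" for m
  proof -
    have "of_real (F m / fact m - l0) * (2 - of_real x) ^ m = complex_of_real ((F m / fact m - l0) * (2 - x) ^ m)"
      by simp
    thus ?thesis by (simp only: Re_complex_of_real)
  qed
  ultimately show ?thesis by (simp only:)
qed

text \<open>Expand h at 2 and evaluate at \<beta>, where its value is at most l0/(1 - \<beta>)
  because v \<ge> 0. The numbers F m / m! are nonnegative and the first is at least 1; Cauchy's
  estimate makes the tail beyond M at most 1/2 in size. Only l0 times a geometric sum of length M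
  can be subtracted, so l0 cannot be small.\<close>

lemma estermann:
  assumes K: "K \<ge> 1" and bd: "\<And>s. s \<in> cball 2 (4/3) \<Longrightarrow> norm (\<Phi> s) \<le> K"
    and l0: "\<Phi> 1 = of_real l0" and \<beta>: "7/8 < \<beta>" "\<beta> < 1" and v: "\<Phi> (of_real \<beta>) = of_real v" "v \<ge> 0"
  shows "l0 \<ge> (1 - \<beta>) / 462 * K powr (-7 * (1 - \<beta>))"
proof -
  have sub: "cball 2 (4/3) \<subseteq> {s. Re s > 0}"
  proof
    fix w :: complex assume "w \<in> cball 2 (4/3)"
    thus "w \<in> {s. Re s > 0}" using abs_Re_le_cmod[of "2 - w"] by (auto simp: dist_norm)
  qed
  have co: "\<bar>F m / fact m - l0\<bar> \<le> 6 * K * (3/4) ^ m" for m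
  proof -
    have "norm ((deriv ^^ m) h 2) \<le> fact m * (6 * K) / (4/3) ^ m"
    proof (rule Cauchy_inequality)
      show "h holomorphic_on ball 2 (4/3)"
        by (rule holomorphic_on_subset[OF hol_h]) (use sub ball_subset_cball in blast)
      show "continuous_on (cball 2 (4/3)) h"
        by (rule holomorphic_on_imp_continuous_on, rule holomorphic_on_subset[OF hol_h]) (use sub in auto)
      fix x :: complex assume x: "norm (2 - x) = (4/3 :: real)"
      \<comment> \<open>The circle of radius 4/3 about 2 stays at distance 1/3 from the point 1,
        whence the bound 2K / (1/3) = 6K for h.\<close>
      have "norm (1 - (2 - x)) \<ge> 1/3" using norm_triangle_ineq3[of "2 - x" 1] x by (simp add: norm_minus_commute)
      hence x1: "norm (x - 1) \<ge> 1/3" by (simp add: algebra_simps)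
      hence "x \<noteq> 1" by auto
      have "norm (\<Phi> x - \<Phi> 1) \<le> K + K"
        using bd[of x] bd[of 1] x norm_triangle_ineq4[of "\<Phi> x" "\<Phi> 1"] by (auto simp: dist_norm)
      hence "norm (\<Phi> x - \<Phi> 1) / norm (x - 1) \<le> (K + K) / (1/3)"
        by (rule frac_le[rotated]) (use x1 K in simp_all)
      hence "norm (h x) \<le> (K + K) / (1/3)"
        using \<open>x \<noteq> 1\<close> by (simp add: h_def norm_divide)
      thus "norm (h x) \<le> 6 * K" by simp
    qed auto
    moreover have "\<bar>F m / fact m - l0\<bar> = norm ((deriv ^^ m) h 2) / fact m"
      using h_coeff[OF l0, of m 1] by (metis (no_types, opaque_lifting) add_diff_cancel_left' diff_add_cancel mult.right_neutral norm_divide norm_fact norm_minus_commute norm_mult norm_of_real norm_one one_add_one power_one norm_power)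
    ultimately show ?thesis by (simp add: field_simps power_divide)
  qed
  define y where "y = 2 - \<beta>"
  have y: "1 < y" "y < 9/8" "y - 1 = 1 - \<beta>" using \<beta> by (auto simp: y_def)
  have hb: "Re (h (of_real \<beta>)) = (l0 - v) / (1 - \<beta>)"
  proof -
    have "h (of_real \<beta>) = of_real ((v - l0) / (\<beta> - 1))"
      unfolding h_def using \<beta> v l0 by simp
    hence "Re (h (of_real \<beta>)) = (v - l0) / (\<beta> - 1)" by (simp only: Re_complex_of_real)
    also have "\<dots> = (l0 - v) / (1 - \<beta>)" using \<beta> by (simp add: field_simps)
    finally show ?thesis .
  qed
  have sums: "(\<lambda>m. (F m / fact m - l0) * y ^ m) sums ((l0 - v) / (1 - \<beta>))"
    using h_real_sums[OF l0, of \<beta>] \<beta> unfolding hb y_def by simp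
  \<comment> \<open>M is the length after which 6K (27/32)^M (32/5) is at most 1/2. The ratio 27/32
    is 3/4, from Cauchy's estimate, times 9/8, which bounds y; it is at most exp(-1/7), and 77
    exceeds twice 6 times 32/5.\<close>
  define M where "M = nat \<lceil>7 * ln (77 * K)\<rceil>"
  have lnK: "ln (77 * K) > 0" using K by simp
  have M: "real M \<ge> 7 * ln (77 * K)" "real M \<le> 7 * ln (77 * K) + 1" "M > 0"
    using lnK unfolding M_def by linarith+
  have tm: "\<bar>(F m / fact m - l0) * y ^ m\<bar> \<le> 6 * K * (27/32) ^ m" for m
  proof -
    have "\<bar>(F m / fact m - l0) * y ^ m\<bar> \<le> 6 * K * (3/4) ^ m * (9/8) ^ m"
      unfolding abs_mult using co[of m] y K by (intro mult_mono) (auto intro!: power_mono)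
    also have "\<dots> = 6 * K * (27/32) ^ m" by (simp add: power_mult_distrib[symmetric])
    finally show ?thesis .
  qed
  have gs: "summable (\<lambda>m. 6 * K * (27/32::real) ^ m)" by (intro summable_mult summable_geometric) auto
  have sm: "summable (\<lambda>m. (F m / fact m - l0) * y ^ m)" using sums by (simp add: sums_iff)
  have "(l0 - v) / (1 - \<beta>) = (\<Sum>m. (F (m + M) / fact (m + M) - l0) * y ^ (m + M)) + (\<Sum>m<M. (F m / fact m - l0) * y ^ m)"
    using sums suminf_split_initial_segment[OF sm, of M] by (simp add: sums_iff)
  moreover have "(\<Sum>m. (F (m + M) / fact (m + M) - l0) * y ^ (m + M)) \<ge> - (1/2)"
  proof -
    have "norm (\<Sum>m. (F (m + M) / fact (m + M) - l0) * y ^ (m + M)) \<le> (\<Sum>m. 6 * K * (27/32) ^ (m + M))"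
      by (rule norm_suminf_le) (use tm summable_ignore_initial_segment[OF gs, of M] in auto)
    also have "\<dots> = (\<Sum>m. 6 * K * (27/32) ^ M * (27/32) ^ m)" by (simp add: power_add mult_ac)
    also have "\<dots> = 6 * K * (27/32) ^ M * (\<Sum>m. (27/32) ^ m)" by (intro suminf_mult summable_geometric) auto
    also have "(\<Sum>m. (27/32::real) ^ m) = 32 / 5" by (subst suminf_geometric) auto
    also have "(27/32 :: real) ^ M \<le> 1 / (77 * K)"
    proof -
      have "exp 1 \<le> (32/27 :: real) ^ 7" using exp_le by (simp add: power_divide)
      hence "exp (1/7) ^ 7 \<le> (32/27 :: real) ^ 7" by (simp flip: exp_of_nat_mult)
      hence "exp (1/7) \<le> (32/27 :: real)" by (rule power_le_imp_le_base[of _ 6, simplified]) auto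
      hence "(27/32 :: real) \<le> exp (- (1/7))" by (simp add: exp_minus field_simps)
      hence "(27/32 :: real) ^ M \<le> exp (- (1/7)) ^ M" by (intro power_mono) auto
      also have "\<dots> = exp (- (real M / 7))" by (simp flip: exp_of_nat_mult)
      also have "\<dots> \<le> exp (- ln (77 * K))" using M by simp
      also have "\<dots> = 1 / (77 * K)" using K by (simp add: exp_minus field_simps)
      finally show ?thesis .
    qed
    hence "6 * K * (27/32) ^ M * (32/5) \<le> 6 * K * (1 / (77 * K)) * (32/5)"
      using K by (intro mult_right_mono mult_left_mono) auto
    also have "\<dots> \<le> 1/2" using K by (simp add: field_simps)
    finally show ?thesis by (simp add: abs_le_iff)
  qed
  moreover have "(\<Sum>m<M. (F m / fact m - l0) * y ^ m) \<ge> 1 - l0 * (y ^ M - 1) / (1 - \<beta>)"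
  proof -
    have "1 \<le> (\<Sum>m\<in>{0}. F m / fact m * y ^ m)" using exp_P_deriv[of 0] by simp
    also have "\<dots> \<le> (\<Sum>m<M. F m / fact m * y ^ m)"
      by (rule sum_mono2) (use M exp_P_deriv y in auto)
    finally have "1 \<le> (\<Sum>m<M. F m / fact m * y ^ m)" .
    moreover have "(\<Sum>m<M. y ^ m) = (y ^ M - 1) / (1 - \<beta>)"
      using geometric_sum[of y M] y by simp
    moreover have "(\<Sum>m<M. (F m / fact m - l0) * y ^ m) = (\<Sum>m<M. F m / fact m * y ^ m) - l0 * (\<Sum>m<M. y ^ m)"
      by (simp add: algebra_simps sum_subtractf sum_distrib_left)
    ultimately show ?thesis by simp
  qed
  ultimately have "(l0 - v) / (1 - \<beta>) \<ge> 1/2 - l0 * (y ^ M - 1) / (1 - \<beta>)" by linarith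
  hence "l0 - v \<ge> (1/2 - l0 * (y ^ M - 1) / (1 - \<beta>)) * (1 - \<beta>)"
    using \<beta> by (simp add: pos_le_divide_eq)
  also have "(1/2 - l0 * (y ^ M - 1) / (1 - \<beta>)) * (1 - \<beta>) = (1 - \<beta>) / 2 - l0 * (y ^ M - 1)"
    using \<beta> by (simp add: field_simps)
  finally have main: "l0 * y ^ M \<ge> (1 - \<beta>) / 2" using v(2) unfolding right_diff_distrib by linarith
  \<comment> \<open>The constant 231 is 3 times 77: 3 bounds exp(1 - \<beta>), and 77 bounds its
    power with exponent 7(1 - \<beta>) < 1. Halving 1 - \<beta> then gives 462.\<close>
  have yM: "y ^ M \<le> 231 * K powr (7 * (1 - \<beta>))"
  proof -
    have "y ^ M \<le> exp (1 - \<beta>) ^ M" using exp_ge_add_one_self[of "1 - \<beta>"] y by (intro power_mono) (auto simp: y_def)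
    also have "\<dots> = exp (real M * (1 - \<beta>))" by (simp flip: exp_of_nat_mult)
    also have "\<dots> \<le> exp ((7 * ln (77 * K) + 1) * (1 - \<beta>))" using M \<beta> by (simp add: mult_right_mono)
    also have "\<dots> = exp (1 - \<beta>) * (77 * K) powr (7 * (1 - \<beta>))"
      using K by (simp add: powr_def exp_add[symmetric] algebra_simps)
    also have "\<dots> = exp (1 - \<beta>) * 77 powr (7 * (1 - \<beta>)) * K powr (7 * (1 - \<beta>))" by (simp add: powr_mult)
    also have "\<dots> \<le> 3 * 77 powr 1 * K powr (7 * (1 - \<beta>))"
    proof (intro mult_right_mono mult_mono powr_mono)
      have "exp (1 - \<beta>) \<le> exp 1" using \<beta> by simp
      thus "exp (1 - \<beta>) \<le> 3" using exp_le by linarith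
    qed (use \<beta> in auto)
    finally show ?thesis by simp
  qed
  have y0: "y ^ M > 0" using y by simp
  have lp: "l0 > 0"
  proof (rule ccontr)
    assume "\<not> l0 > 0"
    hence "l0 * y ^ M \<le> 0" using y0 by (simp add: mult_le_0_iff)
    hence "(1 - \<beta>) / 2 \<le> 0" by (rule order_trans[OF main])
    thus False using \<beta> by simp
  qed
  have "(1 - \<beta>) / 2 \<le> l0 * (231 * K powr (7 * (1 - \<beta>)))"
    by (rule order_trans[OF main mult_left_mono[OF yM]]) (use lp in simp)
  hence "(1 - \<beta>) / 462 * K powr (-7 * (1 - \<beta>)) \<le> l0 * (K powr (7 * (1 - \<beta>)) * K powr (-7 * (1 - \<beta>)))"
    using K mult_right_mono[of "(1 - \<beta>) / 462" "l0 * K powr (7 * (1 - \<beta>))" "K powr (-7 * (1 - \<beta>))"] by simp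
  also have "K powr (7 * (1 - \<beta>)) * K powr (-7 * (1 - \<beta>)) = 1"
    using K by (simp add: powr_add[symmetric])
  finally show ?thesis by simp
qed

end

text \<open>When \<Phi> 1 = 0 nothing is subtracted in the expansion of h at 2. Bounding F m below
  by p m for m > 0 and resumming the exponential series in m turns n^(-2) into n^(-x); the
  subtracted n^(-2) is the term m = 0. Nonnegativity permits restriction to finitely many n.\<close>

lemma (in nonneg_exp) h_lower:
  assumes \<Phi>1: "\<Phi> 1 = 0" and x: "0 < x" "x < 1" and A: "finite A" "0 \<notin> A"
  shows "Re (h (of_real x)) \<ge> (\<Sum>n\<in>A. c n * (real n powr (-x) - real n powr (-2)))"
proof -
  define y where "y = 2 - x"
  have y: "y > 0" using x by (simp add: y_def)
  have s1: "(\<lambda>m. F m / fact m * y ^ m) sums Re (h (of_real x))"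
    using h_real_sums[of 0 x] \<Phi>1 x by (simp add: y_def)
  define e where "e = (\<lambda>n m. ln (real n) ^ m / fact m * y ^ m)"
  have ee: "e n sums (real n powr y)" if "n > 0" for n
  proof -
    have "(\<lambda>m. (y * ln (real n)) ^ m /\<^sub>R fact m) sums exp (y * ln (real n))" by (rule exp_converges)
    thus ?thesis using that by (simp add: e_def powr_def power_mult_distrib field_simps)
  qed
  have s2: "(\<lambda>m. \<Sum>n\<in>A. c n * real n powr (-2) * e n m) sums (\<Sum>n\<in>A. c n * real n powr (-2) * real n powr y)"
  proof (intro sums_sum sums_mult ee)
    fix n assume "n \<in> A" thus "n > 0" using A by (cases n) auto
  qed
  have s2': "(\<lambda>m. \<Sum>n\<in>A. c n * real n powr (-2) * e n (m + 1)) sums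
     ((\<Sum>n\<in>A. c n * real n powr (-2) * real n powr y) - (\<Sum>m<1. \<Sum>n\<in>A. c n * real n powr (-2) * e n m))"
    by (subst sums_iff_shift) (use s2 in simp)
  have s1': "(\<lambda>m. F (m+1) / fact (m+1) * y ^ (m+1)) sums (Re (h (of_real x)) - (\<Sum>m<1. F m / fact m * y ^ m))"
    by (subst sums_iff_shift[where f = "\<lambda>m. F m / fact m * y ^ m"]) (use s1 in simp)
  have le: "(\<Sum>n\<in>A. c n * real n powr (-2) * e n (m + 1)) \<le> F (m+1) / fact (m+1) * y ^ (m+1)" for m
  proof -
    have "(\<Sum>n\<in>A. c n * real n powr (-2) * e n (m+1)) = (\<Sum>n\<in>A. c n * ln (real n) ^ (m+1) * real n powr (-2)) / fact (m+1) * y ^ (m+1)"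
      by (simp add: e_def sum_divide_distrib sum_distrib_right sum_distrib_left mult_ac)
    also have "(\<Sum>n\<in>A. c n * ln (real n) ^ (m+1) * real n powr (-2)) \<le> p (m+1)"
      unfolding p_def
    proof (rule sum_le_suminf[OF summable_p A(1)])
      fix n :: nat show "0 \<le> c n * ln (real n) ^ (m+1) * real n powr -2"
        using c0[of n] by (cases "n = 0") auto
    qed
    also have "p (m+1) \<le> F (m+1)" using exp_P_deriv[of "m+1"] by simp
    finally show ?thesis using y by (simp add: divide_right_mono mult_right_mono)
  qed
  have "(\<Sum>n\<in>A. c n * real n powr (-2) * real n powr y) - (\<Sum>m<1. \<Sum>n\<in>A. c n * real n powr (-2) * e n m) \<le>
      Re (h (of_real x)) - (\<Sum>m<1. F m / fact m * y ^ m)"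
    by (rule sums_le[OF le s2' s1'])
  moreover have "F 0 \<ge> 0" using exp_P_deriv[of 0] by simp
  ultimately have "Re (h (of_real x)) \<ge> (\<Sum>n\<in>A. c n * real n powr (-2) * real n powr y) - (\<Sum>n\<in>A. c n * real n powr (-2))"
    by (simp add: e_def)
  also have "(\<Sum>n\<in>A. c n * real n powr (-2) * real n powr y) - (\<Sum>n\<in>A. c n * real n powr (-2)) =
     (\<Sum>n\<in>A. c n * (real n powr (-x) - real n powr (-2)))"
  proof -
    have "real n powr (-2) * real n powr y = real n powr (-x)" for n
      by (simp add: powr_add[symmetric] y_def)
    thus ?thesis by (simp add: algebra_simps sum_subtractf mult.assoc)
  qed
  finally show ?thesis .
qed

lemma Re_zetaF_real: "x > 0 \<Longrightarrow> zetaF (of_real x) = of_real (Re (zetaF (of_real x)))"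
proof -
  assume x: "x > 0"
  have t: "zterm n (of_real x) = of_real (Re (zterm n (of_real x)))" for n
  proof (cases "n = 0")
    case False
    have "zterm n (of_real x) = of_real ((x - 1) * real n powr (-x) - (real n powr (-(x-1)) - real (Suc n) powr (-(x-1))))"
      using False nps_of_real[of n x] nps_of_real[of n "x - 1"] nps_of_real[of "Suc n" "x - 1"]
      by (simp add: zterm_def)
    thus ?thesis by (metis Re_complex_of_real)
  qed (auto simp: zterm_def)
  have "summable (\<lambda>n. zterm n (of_real x))" using x by (intro summable_zterm) auto
  hence "summable (\<lambda>n. Re (zterm n (of_real x)))" by (rule summable_Re)
  from suminf_of_real[OF this, where ?'a = complex]
  have "(\<Sum>n. zterm n (of_real x)) = of_real (\<Sum>n. Re (zterm n (of_real x)))" by (simp only: t[symmetric])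
  thus ?thesis by (simp add: zetaF_def)
qed

lemma Lc_real:
  assumes b: "\<And>n. b n \<in> \<real>" and S: "\<And>n. norm (psum b n) \<le> Q" and x: "x > 0"
  shows "Lc b (of_real x) = of_real (Re (Lc b (of_real x)))"
proof -
  have ps: "psum b n \<in> \<real>" for n unfolding psum_def using b by (intro sum_in_Reals)
  have t: "psum b n * (nps n (of_real x) - nps (Suc n) (of_real x)) =
     of_real (Re (psum b n * (nps n (of_real x) - nps (Suc n) (of_real x))))" for n
    using ps[of n] unfolding nps_of_real by (auto elim!: Reals_cases)
  have "summable (\<lambda>n. psum b n * (nps n (of_real x) - nps (Suc n) (of_real x)))"
    using x by (intro summable_Lc[OF S]) auto
  hence "summable (\<lambda>n. Re (psum b n * (nps n (of_real x) - nps (Suc n) (of_real x))))" by (rule summable_Re)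
  from suminf_of_real[OF this, where ?'a = complex]
  have "Lc b (of_real x) = of_real (\<Sum>n. Re (psum b n * (nps n (of_real x) - nps (Suc n) (of_real x))))"
    unfolding Lc_def by (simp only: t[symmetric])
  thus ?thesis by simp
qed

lemma rchar_npchar: "rchar q \<phi> \<Longrightarrow> npchar q \<phi>" by (simp add: rchar_def)

lemma npchar_dchar: "npchar q \<phi> \<Longrightarrow> dchar q \<phi>" by (simp add: npchar_def)

lemma rchar_Reals: "rchar q \<phi> \<Longrightarrow> \<phi> n \<in> \<real>"
  by (auto simp: rchar_def) (metis Reals_0 Reals_1 Reals_minus)

lemma rchar_Lc_real:
  assumes "rchar q \<phi>" "x > 0"
  shows "Lc \<phi> (of_real x) = of_real (Re (Lc \<phi> (of_real x)))"
  using assms norm_psum_dchar_le[of q \<phi>] rchar_Reals[of q \<phi>]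
  by (intro Lc_real[of \<phi> "2 * real q"]) (auto simp: rchar_def npchar_def)

lemma nonneg_exp_rchar:
  assumes \<phi>: "rchar q \<phi>"
  shows "nonneg_exp (\<lambda>n. (1 + Re (\<phi> n)) * (mangoldt n / ln (real n))) 2 (\<lambda>s. zetaF s * Lc \<phi> s)"
proof
  have v: "\<phi> n \<in> {-1, 0, 1}" for n using \<phi> by (simp add: rchar_def)
  have r: "0 \<le> 1 + Re (\<phi> n)" "1 + Re (\<phi> n) \<le> 2" for n using v[of n] by auto
  fix n
  show "0 \<le> (1 + Re (\<phi> n)) * (mangoldt n / ln (real n))"
    using r mangoldt_over_ln by (intro mult_nonneg_nonneg)
  have "(1 + Re (\<phi> n)) * (mangoldt n / ln (real n)) \<le> 2 * 1"
    using r mangoldt_over_ln by (intro mult_mono) auto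
  thus "(1 + Re (\<phi> n)) * (mangoldt n / ln (real n)) \<le> 2" by simp
  show "(\<lambda>s. zetaF s * Lc \<phi> s) holomorphic_on {s. 0 < Re s}"
    by (intro holomorphic_intros zetaF_holomorphic npchar_holomorphic[OF rchar_npchar[OF \<phi>]])
  fix s :: complex assume s: "Re s > 1"
  have ac: "abs_conv (logc (\<lambda>_. 1))" "abs_conv (logc \<phi>)"
    using abs_conv_logc[of "\<lambda>_. 1" 1] abs_conv_logc[of \<phi> 1] \<phi> norm_dchar_le by (auto simp: rchar_def npchar_def)
  have "zetaF s * Lc \<phi> s = (s - 1) * (DS (\<lambda>_. 1) s * DS \<phi> s)"
    using zetaF_eq_DS[OF s] npchar_Lc_eq_DS[OF rchar_npchar[OF \<phi>] s] by simp
  also have "DS (\<lambda>_. 1) s * DS \<phi> s = exp (DS (\<lambda>n. logc (\<lambda>_. 1) n + logc \<phi> n) s)"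
    using DS_eq_exp_logc[OF cmult_fun_1 s] DS_eq_exp_logc[OF dchar_cmult_fun s, of q \<phi>] \<phi>
    by (simp add: DS_add[OF ac s] exp_add rchar_def npchar_def)
  also have "(\<lambda>n. logc (\<lambda>_. 1) n + logc \<phi> n) = (\<lambda>n. of_real ((1 + Re (\<phi> n)) * (mangoldt n / ln (real n))))"
  proof
    fix n
    have "\<phi> n = of_real (Re (\<phi> n))" using v[of n] by auto
    thus "logc (\<lambda>_. 1) n + logc \<phi> n = of_real ((1 + Re (\<phi> n)) * (mangoldt n / ln (real n)))"
      unfolding logc_def by (metis (no_types) distrib_right of_real_1 of_real_add of_real_mult)
  qed
  finally show "zetaF s * Lc \<phi> s = (s - 1) * exp (DS (\<lambda>n. complex_of_real ((1 + Re (\<phi> n)) * (mangoldt n / ln (real n)))) s)" .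
qed

text \<open>Nonnegativity comes from the factorisation 1 + \<phi> + \<psi> + \<phi>\<psi> = (1 +
  \<phi>)(1 + \<psi>).\<close>

lemma nonneg_exp_rchar2:
  assumes \<phi>: "rchar q \<phi>" and \<psi>: "rchar r \<psi>" and np: "npchar (q * r) (\<lambda>n. \<phi> n * \<psi> n)"
  shows "nonneg_exp (\<lambda>n. (1 + Re (\<phi> n)) * (1 + Re (\<psi> n)) * (mangoldt n / ln (real n))) 4
     (\<lambda>s. zetaF s * Lc \<phi> s * Lc \<psi> s * Lc (\<lambda>n. \<phi> n * \<psi> n) s)"
proof
  have v: "\<phi> n \<in> {-1, 0, 1}" "\<psi> n \<in> {-1, 0, 1}" for n using \<phi> \<psi> by (auto simp: rchar_def)
  have r: "0 \<le> 1 + Re (\<phi> n)" "1 + Re (\<phi> n) \<le> 2" "0 \<le> 1 + Re (\<psi> n)" "1 + Re (\<psi> n) \<le> 2" for n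
    using v[of n] by auto
  fix n
  show "0 \<le> (1 + Re (\<phi> n)) * (1 + Re (\<psi> n)) * (mangoldt n / ln (real n))"
    using r mangoldt_over_ln by (intro mult_nonneg_nonneg)
  have "(1 + Re (\<phi> n)) * (1 + Re (\<psi> n)) * (mangoldt n / ln (real n)) \<le> 2 * 2 * 1"
    using r mangoldt_over_ln by (intro mult_mono mult_nonneg_nonneg) auto
  thus "(1 + Re (\<phi> n)) * (1 + Re (\<psi> n)) * (mangoldt n / ln (real n)) \<le> 4" by simp
  show "(\<lambda>s. zetaF s * Lc \<phi> s * Lc \<psi> s * Lc (\<lambda>n. \<phi> n * \<psi> n) s) holomorphic_on {s. 0 < Re s}"
    by (intro holomorphic_intros zetaF_holomorphic npchar_holomorphic[OF rchar_npchar[OF \<phi>]]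
          npchar_holomorphic[OF rchar_npchar[OF \<psi>]] npchar_holomorphic[OF np])
  fix s :: complex assume s: "Re s > 1"
  define \<theta> where "\<theta> = (\<lambda>n. \<phi> n * \<psi> n)"
  note d = npchar_dchar[OF rchar_npchar[OF \<phi>]] npchar_dchar[OF rchar_npchar[OF \<psi>]] npchar_dchar[OF np, folded \<theta>_def]
  have ac: "abs_conv (logc (\<lambda>_. 1))" "abs_conv (logc \<phi>)" "abs_conv (logc \<psi>)" "abs_conv (logc \<theta>)"
    using abs_conv_logc[of "\<lambda>_. 1" 1] abs_conv_logc[of \<phi> 1] abs_conv_logc[of \<psi> 1] abs_conv_logc[of \<theta> 1]
      norm_dchar_le[OF d(1)] norm_dchar_le[OF d(2)] norm_dchar_le[OF d(3)] by auto
  have "zetaF s * Lc \<phi> s * Lc \<psi> s * Lc \<theta> s = (s - 1) * (DS (\<lambda>_. 1) s * DS \<phi> s * DS \<psi> s * DS \<theta> s)"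
    using zetaF_eq_DS[OF s] npchar_Lc_eq_DS[OF rchar_npchar[OF \<phi>] s] npchar_Lc_eq_DS[OF rchar_npchar[OF \<psi>] s]
      npchar_Lc_eq_DS[OF np s] by (simp add: \<theta>_def)
  also have "DS (\<lambda>_. 1) s * DS \<phi> s * DS \<psi> s * DS \<theta> s =
       exp (DS (\<lambda>n. logc (\<lambda>_. 1) n + logc \<phi> n + logc \<psi> n + logc \<theta> n) s)"
    using DS_eq_exp_logc[OF cmult_fun_1 s] DS_eq_exp_logc[OF dchar_cmult_fun[OF d(1)] s]
      DS_eq_exp_logc[OF dchar_cmult_fun[OF d(2)] s] DS_eq_exp_logc[OF dchar_cmult_fun[OF d(3)] s]
    by (simp add: DS_add abs_conv_add ac s exp_add)
  also have "(\<lambda>n. logc (\<lambda>_. 1) n + logc \<phi> n + logc \<psi> n + logc \<theta> n) =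
     (\<lambda>n. of_real ((1 + Re (\<phi> n)) * (1 + Re (\<psi> n)) * (mangoldt n / ln (real n))))"
  proof
    fix n
    have e: "\<phi> n = of_real (Re (\<phi> n))" "\<psi> n = of_real (Re (\<psi> n))" using v[of n] by auto
    define w where "w = (mangoldt n / ln (real n) :: real)"
    have "logc (\<lambda>_. 1) n + logc \<phi> n + logc \<psi> n + logc \<theta> n = (1 + \<phi> n) * (1 + \<psi> n) * of_real w"
      unfolding logc_def \<theta>_def w_def[symmetric] by (simp add: algebra_simps)
    also have "\<dots> = of_real ((1 + Re (\<phi> n)) * (1 + Re (\<psi> n)) * w)"
      by (subst e(1), subst e(2)) simp
    finally show "logc (\<lambda>_. 1) n + logc \<phi> n + logc \<psi> n + logc \<theta> n =
       of_real ((1 + Re (\<phi> n)) * (1 + Re (\<psi> n)) * (mangoldt n / ln (real n)))" by (simp only: w_def)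
  qed
  finally show "zetaF s * Lc \<phi> s * Lc \<psi> s * Lc (\<lambda>n. \<phi> n * \<psi> n) s = (s - 1) *
     exp (DS (\<lambda>n. complex_of_real ((1 + Re (\<phi> n)) * (1 + Re (\<psi> n)) * (mangoldt n / ln (real n)))) s)"
    by (simp only: \<theta>_def)
qed

text \<open>Compactness bounds (s - 1) zeta(s) on the segment from 1 to 2.\<close>

lemma zeta_real_bound:
  obtains C where "C > 0" "\<And>x. 0 < x \<Longrightarrow> x \<le> 1 \<Longrightarrow> (\<Sum>n. real n powr (-x-1)) \<le> C / x"
proof -
  have "compact (of_real ` {1..2::real} :: complex set)"
    by (intro compact_continuous_image continuous_intros) auto
  moreover have "continuous_on (of_real ` {1..2::real}) zetaF"
    by (rule holomorphic_on_imp_continuous_on, rule holomorphic_on_subset[OF zetaF_holomorphic]) auto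
  ultimately have "bounded (zetaF ` (of_real ` {1..2::real}))"
    using compact_continuous_image compact_imp_bounded by blast
  then obtain C where C0: "C > 0" "\<forall>z\<in>zetaF ` (of_real ` {1..2::real}). norm z \<le> C"
    unfolding bounded_pos by blast
  hence C: "\<And>x. x \<in> {1..2} \<Longrightarrow> norm (zetaF (of_real x)) \<le> C" "C > 0" by blast+
  show ?thesis
  proof (rule that[OF C(2)])
    fix x :: real assume x: "0 < x" "x \<le> 1"
    have "zetaF (of_real (1 + x)) = of_real x * DS (\<lambda>_. 1) (of_real (1 + x))"
      using x by (subst zetaF_eq_DS) auto
    also have "DS (\<lambda>_. 1) (of_real (1 + x)) = (\<Sum>n. of_real (real n powr (-x-1)))"
    proof -
      have "-(1 + x) = -x-1" by simp
      thus ?thesis unfolding DS_def nps_of_real by (simp only: mult_1)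
    qed
    also have "\<dots> = of_real (\<Sum>n. real n powr (-x-1))"
      by (rule suminf_of_real[OF summable_powr_shift[OF x(1)], symmetric])
    finally have "norm (zetaF (of_real (1 + x))) = \<bar>x * (\<Sum>n. real n powr (-x-1))\<bar>"
      by (simp only: of_real_mult[symmetric] norm_of_real)
    hence "x * (\<Sum>n. real n powr (-x-1)) \<le> C" using C(1)[of "1 + x"] x by auto
    thus "(\<Sum>n. real n powr (-x-1)) \<le> C / x" using x by (simp add: field_simps)
  qed
qed

text \<open>If L(1) = 0, then h is bounded on the real interval from 0 to 1/2, whereas
  \<open>h_lower\<close> at x near 0 collects from the square of each prime not dividing q almost 1
  - p^(-4). There are infinitely many such primes.\<close>

lemma Lc_1_nonzero:
  assumes \<phi>: "rchar q \<phi>"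
  shows "Lc \<phi> 1 \<noteq> 0"
proof
  assume L1: "Lc \<phi> 1 = 0"
  interpret nonneg_exp "\<lambda>n. (1 + Re (\<phi> n)) * (mangoldt n / ln (real n))" 2 "\<lambda>s. zetaF s * Lc \<phi> s"
    by (rule nonneg_exp_rchar[OF \<phi>])
  obtain C where C: "C > 0" "\<And>x. 0 < x \<Longrightarrow> x \<le> 1 \<Longrightarrow> (\<Sum>n. real n powr (-x-1)) \<le> C / x"
    using zeta_real_bound by blast
  have d: "dchar q \<phi>" "\<phi> \<noteq> principal_char q" using \<phi> by (auto simp: rchar_def npchar_def)
  have q: "q > 0" using dchar_pos[OF d(1)] .
  \<comment> \<open>As x tends to 0 the series of n^(-x-1) grows like 1/x, and the factor x in the
    bounds for the terms cancels this.\<close>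
  have hb: "Re (h (of_real x)) \<le> 2 * ((1 + C) * (2 * real q * C))" if x: "0 < x" "x \<le> 1/2" for x
  proof -
    have sm: "summable (\<lambda>n. real n powr (-x-1))" by (rule summable_powr_shift[OF x(1)])
    have "norm (complex_of_real x - 1) = norm (complex_of_real (x - 1))" by simp
    hence xe: "Re (of_real x) = x" "norm (complex_of_real x) = x" "norm (complex_of_real x - 1) = 1 - x"
      using x unfolding norm_of_real by simp_all
    have "norm (\<Sum>n. zterm n (of_real x)) \<le> (\<Sum>n. (1 - x) * x * real n powr (-x-1))"
      by (rule norm_suminf_le[OF _ summable_mult[OF sm]]) (use norm_zterm_le[of "of_real x"] x xe in simp)
    also have "\<dots> = (1 - x) * x * (\<Sum>n. real n powr (-x-1))" by (rule suminf_mult[OF sm])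
    also have "\<dots> \<le> (1 - x) * x * (C / x)" using C(2)[of x] x by (intro mult_left_mono) auto
    also have "\<dots> \<le> C" using x C by (simp add: mult_le_cancel_right1)
    finally have z: "norm (zetaF (of_real x)) \<le> 1 + C"
      unfolding zetaF_def using norm_triangle_ineq[of 1 "\<Sum>n. zterm n (of_real x)"] by simp
    have "norm (Lc \<phi> (of_real x)) \<le> (\<Sum>n. 2 * real q * x * real n powr (-x-1))"
      unfolding Lc_def using norm_Lc_term_le[OF norm_psum_dchar_le[OF d], of "of_real x"] x xe
      by (intro norm_suminf_le[OF _ summable_mult[OF sm]]) simp
    also have "\<dots> = 2 * real q * x * (\<Sum>n. real n powr (-x-1))" by (rule suminf_mult[OF sm])
    also have "\<dots> \<le> 2 * real q * x * (C / x)" using C(2)[of x] x by (intro mult_left_mono) auto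
    also have "\<dots> = 2 * real q * C" using x by simp
    finally have l: "norm (Lc \<phi> (of_real x)) \<le> 2 * real q * C" .
    have "of_real x \<noteq> (1::complex)" using x by auto
    hence "norm (h (of_real x)) = norm (zetaF (of_real x)) * norm (Lc \<phi> (of_real x)) / (1 - x)"
      unfolding h_def using L1 xe by (simp add: norm_divide norm_mult)
    also have "\<dots> \<le> (1 + C) * (2 * real q * C) / (1/2)"
      using z l x C q by (intro frac_le mult_mono mult_nonneg_nonneg) auto
    finally show ?thesis using complex_Re_le_cmod[of "h (of_real x)"] by simp
  qed
  define D where "D = 2 * ((1 + C) * (2 * real q * C))"
  have "infinite ({p. prime p} - {p. p dvd q})"
    using primes_infinite q by (intro Diff_infinite_finite) auto
  then obtain S where S: "S \<subseteq> {p. prime p} - {p. p dvd q}" "finite S" "card S = nat \<lceil>2 * D\<rceil> + 1"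
    using infinite_arbitrarily_large by blast
  \<comment> \<open>Squares, since \<phi>(p^2) = 1 whatever the sign of \<phi> p; the coefficient is
    then 2 times 1/2.\<close>
  define A where "A = (\<lambda>p. p ^ 2) ` S"
  have A: "finite A" "0 \<notin> A" using S by (auto simp: A_def)
  have inj: "inj_on (\<lambda>p::nat. p ^ 2) S" by (rule inj_onI) auto
  have w: "(1 + Re (\<phi> (p ^ 2))) * (mangoldt (p ^ 2) / ln (real (p ^ 2))) = 1" if "p \<in> S" for p
  proof -
    have p: "prime p" "\<not> p dvd q" using S that by auto
    hence cp: "coprime p q" by (simp add: prime_imp_coprime)
    have "\<phi> p \<in> {-1, 1}" using \<phi> dchar_eq_0_iff[OF d(1), of p] cp by (auto simp: rchar_def)
    hence "\<phi> (p ^ 2) = 1" using dchar_power[OF d(1), of p 2] by auto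
    moreover have "real p > 1" using prime_gt_1_nat[OF p(1)] by simp
    ultimately show ?thesis using p by (simp add: ln_realpow)
  qed
  have "D \<ge> (\<Sum>p\<in>S. 1 - real p powr (-4))"
  proof (rule tendsto_le[of "at_right 0"])
    show "((\<lambda>_. D) \<longlongrightarrow> D) (at_right 0)" by simp
    show "((\<lambda>x. \<Sum>p\<in>S. real p powr (-2*x) - real p powr (-4)) \<longlongrightarrow> (\<Sum>p\<in>S. 1 - real p powr (-4))) (at_right 0)"
    proof (intro tendsto_sum tendsto_diff tendsto_const)
      fix p assume "p \<in> S"
      hence "real p > 0" using S prime_gt_0_nat by auto
      thus "((\<lambda>x. real p powr (-2*x)) \<longlongrightarrow> 1) (at_right 0)" by real_asymp
    qed
    show "\<forall>\<^sub>F x in at_right 0. (\<Sum>p\<in>S. real p powr (-2*x) - real p powr (-4)) \<le> D"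
    proof -
      have "\<forall>\<^sub>F x in at_right 0. x \<in> {0<..<(1/2::real)}" by (rule eventually_at_right_real) auto
      thus ?thesis
      proof eventually_elim
        case (elim x)
        have "(\<Sum>p\<in>S. real p powr (-2*x) - real p powr (-4)) =
          (\<Sum>n\<in>A. (1 + Re (\<phi> n)) * (mangoldt n / ln (real n)) * (real n powr (-x) - real n powr (-2)))"
          unfolding A_def
        proof (subst sum.reindex[OF inj], rule sum.cong[OF refl], unfold o_def)
          fix p assume p: "p \<in> S"
          have "real p > 0" using S p prime_gt_0_nat by auto
          hence "real (p ^ 2) powr (-x) = real p powr (-2*x)" "real (p ^ 2) powr (-2) = real p powr (-4)"
            by (simp_all add: powr_powr flip: powr_numeral)
          thus "real p powr (-2*x) - real p powr (-4) =
             (1 + Re (\<phi> (p ^ 2))) * (mangoldt (p ^ 2) / ln (real (p ^ 2))) * (real (p ^ 2) powr (-x) - real (p ^ 2) powr (-2))"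
            unfolding w[OF p] by simp
        qed
        also have "\<dots> \<le> Re (h (of_real x))"
          by (rule h_lower) (use L1 A elim in auto)
        also have "\<dots> \<le> D" unfolding D_def using elim by (intro hb) auto
        finally show ?case .
      qed
    qed
  qed auto
  moreover have "(\<Sum>p\<in>S. 1 - real p powr (-4)) \<ge> (\<Sum>p\<in>S. 1/2)"
  proof (rule sum_mono)
    fix p assume "p \<in> S"
    hence "p \<ge> 2" using S prime_ge_2_nat by auto
    hence "real p powr (-4) \<le> 2 powr (-4)" by (intro powr_mono2') auto
    thus "1/2 \<le> 1 - real p powr (-4)" by (simp add: powr_minus)
  qed
  moreover have "(\<Sum>p\<in>S. 1/2 :: real) > D"
    using S(3) by simp linarith
  ultimately show False by linarith
qed

section \<open>Removing Euler factors\<close>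

lemma DS_remove_prime:
  assumes p: "p > 0" and g: "\<And>n. norm (g n) \<le> 1" and w: "\<And>m. g (p * m) = w * g m" and s: "Re s > 1"
  shows "DS (\<lambda>n. if p dvd n then 0 else g n) s = (1 - w * nps p s) * DS g s"
proof -
  have a: "abs_conv g" by (rule abs_conv_bounded[OF g])
  have a1: "abs_conv (\<lambda>n. if p dvd n then 0 else g n)" by (rule abs_conv_bounded[of _ 1]) (use g in auto)
  have a2: "abs_conv (\<lambda>n. if p dvd n then g n else 0)" by (rule abs_conv_bounded[of _ 1]) (use g in auto)
  have "DS g s = DS (\<lambda>n. (if p dvd n then 0 else g n) + (if p dvd n then g n else 0)) s"
    by (rule arg_cong[where f = "\<lambda>a. DS a s"]) auto
  also have "\<dots> = DS (\<lambda>n. if p dvd n then 0 else g n) s + DS (\<lambda>n. if p dvd n then g n else 0) s"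
    by (rule DS_add[OF a1 a2 s])
  also have "DS (\<lambda>n. if p dvd n then g n else 0) s = (\<Sum>m. (if p dvd (p * m) then g (p * m) else 0) * nps (p * m) s)"
    unfolding DS_def
  proof (rule suminf_mono_reindex[symmetric])
    show "strict_mono (\<lambda>m. p * m)" using p by (simp add: strict_mono_def)
    fix n assume "n \<notin> range (\<lambda>m. p * m)"
    hence "\<not> p dvd n" by (metis dvdE rangeI)
    thus "(if p dvd n then g n else 0) * nps n s = 0" by simp
  qed
  also have "\<dots> = (\<Sum>m. (w * nps p s) * (g m * nps m s))"
    by (intro suminf_cong) (simp add: w nps_mult)
  also have "\<dots> = w * nps p s * DS g s"
    unfolding DS_def by (rule suminf_mult[OF abs_conv_summable[OF a s]])
  finally have "DS (\<lambda>n. if p dvd n then 0 else g n) s = DS g s - w * nps p s * DS g s"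
    by (metis add_diff_cancel_right')
  thus ?thesis by (simp only: left_diff_distrib mult_1)
qed

lemma DS_remove_primes:
  assumes A: "finite A" "\<And>p. p \<in> A \<Longrightarrow> prime p" and f: "cmult_fun f" and s: "Re s > 1"
  shows "DS (\<lambda>n. if \<exists>p\<in>A. p dvd n then 0 else f n) s = (\<Prod>p\<in>A. 1 - f p * nps p s) * DS f s"
  using A
proof (induction A rule: finite_induct)
  case (insert p A)
  define g where "g = (\<lambda>n. if \<exists>p\<in>A. p dvd n then 0 else f n)"
  have pr: "prime p" using insert by auto
  have "DS (\<lambda>n. if \<exists>p'\<in>insert p A. p' dvd n then 0 else f n) s = DS (\<lambda>n. if p dvd n then 0 else g n) s"
    by (rule arg_cong[where f = "\<lambda>a. DS a s"]) (auto simp: g_def)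
  also have "\<dots> = (1 - f p * nps p s) * DS g s"
  proof (rule DS_remove_prime)
    show "p > 0" using prime_gt_0_nat[OF pr] .
    show "norm (g n) \<le> 1" for n using f by (auto simp: g_def cmult_fun_def)
    show "g (p * m) = f p * g m" for m
    proof -
      have "(\<exists>p'\<in>A. p' dvd p * m) \<longleftrightarrow> (\<exists>p'\<in>A. p' dvd m)"
        using insert pr by (metis (full_types) dvd_triv_right dvd_trans insert_iff prime_dvd_mult_iff primes_dvd_imp_eq)
      thus ?thesis using f by (simp add: g_def cmult_fun_def)
    qed
  qed (rule s)
  finally show ?case using insert by (simp add: g_def mult_ac)
qed auto

lemma ex_prime_factor_dvd_iff:
  fixes m n :: nat assumes "m > 0"
  shows "(\<exists>p\<in>prime_factors m. p dvd n) \<longleftrightarrow> \<not> coprime n m"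
proof
  assume "\<exists>p\<in>prime_factors m. p dvd n"
  then obtain p where "prime p" "p dvd m" "p dvd n" by (auto simp: in_prime_factors_iff)
  thus "\<not> coprime n m" by (meson coprime_common_divisor not_prime_unit)
next
  assume "\<not> coprime n m"
  hence "gcd n m \<noteq> 1" using coprime_iff_gcd_eq_1 by blast
  then obtain p where "prime p" "p dvd gcd n m" using prime_factor_nat by blast
  thus "\<exists>p\<in>prime_factors m. p dvd n" using assms by (auto simp: in_prime_factors_iff)
qed

text \<open>Real characters with principal product agree on all n prime to q r, so their L-functions
  differ only by Euler factors at the primes dividing q r, none of which vanishes at \<beta> > 0.
  The identity is continued from Re s > 1. This settles characters induced by the same primitive
  one.\<close>

lemma Lc_zero_transfer:
  assumes \<phi>: "rchar q \<phi>" and \<psi>: "rchar r \<psi>" and pr: "(\<lambda>n. \<phi> n * \<psi> n) = principal_char (q * r)"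
    and \<beta>: "\<beta> > 0" and z: "Lc \<phi> (of_real \<beta>) = 0"
  shows "Lc \<psi> (of_real \<beta>) = 0"
proof -
  note n\<phi> = rchar_npchar[OF \<phi>] and n\<psi> = rchar_npchar[OF \<psi>]
  note d\<phi> = npchar_dchar[OF n\<phi>] and d\<psi> = npchar_dchar[OF n\<psi>]
  have qr: "q * r > 0" using dchar_pos[OF d\<phi>] dchar_pos[OF d\<psi>] by simp
  define A where "A = prime_factors (q * r)"
  have A: "finite A" "\<And>p. p \<in> A \<Longrightarrow> prime p" by (auto simp: A_def)
  define E where "E = (\<lambda>f s. \<Prod>p\<in>A. 1 - f p * nps p s :: complex)"
  define G where "G = (\<lambda>f s. E f s * Lc f s)"
  have same: "(if \<exists>p\<in>A. p dvd n then 0 else \<phi> n) = (if \<exists>p\<in>A. p dvd n then 0 else \<psi> n)" for n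
  proof (cases "coprime n (q * r)")
    case True
    have "\<phi> n * \<psi> n = 1" using fun_cong[OF pr, of n] True by (simp add: principal_char_def)
    moreover have "\<phi> n \<in> {-1,0,1}" "\<psi> n \<in> {-1,0,1}" using \<phi> \<psi> by (auto simp: rchar_def)
    ultimately have "\<phi> n = \<psi> n" by auto
    thus ?thesis by simp
  next
    case False
    thus ?thesis using ex_prime_factor_dvd_iff[OF qr] by (simp add: A_def)
  qed
  have "G \<phi> (of_real \<beta>) = G \<psi> (of_real \<beta>)"
  proof (rule analytic_continuation_open[of "{s. Re s > 1}" "{s. Re s > 0}" "G \<phi>" "G \<psi>"])
    show "open {s. Re s > 1}" "open {s. Re s > 0}" by (rule open_halfspace_Re_gt)+
    have "2 \<in> {s. Re s > 1}" by simp
    thus "{s. Re s > 1} \<noteq> {}" by blast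
    show "connected {s. Re s > 0}" by (intro convex_connected convex_halfspace_Re_gt)
    show "G \<phi> holomorphic_on {s. Re s > 0}" unfolding G_def E_def
      by (intro holomorphic_intros npchar_holomorphic[OF n\<phi>])
    show "G \<psi> holomorphic_on {s. Re s > 0}" unfolding G_def E_def
      by (intro holomorphic_intros npchar_holomorphic[OF n\<psi>])
    show "complex_of_real \<beta> \<in> {s. Re s > 0}" using \<beta> by simp
    fix s assume "s \<in> {s. Re s > 1}"
    hence s: "Re s > 1" by simp
    have "G \<phi> s = DS (\<lambda>n. if \<exists>p\<in>A. p dvd n then 0 else \<phi> n) s"
      unfolding G_def E_def npchar_Lc_eq_DS[OF n\<phi> s] by (rule DS_remove_primes[OF A dchar_cmult_fun[OF d\<phi>] s, symmetric])
    also have "\<dots> = DS (\<lambda>n. if \<exists>p\<in>A. p dvd n then 0 else \<psi> n) s" by (simp only: same)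
    also have "\<dots> = G \<psi> s"
      unfolding G_def E_def npchar_Lc_eq_DS[OF n\<psi> s] by (rule DS_remove_primes[OF A dchar_cmult_fun[OF d\<psi>] s])
    finally show "G \<phi> s = G \<psi> s" .
  qed auto
  hence "E \<psi> (of_real \<beta>) * Lc \<psi> (of_real \<beta>) = 0" using z by (simp add: G_def)
  moreover have "E \<psi> (of_real \<beta>) \<noteq> 0"
    unfolding E_def
  proof (subst prod_zero_iff[OF A(1)], safe)
    fix p assume p: "p \<in> A" and e: "1 - \<psi> p * nps p (of_real \<beta>) = 0"
    have "p > 1" using A(2)[OF p] prime_gt_1_nat by blast
    have "norm (\<psi> p * nps p (of_real \<beta>)) \<le> 1 * real p powr (-\<beta>)"
      unfolding norm_mult norm_nps using norm_dchar_le[OF d\<psi>] by (intro mult_mono) auto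
    also have "\<dots> < 1" using \<open>p > 1\<close> \<beta> by (simp add: powr_less_one)
    finally show False using e by auto
  qed
  ultimately show ?thesis by simp
qed

lemma DS_Reals:
  assumes "abs_conv a" "\<And>n. a n \<in> \<real>" "x > 1"
  shows "DS a (of_real x) \<in> \<real>"
proof -
  have s: "summable (\<lambda>n. a n * nps n (of_real x))" by (rule abs_conv_summable) (use assms in auto)
  have "Im (DS a (of_real x)) = (\<Sum>n. Im (a n * nps n (of_real x)))"
    unfolding DS_def by (rule bounded_linear.suminf[OF bounded_linear_Im s])
  also have "\<dots> = (\<Sum>n. 0)"
    using assms(2) by (intro suminf_cong) (auto simp: nps_of_real complex_is_Real_iff)
  finally show ?thesis by (simp add: complex_is_Real_iff)
qed

lemma continuous_Re_Lc:
  assumes "npchar q \<phi>"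
  shows "continuous_on {0<..} (\<lambda>x. Re (Lc \<phi> (of_real x)))"
proof -
  have "continuous_on {0<..} (\<lambda>x. Lc \<phi> (of_real x))"
    by (rule continuous_on_compose2[OF holomorphic_on_imp_continuous_on[OF npchar_holomorphic[OF assms]]])
       (auto intro!: continuous_on_of_real continuous_on_id)
  thus ?thesis by (rule continuous_on_Re)
qed

text \<open>For x > 1 the value is the exponential of a real number; continuity gives a nonnegative
  value at 1, and \<open>Lc_1_nonzero\<close> excludes 0.\<close>

lemma rchar_Lc_1_pos:
  assumes \<phi>: "rchar q \<phi>"
  shows "Re (Lc \<phi> 1) > 0"
proof -
  have pos: "Re (Lc \<phi> (of_real x)) > 0" if x: "x > 1" for x
  proof -
    have d: "dchar q \<phi>" using \<phi> by (simp add: rchar_def npchar_def)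
    have "Lc \<phi> (of_real x) = exp (DS (logc \<phi>) (of_real x))"
      using x npchar_Lc_eq_DS[OF rchar_npchar[OF \<phi>]] DS_eq_exp_logc[OF dchar_cmult_fun[OF d]] by simp
    moreover have "DS (logc \<phi>) (of_real x) \<in> \<real>"
    proof (rule DS_Reals[OF abs_conv_logc[OF norm_dchar_le[OF d]] _ x])
      show "logc \<phi> n \<in> \<real>" for n
        unfolding logc_def by (intro Reals_mult Reals_of_real rchar_Reals[OF \<phi>])
    qed
    ultimately show ?thesis by (auto simp: exp_of_real elim!: Reals_cases)
  qed
  have "continuous_on {0<..} (\<lambda>x. Re (Lc \<phi> (of_real x)))" by (rule continuous_Re_Lc[OF rchar_npchar[OF \<phi>]])
  hence "isCont (\<lambda>x. Re (Lc \<phi> (of_real x))) 1" by (simp add: continuous_on_eq_continuous_at)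
  hence "((\<lambda>x. Re (Lc \<phi> (of_real x))) \<longlongrightarrow> Re (Lc \<phi> (of_real 1))) (at_right 1)"
    unfolding isCont_def by (rule filterlim_mono) (auto simp: at_within_le_at)
  hence "Re (Lc \<phi> (of_real 1)) \<ge> 0"
    by (rule tendsto_lowerbound) (auto simp: eventually_at_filter intro!: always_eventually less_imp_le[OF pos])
  moreover have "Re (Lc \<phi> (of_real 1)) \<noteq> 0"
    using Lc_1_nonzero[OF \<phi>] rchar_Lc_real[OF \<phi>, of 1] by auto
  ultimately show ?thesis by simp
qed

text \<open>The choice \<eta> = 1/3 covers the disc of \<open>estermann\<close>, which reaches down
  to Re s = 2/3; the exponents 11/3 for \<open>zetaF\<close> and 8/3 for \<open>Lc\<close> are
  rounded up to 4 and 3.\<close>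

lemma disc_bounds:
  obtains C where "C \<ge> 1" "\<And>s. s \<in> cball 2 (4/3) \<Longrightarrow> norm (zetaF s) \<le> C"
    "\<And>q \<phi> s. npchar q \<phi> \<Longrightarrow> s \<in> cball 2 (4/3) \<Longrightarrow> norm (Lc \<phi> s) \<le> C * real q ^ 3"
proof -
  obtain C1 where C1: "C1 > 0" "\<And>s. Re s \<ge> 1 - 1/3 \<Longrightarrow> norm (zetaF s) \<le> C1 * (norm s + 1) powr (1 + 8 * (1/3))"
    using zetaF_bound[of "1/3"] by auto
  obtain C2 where C2: "C2 > 0" "\<And>q \<phi> s. npchar q \<phi> \<Longrightarrow> Re s \<ge> 1 - 1/3 \<Longrightarrow>
     norm (Lc \<phi> s) \<le> C2 * (real q * (norm s + 1)) powr (8 * (1/3))"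
    using npchar_bound[of "1/3"] by auto
  define C where "C = max 1 (max (C1 * 5 ^ 4) (C2 * 5 ^ 3))"
  have b: "Re s \<ge> 1 - 1/3" "norm s + 1 \<le> 5" if "s \<in> cball 2 (4/3)" for s :: complex
  proof -
    have d: "norm (2 - s) \<le> 4/3" using that by (simp add: dist_norm)
    thus "Re s \<ge> 1 - 1/3" using abs_Re_le_cmod[of "2 - s"] by simp
    have "norm s \<le> norm (2 :: complex) + norm (2 - s)" by (metis norm_triangle_sub norm_minus_commute)
    thus "norm s + 1 \<le> 5" using d by simp
  qed
  show ?thesis
  proof (rule that[of C])
    show "C \<ge> 1" by (simp add: C_def)
    fix s :: complex assume s: "s \<in> cball 2 (4/3)"
    have "(norm s + 1) powr (1 + 8 * (1/3)) \<le> 5 powr (1 + 8 * (1/3))" using b[OF s] by (intro powr_mono2) auto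
    also have "\<dots> \<le> 5 powr 4" by (rule powr_mono) auto
    finally have "norm (zetaF s) \<le> C1 * 5 powr 4"
      using C1(2)[OF b(1)[OF s]] mult_left_mono[of _ _ C1] C1(1) by (meson less_imp_le order_trans)
    thus "norm (zetaF s) \<le> C" by (simp add: C_def)
    fix q \<phi> assume \<phi>: "npchar q \<phi>"
    have q: "real q \<ge> 1" using dchar_pos[OF npchar_dchar[OF \<phi>]] by simp
    have "(real q * (norm s + 1)) powr (8 * (1/3)) \<le> (real q * 5) powr (8 * (1/3))"
      using b[OF s] by (intro powr_mono2 mult_left_mono) auto
    also have "\<dots> \<le> (real q * 5) powr 3" using q by (intro powr_mono) auto
    also have "\<dots> = real q ^ 3 * 5 ^ 3" using q by (simp add: power_mult_distrib)
    finally have "norm (Lc \<phi> s) \<le> C2 * (real q ^ 3 * 5 ^ 3)"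
      using C2(2)[OF \<phi> b(1)[OF s]] mult_left_mono[of _ _ C2] C2(1) by (meson less_imp_le order_trans)
    also have "\<dots> = (C2 * 5 ^ 3) * real q ^ 3" by simp
    also have "\<dots> \<le> C * real q ^ 3" using q by (intro mult_right_mono) (auto simp: C_def)
    finally show "norm (Lc \<phi> s) \<le> C * real q ^ 3" .
  qed
qed

lemma powr_weaken:
  fixes K C x \<delta> t :: real
  assumes "C \<ge> 1" "x \<ge> 1" "0 \<le> t" "t \<le> \<delta>" "K = C * x ^ n"
  shows "K powr (-7 * t) \<ge> C powr (-7 * \<delta>) * x powr (-7 * real n * \<delta>)"
proof -
  have K1: "K \<ge> 1" using assms mult_mono[of 1 C 1 "x ^ n"] by simp
  have "C powr (-7 * \<delta>) * x powr (-7 * real n * \<delta>) = K powr (-7 * \<delta>)"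
    unfolding assms(5) using assms by (simp add: powr_mult powr_powr mult_ac flip: powr_realpow)
  also have "\<dots> \<le> K powr (-7 * t)" using assms K1 by (intro powr_mono) auto
  finally show ?thesis .
qed

text \<open>If no quadratic L-function has a real zero in (1 - \<delta>, 1),
  \<open>estermann\<close> applies to zeta L(\<phi>) alone. Otherwise one zero \<beta> of one
  L(\<psi>) is fixed once and for all, and the product of four factors vanishes at \<beta> for every
  other \<phi>. The constant depends on \<psi> and \<beta>, hence is ineffective.\<close>

theorem siegel:
  assumes \<epsilon>: "\<epsilon> > 0"
  obtains c where "c > 0" "\<And>q \<phi>. rchar q \<phi> \<Longrightarrow> Re (Lc \<phi> 1) \<ge> c * real q powr (-\<epsilon>)"
proof -
  obtain C where C: "C \<ge> 1" "\<And>s. s \<in> cball 2 (4/3) \<Longrightarrow> norm (zetaF s) \<le> C"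
    "\<And>q \<phi> s. npchar q \<phi> \<Longrightarrow> s \<in> cball 2 (4/3) \<Longrightarrow> norm (Lc \<phi> s) \<le> C * real q ^ 3"
    using disc_bounds by metis
  have "isCont zetaF 1"
    using holomorphic_on_imp_continuous_on[OF zetaF_holomorphic] open_halfspace_Re_gt[of 0]
    by (simp add: continuous_on_eq_continuous_at)
  then obtain e0 where e0: "e0 > 0" "\<And>s. dist s 1 < e0 \<Longrightarrow> dist (zetaF s) (zetaF 1) < 1"
    unfolding continuous_at_eps_delta by (metis dist_norm zero_less_one)
  \<comment> \<open>\<delta> < 1/8 is the range of \<open>estermann\<close>, \<delta> < e0 makes
    \<open>zetaF\<close> positive near 1, and \<delta> \<le> \<epsilon>/50 leaves room for the loss
    q^(43\<delta>) at the end.\<close>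
  define \<delta> where "\<delta> = min (\<epsilon> / 50) (min (e0 / 2) (1/16))"
  have \<delta>: "\<delta> > 0" "\<delta> \<le> \<epsilon> / 50" "\<delta> < e0" "\<delta> < 1/8" using \<epsilon> e0 by (auto simp: \<delta>_def min_def)
  have zpos: "Re (zetaF (of_real x)) > 0" if "1 - \<delta> < x" "x < 1" for x
  proof -
    have "dist (complex_of_real x) 1 = \<bar>x - 1\<bar>" by (metis dist_norm norm_of_real of_real_1 of_real_diff)
    hence "dist (zetaF (of_real x)) (zetaF 1) < 1" using that \<delta> by (intro e0(2)) auto
    hence "\<bar>Re (zetaF (of_real x) - 1)\<bar> < 1" using abs_Re_le_cmod[of "zetaF (of_real x) - 1"]
      by (simp add: dist_norm zetaF_1)
    thus ?thesis by auto
  qed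
  have one: "Re (Lc \<phi> 1) \<ge> (1 - x) / 462 * (C^2 * real q ^ 3) powr (-7 * (1 - x))"
    if \<phi>: "rchar q \<phi>" and x: "1 - \<delta> < x" "x < 1" and nn: "Re (Lc \<phi> (of_real x)) \<ge> 0" for q \<phi> x
  proof -
    interpret nonneg_exp "\<lambda>n. (1 + Re (\<phi> n)) * (mangoldt n / ln (real n))" 2 "\<lambda>s. zetaF s * Lc \<phi> s"
      by (rule nonneg_exp_rchar[OF \<phi>])
    have q: "real q \<ge> 1" using dchar_pos[OF npchar_dchar[OF rchar_npchar[OF \<phi>]]] by simp
    show ?thesis
    proof (rule estermann)
      show "1 \<le> C\<^sup>2 * real q ^ 3" using C q mult_mono[of 1 "C^2" 1 "real q ^ 3"] by simp
      fix s :: complex assume s: "s \<in> cball 2 (4/3)"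
      have "norm (zetaF s * Lc \<phi> s) \<le> C * (C * real q ^ 3)"
        unfolding norm_mult using C(2)[OF s] C(3)[OF rchar_npchar[OF \<phi>] s] C(1) by (intro mult_mono) auto
      thus "norm (zetaF s * Lc \<phi> s) \<le> C\<^sup>2 * real q ^ 3" by (simp add: power2_eq_square mult_ac)
    next
      show "zetaF 1 * Lc \<phi> 1 = of_real (Re (Lc \<phi> 1))" using rchar_Lc_real[OF \<phi>, of 1] by (simp add: zetaF_1)
      show "zetaF (of_real x) * Lc \<phi> (of_real x) = of_real (Re (zetaF (of_real x)) * Re (Lc \<phi> (of_real x)))"
      proof -
        have "x > 0" using x \<delta> by simp
        from rchar_Lc_real[OF \<phi> this] Re_zetaF_real[OF this] show ?thesis by (metis of_real_mult)
      qed
      show "0 \<le> Re (zetaF (of_real x)) * Re (Lc \<phi> (of_real x))"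
        using zpos[OF x] nn by simp
    qed (use x \<delta> in auto)
  qed
  show ?thesis
  proof (cases "\<exists>r \<psi> \<beta>. rchar r \<psi> \<and> 1 - \<delta> < \<beta> \<and> \<beta> < 1 \<and> Lc \<psi> (of_real \<beta>) = 0")
    case False
    define c where "c = \<delta> / 2 / 462 * (C^2) powr (-7 * \<delta>)"
    show ?thesis
    proof (rule that[of c])
      show "c > 0" using \<delta> C by (simp add: c_def)
      fix q \<phi> assume \<phi>: "rchar q \<phi>"
      have q: "real q \<ge> 1" using dchar_pos[OF npchar_dchar[OF rchar_npchar[OF \<phi>]]] by simp
      define x where "x = 1 - \<delta> / 2"
      have x: "1 - \<delta> < x" "x < 1" "x > 0" using \<delta> by (auto simp: x_def)
      \<comment> \<open>A negative value at x and the positive value at 1 would enclose a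
        zero.\<close>
      have nn: "Re (Lc \<phi> (of_real x)) \<ge> 0"
      proof (rule ccontr)
        assume "\<not> ?thesis"
        moreover have "continuous_on {x..1} (\<lambda>x. Re (Lc \<phi> (of_real x)))"
          by (rule continuous_on_subset[OF continuous_Re_Lc[OF rchar_npchar[OF \<phi>]]]) (use x in auto)
        ultimately obtain y where y: "x \<le> y" "y \<le> 1" "Re (Lc \<phi> (of_real y)) = 0"
          using IVT'[of "\<lambda>x. Re (Lc \<phi> (of_real x))" x 0 1] rchar_Lc_1_pos[OF \<phi>] x by auto
        hence "y \<noteq> 1" using rchar_Lc_1_pos[OF \<phi>] by auto
        moreover have "Lc \<phi> (of_real y) = 0" using rchar_Lc_real[OF \<phi>, of y] y x by simp
        ultimately show False using False \<phi> x y by (meson less_le_trans order_le_less)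
      qed
      have "c * real q powr (-\<epsilon>) \<le> c * real q powr (-7 * real 3 * \<delta>)"
        using \<open>c > 0\<close> q \<delta> by (intro mult_left_mono powr_mono) auto
      also have "\<dots> = (1 - x) / 462 * ((C^2) powr (-7 * \<delta>) * real q powr (-7 * real 3 * \<delta>))"
        by (simp add: c_def x_def mult_ac)
      also have "\<dots> \<le> (1 - x) / 462 * (C^2 * real q ^ 3) powr (-7 * (1 - x))"
        using x \<delta> q C by (intro mult_left_mono powr_weaken) auto
      also have "\<dots> \<le> Re (Lc \<phi> 1)" by (rule one[OF \<phi> x(1,2) nn])
      finally show "Re (Lc \<phi> 1) \<ge> c * real q powr (-\<epsilon>)" .
    qed
  next
    case True
    then obtain r \<psi> \<beta> where \<psi>: "rchar r \<psi>" and \<beta>: "1 - \<delta> < \<beta>" "\<beta> < 1" and z: "Lc \<psi> (of_real \<beta>) = 0"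
      by blast
    have r: "real r \<ge> 1" using dchar_pos[OF npchar_dchar[OF rchar_npchar[OF \<psi>]]] by simp
    obtain D where D: "D > 0" "\<And>q \<phi> s. npchar q \<phi> \<Longrightarrow> Re s \<ge> 1 - \<delta>/8 \<Longrightarrow>
      norm (Lc \<phi> s) \<le> D * (real q * (norm s + 1)) powr (8 * (\<delta>/8))"
      using npchar_bound[of "\<delta>/8"] \<delta> by auto
    define L where "L = Re (Lc \<psi> 1)"
    have L: "L > 0" unfolding L_def by (rule rchar_Lc_1_pos[OF \<psi>])
    define c1 where "c1 = (1 - \<beta>) / 462 * (C^2) powr (-7 * \<delta>)"
    define c2 where "c2 = (1 - \<beta>) / 462 * (C^4 * real r ^ 6) powr (-7 * \<delta>) / (L * D * (real r * 2) powr \<delta>)"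
    have c: "c1 > 0" "c2 > 0" using \<beta> C L D r by (auto simp: c1_def c2_def)
    show ?thesis
    proof (rule that[of "min c1 c2"])
      show "min c1 c2 > 0" using c by simp
      fix q \<phi> assume \<phi>: "rchar q \<phi>"
      have q: "real q \<ge> 1" using dchar_pos[OF npchar_dchar[OF rchar_npchar[OF \<phi>]]] by simp
      show "Re (Lc \<phi> 1) \<ge> min c1 c2 * real q powr (-\<epsilon>)"
      \<comment> \<open>A principal product would bring a second pole through the fourth factor; but
        then \<phi> shares the zero \<beta> of \<psi>, and the product of two factors is
        enough.\<close>
      proof (cases "(\<lambda>n. \<psi> n * \<phi> n) = principal_char (r * q)")
        case True
        have "Lc \<phi> (of_real \<beta>) = 0" by (rule Lc_zero_transfer[OF \<psi> \<phi> True _ z]) (use \<beta> \<delta> in auto)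
        hence nn: "Re (Lc \<phi> (of_real \<beta>)) \<ge> 0" by simp
        have "min c1 c2 * real q powr (-\<epsilon>) \<le> c1 * real q powr (-7 * real 3 * \<delta>)"
          using c q \<delta> by (intro mult_mono powr_mono) auto
        also have "\<dots> = (1 - \<beta>) / 462 * ((C^2) powr (-7 * \<delta>) * real q powr (-7 * real 3 * \<delta>))"
          by (simp add: c1_def mult_ac)
        also have "\<dots> \<le> (1 - \<beta>) / 462 * (C^2 * real q ^ 3) powr (-7 * (1 - \<beta>))"
          using \<beta> \<delta> q C by (intro mult_left_mono powr_weaken) auto
        also have "\<dots> \<le> Re (Lc \<phi> 1)" by (rule one[OF \<phi> \<beta> nn])
        finally show ?thesis .
      next
        case False
        define \<theta> where "\<theta> = (\<lambda>n. \<psi> n * \<phi> n)"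
        have d: "dchar (r * q) \<theta>"
          unfolding \<theta>_def by (intro dchar_prod npchar_dchar rchar_npchar \<phi> \<psi>)
        hence np: "npchar (r * q) \<theta>" using False by (simp add: npchar_def \<theta>_def)
        have rv: "\<theta> n \<in> {-1,0,1}" for n
        proof -
          have "\<phi> n \<in> {-1,0,1}" "\<psi> n \<in> {-1,0,1}" using \<phi> \<psi> by (simp_all add: rchar_def)
          thus ?thesis by (auto simp: \<theta>_def)
        qed
        have r\<theta>: "rchar (r * q) \<theta>" using np rv by (simp add: rchar_def)
        interpret nonneg_exp "\<lambda>n. (1 + Re (\<psi> n)) * (1 + Re (\<phi> n)) * (mangoldt n / ln (real n))" 4
            "\<lambda>s. zetaF s * Lc \<psi> s * Lc \<phi> s * Lc \<theta> s"
          unfolding \<theta>_def by (rule nonneg_exp_rchar2[OF \<psi> \<phi> np[unfolded \<theta>_def]])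
        have main: "L * Re (Lc \<phi> 1) * Re (Lc \<theta> 1) \<ge> (1 - \<beta>) / 462 * (C^4 * (real r * real q) ^ 6) powr (-7 * (1 - \<beta>))"
        proof (rule estermann)
          have "(real r * real q) ^ 6 \<ge> 1" using q r mult_mono[of 1 "real r" 1 "real q"] by simp
          thus "1 \<le> C ^ 4 * (real r * real q) ^ 6"
            using C mult_mono[of 1 "C^4" 1 "(real r * real q) ^ 6"] by simp
          fix s :: complex assume s: "s \<in> cball 2 (4/3)"
          have "norm (zetaF s * Lc \<psi> s * Lc \<phi> s * Lc \<theta> s) \<le> C * (C * real r ^ 3) * (C * real q ^ 3) * (C * real (r * q) ^ 3)"
            unfolding norm_mult using C(2)[OF s] C(3)[OF rchar_npchar[OF \<psi>] s] C(3)[OF rchar_npchar[OF \<phi>] s] C(3)[OF np s] C(1)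
            by (intro mult_mono mult_nonneg_nonneg) auto
          also have "\<dots> = C ^ 4 * (real r * real q) ^ 6" by (simp add: power_mult_distrib eval_nat_numeral)
          finally show "norm (zetaF s * Lc \<psi> s * Lc \<phi> s * Lc \<theta> s) \<le> C ^ 4 * (real r * real q) ^ 6" .
        next
          have "Lc \<psi> 1 = of_real L" "Lc \<phi> 1 = of_real (Re (Lc \<phi> 1))" "Lc \<theta> 1 = of_real (Re (Lc \<theta> 1))"
            using rchar_Lc_real[OF \<psi>, of 1] rchar_Lc_real[OF \<phi>, of 1] rchar_Lc_real[OF r\<theta>, of 1] by (auto simp: L_def)
          thus "zetaF 1 * Lc \<psi> 1 * Lc \<phi> 1 * Lc \<theta> 1 = of_real (L * Re (Lc \<phi> 1) * Re (Lc \<theta> 1))"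
            by (simp add: zetaF_1)
          show "zetaF (of_real \<beta>) * Lc \<psi> (of_real \<beta>) * Lc \<phi> (of_real \<beta>) * Lc \<theta> (of_real \<beta>) = of_real 0"
            using z by simp
        qed (use \<beta> \<delta> in auto)
        have up: "Re (Lc \<theta> 1) \<le> D * (real r * 2) powr \<delta> * real q powr \<delta>"
        proof -
          have "Re (Lc \<theta> 1) \<le> norm (Lc \<theta> 1)" by (rule complex_Re_le_cmod)
          also have "\<dots> \<le> D * (real (r * q) * (norm (1::complex) + 1)) powr (8 * (\<delta>/8))"
            using \<delta> by (intro D(2)[OF np]) auto
          also have "real (r * q) * (norm (1::complex) + 1) = real r * 2 * real q" by simp
          also have "D * (real r * 2 * real q) powr (8 * (\<delta>/8)) = D * (real r * 2) powr \<delta> * real q powr \<delta>"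
            by (simp add: powr_mult)
          finally show ?thesis .
        qed
        define U where "U = L * D * (real r * 2) powr \<delta>"
        have U: "U > 0" using L D r by (simp add: U_def)
        have p\<phi>: "Re (Lc \<phi> 1) > 0" by (rule rchar_Lc_1_pos[OF \<phi>])
        have "(C^4 * real r ^ 6) powr (-7 * \<delta>) * real q powr (-7 * real 6 * \<delta>) \<le> (C^4 * (real r * real q) ^ 6) powr (-7 * (1 - \<beta>))"
        proof (rule powr_weaken)
          show "1 \<le> C ^ 4 * real r ^ 6" using C r mult_mono[of 1 "C^4" 1 "real r ^ 6"] by simp
        qed (use q \<beta> \<delta> in \<open>auto simp: power_mult_distrib\<close>)
        hence "(1 - \<beta>) / 462 * ((C^4 * real r ^ 6) powr (-7 * \<delta>) * real q powr (-7 * real 6 * \<delta>)) \<le> L * Re (Lc \<phi> 1) * Re (Lc \<theta> 1)"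
          using \<beta> by (intro order_trans[OF mult_left_mono main]) auto
        also have "\<dots> \<le> L * Re (Lc \<phi> 1) * (D * (real r * 2) powr \<delta> * real q powr \<delta>)"
          using up L p\<phi> by (intro mult_left_mono) auto
        also have "\<dots> = U * (Re (Lc \<phi> 1) * real q powr \<delta>)" by (simp add: U_def)
        finally have "c2 * real q powr (-7 * real 6 * \<delta>) \<le> Re (Lc \<phi> 1) * real q powr \<delta>"
          unfolding c2_def U_def[symmetric] using U by (simp add: field_simps)
        hence "c2 * real q powr (-7 * real 6 * \<delta>) * real q powr (-\<delta>) \<le> Re (Lc \<phi> 1) * real q powr \<delta> * real q powr (-\<delta>)"
          by (intro mult_right_mono) auto
        \<comment> \<open>43 = 7 * 6 + 1: the bound C^4 (r q)^6 on the disc gives 42, the upper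
          bound for the value of L(\<theta>) at 1 gives one more.\<close>
        hence fin: "c2 * real q powr (-43 * \<delta>) \<le> Re (Lc \<phi> 1)"
          using q by (simp add: mult.assoc powr_add[symmetric])
        have "min c1 c2 * real q powr (-\<epsilon>) \<le> c2 * real q powr (-43 * \<delta>)"
          using c q \<delta> by (intro mult_mono powr_mono) auto
        thus ?thesis using fin by linarith
      qed
    qed
  qed
qed

section \<open>Lower bounds on the line of absolute convergence\<close>

text \<open>Cauchy's inequality on half the radius, since f is controlled on the open ball.\<close>

lemma higher_deriv_bound:
  assumes hol: "f holomorphic_on ball s r" and r: "r > 0" and B: "\<And>z. z \<in> ball s r \<Longrightarrow> norm (f z) \<le> B"
  shows "norm ((deriv ^^ k) f s) \<le> fact k * B * (2 / r) ^ k"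
proof -
  have sub: "cball s (r/2) \<subseteq> ball s r" using r by auto
  have "norm ((deriv ^^ k) f s) \<le> fact k * B / (r/2) ^ k"
  proof (rule Cauchy_inequality)
    show "f holomorphic_on ball s (r/2)" by (rule holomorphic_on_subset[OF hol]) (use r in auto)
    show "continuous_on (cball s (r/2)) f"
      by (rule continuous_on_subset[OF holomorphic_on_imp_continuous_on[OF hol] sub])
    fix x assume "norm (s - x) = r/2"
    thus "norm (f x) \<le> B" using r by (intro B) (simp add: dist_norm)
  qed (use r in auto)
  thus ?thesis by (simp add: power_divide field_simps)
qed

lemma deriv_bound:
  assumes hol: "f holomorphic_on ball s r" and r: "r > 0" and B: "\<And>z. z \<in> ball s r \<Longrightarrow> norm (f z) \<le> B"
  shows "norm (deriv f s) \<le> 2 * B / r"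
  using higher_deriv_bound[OF assms, of 1] by (simp add: mult.commute)

lemma norm_plus_1_le:
  assumes "\<bar>Re s\<bar> \<le> 4" shows "norm s + 1 \<le> 3 * (\<bar>Im s\<bar> + 2)"
  using cmod_le[of s] assms by simp

lemma Lc_upper:
  assumes \<epsilon>: "0 < \<epsilon>" "\<epsilon> \<le> 1"
  obtains C where "C \<ge> 1" "\<And>Q b s. Q \<ge> 1 \<Longrightarrow> (\<And>n. norm (b n) \<le> 2) \<Longrightarrow> (\<And>n. norm (psum b n) \<le> 2 * Q) \<Longrightarrow>
     1 - \<epsilon>/8 \<le> Re s \<Longrightarrow> Re s \<le> 4 \<Longrightarrow> norm (Lc b s) \<le> C * (Q * (\<bar>Im s\<bar> + 2)) powr \<epsilon>"
proof -
  obtain C where C: "C > 0" "\<And>b Q s. Q \<ge> 1 \<Longrightarrow> (\<And>n. norm (b n) \<le> 2) \<Longrightarrow> (\<And>n. norm (psum b n) \<le> Q) \<Longrightarrow>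
     Re s \<ge> 1 - \<epsilon>/8 \<Longrightarrow> norm (Lc b s) \<le> C * (Q * (norm s + 1)) powr (8 * (\<epsilon>/8))"
    using Lc_bound[of "\<epsilon>/8"] \<epsilon> by auto
  show ?thesis
  proof (rule that[of "max 1 (C * 6 powr \<epsilon>)"])
    fix Q b s assume *: "Q \<ge> (1::real)" "\<And>n. norm (b n) \<le> 2" "\<And>n. norm (psum b n) \<le> 2 * Q"
      "1 - \<epsilon>/8 \<le> Re s" "Re s \<le> 4"
    have "norm (Lc b s) \<le> C * (2 * Q * (norm s + 1)) powr (8 * (\<epsilon>/8))" using * by (intro C(2)) auto
    also have "\<dots> \<le> C * (2 * Q * (3 * (\<bar>Im s\<bar> + 2))) powr (8 * (\<epsilon>/8))"
      using C * \<epsilon> norm_plus_1_le[of s] by (intro mult_left_mono powr_mono2) auto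
    also have "2 * Q * (3 * (\<bar>Im s\<bar> + 2)) = 6 * (Q * (\<bar>Im s\<bar> + 2))" by simp
    also have "C * (6 * (Q * (\<bar>Im s\<bar> + 2))) powr (8 * (\<epsilon>/8)) = C * 6 powr \<epsilon> * (Q * (\<bar>Im s\<bar> + 2)) powr \<epsilon>"
      by (subst powr_mult) simp
    also have "\<dots> \<le> max 1 (C * 6 powr \<epsilon>) * (Q * (\<bar>Im s\<bar> + 2)) powr \<epsilon>"
      by (intro mult_right_mono) auto
    finally show "norm (Lc b s) \<le> max 1 (C * 6 powr \<epsilon>) * (Q * (\<bar>Im s\<bar> + 2)) powr \<epsilon>" .
  qed auto
qed

definition zeta :: "complex \<Rightarrow> complex" where "zeta s = zetaF s / (s - 1)"

lemma zeta_eq_DS: "Re s > 1 \<Longrightarrow> zeta s = DS (\<lambda>_. 1) s"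
proof -
  assume s: "Re s > 1"
  hence "s - 1 \<noteq> 0" by auto
  thus ?thesis using zetaF_eq_DS[OF s] by (simp add: zeta_def)
qed

lemma zeta_holomorphic: "zeta holomorphic_on ({s. Re s > 0} - {1})"
  unfolding zeta_def[abs_def]
  by (intro holomorphic_intros holomorphic_on_subset[OF zetaF_holomorphic]) auto

text \<open>Dividing \<open>zetaF\<close> by s - 1 lowers the exponent 1 + \<epsilon> to \<epsilon>;
  the factor 1 + 1/|s - 1| accounts for the pole.\<close>

lemma zeta_upper:
  assumes \<epsilon>: "0 < \<epsilon>" "\<epsilon> \<le> 1"
  obtains C where "C \<ge> 1" "\<And>s. s \<noteq> 1 \<Longrightarrow> 1 - \<epsilon>/8 \<le> Re s \<Longrightarrow> Re s \<le> 4 \<Longrightarrow>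
     norm (zeta s) \<le> C * (\<bar>Im s\<bar> + 2) powr \<epsilon> * (1 + 1 / norm (s - 1))"
proof -
  obtain C where C: "C > 0" "\<And>s. Re s \<ge> 1 - \<epsilon>/8 \<Longrightarrow> norm (zetaF s) \<le> C * (norm s + 1) powr (1 + 8 * (\<epsilon>/8))"
    using zetaF_bound[of "\<epsilon>/8"] \<epsilon> by auto
  show ?thesis
  proof (rule that[of "max 1 (C * 3 powr \<epsilon> * 2)"])
    fix s :: complex assume *: "s \<noteq> 1" "1 - \<epsilon>/8 \<le> Re s" "Re s \<le> 4"
    have n: "norm (s - 1) > 0" using * by simp
    have "norm s \<le> norm (s - 1) + 1" using norm_triangle_ineq[of "s - 1" 1] by simp
    hence "(norm s + 1) / norm (s - 1) \<le> (norm (s - 1) + 2) / norm (s - 1)"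
      using n by (intro divide_right_mono) auto
    also have "\<dots> \<le> 2 * (1 + 1 / norm (s - 1))" using n by (simp add: field_simps)
    finally have r: "(norm s + 1) / norm (s - 1) \<le> 2 * (1 + 1 / norm (s - 1))" .
    have p: "(norm s + 1) powr \<epsilon> \<le> 3 powr \<epsilon> * (\<bar>Im s\<bar> + 2) powr \<epsilon>"
    proof -
      have "(norm s + 1) powr \<epsilon> \<le> (3 * (\<bar>Im s\<bar> + 2)) powr \<epsilon>"
        using \<epsilon> * norm_plus_1_le[of s] by (intro powr_mono2) auto
      thus ?thesis by (subst (asm) powr_mult) auto
    qed
    have "norm (zeta s) \<le> C * (norm s + 1) powr (1 + 8 * (\<epsilon>/8)) / norm (s - 1)"
      unfolding zeta_def norm_divide using C(2)[of s] * by (intro divide_right_mono) auto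
    also have "\<dots> = C * ((norm s + 1) powr \<epsilon> * ((norm s + 1) / norm (s - 1)))"
      by (simp add: powr_add)
    also have "\<dots> \<le> C * ((3 powr \<epsilon> * (\<bar>Im s\<bar> + 2) powr \<epsilon>) * (2 * (1 + 1 / norm (s - 1))))"
      using C r p by (intro mult_left_mono mult_mono) auto
    also have "\<dots> = C * 3 powr \<epsilon> * 2 * ((\<bar>Im s\<bar> + 2) powr \<epsilon> * (1 + 1 / norm (s - 1)))" by (simp add: mult_ac)
    also have "\<dots> \<le> max 1 (C * 3 powr \<epsilon> * 2) * ((\<bar>Im s\<bar> + 2) powr \<epsilon> * (1 + 1 / norm (s - 1)))"
      by (intro mult_right_mono mult_nonneg_nonneg) auto
    finally show "norm (zeta s) \<le> max 1 (C * 3 powr \<epsilon> * 2) * (\<bar>Im s\<bar> + 2) powr \<epsilon> * (1 + 1 / norm (s - 1))"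
      by (simp add: mult.assoc)
  qed auto
qed

text \<open>Stated on the closed disc rather than the circle because z will be f n n^(-it), which is
  0 where a character vanishes. The real part is at least 2 (1 + Re z)^2.\<close>

lemma Re_341_nonneg:
  fixes z :: complex assumes "norm z \<le> 1"
  shows "Re (3 + 4 * z + z * z) \<ge> 0"
proof -
  have "(Re z)\<^sup>2 + (Im z)\<^sup>2 \<le> 1" using assms cmod_power2[of z] by (metis norm_ge_zero power_le_one)
  hence "(Im z)\<^sup>2 \<le> 1 - (Re z)\<^sup>2" by simp
  moreover have "Re (3 + 4 * z + z * z) = 3 + 4 * Re z + (Re z)\<^sup>2 - (Im z)\<^sup>2" by (simp add: power2_eq_square)
  ultimately have "Re (3 + 4 * z + z * z) \<ge> 2 + 4 * Re z + 2 * (Re z)\<^sup>2" by simp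
  also have "2 + 4 * Re z + 2 * (Re z)\<^sup>2 = 2 * (Re z + 1)\<^sup>2" by (simp add: power2_eq_square algebra_simps)
  finally show ?thesis by (smt (verit) zero_le_power2)
qed

text \<open>The logarithm of the product is a series with terms \<Lambda>(n)/log n times
  n^(-\<sigma>) times Re (3 + 4z + z^2).\<close>

lemma three_four_one:
  assumes f: "cmult_fun f" and \<sigma>: "\<sigma> > 1"
  shows "norm (DS (\<lambda>_. 1) (of_real \<sigma>)) ^ 3 * norm (DS f (Complex \<sigma> t)) ^ 4 *
     norm (DS (\<lambda>n. f n * f n) (Complex \<sigma> (2 * t))) \<ge> 1"
proof -
  define g where "g = (\<lambda>n. f n * f n)"
  have g: "cmult_fun g" using f unfolding cmult_fun_def g_def
    by (auto simp: norm_mult intro: mult_le_one)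
  have fb: "\<And>n. norm (f n) \<le> 1" and gb: "\<And>n. norm (g n) \<le> 1" using f g by (auto simp: cmult_fun_def)
  have s: "Re (of_real \<sigma>) > 1" "Re (Complex \<sigma> t) > 1" "Re (Complex \<sigma> (2 * t)) > 1" using \<sigma> by auto
  define a1 where "a1 = (\<lambda>n. logc (\<lambda>_. 1) n * nps n (of_real \<sigma>))"
  define a2 where "a2 = (\<lambda>n. logc f n * nps n (Complex \<sigma> t))"
  define a3 where "a3 = (\<lambda>n. logc g n * nps n (Complex \<sigma> (2 * t)))"
  have sm: "summable a1" "summable a2" "summable a3" unfolding a1_def a2_def a3_def
    by (intro abs_conv_summable s abs_conv_logc[of _ 1]; use fb gb in simp)+
  have Re: "Re (3 * a1 n + 4 * a2 n + a3 n) \<ge> 0" for n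
  proof (cases "n = 0")
    case False
    define z where "z = f n * nps n (Complex 0 t)"
    define w where "w = (mangoldt n / ln (real n) * real n powr (-\<sigma>) :: real)"
    have w: "w \<ge> 0" unfolding w_def using mangoldt_over_ln(1)[of n] by (intro mult_nonneg_nonneg) auto
    have c1: "Complex \<sigma> t = of_real \<sigma> + Complex 0 t"
      and c2: "Complex \<sigma> (2 * t) = of_real \<sigma> + (Complex 0 t + Complex 0 t)" by (auto simp: complex_eq_iff)
    have e1: "nps n (Complex \<sigma> t) = of_real (real n powr (-\<sigma>)) * nps n (Complex 0 t)"
      using False by (simp only: c1 nps_add nps_of_real gr0I)
    have e2: "nps n (Complex \<sigma> (2*t)) = of_real (real n powr (-\<sigma>)) * (nps n (Complex 0 t) * nps n (Complex 0 t))"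
      using False by (simp only: c2 nps_add nps_of_real gr0I)
    have "3 * a1 n + 4 * a2 n + a3 n = of_real w * (3 + 4 * z + z * z)"
      unfolding a1_def a2_def a3_def e1 e2 logc_def nps_of_real w_def z_def g_def of_real_mult
      by (simp only: algebra_simps mult_1)
    also have "Re \<dots> = w * Re (3 + 4 * z + z * z)" by simp
    also have "\<dots> \<ge> 0"
    proof (intro mult_nonneg_nonneg w Re_341_nonneg)
      have "real n powr 0 = 1" using False by simp
      thus "norm z \<le> 1" unfolding z_def norm_mult norm_nps using fb[of n] by simp
    qed
    finally show ?thesis .
  qed (auto simp: a1_def a2_def a3_def)
  have smT: "summable (\<lambda>n. 3 * a1 n + 4 * a2 n + a3 n)" by (intro summable_add summable_mult sm)
  have "Re (\<Sum>n. 3 * a1 n + 4 * a2 n + a3 n) = (\<Sum>n. Re (3 * a1 n + 4 * a2 n + a3 n))"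
    by (rule bounded_linear.suminf[OF bounded_linear_Re smT])
  also have "\<dots> \<ge> 0" by (rule suminf_nonneg[OF summable_Re[OF smT] Re])
  finally have R: "Re (\<Sum>n. 3 * a1 n + 4 * a2 n + a3 n) \<ge> 0" .
  have sum: "(\<Sum>n. 3 * a1 n + 4 * a2 n + a3 n) = 3 * suminf a1 + 4 * suminf a2 + suminf a3"
    by (simp add: suminf_add[symmetric] suminf_mult[symmetric] sm summable_mult summable_add)
  have D: "DS (\<lambda>_. 1) (of_real \<sigma>) = exp (suminf a1)" "DS f (Complex \<sigma> t) = exp (suminf a2)"
    "DS g (Complex \<sigma> (2 * t)) = exp (suminf a3)"
    using DS_eq_exp_logc[OF cmult_fun_1 s(1)] DS_eq_exp_logc[OF f s(2)] DS_eq_exp_logc[OF g s(3)]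
    by (auto simp: DS_def a1_def a2_def a3_def)
  have "norm (DS (\<lambda>_. 1) (of_real \<sigma>)) ^ 3 * norm (DS f (Complex \<sigma> t)) ^ 4 * norm (DS g (Complex \<sigma> (2 * t))) =
     exp (Re (3 * suminf a1 + 4 * suminf a2 + suminf a3))"
    unfolding D by (simp add: exp_add exp_of_nat_mult[symmetric] flip: exp_of_nat_mult)
  also have "\<dots> \<ge> 1" using R unfolding sum by simp
  finally show ?thesis unfolding g_def .
qed

text \<open>The inequality bounds |L| below at 1 + x + it by a multiple of x^(3/4), while moving to
  1 + it costs at most U x; for small x the first wins. U bounds the derivative of the continuation
  \<open>LF\<close>, and V the series of the squared coefficients.\<close>

lemma lower_from_341:
  obtains c where "c > 0" "\<And>f LF U V t. cmult_fun f \<Longrightarrow> U \<ge> 1 \<Longrightarrow> V \<ge> 1 \<Longrightarrow>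
    (\<And>\<sigma>. 1 \<le> \<sigma> \<Longrightarrow> \<sigma> \<le> 2 \<Longrightarrow> LF field_differentiable (at (Complex \<sigma> t))) \<Longrightarrow>
    (\<And>\<sigma>. 1 \<le> \<sigma> \<Longrightarrow> \<sigma> \<le> 2 \<Longrightarrow> norm (deriv LF (Complex \<sigma> t)) \<le> U) \<Longrightarrow>
    (\<And>\<sigma>. 1 < \<sigma> \<Longrightarrow> \<sigma> \<le> 2 \<Longrightarrow> LF (Complex \<sigma> t) = DS f (Complex \<sigma> t)) \<Longrightarrow>
    (\<And>\<sigma>. 1 < \<sigma> \<Longrightarrow> \<sigma> \<le> 2 \<Longrightarrow> norm (DS (\<lambda>n. f n * f n) (Complex \<sigma> (2 * t))) \<le> V) \<Longrightarrow>
    norm (LF (Complex 1 t)) \<ge> c / (V * U ^ 3)"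
proof -
  obtain C0 where C0: "C0 > 0" "\<And>x. 0 < x \<Longrightarrow> x \<le> 1 \<Longrightarrow> (\<Sum>n. real n powr (-x-1)) \<le> C0 / x"
    using zeta_real_bound by blast
  define C where "C = max 1 C0"
  have C: "C \<ge> 1" by (simp add: C_def)
  have zb: "norm (DS (\<lambda>_. 1) (of_real (1 + x))) \<le> C / x" if "0 < x" "x \<le> 1" for x
  proof -
    have e: "- Re (complex_of_real (1 + x)) = - x - 1" by simp
    have "norm (DS (\<lambda>_. 1) (of_real (1 + x))) \<le> (\<Sum>n. norm (1::complex) * real n powr (- Re (complex_of_real (1 + x))))"
      using that by (intro norm_DS_le abs_conv_1) auto
    also have "\<dots> = (\<Sum>n. real n powr (-x-1))" unfolding e by simp
    also have "\<dots> \<le> C0 / x" by (rule C0(2)[OF that])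
    also have "\<dots> \<le> C / x" using that by (intro divide_right_mono) (auto simp: C_def)
    finally show ?thesis .
  qed
  show ?thesis
  proof (rule that[of "1 / (16 * C ^ 3)"])
    show "1 / (16 * C ^ 3) > 0" using C by simp
    fix f LF U V t
    assume f: "cmult_fun f" and U: "U \<ge> (1::real)" and V: "V \<ge> (1::real)"
      and diff: "\<And>\<sigma>. 1 \<le> \<sigma> \<Longrightarrow> \<sigma> \<le> 2 \<Longrightarrow> LF field_differentiable (at (Complex \<sigma> t))"
      and dU: "\<And>\<sigma>. 1 \<le> \<sigma> \<Longrightarrow> \<sigma> \<le> 2 \<Longrightarrow> norm (deriv LF (Complex \<sigma> t)) \<le> U"
      and eq: "\<And>\<sigma>. 1 < \<sigma> \<Longrightarrow> \<sigma> \<le> 2 \<Longrightarrow> LF (Complex \<sigma> t) = DS f (Complex \<sigma> t)"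
      and dV: "\<And>\<sigma>. 1 < \<sigma> \<Longrightarrow> \<sigma> \<le> 2 \<Longrightarrow> norm (DS (\<lambda>n. f n * f n) (Complex \<sigma> (2 * t))) \<le> V"
    \<comment> \<open>With this x the lower bound at 1 + x + it is exactly 2 U x; half of it is lost
      on the way to 1 + it.\<close>
    define x where "x = 1 / (16 * C ^ 3 * V * U ^ 4)"
    have den: "16 * C ^ 3 * V * U ^ 4 \<ge> 1"
    proof -
      have "1 * 1 * 1 * 1 \<le> 16 * C ^ 3 * V * U ^ 4" using C U V by (intro mult_mono mult_nonneg_nonneg) auto
      thus ?thesis by simp
    qed
    have dp: "16 * C ^ 3 * V * U ^ 4 > 0" using den by linarith
    have x: "x > 0" "x \<le> 1" unfolding x_def
      using divide_pos_pos[OF zero_less_one dp] divide_le_eq_1_pos[THEN iffD2, OF dp den] by blast+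
    define X where "X = norm (LF (Complex (1 + x) t))"
    have "1 \<le> (C / x) ^ 3 * X ^ 4 * V"
    proof -
      have "1 \<le> norm (DS (\<lambda>_. 1) (of_real (1 + x))) ^ 3 * norm (DS f (Complex (1 + x) t)) ^ 4 *
        norm (DS (\<lambda>n. f n * f n) (Complex (1 + x) (2 * t)))"
        using x by (intro three_four_one f) auto
      also have "\<dots> \<le> (C / x) ^ 3 * X ^ 4 * V"
        using zb[OF x] dV[of "1 + x"] eq[of "1 + x"] x C
        by (intro mult_mono power_mono mult_nonneg_nonneg) (auto simp: X_def)
      finally show ?thesis .
    qed
    hence "x ^ 3 \<le> C ^ 3 * V * X ^ 4" using x by (simp add: power_divide field_simps)
    hence "x ^ 3 * (x * 16 * U ^ 4) \<le> C ^ 3 * V * X ^ 4 * (x * 16 * U ^ 4)"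
      using x U by (intro mult_right_mono) auto
    also have "\<dots> = X ^ 4 * (x * (16 * C ^ 3 * V * U ^ 4))" by (simp add: mult_ac)
    also have "x * (16 * C ^ 3 * V * U ^ 4) = 1" using C U V by (simp add: x_def)
    finally have "(2 * U * x) ^ 4 \<le> X ^ 4" by (simp add: power_mult_distrib eval_nat_numeral mult_ac)
    hence X: "2 * U * x \<le> X" by (rule power_le_imp_le_base[of _ 3, simplified]) (simp add: X_def)
    have "norm (LF (Complex (1 + x) t) - LF (Complex 1 t)) \<le> U * norm (Complex (1 + x) t - Complex 1 t)"
    proof (rule field_differentiable_bound[where S = "closed_segment (Complex 1 t) (Complex (1 + x) t)" and f' = "deriv LF"])
      fix z assume "z \<in> closed_segment (Complex 1 t) (Complex (1 + x) t)"
      then obtain u where u: "0 \<le> u" "u \<le> 1" "z = (1 - u) *\<^sub>R Complex 1 t + u *\<^sub>R Complex (1 + x) t"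
        by (auto simp: closed_segment_def)
      hence z: "z = Complex (1 + u * x) t" by (simp add: complex_eq_iff algebra_simps)
      have ux: "0 \<le> u * x" "u * x \<le> 1" using u x by (auto simp: mult_le_one)
      show "norm (deriv LF z) \<le> U" unfolding z using ux by (intro dU) auto
      have "LF field_differentiable (at z)" unfolding z using ux by (intro diff) auto
      thus "(LF has_field_derivative deriv LF z) (at z within closed_segment (Complex 1 t) (Complex (1 + x) t))"
        using field_differentiable_derivI has_field_derivative_at_within by blast
    qed auto
    also have "Complex (1 + x) t - Complex 1 t = of_real x" by (simp add: complex_eq_iff)
    also have "norm (complex_of_real x) = x" using x by simp
    finally have "norm (LF (Complex 1 t)) \<ge> X - U * x"
      unfolding X_def using norm_triangle_ineq2[of "LF (Complex (1 + x) t)" "LF (Complex 1 t)"] by linarith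
    hence "norm (LF (Complex 1 t)) \<ge> U * x" using X by linarith
    moreover have "U * x = 1 / (16 * C ^ 3) / (V * U ^ 3)"
      using U V C by (simp add: x_def eval_nat_numeral field_simps)
    ultimately show "norm (LF (Complex 1 t)) \<ge> 1 / (16 * C ^ 3) / (V * U ^ 3)" by simp
  qed
qed

section \<open>Bounds for logarithmic derivatives\<close>

lemma Complex_ball_Re_Im:
  assumes "z \<in> ball (Complex a t) r"
  shows "\<bar>Re z - a\<bar> < r" "\<bar>Im z - t\<bar> < r"
proof -
  have "norm (Complex a t - z) < r" using assms by (simp add: dist_norm)
  thus "\<bar>Re z - a\<bar> < r" "\<bar>Im z - t\<bar> < r"
    using abs_Re_le_cmod[of "Complex a t - z"] abs_Im_le_cmod[of "Complex a t - z"] by auto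
qed

lemma double_powr_le:
  fixes \<epsilon> x y :: real
  assumes "0 < \<epsilon>" "\<epsilon> \<le> 1" "0 \<le> x" "x \<le> 2 * y"
  shows "x powr \<epsilon> \<le> 2 * y powr \<epsilon>"
proof -
  have y: "y \<ge> 0" using assms by simp
  have "x powr \<epsilon> \<le> (2 * y) powr \<epsilon>" using assms by (intro powr_mono2) auto
  also have "\<dots> = 2 powr \<epsilon> * y powr \<epsilon>" by (simp add: powr_mult)
  also have "\<dots> \<le> 2 powr 1 * y powr \<epsilon>" using assms by (intro mult_right_mono powr_mono) auto
  finally show ?thesis by simp
qed

lemma npchar_pos: "npchar q \<phi> \<Longrightarrow> real q \<ge> 1"
  using dchar_pos[OF npchar_dchar] by fastforce

section \<open>Upper bounds for L-functions and their derivatives\<close>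

lemma npchar_upper:
  assumes \<epsilon>: "0 < \<epsilon>" "\<epsilon> \<le> 1"
  obtains C where "C \<ge> 1" "\<And>q \<phi> s. npchar q \<phi> \<Longrightarrow> 1 - \<epsilon>/8 \<le> Re s \<Longrightarrow> Re s \<le> 4 \<Longrightarrow>
     norm (Lc \<phi> s) \<le> C * (real q * (\<bar>Im s\<bar> + 2)) powr \<epsilon>"
proof -
  obtain C where C: "C \<ge> 1" "\<And>Q b s. Q \<ge> 1 \<Longrightarrow> (\<And>n. norm (b n) \<le> 2) \<Longrightarrow> (\<And>n. norm (psum b n) \<le> 2 * Q) \<Longrightarrow>
     1 - \<epsilon>/8 \<le> Re s \<Longrightarrow> Re s \<le> 4 \<Longrightarrow> norm (Lc b s) \<le> C * (Q * (\<bar>Im s\<bar> + 2)) powr \<epsilon>"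
    using Lc_upper[OF \<epsilon>] by blast
  show ?thesis
  proof (rule that[OF C(1)])
    fix q \<phi> s assume \<phi>: "npchar q \<phi>" and s: "1 - \<epsilon>/8 \<le> Re s" "Re s \<le> 4"
    show "norm (Lc \<phi> s) \<le> C * (real q * (\<bar>Im s\<bar> + 2)) powr \<epsilon>"
    proof (rule C(2)[OF npchar_pos[OF \<phi>] _ _ s])
      show "norm (\<phi> n) \<le> 2" for n
        using norm_dchar_le[OF npchar_dchar[OF \<phi>], of n] by simp
      show "norm (psum \<phi> n) \<le> 2 * real q" for n
        using \<phi> norm_psum_dchar_le[of q \<phi>] by (simp add: npchar_def)
    qed
  qed
qed

lemma npchar_ball_holomorphic:
  assumes "npchar q \<phi>" "r \<le> a"
  shows "Lc \<phi> holomorphic_on ball (Complex a t) r"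
  by (rule holomorphic_on_subset[OF npchar_holomorphic[OF assms(1)]])
     (use Complex_ball_Re_Im(1)[of _ a t r] assms(2) in fastforce)

lemma npchar_deriv_upper:
  assumes \<epsilon>: "0 < \<epsilon>" "\<epsilon> \<le> 1"
  obtains C where "C \<ge> 1" "\<And>q \<phi> \<sigma> t. npchar q \<phi> \<Longrightarrow> 1 \<le> \<sigma> \<Longrightarrow> \<sigma> \<le> 2 \<Longrightarrow>
     norm (deriv (Lc \<phi>) (Complex \<sigma> t)) \<le> C * (real q * (\<bar>t\<bar> + 2)) powr \<epsilon>"
proof -
  obtain C where C: "C \<ge> 1" "\<And>q \<phi> s. npchar q \<phi> \<Longrightarrow> 1 - \<epsilon>/8 \<le> Re s \<Longrightarrow> Re s \<le> 4 \<Longrightarrow>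
     norm (Lc \<phi> s) \<le> C * (real q * (\<bar>Im s\<bar> + 2)) powr \<epsilon>"
    using npchar_upper[OF \<epsilon>] by blast
  show ?thesis
  proof (rule that[of "max 1 (2 * (C * 2) / (\<epsilon>/8))"])
    fix q \<phi> \<sigma> t assume \<phi>: "npchar q \<phi>" and \<sigma>: "1 \<le> \<sigma>" "\<sigma> \<le> (2::real)"
    define \<tau> where "\<tau> = real q * (\<bar>t\<bar> + 2)"
    have "norm (deriv (Lc \<phi>) (Complex \<sigma> t)) \<le> 2 * (C * (2 * \<tau> powr \<epsilon>)) / (\<epsilon>/8)"
    proof (rule deriv_bound)
      show "Lc \<phi> holomorphic_on ball (Complex \<sigma> t) (\<epsilon>/8)" using \<epsilon> \<sigma> by (intro npchar_ball_holomorphic[OF \<phi>]) auto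
      fix z assume "z \<in> ball (Complex \<sigma> t) (\<epsilon>/8)"
      note z = Complex_ball_Re_Im[OF this]
      have "norm (Lc \<phi> z) \<le> C * (real q * (\<bar>Im z\<bar> + 2)) powr \<epsilon>"
      proof (rule C(2)[OF \<phi>])
        show "1 - \<epsilon>/8 \<le> Re z" "Re z \<le> 4" using z \<epsilon> \<sigma> by linarith+
      qed
      also have "(real q * (\<bar>Im z\<bar> + 2)) powr \<epsilon> \<le> 2 * \<tau> powr \<epsilon>"
      proof (rule double_powr_le[OF \<epsilon>])
        have "\<bar>Im z\<bar> \<le> \<bar>Im z - t\<bar> + \<bar>t\<bar>" using abs_triangle_ineq[of "Im z - t" t] by simp
        also have "\<dots> \<le> 1 + \<bar>t\<bar>" using order_trans[OF less_imp_le[OF z(2)], of 1] \<epsilon>(2) by simp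
        finally have "\<bar>Im z\<bar> + 2 \<le> 2 * (\<bar>t\<bar> + 2)" by simp
        hence "real q * (\<bar>Im z\<bar> + 2) \<le> real q * (2 * (\<bar>t\<bar> + 2))" by (intro mult_left_mono) auto
        thus "real q * (\<bar>Im z\<bar> + 2) \<le> 2 * \<tau>" by (simp add: \<tau>_def mult_ac)
      qed auto
      finally show "norm (Lc \<phi> z) \<le> C * (2 * \<tau> powr \<epsilon>)" using C by (simp add: mult_left_mono)
    qed (use \<epsilon> in auto)
    also have "\<dots> = 2 * (C * 2) / (\<epsilon>/8) * \<tau> powr \<epsilon>" by simp
    also have "\<dots> \<le> max 1 (2 * (C * 2) / (\<epsilon>/8)) * \<tau> powr \<epsilon>" by (intro mult_right_mono) auto
    finally show "norm (deriv (Lc \<phi>) (Complex \<sigma> t)) \<le> max 1 (2 * (C * 2) / (\<epsilon>/8)) * (real q * (\<bar>t\<bar> + 2)) powr \<epsilon>"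
      unfolding \<tau>_def .
  qed auto
qed

text \<open>Subtracting the mean \<delta> = totient q / q from the principal character leaves a
  function with zero sum over a period. So the series is \<delta> zeta plus a part continued by
  \<open>Lc\<close>, and only zeta carries a pole.\<close>

lemma principal_upper:
  assumes \<epsilon>: "0 < \<epsilon>" "\<epsilon> \<le> 1"
  obtains C where "C \<ge> 1" "\<And>q s. q > 0 \<Longrightarrow> 1 < Re s \<Longrightarrow> Re s \<le> 4 \<Longrightarrow>
     norm (DS (principal_char q) s) \<le> C * (real q * (\<bar>Im s\<bar> + 2)) powr \<epsilon> * (1 + 1 / norm (s - 1))"
proof -
  obtain C1 where C1: "C1 \<ge> 1" "\<And>Q b s. Q \<ge> 1 \<Longrightarrow> (\<And>n. norm (b n) \<le> 2) \<Longrightarrow> (\<And>n. norm (psum b n) \<le> 2 * Q) \<Longrightarrow>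
     1 - \<epsilon>/8 \<le> Re s \<Longrightarrow> Re s \<le> 4 \<Longrightarrow> norm (Lc b s) \<le> C1 * (Q * (\<bar>Im s\<bar> + 2)) powr \<epsilon>"
    using Lc_upper[OF \<epsilon>] by blast
  obtain C2 where C2: "C2 \<ge> 1" "\<And>s. s \<noteq> 1 \<Longrightarrow> 1 - \<epsilon>/8 \<le> Re s \<Longrightarrow> Re s \<le> 4 \<Longrightarrow>
     norm (zeta s) \<le> C2 * (\<bar>Im s\<bar> + 2) powr \<epsilon> * (1 + 1 / norm (s - 1))"
    using zeta_upper[OF \<epsilon>] by blast
  show ?thesis
  proof (rule that[of "C2 + C1"])
    show "C2 + C1 \<ge> 1" using C1 C2 by simp
    fix q :: nat and s :: complex assume q: "q > 0" and s: "1 < Re s" "Re s \<le> 4"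
    define \<delta> where "\<delta> = real (totient q) / real q"
    have \<delta>: "0 \<le> \<delta>" "\<delta> \<le> 1" using q totient_le[of q] by (auto simp: \<delta>_def)
    define b where "b = (\<lambda>n. principal_char q n - of_real \<delta>)"
    have b1: "norm (b n) \<le> 1" for n
    proof (cases "coprime n q")
      case True
      have "b n = of_real (1 - \<delta>)" using True by (simp add: b_def principal_char_def)
      thus ?thesis using \<delta> by (metis abs_of_nonneg diff_ge_0_iff_ge le_add_diff_inverse2 le_add_same_cancel2 le_add_same_cancel1 norm_of_real)
    qed (use \<delta> in \<open>auto simp: b_def principal_char_def\<close>)
    have S: "norm (psum b n) \<le> 2 * real q" for n
    proof (rule norm_psum_le[OF _ b1])
      show "norm (\<Sum>k<N. b k) \<le> real q" for N
      proof (rule norm_sum_periodic_le[OF _ _ b1 q])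
        have "coprime (n + q) q \<longleftrightarrow> coprime n q" for n by (metis coprime_add_one_left gcd_add1 coprime_iff_gcd_eq_1)
        thus "b (n + q) = b n" for n by (simp add: b_def principal_char_def)
        have "(\<Sum>n<q. b n) = of_nat (totient q) - of_nat q * of_real \<delta>"
          unfolding b_def sum_subtractf sum_principal_period[OF q] by simp
        also have "\<dots> = 0" using q by (simp add: \<delta>_def)
        finally show "(\<Sum>n<q. b n) = 0" .
      qed
    qed (use q in auto)
    have ab: "abs_conv b" by (rule abs_conv_bounded[OF b1])
    define X where "X = (real q * (\<bar>Im s\<bar> + 2)) powr \<epsilon>"
    have s1: "s \<noteq> 1" using s by auto
    have "principal_char q = (\<lambda>n. of_real \<delta> * 1 + b n)" by (auto simp: b_def)
    hence "DS (principal_char q) s = of_real \<delta> * zeta s + Lc b s"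
      using DS_add[OF abs_conv_cmult[OF abs_conv_1] ab s(1), of "of_real \<delta>"] DS_cmult[OF abs_conv_1 s(1), of "of_real \<delta>"]
        zeta_eq_DS[OF s(1)] Lc_eq_DS[OF S ab s(1)] by simp
    hence tri: "norm (DS (principal_char q) s) \<le> norm (of_real \<delta> * zeta s) + norm (Lc b s)" by (metis norm_triangle_ineq)
    have "norm (of_real \<delta> * zeta s) \<le> 1 * norm (zeta s)"
      unfolding norm_mult using \<delta> by (intro mult_right_mono) auto
    also have "1 * norm (zeta s) \<le> C2 * (\<bar>Im s\<bar> + 2) powr \<epsilon> * (1 + 1 / norm (s - 1))"
      using C2(2)[OF s1] s \<epsilon> by simp
    also have "\<dots> \<le> C2 * X * (1 + 1 / norm (s - 1))"
    proof (intro mult_right_mono mult_left_mono)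
      have "1 * (\<bar>Im s\<bar> + 2) \<le> real q * (\<bar>Im s\<bar> + 2)" using q by (intro mult_right_mono) auto
      thus "(\<bar>Im s\<bar> + 2) powr \<epsilon> \<le> X" unfolding X_def using \<epsilon> by (intro powr_mono2) auto
    qed (use C2 in auto)
    finally have h1: "norm (of_real \<delta> * zeta s) \<le> C2 * X * (1 + 1 / norm (s - 1))" .
    have b2: "norm (b n) \<le> 2" for n using b1[of n] by simp
    have "norm (Lc b s) \<le> C1 * X" unfolding X_def by (rule C1(2)[OF _ b2 S]) (use q s \<epsilon> in auto)
    also have "\<dots> = C1 * X * 1" by simp
    also have "\<dots> \<le> C1 * X * (1 + 1 / norm (s - 1))"
      using C1 by (intro mult_left_mono) (auto simp: X_def)
    finally show "norm (DS (principal_char q) s) \<le> (C2 + C1) * (real q * (\<bar>Im s\<bar> + 2)) powr \<epsilon> * (1 + 1 / norm (s - 1))"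
      using tri h1 unfolding X_def distrib_right by linarith
  qed
qed

section \<open>Lower bounds on the line Re s = 1\<close>

lemma tau_facts:
  assumes "q > 0" shows "1 \<le> real q * (\<bar>t\<bar> + 2)" "real q \<le> real q * (\<bar>t\<bar> + 2)"
proof -
  have "real q * 1 \<le> real q * (\<bar>t\<bar> + 2)" by (intro mult_left_mono) auto
  thus "real q \<le> real q * (\<bar>t\<bar> + 2)" by simp
  thus "1 \<le> real q * (\<bar>t\<bar> + 2)" using assms by linarith
qed

text \<open>Three situations. If \<phi>^2 is not principal, its series is bounded by a power of
  \<tau>. If \<phi> is real and |t| \<ge> \<kappa> q^(-2\<epsilon>), the pole met at height 2t costs
  only q^(2\<epsilon>). For smaller |t| Siegel's bound at 1 is carried over by the derivative bound.
  The exponent is 6 = 3 + 3, from V and from U^3.\<close>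

lemma npchar_lower:
  assumes \<epsilon>: "0 < \<epsilon>" "\<epsilon> \<le> 1"
  obtains c where "c > 0" "\<And>q \<phi> t. npchar q \<phi> \<Longrightarrow>
     norm (Lc \<phi> (Complex 1 t)) \<ge> c * (real q * (\<bar>t\<bar> + 2)) powr (-6 * \<epsilon>)"
proof -
  obtain C1 where C1: "C1 \<ge> 1" "\<And>q \<phi> s. npchar q \<phi> \<Longrightarrow> 1 - \<epsilon>/8 \<le> Re s \<Longrightarrow> Re s \<le> 4 \<Longrightarrow>
     norm (Lc \<phi> s) \<le> C1 * (real q * (\<bar>Im s\<bar> + 2)) powr \<epsilon>"
    using npchar_upper[OF \<epsilon>] by blast
  obtain C2 where C2: "C2 \<ge> 1" "\<And>q \<phi> \<sigma> t. npchar q \<phi> \<Longrightarrow> 1 \<le> \<sigma> \<Longrightarrow> \<sigma> \<le> 2 \<Longrightarrow>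
     norm (deriv (Lc \<phi>) (Complex \<sigma> t)) \<le> C2 * (real q * (\<bar>t\<bar> + 2)) powr \<epsilon>"
    using npchar_deriv_upper[OF \<epsilon>] by blast
  obtain C3 where C3: "C3 \<ge> 1" "\<And>q s. q > 0 \<Longrightarrow> 1 < Re s \<Longrightarrow> Re s \<le> 4 \<Longrightarrow>
     norm (DS (principal_char q) s) \<le> C3 * (real q * (\<bar>Im s\<bar> + 2)) powr \<epsilon> * (1 + 1 / norm (s - 1))"
    using principal_upper[OF \<epsilon>] by blast
  obtain cs where cs: "cs > 0" "\<And>q \<phi>. rchar q \<phi> \<Longrightarrow> Re (Lc \<phi> 1) \<ge> cs * real q powr (-\<epsilon>)"
    using siegel[OF \<epsilon>(1)] by blast
  obtain c0 where c0: "c0 > 0" "\<And>f LF U V t. cmult_fun f \<Longrightarrow> U \<ge> 1 \<Longrightarrow> V \<ge> 1 \<Longrightarrow>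
    (\<And>\<sigma>. 1 \<le> \<sigma> \<Longrightarrow> \<sigma> \<le> 2 \<Longrightarrow> LF field_differentiable (at (Complex \<sigma> t))) \<Longrightarrow>
    (\<And>\<sigma>. 1 \<le> \<sigma> \<Longrightarrow> \<sigma> \<le> 2 \<Longrightarrow> norm (deriv LF (Complex \<sigma> t)) \<le> U) \<Longrightarrow>
    (\<And>\<sigma>. 1 < \<sigma> \<Longrightarrow> \<sigma> \<le> 2 \<Longrightarrow> LF (Complex \<sigma> t) = DS f (Complex \<sigma> t)) \<Longrightarrow>
    (\<And>\<sigma>. 1 < \<sigma> \<Longrightarrow> \<sigma> \<le> 2 \<Longrightarrow> norm (DS (\<lambda>n. f n * f n) (Complex \<sigma> (2 * t))) \<le> V) \<Longrightarrow>
    norm (LF (Complex 1 t)) \<ge> c0 / (V * U ^ 3)"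
    using lower_from_341 by blast
  \<comment> \<open>On |t| \<le> \<kappa> q^(-2\<epsilon>) the function varies by at most 3 C2
    \<kappa> q^(-\<epsilon>), which this choice makes at most half of Siegel's bound.\<close>
  define \<kappa> where "\<kappa> = min 1 (cs / (6 * C2))"
  have \<kappa>: "\<kappa> > 0" "\<kappa> \<le> 1" "3 * C2 * \<kappa> \<le> cs / 2"
  proof -
    show "\<kappa> > 0" "\<kappa> \<le> 1" using cs C2 by (auto simp: \<kappa>_def)
    have "3 * C2 * \<kappa> \<le> 3 * C2 * (cs / (6 * C2))" using C2 by (intro mult_left_mono) (auto simp: \<kappa>_def)
    thus "3 * C2 * \<kappa> \<le> cs / 2" using C2 by simp
  qed
  define CV where "CV = max (2 * C1) (2 * C3 * (1 + 1 / \<kappa>))"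
  have CV: "CV \<ge> 1" "2 * C1 \<le> CV" "2 * C3 * (1 + 1 / \<kappa>) \<le> CV" using C1 by (auto simp: CV_def)
  define c where "c = min (c0 / (CV * C2 ^ 3)) (cs / 2)"
  show ?thesis
  proof (rule that[of c])
    show "c > 0" using c0 CV C2 cs by (simp add: c_def)
    fix q \<phi> and t :: real assume \<phi>: "npchar q \<phi>"
    have q: "q > 0" "real q \<ge> 1" using npchar_pos[OF \<phi>] by auto
    have d: "dchar q \<phi>" by (rule npchar_dchar[OF \<phi>])
    define \<tau> where "\<tau> = real q * (\<bar>t\<bar> + 2)"
    have \<tau>: "\<tau> \<ge> 1" "real q \<le> \<tau>" unfolding \<tau>_def using tau_facts[OF q(1)] by auto
    have dbl: "(real q * (\<bar>2 * t\<bar> + 2)) powr \<epsilon> \<le> 2 * \<tau> powr \<epsilon>"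
    proof (rule double_powr_le[OF \<epsilon>])
      have "real q * (\<bar>2 * t\<bar> + 2) \<le> real q * (2 * (\<bar>t\<bar> + 2))" by (intro mult_left_mono) auto
      thus "real q * (\<bar>2 * t\<bar> + 2) \<le> 2 * \<tau>" by (simp add: \<tau>_def mult_ac)
    qed auto
    have mono: "\<tau> powr a \<le> \<tau> powr b" if "a \<le> b" for a b using that \<tau> by (intro powr_mono) auto
    have holo: "Lc \<phi> holomorphic_on {s. Re s > 0}" by (rule npchar_holomorphic[OF \<phi>])
    have diff: "Lc \<phi> field_differentiable (at s)" if "Re s > 0" for s
      using that holomorphic_on_imp_differentiable_at[OF holo open_halfspace_Re_gt] by simp
    have main: "c * \<tau> powr (-6 * \<epsilon>) \<le> norm (Lc \<phi> (Complex 1 t))"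
      if V: "\<And>\<sigma>. 1 < \<sigma> \<Longrightarrow> \<sigma> \<le> 2 \<Longrightarrow> norm (DS (\<lambda>n. \<phi> n * \<phi> n) (Complex \<sigma> (2 * t))) \<le> CV * \<tau> powr (3 * \<epsilon>)"
    proof -
      have t1: "\<tau> powr (3 * \<epsilon>) \<ge> 1" "\<tau> powr \<epsilon> \<ge> 1" using \<tau> \<epsilon> by (auto intro!: ge_one_powr_ge_zero)
      have "c0 / ((CV * \<tau> powr (3 * \<epsilon>)) * (C2 * \<tau> powr \<epsilon>) ^ 3) \<le> norm (Lc \<phi> (Complex 1 t))"
      proof (rule c0(2)[OF dchar_cmult_fun[OF d]])
        show "1 \<le> C2 * \<tau> powr \<epsilon>" using C2 t1 mult_mono[of 1 C2 1 "\<tau> powr \<epsilon>"] by simp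
        show "1 \<le> CV * \<tau> powr (3 * \<epsilon>)" using CV t1 mult_mono[of 1 CV 1 "\<tau> powr (3 * \<epsilon>)"] by simp
        fix \<sigma> :: real
        show "Lc \<phi> field_differentiable (at (Complex \<sigma> t))" if "1 \<le> \<sigma>" using that by (intro diff) auto
        show "norm (deriv (Lc \<phi>) (Complex \<sigma> t)) \<le> C2 * \<tau> powr \<epsilon>" if "1 \<le> \<sigma>" "\<sigma> \<le> 2"
          unfolding \<tau>_def using that by (intro C2(2)[OF \<phi>]) auto
        show "Lc \<phi> (Complex \<sigma> t) = DS \<phi> (Complex \<sigma> t)" if "1 < \<sigma>"
          using that by (intro npchar_Lc_eq_DS[OF \<phi>]) auto
        show "norm (DS (\<lambda>n. \<phi> n * \<phi> n) (Complex \<sigma> (2 * t))) \<le> CV * \<tau> powr (3 * \<epsilon>)" if "1 < \<sigma>" "\<sigma> \<le> 2"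
          using that by (rule V)
      qed
      moreover have "c0 / ((CV * \<tau> powr (3 * \<epsilon>)) * (C2 * \<tau> powr \<epsilon>) ^ 3) = c0 / (CV * C2 ^ 3) * \<tau> powr (-6 * \<epsilon>)"
      proof -
        have "(\<tau> powr \<epsilon>) ^ 3 = \<tau> powr (3 * \<epsilon>)" using \<tau> by (simp add: powr_power mult.commute)
        hence "(CV * \<tau> powr (3 * \<epsilon>)) * (C2 * \<tau> powr \<epsilon>) ^ 3 = CV * C2 ^ 3 * (\<tau> powr (3 * \<epsilon>) * \<tau> powr (3 * \<epsilon>))"
          by (simp add: power_mult_distrib)
        also have "\<tau> powr (3 * \<epsilon>) * \<tau> powr (3 * \<epsilon>) = \<tau> powr (6 * \<epsilon>)" by (simp add: powr_add[symmetric])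
        finally have e: "(CV * \<tau> powr (3 * \<epsilon>)) * (C2 * \<tau> powr \<epsilon>) ^ 3 = CV * C2 ^ 3 * \<tau> powr (6 * \<epsilon>)" .
        show ?thesis unfolding e by (simp add: powr_minus divide_simps)
      qed
      moreover have "c * \<tau> powr (-6 * \<epsilon>) \<le> c0 / (CV * C2 ^ 3) * \<tau> powr (-6 * \<epsilon>)"
        by (intro mult_right_mono) (auto simp: c_def)
      ultimately show ?thesis by linarith
    qed
    define \<theta> where "\<theta> = (\<lambda>n. \<phi> n * \<phi> n)"
    have d\<theta>: "dchar q \<theta>" unfolding \<theta>_def by (rule dchar_mult_same[OF d d])
    have "c * \<tau> powr (-6 * \<epsilon>) \<le> norm (Lc \<phi> (Complex 1 t))"
    proof (cases "\<theta> = principal_char q")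
      case False
      hence np: "npchar q \<theta>" using d\<theta> by (simp add: npchar_def)
      show ?thesis
      proof (rule main, fold \<theta>_def)
        fix \<sigma> :: real assume \<sigma>: "1 < \<sigma>" "\<sigma> \<le> 2"
        have "norm (DS \<theta> (Complex \<sigma> (2 * t))) = norm (Lc \<theta> (Complex \<sigma> (2 * t)))"
          using npchar_Lc_eq_DS[OF np, of "Complex \<sigma> (2 * t)"] \<sigma> by simp
        also have "\<dots> \<le> C1 * (real q * (\<bar>Im (Complex \<sigma> (2 * t))\<bar> + 2)) powr \<epsilon>"
          using \<sigma> \<epsilon> by (intro C1(2)[OF np]) auto
        also have "\<dots> \<le> C1 * (2 * \<tau> powr \<epsilon>)" using dbl C1 by (intro mult_left_mono) auto
        also have "\<dots> = 2 * C1 * \<tau> powr \<epsilon>" by simp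
        also have "\<dots> \<le> CV * \<tau> powr (3 * \<epsilon>)" using CV \<epsilon> by (intro mult_mono mono) auto
        finally show "norm (DS \<theta> (Complex \<sigma> (2 * t))) \<le> CV * \<tau> powr (3 * \<epsilon>)" .
      qed
    next
      case True
      have r: "rchar q \<phi>" using \<phi> dchar_real_of_sq[OF d True[unfolded \<theta>_def]] by (simp add: rchar_def)
      show ?thesis
      proof (cases "\<bar>t\<bar> \<ge> \<kappa> * real q powr (-2 * \<epsilon>)")
        case t: True
        have t0: "\<kappa> * real q powr (-2 * \<epsilon>) > 0" using \<kappa> q by simp
        show ?thesis
        proof (rule main, fold \<theta>_def, unfold True)
          fix \<sigma> :: real assume \<sigma>: "1 < \<sigma>" "\<sigma> \<le> 2"
          have "\<kappa> * real q powr (-2 * \<epsilon>) \<le> norm (Complex \<sigma> (2 * t) - 1)"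
            using t abs_Im_le_cmod[of "Complex \<sigma> (2 * t) - 1"] by simp
          hence "1 / norm (Complex \<sigma> (2 * t) - 1) \<le> 1 / (\<kappa> * real q powr (-2 * \<epsilon>))"
            by (rule divide_left_mono) (use t0 \<open>\<kappa> * real q powr (-2 * \<epsilon>) \<le> norm (Complex \<sigma> (2 * t) - 1)\<close> in \<open>auto intro!: mult_pos_pos simp del: zero_less_mult_iff\<close>)
          also have "\<dots> = 1 / \<kappa> * real q powr (2 * \<epsilon>)" by (simp add: powr_minus divide_simps)
          also have "\<dots> \<le> 1 / \<kappa> * \<tau> powr (2 * \<epsilon>)"
            using \<kappa> \<tau> \<epsilon> by (intro mult_left_mono powr_mono2) auto
          finally have "1 + 1 / norm (Complex \<sigma> (2 * t) - 1) \<le> \<tau> powr (2 * \<epsilon>) + 1 / \<kappa> * \<tau> powr (2 * \<epsilon>)"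
            using ge_one_powr_ge_zero[of \<tau> "2 * \<epsilon>"] \<tau> \<epsilon> by simp
          hence i: "1 + 1 / norm (Complex \<sigma> (2 * t) - 1) \<le> (1 + 1 / \<kappa>) * \<tau> powr (2 * \<epsilon>)"
            by (simp only: distrib_right mult_1)
          have "norm (DS (principal_char q) (Complex \<sigma> (2 * t))) \<le>
             C3 * (real q * (\<bar>Im (Complex \<sigma> (2 * t))\<bar> + 2)) powr \<epsilon> * (1 + 1 / norm (Complex \<sigma> (2 * t) - 1))"
            using \<sigma> by (intro C3(2)[OF q(1)]) auto
          also have "\<dots> \<le> C3 * (2 * \<tau> powr \<epsilon>) * ((1 + 1 / \<kappa>) * \<tau> powr (2 * \<epsilon>))"
            using dbl i C3 by (intro mult_mono mult_nonneg_nonneg) auto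
          also have "\<dots> = 2 * C3 * (1 + 1 / \<kappa>) * (\<tau> powr \<epsilon> * \<tau> powr (2 * \<epsilon>))" by (simp only: mult_ac)
          also have "\<tau> powr \<epsilon> * \<tau> powr (2 * \<epsilon>) = \<tau> powr (3 * \<epsilon>)" by (simp add: powr_add[symmetric])
          also have "2 * C3 * (1 + 1 / \<kappa>) * \<tau> powr (3 * \<epsilon>) \<le> CV * \<tau> powr (3 * \<epsilon>)"
            using CV by (intro mult_right_mono) auto
          finally show "norm (DS (principal_char q) (Complex \<sigma> (2 * t))) \<le> CV * \<tau> powr (3 * \<epsilon>)" .
        qed
      next
        case False
        hence t: "\<bar>t\<bar> \<le> \<kappa> * real q powr (-2 * \<epsilon>)" by simp
        have "real q powr (-2 * \<epsilon>) \<le> real q powr 0" using q \<epsilon> by (intro powr_mono) auto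
        hence "real q powr (-2 * \<epsilon>) \<le> 1" using q by simp
        hence t1: "\<bar>t\<bar> \<le> 1" using t \<kappa> mult_le_one[of \<kappa> "real q powr (-2 * \<epsilon>)"] by simp
        have "norm (Lc \<phi> (Complex 1 t) - Lc \<phi> (Complex 1 0)) \<le> C2 * (3 * real q powr \<epsilon>) * norm (Complex 1 t - Complex 1 0)"
        proof (rule field_differentiable_bound[where S = "closed_segment (Complex 1 0) (Complex 1 t)" and f' = "deriv (Lc \<phi>)"])
          fix z assume "z \<in> closed_segment (Complex 1 0) (Complex 1 t)"
          then obtain u where u: "0 \<le> u" "u \<le> 1" "z = (1 - u) *\<^sub>R Complex 1 0 + u *\<^sub>R Complex 1 t"
            by (auto simp: closed_segment_def)
          hence z: "z = Complex 1 (u * t)" by (simp add: complex_eq_iff algebra_simps)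
          have ut: "\<bar>u * t\<bar> \<le> 1" using u t1 by (simp add: abs_mult mult_le_one)
          have "norm (deriv (Lc \<phi>) z) \<le> C2 * (real q * (\<bar>u * t\<bar> + 2)) powr \<epsilon>"
            unfolding z by (intro C2(2)[OF \<phi>]) auto
          also have "\<dots> \<le> C2 * (real q * 3) powr \<epsilon>"
            using C2 ut \<epsilon> by (intro mult_left_mono powr_mono2) auto
          also have "\<dots> = C2 * (3 powr \<epsilon> * real q powr \<epsilon>)" by (simp add: powr_mult mult.commute)
          also have "\<dots> \<le> C2 * (3 powr 1 * real q powr \<epsilon>)"
            using C2 \<epsilon> by (intro mult_left_mono mult_right_mono powr_mono) auto
          finally show "norm (deriv (Lc \<phi>) z) \<le> C2 * (3 * real q powr \<epsilon>)" by simp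
          have "Lc \<phi> field_differentiable (at z)" unfolding z by (intro diff) auto
          thus "(Lc \<phi> has_field_derivative deriv (Lc \<phi>) z) (at z within closed_segment (Complex 1 0) (Complex 1 t))"
            using field_differentiable_derivI has_field_derivative_at_within by blast
        qed auto
        also have "norm (Complex 1 t - Complex 1 0) = \<bar>t\<bar>" by (simp add: cmod_def)
        also have "C2 * (3 * real q powr \<epsilon>) * \<bar>t\<bar> \<le> C2 * (3 * real q powr \<epsilon>) * (\<kappa> * real q powr (-2 * \<epsilon>))"
          using C2 t by (intro mult_left_mono) auto
        also have "\<dots> = 3 * C2 * \<kappa> * (real q powr \<epsilon> * real q powr (-2 * \<epsilon>))" by (simp only: mult_ac)
        also have "real q powr \<epsilon> * real q powr (-2 * \<epsilon>) = real q powr (-\<epsilon>)" by (simp add: powr_add[symmetric])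
        also have "3 * C2 * \<kappa> * real q powr (-\<epsilon>) \<le> cs / 2 * real q powr (-\<epsilon>)"
          using \<kappa> by (intro mult_right_mono) auto
        finally have dd: "norm (Lc \<phi> (Complex 1 t) - Lc \<phi> 1) \<le> cs / 2 * real q powr (-\<epsilon>)"
          by (simp add: one_complex.code[symmetric])
        have "cs * real q powr (-\<epsilon>) \<le> norm (Lc \<phi> 1)"
          using cs(2)[OF r] complex_Re_le_cmod[of "Lc \<phi> 1"] by linarith
        hence "norm (Lc \<phi> (Complex 1 t)) \<ge> cs / 2 * real q powr (-\<epsilon>)"
          using dd norm_triangle_ineq2[of "Lc \<phi> 1" "Lc \<phi> (Complex 1 t)"] by (simp add: norm_minus_commute)
        moreover have "c * \<tau> powr (-6 * \<epsilon>) \<le> cs / 2 * real q powr (-\<epsilon>)"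
        proof (intro mult_mono)
          have "\<tau> powr (-6 * \<epsilon>) \<le> \<tau> powr (-\<epsilon>)" using \<epsilon> by (intro mono) auto
          also have "\<dots> \<le> real q powr (-\<epsilon>)" using \<epsilon> \<tau> q by (intro powr_mono2') auto
          finally show "\<tau> powr (-6 * \<epsilon>) \<le> real q powr (-\<epsilon>)" .
        next
          show "c \<le> cs / 2" unfolding c_def by (rule min.cobounded2)
        qed (use cs in auto)
        ultimately show ?thesis by linarith
      qed
    qed
    thus "norm (Lc \<phi> (Complex 1 t)) \<ge> c * (real q * (\<bar>t\<bar> + 2)) powr (-6 * \<epsilon>)" unfolding \<tau>_def .
  qed
qed

text \<open>The disc for Cauchy's estimate must avoid the pole, so its radius shrinks with |t|. This
  gives one factor 1 + 1/|t|, the size of zeta gives the other.\<close>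

lemma zeta_deriv_upper:
  assumes \<epsilon>: "0 < \<epsilon>" "\<epsilon> \<le> 1"
  obtains C where "C \<ge> 1" "\<And>\<sigma> t. t \<noteq> 0 \<Longrightarrow> 1 \<le> \<sigma> \<Longrightarrow> \<sigma> \<le> 2 \<Longrightarrow>
     norm (deriv zeta (Complex \<sigma> t)) \<le> C * (\<bar>t\<bar> + 2) powr \<epsilon> * (1 + 1 / \<bar>t\<bar>) ^ 2"
proof -
  obtain C where C: "C \<ge> 1" "\<And>s. s \<noteq> 1 \<Longrightarrow> 1 - \<epsilon>/8 \<le> Re s \<Longrightarrow> Re s \<le> 4 \<Longrightarrow>
     norm (zeta s) \<le> C * (\<bar>Im s\<bar> + 2) powr \<epsilon> * (1 + 1 / norm (s - 1))"
    using zeta_upper[OF \<epsilon>] by blast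
  define K where "K = 2 * (C * 2 * 2) * (8 / \<epsilon> + 2)"
  show ?thesis
  proof (rule that[of "max 1 K"])
    fix \<sigma> t :: real assume t: "t \<noteq> 0" and \<sigma>: "1 \<le> \<sigma>" "\<sigma> \<le> 2"
    define r where "r = min (\<epsilon>/8) (\<bar>t\<bar>/2)"
    have r: "r > 0" "r \<le> \<epsilon>/8" "r \<le> \<bar>t\<bar>/2" using \<epsilon> t by (auto simp: r_def)
    define X where "X = (\<bar>t\<bar> + 2) powr \<epsilon>"
    define Y where "Y = 1 + 1 / \<bar>t\<bar>"
    have Y: "Y \<ge> 1" using t by (simp add: Y_def)
    have zr: "\<bar>Im z - t\<bar> < r" "\<bar>Re z - \<sigma>\<bar> < r" "norm (z - 1) \<ge> \<bar>t\<bar>/2" "z \<noteq> 1"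
      if "z \<in> ball (Complex \<sigma> t) r" for z
    proof -
      note z = Complex_ball_Re_Im[OF that]
      show "\<bar>Im z - t\<bar> < r" "\<bar>Re z - \<sigma>\<bar> < r" by fact+
      have "\<bar>Im (z - 1)\<bar> \<ge> \<bar>t\<bar>/2" using z(2) r(3) by simp
      thus "norm (z - 1) \<ge> \<bar>t\<bar>/2" using abs_Im_le_cmod[of "z - 1"] by linarith
      thus "z \<noteq> 1" using t by auto
    qed
    have "norm (deriv zeta (Complex \<sigma> t)) \<le> 2 * (C * (2 * X) * (2 * Y)) / r"
    proof (rule deriv_bound)
      show "zeta holomorphic_on ball (Complex \<sigma> t) r"
      proof (rule holomorphic_on_subset[OF zeta_holomorphic], safe)
        fix z assume z: "z \<in> ball (Complex \<sigma> t) r"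
        show "Re z > 0" using zr(2)[OF z] \<sigma> r \<epsilon> by linarith
      qed (use zr(4) in auto)
      fix z assume z: "z \<in> ball (Complex \<sigma> t) r"
      have "norm (zeta z) \<le> C * (\<bar>Im z\<bar> + 2) powr \<epsilon> * (1 + 1 / norm (z - 1))"
      proof (rule C(2)[OF zr(4)[OF z]])
        show "1 - \<epsilon>/8 \<le> Re z" "Re z \<le> 4" using zr(2)[OF z] \<sigma> r \<epsilon> by linarith+
      qed
      also have "\<dots> \<le> C * (2 * X) * (2 * Y)"
      proof (intro mult_mono mult_left_mono mult_nonneg_nonneg)
        show "(\<bar>Im z\<bar> + 2) powr \<epsilon> \<le> 2 * X"
          unfolding X_def
        proof (rule double_powr_le[OF \<epsilon>])
          show "0 \<le> \<bar>Im z\<bar> + 2" "\<bar>Im z\<bar> + 2 \<le> 2 * (\<bar>t\<bar> + 2)"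
            using zr(1)[OF z] r \<epsilon> abs_triangle_ineq[of "Im z - t" t] by auto
        qed
        have "1 / norm (z - 1) \<le> 1 / (\<bar>t\<bar>/2)" using zr(3)[OF z] t by (intro divide_left_mono mult_pos_pos) auto
        thus "1 + 1 / norm (z - 1) \<le> 2 * Y" by (simp add: Y_def)
      qed (use C in \<open>auto simp: X_def\<close>)
      finally show "norm (zeta z) \<le> C * (2 * X) * (2 * Y)" .
    qed (use r in auto)
    also have "\<dots> = 2 * (C * 2 * 2) * X * Y * (1 / r)" by simp
    also have "\<dots> \<le> 2 * (C * 2 * 2) * X * Y * ((8 / \<epsilon> + 2) * Y)"
    proof (intro mult_left_mono mult_nonneg_nonneg)
      have "1 / r \<le> 8 / \<epsilon> + 2 / \<bar>t\<bar>" using \<epsilon> t by (auto simp: r_def min_def field_simps)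
      also have "\<dots> \<le> (8 / \<epsilon> + 2) * Y" using \<epsilon> t by (simp add: Y_def field_simps)
      finally show "1 / r \<le> (8 / \<epsilon> + 2) * Y" .
    qed (use C Y in \<open>auto simp: X_def\<close>)
    also have "\<dots> = K * (X * Y ^ 2)" by (simp add: K_def power2_eq_square mult_ac)
    also have "\<dots> \<le> max 1 K * (X * Y ^ 2)" by (intro mult_right_mono) (auto simp: X_def)
    finally show "norm (deriv zeta (Complex \<sigma> t)) \<le> max 1 K * (\<bar>t\<bar> + 2) powr \<epsilon> * (1 + 1 / \<bar>t\<bar>) ^ 2"
      by (simp add: X_def Y_def mult_ac)
  qed auto
qed

text \<open>In \<open>lower_from_341\<close> V carries one factor 1 + 1/|t| and U carries two, so V
  U^3 carries seven.\<close>

lemma zeta_lower: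
  assumes \<epsilon>: "0 < \<epsilon>" "\<epsilon> \<le> 1"
  obtains c where "c > 0" "\<And>t. t \<noteq> 0 \<Longrightarrow>
     norm (zeta (Complex 1 t)) * (1 + 1 / \<bar>t\<bar>) ^ 7 \<ge> c * (\<bar>t\<bar> + 2) powr (-6 * \<epsilon>)"
proof -
  obtain C1 where C1: "C1 \<ge> 1" "\<And>s. s \<noteq> 1 \<Longrightarrow> 1 - \<epsilon>/8 \<le> Re s \<Longrightarrow> Re s \<le> 4 \<Longrightarrow>
     norm (zeta s) \<le> C1 * (\<bar>Im s\<bar> + 2) powr \<epsilon> * (1 + 1 / norm (s - 1))"
    using zeta_upper[OF \<epsilon>] by blast
  obtain C2 where C2: "C2 \<ge> 1" "\<And>\<sigma> t. t \<noteq> 0 \<Longrightarrow> 1 \<le> \<sigma> \<Longrightarrow> \<sigma> \<le> 2 \<Longrightarrow>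
     norm (deriv zeta (Complex \<sigma> t)) \<le> C2 * (\<bar>t\<bar> + 2) powr \<epsilon> * (1 + 1 / \<bar>t\<bar>) ^ 2"
    using zeta_deriv_upper[OF \<epsilon>] by blast
  obtain c0 where c0: "c0 > 0" "\<And>f LF U V t. cmult_fun f \<Longrightarrow> U \<ge> 1 \<Longrightarrow> V \<ge> 1 \<Longrightarrow>
    (\<And>\<sigma>. 1 \<le> \<sigma> \<Longrightarrow> \<sigma> \<le> 2 \<Longrightarrow> LF field_differentiable (at (Complex \<sigma> t))) \<Longrightarrow>
    (\<And>\<sigma>. 1 \<le> \<sigma> \<Longrightarrow> \<sigma> \<le> 2 \<Longrightarrow> norm (deriv LF (Complex \<sigma> t)) \<le> U) \<Longrightarrow>
    (\<And>\<sigma>. 1 < \<sigma> \<Longrightarrow> \<sigma> \<le> 2 \<Longrightarrow> LF (Complex \<sigma> t) = DS f (Complex \<sigma> t)) \<Longrightarrow>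
    (\<And>\<sigma>. 1 < \<sigma> \<Longrightarrow> \<sigma> \<le> 2 \<Longrightarrow> norm (DS (\<lambda>n. f n * f n) (Complex \<sigma> (2 * t))) \<le> V) \<Longrightarrow>
    norm (LF (Complex 1 t)) \<ge> c0 / (V * U ^ 3)"
    using lower_from_341 by blast
  show ?thesis
  proof (rule that[of "c0 / (2 * C1 * C2 ^ 3)"])
    show "c0 / (2 * C1 * C2 ^ 3) > 0" using c0 C1 C2 by simp
    fix t :: real assume t: "t \<noteq> 0"
    define \<tau> where "\<tau> = \<bar>t\<bar> + 2"
    have \<tau>: "\<tau> \<ge> 1" by (simp add: \<tau>_def)
    have mono: "\<tau> powr a \<le> \<tau> powr b" if "a \<le> b" for a b using that \<tau> by (intro powr_mono) auto
    define Y where "Y = 1 + 1 / \<bar>t\<bar>"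
    have Y: "Y \<ge> 1" using t by (simp add: Y_def)
    have t1: "\<tau> powr (3 * \<epsilon>) \<ge> 1" "\<tau> powr \<epsilon> \<ge> 1" using \<tau> \<epsilon> by (auto intro!: ge_one_powr_ge_zero)
    define U where "U = C2 * \<tau> powr \<epsilon> * Y ^ 2"
    define V where "V = 2 * C1 * \<tau> powr (3 * \<epsilon>) * Y"
    have "1 * 1 * 1 \<le> U" unfolding U_def using C2 t1 Y by (intro mult_mono) auto
    hence U1: "U \<ge> 1" by simp
    have "1 * 1 * 1 \<le> V" unfolding V_def using C1 t1 Y by (intro mult_mono) auto
    hence V1: "V \<ge> 1" by simp
    have "c0 / (V * U ^ 3) \<le> norm (zeta (Complex 1 t))"
    proof (rule c0(2)[OF cmult_fun_1 U1 V1])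
      fix \<sigma> :: real
      show "zeta field_differentiable (at (Complex \<sigma> t))" if "1 \<le> \<sigma>"
        using that t by (intro holomorphic_on_imp_differentiable_at[OF zeta_holomorphic])
          (auto intro!: open_Diff open_halfspace_Re_gt simp: complex_eq_iff)
      show "norm (deriv zeta (Complex \<sigma> t)) \<le> U" if "1 \<le> \<sigma>" "\<sigma> \<le> 2"
        unfolding U_def \<tau>_def Y_def using that t by (intro C2(2)) auto
      show "zeta (Complex \<sigma> t) = DS (\<lambda>_. 1) (Complex \<sigma> t)" if "1 < \<sigma>"
        using that by (intro zeta_eq_DS) auto
      show "norm (DS (\<lambda>n. 1 * 1) (Complex \<sigma> (2 * t))) \<le> V" if \<sigma>: "1 < \<sigma>" "\<sigma> \<le> 2"
      proof -
        have n: "\<bar>t\<bar> \<le> norm (Complex \<sigma> (2 * t) - 1)"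
          using abs_Im_le_cmod[of "Complex \<sigma> (2 * t) - 1"] by simp
        have "norm (DS (\<lambda>n. 1 * 1) (Complex \<sigma> (2 * t))) = norm (zeta (Complex \<sigma> (2 * t)))"
          using \<sigma> by (simp add: zeta_eq_DS)
        also have "\<dots> \<le> C1 * (\<bar>Im (Complex \<sigma> (2 * t))\<bar> + 2) powr \<epsilon> * (1 + 1 / norm (Complex \<sigma> (2 * t) - 1))"
          using \<sigma> \<epsilon> t by (intro C1(2)) (auto simp: complex_eq_iff)
        also have "\<dots> \<le> C1 * (2 * \<tau> powr \<epsilon>) * Y"
        proof (intro mult_mono mult_left_mono mult_nonneg_nonneg)
          show "(\<bar>Im (Complex \<sigma> (2 * t))\<bar> + 2) powr \<epsilon> \<le> 2 * \<tau> powr \<epsilon>"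
            by (rule double_powr_le[OF \<epsilon>]) (auto simp: \<tau>_def)
          have "1 / norm (Complex \<sigma> (2 * t) - 1) \<le> 1 / \<bar>t\<bar>" using n t by (intro divide_left_mono mult_pos_pos) auto
          thus "1 + 1 / norm (Complex \<sigma> (2 * t) - 1) \<le> Y" by (simp add: Y_def)
        qed (use C1 in auto)
        also have "\<dots> = 2 * C1 * \<tau> powr \<epsilon> * Y" by simp
        also have "\<dots> \<le> V" unfolding V_def using C1 Y \<epsilon> by (intro mult_right_mono mult_left_mono mono) auto
        finally show ?thesis .
      qed
    qed
    hence "c0 \<le> norm (zeta (Complex 1 t)) * (V * U ^ 3)" using U1 V1 by (simp add: pos_divide_le_eq)
    also have "V * U ^ 3 = (2 * C1 * C2 ^ 3) * Y ^ 7 * (\<tau> powr (3 * \<epsilon>) * (\<tau> powr \<epsilon>) ^ 3)"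
      unfolding U_def V_def by (simp add: power_mult_distrib eval_nat_numeral mult_ac)
    also have "(\<tau> powr \<epsilon>) ^ 3 = \<tau> powr (3 * \<epsilon>)" using \<tau> by (simp add: powr_power mult.commute)
    also have "\<tau> powr (3 * \<epsilon>) * \<tau> powr (3 * \<epsilon>) = \<tau> powr (6 * \<epsilon>)" by (simp add: powr_add[symmetric])
    finally have "c0 * \<tau> powr (-6 * \<epsilon>) \<le> norm (zeta (Complex 1 t)) * ((2 * C1 * C2 ^ 3) * Y ^ 7 * \<tau> powr (6 * \<epsilon>)) * \<tau> powr (-6 * \<epsilon>)"
      by (intro mult_right_mono) auto
    also have "\<dots> = norm (zeta (Complex 1 t)) * Y ^ 7 * (2 * C1 * C2 ^ 3) * (\<tau> powr (6 * \<epsilon>) * \<tau> powr (-6 * \<epsilon>))"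
      by (simp only: mult_ac)
    also have "\<tau> powr (6 * \<epsilon>) * \<tau> powr (-6 * \<epsilon>) = 1" using \<tau> by (simp add: powr_add[symmetric])
    finally have "c0 / (2 * C1 * C2 ^ 3) * \<tau> powr (-6 * \<epsilon>) \<le> norm (zeta (Complex 1 t)) * Y ^ 7"
      using C1 C2 by (simp add: field_simps)
    thus "norm (zeta (Complex 1 t)) * (1 + 1 / \<bar>t\<bar>) ^ 7 \<ge> c0 / (2 * C1 * C2 ^ 3) * (\<bar>t\<bar> + 2) powr (-6 * \<epsilon>)"
      unfolding Y_def \<tau>_def .
  qed
qed

lemma zetaF_nonzero_line: "zetaF (Complex 1 t) \<noteq> 0"
proof (cases "t = 0")
  case True
  thus ?thesis using zetaF_1 by (simp add: one_complex.code[symmetric])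
next
  case False
  obtain c where c: "c > 0" "\<And>t. t \<noteq> 0 \<Longrightarrow>
     norm (zeta (Complex 1 t)) * (1 + 1 / \<bar>t\<bar>) ^ 7 \<ge> c * (\<bar>t\<bar> + 2) powr (-6 * 1)"
    using zeta_lower[of 1] by auto
  have "c * (\<bar>t\<bar> + 2) powr (-6 * 1) > 0" using c by simp
  hence "norm (zeta (Complex 1 t)) * (1 + 1 / \<bar>t\<bar>) ^ 7 > 0" using c(2)[OF False] by linarith
  hence "zeta (Complex 1 t) \<noteq> 0" by auto
  thus ?thesis by (auto simp: zeta_def)
qed

text \<open>Near s0 the derivative is at most 4U/\<rho>, so within twice the radius l\<rho>/(16U)
  the function changes by at most l/2 and stays at least l/2. There f'/f is bounded, and Cauchy's
  estimate controls its derivatives.\<close>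

lemma logderiv_bound:
  assumes hol: "f holomorphic_on ball s0 \<rho>" and \<rho>: "\<rho> > 0" and U: "\<And>z. z \<in> ball s0 \<rho> \<Longrightarrow> norm (f z) \<le> U"
    and l: "l > 0" "norm (f s0) \<ge> l" and s: "s \<in> cball s0 (l * \<rho> / (16 * U))"
  shows "norm ((deriv ^^ k) (\<lambda>z. deriv f z / f z) s) \<le> fact k * (32 * U / (l * \<rho>)) ^ (k + 1)"
proof -
  have Ul: "U \<ge> l" using U[of s0] l \<rho> by simp
  hence U0: "U > 0" using l by simp
  define r where "r = l * \<rho> / (16 * U)"
  have r: "r > 0" using l \<rho> U0 by (simp add: r_def)
  have "l * \<rho> \<le> U * \<rho>" using Ul \<rho> by (intro mult_right_mono) auto
  hence r16: "r \<le> \<rho> / 16" using U0 by (simp add: r_def field_simps)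
  have sub: "ball s0 (2 * r) \<subseteq> ball s0 \<rho>" using r16 \<rho> by (intro subset_ball) auto
  have dU: "norm (deriv f z) \<le> 4 * U / \<rho>" if "z \<in> ball s0 (2 * r)" for z
  proof -
    have sb: "ball z (\<rho>/2) \<subseteq> ball s0 \<rho>"
    proof
      fix w assume "w \<in> ball z (\<rho>/2)"
      thus "w \<in> ball s0 \<rho>" using that r16 \<rho> dist_triangle[of s0 w z] by auto
    qed
    have "norm (deriv f z) \<le> 2 * U / (\<rho>/2)"
      by (rule deriv_bound[OF holomorphic_on_subset[OF hol sb]]) (use U sb \<rho> in auto)
    thus ?thesis by simp
  qed
  have low: "norm (f z) \<ge> l / 2" if z: "z \<in> ball s0 (2 * r)" for z
  proof -
    have "norm (f z - f s0) \<le> 4 * U / \<rho> * norm (z - s0)"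
    proof (rule field_differentiable_bound[where S = "ball s0 (2 * r)" and f' = "deriv f"])
      fix w assume w: "w \<in> ball s0 (2 * r)"
      hence "(f has_field_derivative deriv f w) (at w)"
        using hol sub holomorphic_derivI[OF hol open_ball, of w] by auto
      thus "(f has_field_derivative deriv f w) (at w within ball s0 (2 * r))" by (rule has_field_derivative_at_within)
      show "norm (deriv f w) \<le> 4 * U / \<rho>" by (rule dU[OF w])
    qed (use z r in auto)
    also have "\<dots> \<le> 4 * U / \<rho> * (2 * r)"
      using z U0 \<rho> by (intro mult_left_mono) (auto simp: dist_norm norm_minus_commute)
    also have "\<dots> = l / 2" using U0 \<rho> by (simp add: r_def)
    finally show ?thesis using l norm_triangle_ineq2[of "f s0" "f z"] by (simp add: norm_minus_commute)
  qed
  have sb: "ball s r \<subseteq> ball s0 (2 * r)"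
  proof
    fix w assume "w \<in> ball s r"
    thus "w \<in> ball s0 (2 * r)" using s dist_triangle[of s0 w s] by (auto simp: r_def[symmetric])
  qed
  have "norm ((deriv ^^ k) (\<lambda>z. deriv f z / f z) s) \<le> fact k * (8 * U / (l * \<rho>)) * (2 / r) ^ k"
  proof (rule higher_deriv_bound[OF _ r])
    have "f holomorphic_on ball s0 (2 * r)" by (rule holomorphic_on_subset[OF hol sub])
    hence "(\<lambda>z. deriv f z / f z) holomorphic_on ball s0 (2 * r)"
      using low l by (intro holomorphic_intros holomorphic_deriv) force+
    thus "(\<lambda>z. deriv f z / f z) holomorphic_on ball s r" by (rule holomorphic_on_subset[OF _ sb])
    fix z assume "z \<in> ball s r"
    hence z: "z \<in> ball s0 (2 * r)" using sb by blast
    have "norm (deriv f z / f z) \<le> (4 * U / \<rho>) / (l / 2)"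
      unfolding norm_divide using dU[OF z] low[OF z] l U0 \<rho> by (intro frac_le) auto
    thus "norm (deriv f z / f z) \<le> 8 * U / (l * \<rho>)" by (simp add: field_simps)
  qed
  also have "2 / r = 32 * U / (l * \<rho>)" using U0 l \<rho> by (simp add: r_def field_simps)
  also have "fact k * (8 * U / (l * \<rho>)) * (32 * U / (l * \<rho>)) ^ k \<le> fact k * (32 * U / (l * \<rho>)) * (32 * U / (l * \<rho>)) ^ k"
    using U0 l \<rho> by (intro mult_right_mono mult_left_mono divide_right_mono) auto
  finally show ?thesis by (simp add: mult.assoc)
qed

lemma DS_nonzero: "cmult_fun f \<Longrightarrow> Re s > 1 \<Longrightarrow> DS f s \<noteq> 0"
  using DS_eq_exp_logc by simp

lemma logderiv_DS_1:
  assumes f: "cmult_fun f" and s: "Re s > 1"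
  shows "deriv (DS f) s / DS f s = - DS (\<lambda>n. f n * mangoldt n) s"
proof -
  have af: "abs_conv f" by (rule cmult_fun_abs_conv[OF f])
  have "deriv (DS f) s = DS (\<lambda>n. - (of_real (ln (real n)) * f n)) s"
    by (rule DERIV_imp_deriv[OF DS_deriv[OF af s]])
  also have "\<dots> = - (DS (\<lambda>n. f n * mangoldt n) s * DS f s)"
    using DS_mangoldt_mult[OF f s] DS_uminus[OF abs_conv_ln[OF af] s] by simp
  finally show ?thesis using DS_nonzero[OF f s] by simp
qed

lemma logderiv_DS:
  assumes f: "cmult_fun f" and s: "Re s > 1"
  shows "(deriv ^^ k) (\<lambda>z. deriv (DS f) z / DS f z) s =
     - ((-1) ^ k * DS (\<lambda>n. of_real (ln (real n)) ^ k * (f n * mangoldt n)) s)"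
proof -
  define S where "S = {s. Re s > 1}"
  have op: "open S" unfolding S_def by (rule open_halfspace_Re_gt)
  have af: "abs_conv f" by (rule cmult_fun_abs_conv[OF f])
  have am: "abs_conv (\<lambda>n. f n * mangoldt n)" by (rule abs_conv_mangoldt[of _ 1]) (use f in \<open>auto simp: cmult_fun_def\<close>)
  have hf: "DS f holomorphic_on S" unfolding S_def by (rule DS_holomorphic[OF af])
  have hm: "DS (\<lambda>n. f n * mangoldt n) holomorphic_on S" unfolding S_def by (rule DS_holomorphic[OF am])
  have "(deriv ^^ k) (\<lambda>z. deriv (DS f) z / DS f z) s = (deriv ^^ k) (\<lambda>z. - DS (\<lambda>n. f n * mangoldt n) z) s"
  proof (rule higher_deriv_transform_within_open[OF _ _ op])
    show "(\<lambda>z. deriv (DS f) z / DS f z) holomorphic_on S"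
      using DS_nonzero[OF f] by (intro holomorphic_intros holomorphic_deriv hf op) (auto simp: S_def)
    show "(\<lambda>z. - DS (\<lambda>n. f n * mangoldt n) z) holomorphic_on S" by (intro holomorphic_intros hm)
    show "s \<in> S" using s by (simp add: S_def)
  qed (use logderiv_DS_1[OF f] in \<open>auto simp: S_def\<close>)
  also have "\<dots> = - (deriv ^^ k) (DS (\<lambda>n. f n * mangoldt n)) s"
    by (rule higher_deriv_uminus[OF hm op]) (use s in \<open>simp add: S_def\<close>)
  finally show ?thesis by (simp add: DS_higher_deriv[OF am s])
qed

text \<open>With 2x = Re s - 1, log^K n is at most a constant times x^(-K) n^x, and the remaining
  series is O(1/x).\<close>

lemma DS_crude_bound:
  obtains C where "C \<ge> 0" "\<And>a s. (\<And>n. norm (a n) \<le> ln (real n) ^ K) \<Longrightarrow> 1 < Re s \<Longrightarrow> Re s \<le> 2 \<Longrightarrow>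
     norm (DS a s) \<le> C / (Re s - 1) ^ (K + 1)"
proof -
  obtain C0 where C0: "C0 > 0" "\<And>x. 0 < x \<Longrightarrow> x \<le> 1 \<Longrightarrow> (\<Sum>n. real n powr (-x-1)) \<le> C0 / x"
    using zeta_real_bound by blast
  \<comment> \<open>The maximum keeps \<alpha> = x/K' positive when K = 0.\<close>
  define K' where "K' = real (max K 1)"
  have K': "K' \<ge> 1" "real K \<le> K'" by (auto simp: K'_def)
  show ?thesis
  proof (rule that[of "K' ^ K * C0 * 2 ^ (K + 1)"])
    show "K' ^ K * C0 * 2 ^ (K + 1) \<ge> 0" using K' C0 by simp
    fix a :: "nat \<Rightarrow> complex" and s :: complex
    assume a: "\<And>n. norm (a n) \<le> ln (real n) ^ K" and s: "1 < Re s" "Re s \<le> 2"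
    define x where "x = (Re s - 1) / 2"
    have x: "0 < x" "x \<le> 1" "Re s = 1 + 2 * x" using s by (auto simp: x_def field_simps)
    define \<alpha> where "\<alpha> = x / K'"
    have \<alpha>: "\<alpha> > 0" "\<alpha> * real K \<le> x" using x K' by (auto simp: \<alpha>_def field_simps)
    have ac: "abs_conv a"
      using abs_conv_ln_power[OF abs_conv_1, of K]
    proof (rule abs_conv_le[of _ _ 1])
      fix n
      show "norm (a n) \<le> 1 * norm (of_real (ln (real n)) ^ K * (1 :: complex))"
        using a[of n] by (cases "n = 0") (auto simp: norm_power)
    qed
    have sm: "summable (\<lambda>n. real n powr (-x-1))" by (rule summable_powr_shift[OF x(1)])
    have le: "norm (a n) * real n powr (- Re s) \<le> (1 / \<alpha>) ^ K * real n powr (-x-1)" for n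
    proof (cases "n = 0")
      case False
      have "norm (a n) \<le> ln (real n) ^ K" by (rule a)
      also have "\<dots> \<le> (real n powr \<alpha> / \<alpha>) ^ K"
        using False \<alpha> by (intro power_mono ln_le_powr) auto
      also have "\<dots> = (1 / \<alpha>) ^ K * (real n powr \<alpha>) ^ K" by (simp add: power_divide)
      also have "(real n powr \<alpha>) ^ K = real n powr (\<alpha> * real K)" using False by (simp add: powr_power mult.commute)
      also have "\<dots> \<le> real n powr x" using False \<alpha> by (intro powr_mono) auto
      finally have "norm (a n) \<le> (1 / \<alpha>) ^ K * real n powr x" using \<alpha> by (simp add: mult_left_mono)
      hence "norm (a n) * real n powr (- Re s) \<le> (1 / \<alpha>) ^ K * real n powr x * real n powr (- Re s)"
        by (intro mult_right_mono) auto
      also have "\<dots> = (1 / \<alpha>) ^ K * (real n powr x * real n powr (- Re s))" by simp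
      also have "real n powr x * real n powr (- Re s) = real n powr (-x-1)"
        by (simp add: powr_add[symmetric] x)
      finally show ?thesis .
    qed auto
    have "norm (DS a s) \<le> (\<Sum>n. norm (a n) * real n powr (- Re s))" by (rule norm_DS_le[OF ac s(1)])
    also have "\<dots> \<le> (\<Sum>n. (1 / \<alpha>) ^ K * real n powr (-x-1))"
    proof (rule suminf_le[OF le _ summable_mult[OF sm]])
      show "summable (\<lambda>n. norm (a n) * real n powr (- Re s))" using ac s unfolding abs_conv_def by blast
    qed
    also have "\<dots> = (1 / \<alpha>) ^ K * (\<Sum>n. real n powr (-x-1))" by (rule suminf_mult[OF sm])
    also have "\<dots> \<le> (1 / \<alpha>) ^ K * (C0 / x)" using C0(2)[OF x(1,2)] \<alpha> by (intro mult_left_mono) auto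
    also have "1 / \<alpha> = K' / x" by (simp add: \<alpha>_def)
    also have "(K' / x) ^ K * (C0 / x) = K' ^ K * C0 * (1 / x ^ (K + 1))" by (simp add: power_divide)
    also have "1 / x ^ (K + 1) = 2 ^ (K + 1) / (Re s - 1) ^ (K + 1)" by (simp add: x_def power_divide)
    also have "K' ^ K * C0 * (2 ^ (K + 1) / (Re s - 1) ^ (K + 1)) = K' ^ K * C0 * 2 ^ (K + 1) / (Re s - 1) ^ (K + 1)"
      by (simp only: times_divide_eq_right)
    finally show "norm (DS a s) \<le> K' ^ K * C0 * 2 ^ (K + 1) / (Re s - 1) ^ (K + 1)" .
  qed
qed

lemma norm_ln_mangoldt_le:
  assumes "norm (f n) \<le> 1"
  shows "norm (of_real (ln (real n)) ^ k * (f n * mangoldt n) :: complex) \<le> ln (real n) ^ (k + 1)"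
proof (cases "n = 0")
  case False
  have "mangoldt n \<le> ln (real n)" using False by (intro mangoldt_le) auto
  hence "norm (f n) * mangoldt n \<le> 1 * ln (real n)"
    using assms mangoldt_nonneg by (intro mult_mono) auto
  hence "ln (real n) ^ k * (norm (f n) * mangoldt n) \<le> ln (real n) ^ k * ln (real n)"
    using False by (intro mult_left_mono) auto
  thus ?thesis using False by (simp add: norm_mult norm_power mult.commute)
qed auto

text \<open>Put r = l\<rho>/(16U), of order \<tau>^(-7\<epsilon>). Up to distance r from Re s = 1,
  \<open>logderiv_bound\<close> centred at 1 + it applies; farther away the crude bound costs at
  most r^(-k-2). Both are powers of \<tau>^(7\<epsilon>), where 7 = 1 + 6 combines the upper and the
  lower bound for L.\<close>

lemma mangoldt_DS_bound:
  assumes \<rho>: "\<rho> > 0" and C1: "C1 > 0" and c1: "c1 > 0"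
  obtains C where "C \<ge> 0" "\<And>f LF t \<tau> \<epsilon> \<sigma>. cmult_fun f \<Longrightarrow> \<tau> \<ge> 1 \<Longrightarrow> \<epsilon> \<ge> 0 \<Longrightarrow>
     LF holomorphic_on ball (Complex 1 t) \<rho> \<Longrightarrow>
     (\<And>z. z \<in> ball (Complex 1 t) \<rho> \<Longrightarrow> Re z > 1 \<Longrightarrow> LF z = DS f z) \<Longrightarrow>
     (\<And>z. z \<in> ball (Complex 1 t) \<rho> \<Longrightarrow> norm (LF z) \<le> C1 * \<tau> powr \<epsilon>) \<Longrightarrow>
     norm (LF (Complex 1 t)) \<ge> c1 * \<tau> powr (-6 * \<epsilon>) \<Longrightarrow> 1 < \<sigma> \<Longrightarrow> \<sigma> \<le> 2 \<Longrightarrow>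
     norm (DS (\<lambda>n. of_real (ln (real n)) ^ k * (f n * mangoldt n)) (Complex \<sigma> t)) \<le> C * \<tau> powr (7 * \<epsilon> * real (k + 2))"
proof -
  obtain C0 where C0: "C0 \<ge> 0" "\<And>a s. (\<And>n. norm (a n) \<le> ln (real n) ^ (k+1)) \<Longrightarrow> 1 < Re s \<Longrightarrow> Re s \<le> 2 \<Longrightarrow>
     norm (DS a s) \<le> C0 / (Re s - 1) ^ ((k+1) + 1)"
    using DS_crude_bound[of "k+1"] by blast
  define A where "A = 16 * C1 / (c1 * \<rho>)"
  have A: "A > 0" using C1 c1 \<rho> by (simp add: A_def)
  define C where "C = max (fact k * (2 * A) ^ (k + 1)) (C0 * A ^ (k + 2))"
  show ?thesis
  proof (rule that[of C])
    show "C \<ge> 0" using C0 A by (simp add: C_def max_def)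
    fix f LF and t \<tau> \<epsilon> \<sigma> :: real
    assume f: "cmult_fun f" and \<tau>: "\<tau> \<ge> 1" and \<epsilon>: "\<epsilon> \<ge> 0" and hol: "LF holomorphic_on ball (Complex 1 t) \<rho>"
      and eq: "\<And>z. z \<in> ball (Complex 1 t) \<rho> \<Longrightarrow> Re z > 1 \<Longrightarrow> LF z = DS f z"
      and up: "\<And>z. z \<in> ball (Complex 1 t) \<rho> \<Longrightarrow> norm (LF z) \<le> C1 * \<tau> powr \<epsilon>"
      and lo: "norm (LF (Complex 1 t)) \<ge> c1 * \<tau> powr (-6 * \<epsilon>)" and \<sigma>: "1 < \<sigma>" "\<sigma> \<le> 2"
    define U l where "U = C1 * \<tau> powr \<epsilon>" and "l = c1 * \<tau> powr (-6 * \<epsilon>)"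
    have Ul: "U > 0" "l > 0" using C1 c1 \<tau> by (auto simp: U_def l_def)
    have rat: "16 * U / (l * \<rho>) = A * \<tau> powr (7 * \<epsilon>)"
    proof -
      have "\<tau> powr \<epsilon> = \<tau> powr (7 * \<epsilon>) * \<tau> powr (-6 * \<epsilon>)" by (simp add: powr_add[symmetric])
      hence "16 * U / (l * \<rho>) = 16 * C1 * (\<tau> powr (7 * \<epsilon>) * \<tau> powr (-6 * \<epsilon>)) / (c1 * \<tau> powr (-6 * \<epsilon>) * \<rho>)"
        unfolding U_def l_def by simp
      thus ?thesis using \<tau> by (simp add: A_def)
    qed
    define r where "r = l * \<rho> / (16 * U)"
    have r: "1 / r = A * \<tau> powr (7 * \<epsilon>)" "r > 0" using rat Ul \<rho> by (auto simp: r_def)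
    have \<tau>7: "(\<tau> powr (7 * \<epsilon>)) ^ n = \<tau> powr (7 * \<epsilon> * real n)" for n using \<tau> by (simp add: powr_power mult.commute)
    define s where "s = Complex \<sigma> t"
    have s1: "Re s > 1" using \<sigma> by (simp add: s_def)
    define G where "G = DS (\<lambda>n. of_real (ln (real n)) ^ k * (f n * mangoldt n)) s"
    have "norm G \<le> C * \<tau> powr (7 * \<epsilon> * real (k + 2))"
    proof (cases "\<sigma> \<le> 1 + r")
      case True
      have ds: "dist (Complex 1 t) s = \<sigma> - 1" using \<sigma> by (simp add: s_def dist_norm cmod_def)
      have scb: "s \<in> cball (Complex 1 t) (l * \<rho> / (16 * U))" using True ds unfolding r_def[symmetric] by simp
      have "l \<le> U" using up[of "Complex 1 t"] lo \<rho> by (simp add: U_def l_def)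
      hence "l * \<rho> \<le> U * \<rho>" using \<rho> by (intro mult_right_mono) auto
      hence "r < \<rho>" using Ul \<rho> unfolding r_def by (auto simp: field_simps intro: le_less_trans)
      hence sb: "s \<in> ball (Complex 1 t) \<rho>" using True ds by simp
      define S where "S = {z. Re z > 1} \<inter> ball (Complex 1 t) \<rho>"
      have op: "open S" unfolding S_def by (intro open_Int open_halfspace_Re_gt open_ball)
      have hL: "LF holomorphic_on S" by (rule holomorphic_on_subset[OF hol]) (auto simp: S_def)
      have hD: "DS f holomorphic_on S"
        by (rule holomorphic_on_subset[OF DS_holomorphic[OF cmult_fun_abs_conv[OF f]]]) (auto simp: S_def)
      have nz: "DS f z \<noteq> 0" "LF z = DS f z" if "z \<in> S" for z
        using that DS_nonzero[OF f] eq by (auto simp: S_def)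
      have dq: "deriv LF z = deriv (DS f) z" if "z \<in> S" for z
        by (rule complex_derivative_transform_within_open[OF hL hD op that nz(2)])
      have "(deriv ^^ k) (\<lambda>z. deriv LF z / LF z) s = (deriv ^^ k) (\<lambda>z. deriv (DS f) z / DS f z) s"
      proof (rule higher_deriv_transform_within_open[OF _ _ op])
        show "(\<lambda>z. deriv LF z / LF z) holomorphic_on S"
          using nz by (intro holomorphic_intros holomorphic_deriv hL op) auto
        show "(\<lambda>z. deriv (DS f) z / DS f z) holomorphic_on S"
          using nz by (intro holomorphic_intros holomorphic_deriv hD op) auto
        show "s \<in> S" using sb s1 by (simp add: S_def)
      qed (use dq nz(2) in auto)
      also have "\<dots> = - ((-1) ^ k * G)" unfolding G_def by (rule logderiv_DS[OF f s1])
      finally have "norm G = norm ((deriv ^^ k) (\<lambda>z. deriv LF z / LF z) s)"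
        by (simp add: norm_mult norm_power)
      also have "\<dots> \<le> fact k * (32 * U / (l * \<rho>)) ^ (k + 1)"
        by (rule logderiv_bound[OF hol \<rho> _ Ul(2) _ scb]) (use up lo in \<open>auto simp: U_def l_def\<close>)
      also have "32 * U / (l * \<rho>) = 2 * A * \<tau> powr (7 * \<epsilon>)" using rat by simp
      also have "fact k * (2 * A * \<tau> powr (7 * \<epsilon>)) ^ (k + 1) = fact k * (2 * A) ^ (k + 1) * \<tau> powr (7 * \<epsilon> * real (k + 1))"
        unfolding power_mult_distrib[of "2 * A"] \<tau>7 by (simp only: mult.assoc)
      also have "\<dots> \<le> C * \<tau> powr (7 * \<epsilon> * real (k + 2))"
      proof (intro mult_mono)
        show "\<tau> powr (7 * \<epsilon> * real (k + 1)) \<le> \<tau> powr (7 * \<epsilon> * real (k + 2))"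
          using \<tau> \<epsilon> by (intro powr_mono mult_left_mono) auto
      qed (use A C0 in \<open>auto simp: C_def max_def\<close>)
      finally show ?thesis .
    next
      case False
      have "norm G \<le> C0 / (Re s - 1) ^ ((k+1) + 1)"
        unfolding G_def
      proof (rule C0(2)[OF norm_ln_mangoldt_le])
        show "norm (f n) \<le> 1" for n using f by (simp add: cmult_fun_def)
      qed (use \<sigma> in \<open>auto simp: s_def\<close>)
      also have "\<dots> \<le> C0 / r ^ (k + 2)"
      proof -
        have "r ^ (k + 2) \<le> (Re s - 1) ^ ((k + 1) + 1)"
          using False r by (simp only: add.assoc one_add_one) (intro power_mono, auto simp: s_def)
        thus ?thesis using C0(1) r(2) s1 by (intro divide_left_mono mult_pos_pos zero_less_power) auto
      qed
      also have "\<dots> = C0 * (1 / r) ^ (k + 2)" by (simp add: power_divide)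
      also have "\<dots> = C0 * A ^ (k + 2) * \<tau> powr (7 * \<epsilon> * real (k + 2))"
        unfolding r power_mult_distrib \<tau>7 by (simp only: mult.assoc)
      also have "\<dots> \<le> C * \<tau> powr (7 * \<epsilon> * real (k + 2))"
        by (intro mult_right_mono) (auto simp: C_def)
      finally show ?thesis .
    qed
    thus "norm (DS (\<lambda>n. of_real (ln (real n)) ^ k * (f n * mangoldt n)) (Complex \<sigma> t)) \<le> C * \<tau> powr (7 * \<epsilon> * real (k + 2))"
      unfolding G_def s_def .
  qed
qed

lemma Im_ball_double:
  assumes "z \<in> ball (Complex a t) r" "r \<le> 1"
  shows "\<bar>Im z\<bar> + 2 \<le> 2 * (\<bar>t\<bar> + 2)"
proof -
  have "\<bar>Im z\<bar> \<le> \<bar>Im z - t\<bar> + \<bar>t\<bar>" using abs_triangle_ineq[of "Im z - t" t] by simp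
  also have "\<dots> \<le> 1 + \<bar>t\<bar>" using order_trans[OF less_imp_le[OF Complex_ball_Re_Im(2)[OF assms(1)]], of 1] assms(2) by simp
  finally show ?thesis by simp
qed

lemma npchar_mangoldt_bound:
  obtains C where "C > 0" "\<And>q \<phi> s. npchar q \<phi> \<Longrightarrow> 1 < Re s \<Longrightarrow> Re s \<le> 2 \<Longrightarrow>
     norm (DS (\<lambda>n. of_real (ln (real n)) ^ k * (\<phi> n * mangoldt n)) s) \<le> C * (real q * (\<bar>Im s\<bar> + 2)) powr (1/2)"
proof -
  \<comment> \<open>\<epsilon> depends on the order k so that the total exponent 7\<epsilon>(k+2) is
    1/2.\<close>
  define \<epsilon> where "\<epsilon> = 1 / (14 * real (k + 2))"
  have \<epsilon>: "0 < \<epsilon>" "\<epsilon> \<le> 1" "7 * \<epsilon> * real (k + 2) = 1/2" by (auto simp: \<epsilon>_def field_simps)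
  obtain C1 where C1: "C1 \<ge> 1" "\<And>q \<phi> s. npchar q \<phi> \<Longrightarrow> 1 - \<epsilon>/8 \<le> Re s \<Longrightarrow> Re s \<le> 4 \<Longrightarrow>
     norm (Lc \<phi> s) \<le> C1 * (real q * (\<bar>Im s\<bar> + 2)) powr \<epsilon>"
    using npchar_upper[OF \<epsilon>(1,2)] by blast
  obtain c1 where c1: "c1 > 0" "\<And>q \<phi> t. npchar q \<phi> \<Longrightarrow>
     norm (Lc \<phi> (Complex 1 t)) \<ge> c1 * (real q * (\<bar>t\<bar> + 2)) powr (-6 * \<epsilon>)"
    using npchar_lower[OF \<epsilon>(1,2)] by blast
  define C2 where "C2 = C1 * 2"
  have pos: "\<epsilon>/8 > 0" "C2 > 0" using \<epsilon> C1 by (auto simp: C2_def)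
  obtain C where C: "C \<ge> 0" "\<And>f LF t \<tau> \<epsilon>' \<sigma>. cmult_fun f \<Longrightarrow> \<tau> \<ge> 1 \<Longrightarrow> \<epsilon>' \<ge> 0 \<Longrightarrow>
     LF holomorphic_on ball (Complex 1 t) (\<epsilon>/8) \<Longrightarrow>
     (\<And>z. z \<in> ball (Complex 1 t) (\<epsilon>/8) \<Longrightarrow> Re z > 1 \<Longrightarrow> LF z = DS f z) \<Longrightarrow>
     (\<And>z. z \<in> ball (Complex 1 t) (\<epsilon>/8) \<Longrightarrow> norm (LF z) \<le> C2 * \<tau> powr \<epsilon>') \<Longrightarrow>
     norm (LF (Complex 1 t)) \<ge> c1 * \<tau> powr (-6 * \<epsilon>') \<Longrightarrow> 1 < \<sigma> \<Longrightarrow> \<sigma> \<le> 2 \<Longrightarrow>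
     norm (DS (\<lambda>n. of_real (ln (real n)) ^ k * (f n * mangoldt n)) (Complex \<sigma> t)) \<le> C * \<tau> powr (7 * \<epsilon>' * real (k + 2))"
    using mangoldt_DS_bound[OF pos c1(1), of k] by blast
  show ?thesis
  proof (rule that[of "C + 1"])
    show "C + 1 > 0" using C by simp
    fix q \<phi> s assume \<phi>: "npchar q \<phi>" and s: "1 < Re s" "Re s \<le> 2"
    define t \<tau> where "t = Im s" and "\<tau> = real q * (\<bar>t\<bar> + 2)"
    have q: "q > 0" using npchar_pos[OF \<phi>] by simp
    have \<tau>: "\<tau> \<ge> 1" unfolding \<tau>_def by (rule tau_facts[OF q])
    have "norm (DS (\<lambda>n. of_real (ln (real n)) ^ k * (\<phi> n * mangoldt n)) (Complex (Re s) t)) \<le> C * \<tau> powr (7 * \<epsilon> * real (k + 2))"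
    proof (rule C(2)[OF dchar_cmult_fun[OF npchar_dchar[OF \<phi>]] \<tau> less_imp_le[OF \<epsilon>(1)], of "Lc \<phi>"])
      show "Lc \<phi> holomorphic_on ball (Complex 1 t) (\<epsilon>/8)" using \<epsilon> by (intro npchar_ball_holomorphic[OF \<phi>]) auto
      show "Lc \<phi> z = DS \<phi> z" if "Re z > 1" for z by (rule npchar_Lc_eq_DS[OF \<phi> that])
      show "c1 * \<tau> powr (-6 * \<epsilon>) \<le> norm (Lc \<phi> (Complex 1 t))" unfolding \<tau>_def by (rule c1(2)[OF \<phi>])
      fix z assume z: "z \<in> ball (Complex 1 t) (\<epsilon>/8)"
      have "norm (Lc \<phi> z) \<le> C1 * (real q * (\<bar>Im z\<bar> + 2)) powr \<epsilon>"
      proof (rule C1(2)[OF \<phi>])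
        show "1 - \<epsilon>/8 \<le> Re z" "Re z \<le> 4" using Complex_ball_Re_Im(1)[OF z] \<epsilon>(1,2) by linarith+
      qed
      also have "\<dots> \<le> C1 * (2 * \<tau> powr \<epsilon>)"
      proof (intro mult_left_mono double_powr_le \<epsilon>)
        have "\<bar>Im z\<bar> + 2 \<le> 2 * (\<bar>t\<bar> + 2)" using \<epsilon> by (intro Im_ball_double[OF z]) auto
        hence "real q * (\<bar>Im z\<bar> + 2) \<le> real q * (2 * (\<bar>t\<bar> + 2))" by (intro mult_left_mono) auto
        thus "real q * (\<bar>Im z\<bar> + 2) \<le> 2 * \<tau>" by (simp add: \<tau>_def mult_ac)
      qed (use C1 in auto)
      finally show "norm (Lc \<phi> z) \<le> C2 * \<tau> powr \<epsilon>" by (simp add: C2_def)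
    qed (use s in auto)
    also have "\<dots> \<le> (C + 1) * \<tau> powr (1/2)" unfolding \<epsilon>(3) by (intro mult_right_mono) auto
    finally show "norm (DS (\<lambda>n. of_real (ln (real n)) ^ k * (\<phi> n * mangoldt n)) s) \<le> (C + 1) * (real q * (\<bar>Im s\<bar> + 2)) powr (1/2)"
      by (simp add: t_def \<tau>_def)
  qed
qed

text \<open>Subtracting 1 from \<Lambda> subtracts zeta from -zeta'/zeta and cancels the pole at 1.
  At height at least 1 the two parts are bounded separately, the derivatives of zeta by Cauchy's
  estimate.\<close>

lemma zeta_mangoldt_bound_large:
  obtains C where "C > 0" "\<And>s. 1 < Re s \<Longrightarrow> Re s \<le> 2 \<Longrightarrow> \<bar>Im s\<bar> \<ge> 1 \<Longrightarrow>
     norm (DS (\<lambda>n. of_real (ln (real n)) ^ k * (mangoldt n - 1)) s) \<le> C * (\<bar>Im s\<bar> + 2) powr (1/2)"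
proof -
  define \<epsilon> where "\<epsilon> = 1 / (14 * real (k + 2))"
  have \<epsilon>: "0 < \<epsilon>" "\<epsilon> \<le> 1/2" "\<epsilon> \<le> 1" "7 * \<epsilon> * real (k + 2) = 1/2" by (auto simp: \<epsilon>_def field_simps)
  obtain C1 where C1: "C1 \<ge> 1" "\<And>s. s \<noteq> 1 \<Longrightarrow> 1 - \<epsilon>/8 \<le> Re s \<Longrightarrow> Re s \<le> 4 \<Longrightarrow>
     norm (zeta s) \<le> C1 * (\<bar>Im s\<bar> + 2) powr \<epsilon> * (1 + 1 / norm (s - 1))"
    using zeta_upper[OF \<epsilon>(1,3)] by blast
  obtain c0 where c0: "c0 > 0" "\<And>t. t \<noteq> 0 \<Longrightarrow>
     norm (zeta (Complex 1 t)) * (1 + 1 / \<bar>t\<bar>) ^ 7 \<ge> c0 * (\<bar>t\<bar> + 2) powr (-6 * \<epsilon>)"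
    using zeta_lower[OF \<epsilon>(1,3)] by blast
  define c1 where "c1 = c0 / 2 ^ 7"
  define C2 where "C2 = C1 * 2 * 3"
  have pos: "\<epsilon>/8 > 0" "C2 > 0" "c1 > 0" using \<epsilon> C1 c0 by (auto simp: C2_def c1_def)
  obtain C where C: "C \<ge> 0" "\<And>f LF t \<tau> \<epsilon>' \<sigma>. cmult_fun f \<Longrightarrow> \<tau> \<ge> 1 \<Longrightarrow> \<epsilon>' \<ge> 0 \<Longrightarrow>
     LF holomorphic_on ball (Complex 1 t) (\<epsilon>/8) \<Longrightarrow>
     (\<And>z. z \<in> ball (Complex 1 t) (\<epsilon>/8) \<Longrightarrow> Re z > 1 \<Longrightarrow> LF z = DS f z) \<Longrightarrow>
     (\<And>z. z \<in> ball (Complex 1 t) (\<epsilon>/8) \<Longrightarrow> norm (LF z) \<le> C2 * \<tau> powr \<epsilon>') \<Longrightarrow>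
     norm (LF (Complex 1 t)) \<ge> c1 * \<tau> powr (-6 * \<epsilon>') \<Longrightarrow> 1 < \<sigma> \<Longrightarrow> \<sigma> \<le> 2 \<Longrightarrow>
     norm (DS (\<lambda>n. of_real (ln (real n)) ^ k * (f n * mangoldt n)) (Complex \<sigma> t)) \<le> C * \<tau> powr (7 * \<epsilon>' * real (k + 2))"
    using mangoldt_DS_bound[OF pos, of k] by blast
  have ballb: "norm (zeta z) \<le> C2 * (\<bar>t\<bar> + 2) powr \<epsilon>" "Re z > 0" "z \<noteq> 1"
    if z: "z \<in> ball (Complex a t) (\<epsilon>/8)" and t: "\<bar>t\<bar> \<ge> 1" and a: "1 \<le> a" "a \<le> 2" for z t a
  proof -
    have re: "1 - \<epsilon>/8 \<le> Re z" "Re z \<le> 4" using Complex_ball_Re_Im(1)[OF z] \<epsilon>(1,2) a by linarith+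
    thus "Re z > 0" using \<epsilon> by linarith
    have "\<bar>t\<bar> \<le> \<bar>Im z\<bar> + \<bar>Im z - t\<bar>" using abs_triangle_ineq4[of "Im z" "Im z - t"] by simp
    moreover have "\<bar>Im z - t\<bar> \<le> 1/2" using Complex_ball_Re_Im(2)[OF z] \<epsilon>(2) \<epsilon>(1) by linarith
    ultimately have "\<bar>Im z\<bar> \<ge> 1/2" using t by linarith
    hence n: "norm (z - 1) \<ge> 1/2" using abs_Im_le_cmod[of "z - 1"] by simp
    thus z1: "z \<noteq> 1" by auto
    have "1 / norm (z - 1) \<le> 1 / (1/2)" using n by (intro divide_left_mono mult_pos_pos) (auto simp: z1)
    hence i: "1 + 1 / norm (z - 1) \<le> 3" by simp
    have "norm (zeta z) \<le> C1 * (\<bar>Im z\<bar> + 2) powr \<epsilon> * (1 + 1 / norm (z - 1))" by (rule C1(2)[OF z1 re])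
    also have "\<dots> \<le> C1 * (2 * (\<bar>t\<bar> + 2) powr \<epsilon>) * 3"
    proof (intro mult_mono mult_left_mono i)
      show "(\<bar>Im z\<bar> + 2) powr \<epsilon> \<le> 2 * (\<bar>t\<bar> + 2) powr \<epsilon>"
        using \<epsilon> by (intro double_powr_le[OF \<epsilon>(1,3)] Im_ball_double[OF z]) auto
    qed (use C1 in auto)
    finally show "norm (zeta z) \<le> C2 * (\<bar>t\<bar> + 2) powr \<epsilon>" by (simp add: C2_def)
  qed
  have hol: "zeta holomorphic_on ball (Complex a t) (\<epsilon>/8)" if "\<bar>t\<bar> \<ge> 1" "1 \<le> a" "a \<le> 2" for a t
    by (rule holomorphic_on_subset[OF zeta_holomorphic]) (use ballb(2,3)[OF _ that] in blast)
  define K where "K = fact k * C2 * (2 / (\<epsilon>/8)) ^ k"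
  have K: "K \<ge> 0" using pos \<epsilon> by (simp add: K_def)
  show ?thesis
  proof (rule that[of "C + K + 1"])
    show "C + K + 1 > 0" using C K by simp
    fix s assume s: "1 < Re s" "Re s \<le> 2" and ts: "\<bar>Im s\<bar> \<ge> 1"
    define t \<tau> where "t = Im s" and "\<tau> = \<bar>t\<bar> + 2"
    have t: "\<bar>t\<bar> \<ge> 1" using ts by (simp add: t_def)
    have \<tau>: "\<tau> \<ge> 1" by (simp add: \<tau>_def)
    have sC: "s = Complex (Re s) t" by (simp add: t_def)
    have "norm (DS (\<lambda>n. of_real (ln (real n)) ^ k * (1 * mangoldt n)) (Complex (Re s) t)) \<le> C * \<tau> powr (7 * \<epsilon> * real (k + 2))"
    proof (rule C(2)[OF cmult_fun_1 \<tau> less_imp_le[OF \<epsilon>(1)], of zeta])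
      show "zeta holomorphic_on ball (Complex 1 t) (\<epsilon>/8)" using t by (intro hol) auto
      show "zeta z = DS (\<lambda>_. 1) z" if "Re z > 1" for z by (rule zeta_eq_DS[OF that])
      show "norm (zeta z) \<le> C2 * \<tau> powr \<epsilon>" if "z \<in> ball (Complex 1 t) (\<epsilon>/8)" for z
        unfolding \<tau>_def using that t by (intro ballb(1)[of z 1]) auto
      have "(1 + 1 / \<bar>t\<bar>) ^ 7 \<le> 2 ^ 7" using t by (intro power_mono) (auto simp: field_simps)
      hence "norm (zeta (Complex 1 t)) * (1 + 1 / \<bar>t\<bar>) ^ 7 \<le> norm (zeta (Complex 1 t)) * 2 ^ 7"
        by (intro mult_left_mono) auto
      hence "c0 * \<tau> powr (-6 * \<epsilon>) \<le> norm (zeta (Complex 1 t)) * 2 ^ 7"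
        using c0(2)[of t] t unfolding \<tau>_def by linarith
      thus "c1 * \<tau> powr (-6 * \<epsilon>) \<le> norm (zeta (Complex 1 t))" by (simp add: c1_def field_simps)
    qed (use s in auto)
    hence p1: "norm (DS (\<lambda>n. of_real (ln (real n)) ^ k * mangoldt n) s) \<le> C * \<tau> powr (1/2)"
      unfolding \<epsilon>(4) sC[symmetric] by simp
    have a1: "abs_conv (\<lambda>n. of_real (ln (real n)) ^ k * 1)" by (rule abs_conv_ln_power[OF abs_conv_1])
    have am: "abs_conv (\<lambda>n. of_real (ln (real n)) ^ k * mangoldt n)"
      using abs_conv_ln_power[OF abs_conv_mangoldt[of "\<lambda>_. 1" 1], of k] by simp
    have "(deriv ^^ k) zeta s = (deriv ^^ k) (DS (\<lambda>_. 1)) s"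
    proof (rule higher_deriv_transform_within_open[of _ "{z. Re z > 1}"])
      show "zeta holomorphic_on {z. Re z > 1}" by (rule holomorphic_on_subset[OF zeta_holomorphic]) auto
      show "DS (\<lambda>_. 1) holomorphic_on {z. Re z > 1}" by (rule DS_holomorphic[OF abs_conv_1])
    qed (use s zeta_eq_DS open_halfspace_Re_gt in auto)
    also have "\<dots> = (-1) ^ k * DS (\<lambda>n. of_real (ln (real n)) ^ k * 1) s"
      by (rule DS_higher_deriv[OF abs_conv_1 s(1)])
    finally have "norm (DS (\<lambda>n. of_real (ln (real n)) ^ k * 1) s) = norm ((deriv ^^ k) zeta s)"
      by (simp add: norm_mult norm_power)
    also have "\<dots> \<le> fact k * (C2 * \<tau> powr \<epsilon>) * (2 / (\<epsilon>/8)) ^ k"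
    proof (rule higher_deriv_bound[OF _ pos(1)])
      show "zeta holomorphic_on ball s (\<epsilon>/8)" using hol[of t "Re s"] t s unfolding sC[symmetric] by simp
      show "norm (zeta z) \<le> C2 * \<tau> powr \<epsilon>" if "z \<in> ball s (\<epsilon>/8)" for z
        using ballb(1)[of z "Re s" t] that t s unfolding sC[symmetric] \<tau>_def by simp
    qed
    also have "\<dots> = K * \<tau> powr \<epsilon>" by (simp add: K_def)
    also have "\<dots> \<le> K * \<tau> powr (1/2)" using K \<tau> \<epsilon> by (intro mult_left_mono powr_mono) auto
    finally have p2: "norm (DS (\<lambda>n. of_real (ln (real n)) ^ k * 1) s) \<le> K * \<tau> powr (1/2)" .
    have "DS (\<lambda>n. of_real (ln (real n)) ^ k * (mangoldt n - 1)) s =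
       DS (\<lambda>n. of_real (ln (real n)) ^ k * mangoldt n) s - DS (\<lambda>n. of_real (ln (real n)) ^ k * 1) s"
      using DS_diff[OF am a1 s(1)] by (simp add: right_diff_distrib)
    hence "norm (DS (\<lambda>n. of_real (ln (real n)) ^ k * (mangoldt n - 1)) s) \<le> C * \<tau> powr (1/2) + K * \<tau> powr (1/2)"
      using p1 p2 norm_triangle_ineq4 by (smt (verit))
    also have "\<dots> \<le> (C + K + 1) * \<tau> powr (1/2)" unfolding distrib_right by simp
    finally show "norm (DS (\<lambda>n. of_real (ln (real n)) ^ k * (mangoldt n - 1)) s) \<le> (C + K + 1) * (\<bar>Im s\<bar> + 2) powr (1/2)"
      by (simp add: \<tau>_def t_def)
  qed
qed

lemma quotient_aux:
  fixes F d u L m :: complex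
  assumes "F = u * L" "u \<noteq> 0" "L \<noteq> 0" "d = L + u * (- m * L)"
  shows "d / F = 1 / u - m"
  using assms by (simp add: field_simps)

text \<open>Near the pole, \<open>-\<zeta>'/\<zeta> - \<zeta>\<close> continues holomorphically across \<open>s = 1\<close>, so a compactness argument suffices.\<close>

lemma zeta_mangoldt_bound_small:
  obtains C where "C > 0" "\<And>s. 1 < Re s \<Longrightarrow> Re s \<le> 2 \<Longrightarrow> \<bar>Im s\<bar> \<le> 1 \<Longrightarrow>
     norm (DS (\<lambda>n. of_real (ln (real n)) ^ k * (mangoldt n - 1)) s) \<le> C"
proof -
  define Q where "Q = {s. Re s > 0} \<inter> zetaF -` (- {0})"
  have opH: "open {s. Re s > 0}" by (rule open_halfspace_Re_gt)
  have op: "open Q" unfolding Q_def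
    by (rule continuous_open_preimage[OF holomorphic_on_imp_continuous_on[OF zetaF_holomorphic] opH]) auto
  define R where "R = (\<lambda>z. if z = 1 then deriv zetaF 1 else (zetaF z - zetaF 1) / (z - 1))"
  have "1 \<in> interior {s. Re s > 0}" using opH by (simp add: interior_open)
  from pole_lemma[OF zetaF_holomorphic this] have hR: "R holomorphic_on {s. Re s > 0}" unfolding R_def .
  \<comment> \<open>For Re s > 1 this is -zeta'/zeta - zeta: the logarithmic derivative of zetaF =
    (s - 1) zeta contributes -1/(s - 1), and R = zeta - 1/(s - 1) cancels it.\<close>
  define W where "W = (\<lambda>z. - (deriv zetaF z / zetaF z) - R z)"
  have hW: "W holomorphic_on Q" unfolding W_def
    by (intro holomorphic_intros holomorphic_on_subset[OF holomorphic_deriv[OF zetaF_holomorphic opH]]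
        holomorphic_on_subset[OF zetaF_holomorphic] holomorphic_on_subset[OF hR]) (auto simp: Q_def)
  define K where "K = cbox (Complex 1 (-1)) (Complex 2 1)"
  have zn: "zetaF z \<noteq> 0" if "Re z \<ge> 1" for z
  proof (cases "Re z = 1")
    case True
    hence "z = Complex 1 (Im z)" by (simp add: complex_eq_iff)
    thus ?thesis using zetaF_nonzero_line[of "Im z"] by simp
  next
    case False
    hence z: "Re z > 1" using that by simp
    hence "z \<noteq> 1" by auto
    thus ?thesis using zetaF_eq_DS[OF z] DS_nonzero[OF cmult_fun_1 z] by simp
  qed
  have sub: "K \<subseteq> Q" using zn by (auto simp: K_def Q_def in_cbox_complex_iff)
  have "continuous_on K ((deriv ^^ k) W)"
    by (rule continuous_on_subset[OF holomorphic_on_imp_continuous_on[OF holomorphic_higher_deriv[OF hW op]] sub])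
  hence "compact ((deriv ^^ k) W ` K)" unfolding K_def by (intro compact_continuous_image) auto
  hence "bounded ((deriv ^^ k) W ` K)" by (rule compact_imp_bounded)
  then obtain C where C: "C > 0" "\<forall>z\<in>(deriv ^^ k) W ` K. norm z \<le> C" unfolding bounded_pos by blast
  have am: "abs_conv (\<lambda>n. mangoldt n - 1)"
    using abs_conv_diff[OF abs_conv_mangoldt[of "\<lambda>_. 1" 1] abs_conv_1] by simp
  have eq: "W z = DS (\<lambda>n. mangoldt n - 1) z" if z: "Re z > 1" for z
  proof -
    have z1: "z \<noteq> 1" "z - 1 \<noteq> 0" using z by auto
    have F: "zetaF z = (z - 1) * DS (\<lambda>_. 1) z" by (rule zetaF_eq_DS[OF z])
    have nz: "DS (\<lambda>_. 1) z \<noteq> 0" by (rule DS_nonzero[OF cmult_fun_1 z])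
    have "deriv zetaF z = deriv (\<lambda>w. (w - 1) * DS (\<lambda>_. 1) w) z"
    proof (rule complex_derivative_transform_within_open)
      show "zetaF holomorphic_on {w. Re w > 1}" by (rule holomorphic_on_subset[OF zetaF_holomorphic]) auto
      show "(\<lambda>w. (w - 1) * DS (\<lambda>_. 1) w) holomorphic_on {w. Re w > 1}"
        by (intro holomorphic_intros DS_holomorphic abs_conv_1)
      show "open {w. Re w > 1}" by (rule open_halfspace_Re_gt)
    qed (use z zetaF_eq_DS in auto)
    also have "\<dots> = DS (\<lambda>_. 1) z + (z - 1) * deriv (DS (\<lambda>_. 1)) z"
    proof (rule DERIV_imp_deriv)
      have "(DS (\<lambda>_. 1) has_field_derivative deriv (DS (\<lambda>_. 1)) z) (at z)"
        using holomorphic_derivI[OF DS_holomorphic[OF abs_conv_1] open_halfspace_Re_gt] z by simp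
      thus "((\<lambda>w. (w - 1) * DS (\<lambda>_. 1) w) has_field_derivative DS (\<lambda>_. 1) z + (z - 1) * deriv (DS (\<lambda>_. 1)) z) (at z)"
        by (auto intro!: derivative_eq_intros)
    qed
    also have "deriv (DS (\<lambda>_. 1)) z = - DS (\<lambda>n. 1 * mangoldt n) z * DS (\<lambda>_. 1) z"
      using logderiv_DS_1[OF cmult_fun_1 z] nz by (simp add: field_simps)
    finally have "deriv zetaF z = DS (\<lambda>_. 1) z + (z - 1) * (- DS mangoldt z * DS (\<lambda>_. 1) z)" by simp
    from quotient_aux[OF F z1(2) nz this] have "deriv zetaF z / zetaF z = 1 / (z - 1) - DS mangoldt z" .
    moreover have "R z = DS (\<lambda>_. 1) z - 1 / (z - 1)"
      unfolding R_def using z1 F by (simp add: zetaF_1 field_simps)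
    ultimately have "W z = DS mangoldt z - DS (\<lambda>_. 1) z" by (simp add: W_def)
    thus ?thesis using DS_diff[OF abs_conv_mangoldt[of "\<lambda>_. 1" 1] abs_conv_1 z] by simp
  qed
  show ?thesis
  proof (rule that[OF C(1)])
    fix s assume s: "1 < Re s" "Re s \<le> 2" "\<bar>Im s\<bar> \<le> 1"
    have "(deriv ^^ k) W s = (deriv ^^ k) (DS (\<lambda>n. mangoldt n - 1)) s"
    proof (rule higher_deriv_transform_within_open[of _ "{z. Re z > 1}"])
      show "W holomorphic_on {z. Re z > 1}"
        by (rule holomorphic_on_subset[OF hW]) (use zn in \<open>auto simp: Q_def\<close>)
      show "DS (\<lambda>n. mangoldt n - 1) holomorphic_on {z. Re z > 1}" by (rule DS_holomorphic[OF am])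
    qed (use s eq open_halfspace_Re_gt in auto)
    hence "norm (DS (\<lambda>n. of_real (ln (real n)) ^ k * (mangoldt n - 1)) s) = norm ((deriv ^^ k) W s)"
      using DS_higher_deriv[OF am s(1), of k] by (simp add: norm_mult norm_power)
    also have "s \<in> K" using s by (auto simp: K_def in_cbox_complex_iff abs_le_iff)
    hence "norm ((deriv ^^ k) W s) \<le> C" using C(2) by blast
    finally show "norm (DS (\<lambda>n. of_real (ln (real n)) ^ k * (mangoldt n - 1)) s) \<le> C" .
  qed
qed

lemma zeta_mangoldt_bound:
  obtains C where "C > 0" "\<And>s. 1 < Re s \<Longrightarrow> Re s \<le> 2 \<Longrightarrow>
     norm (DS (\<lambda>n. of_real (ln (real n)) ^ k * (mangoldt n - 1)) s) \<le> C * (\<bar>Im s\<bar> + 2) powr (1/2)"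
proof -
  obtain C1 where C1: "C1 > 0" "\<And>s. 1 < Re s \<Longrightarrow> Re s \<le> 2 \<Longrightarrow> \<bar>Im s\<bar> \<ge> 1 \<Longrightarrow>
     norm (DS (\<lambda>n. of_real (ln (real n)) ^ k * (mangoldt n - 1)) s) \<le> C1 * (\<bar>Im s\<bar> + 2) powr (1/2)"
    using zeta_mangoldt_bound_large[of k] by blast
  obtain C2 where C2: "C2 > 0" "\<And>s. 1 < Re s \<Longrightarrow> Re s \<le> 2 \<Longrightarrow> \<bar>Im s\<bar> \<le> 1 \<Longrightarrow>
     norm (DS (\<lambda>n. of_real (ln (real n)) ^ k * (mangoldt n - 1)) s) \<le> C2"
    using zeta_mangoldt_bound_small[of k] by blast
  show ?thesis
  proof (rule that[of "max C1 C2"])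
    show "max C1 C2 > 0" using C1 by simp
    fix s assume s: "1 < Re s" "Re s \<le> 2"
    define X where "X = (\<bar>Im s\<bar> + 2) powr (1/2)"
    have X: "X \<ge> 1" unfolding X_def by (rule ge_one_powr_ge_zero) auto
    have "C1 * X \<le> max C1 C2 * X" using X by (intro mult_right_mono) auto
    moreover have "C2 * 1 \<le> max C1 C2 * X" using X C2(1) by (intro mult_mono) auto
    ultimately show "norm (DS (\<lambda>n. of_real (ln (real n)) ^ k * (mangoldt n - 1)) s) \<le> max C1 C2 * (\<bar>Im s\<bar> + 2) powr (1/2)"
      using C1(2)[OF s] C2(2)[OF s] unfolding X_def[symmetric] by (cases "\<bar>Im s\<bar> \<ge> 1") auto
  qed
qed

section \<open>Fourier inversion\<close>

lemma norm_iexp [simp]: "norm (iexp x) = 1"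
  by (simp add: norm_exp_eq_Re)

lemma iexp_add: "iexp (x + y) = iexp x * iexp y"
  by (simp add: exp_add algebra_simps)

lemma fourier_std_normal:
  "(CLINT t|lborel. iexp (x * t) * of_real (std_normal_density t)) = of_real (sqrt (2 * pi) * std_normal_density x)"
proof -
  have "char std_normal_distribution x = (CLINT t|lborel. std_normal_density t *\<^sub>R iexp (x * t))"
    unfolding char_def by (rule integral_density) auto
  also have "\<dots> = (CLINT t|lborel. iexp (x * t) * of_real (std_normal_density t))"
    by (simp add: scaleR_conv_of_real mult.commute)
  finally have "(CLINT t|lborel. iexp (x * t) * of_real (std_normal_density t)) = char std_normal_distribution x" ..
  also have "\<dots> = complex_of_real (exp (- (x^2) / 2))" unfolding char_std_normal_distribution ..
  also have "exp (- (x^2) / 2) = sqrt (2 * pi) * std_normal_density x" by (simp add: std_normal_density_def)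
  finally show ?thesis .
qed

lemma fourier_normal_scaled:
  assumes h: "h > 0"
  shows "(CLINT t|lborel. iexp (x * t) * of_real (std_normal_density (h * t))) = of_real (sqrt (2 * pi) / h * std_normal_density (x / h))"
proof -
  define f where "f = (\<lambda>u. iexp (x / h * u) * complex_of_real (std_normal_density u))"
  have "(CLINT u|lborel. f u) = \<bar>h\<bar> *\<^sub>R (CLINT t|lborel. f (0 + h * t))"
    using h by (intro lborel_integral_real_affine) auto
  hence "of_real h * (CLINT t|lborel. f (h * t)) = of_real (sqrt (2 * pi) * std_normal_density (x / h))"
    using fourier_std_normal[of "x / h"] h unfolding f_def by (simp add: scaleR_conv_of_real)
  hence "(CLINT t|lborel. f (h * t)) = of_real (sqrt (2 * pi) * std_normal_density (x / h)) / of_real h"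
    using h by (simp add: field_simps)
  also have "\<dots> = of_real (sqrt (2 * pi) / h * std_normal_density (x / h))" by simp
  finally show ?thesis using h unfolding f_def by simp
qed

lemma std_normal_density_even: "std_normal_density (-x) = std_normal_density x"
  by (simp add: std_normal_density_def)

text \<open>Gaussian regularisation: with the factor exp(-(ht)^2/2) inserted, Fubini turns the
  integral into an average of g around v against a normal density of width h. As h tends to 0,
  dominated convergence applies on both sides.\<close>

lemma fourier_inversion:
  fixes g :: "real \<Rightarrow> real" and G :: "real \<Rightarrow> complex"
  assumes gi: "integrable lborel g" and gc: "\<And>x. isCont g x" and gB: "\<And>x. \<bar>g x\<bar> \<le> B"
    and G: "\<And>t. G t = (CLINT w|lborel. of_real (g w) * iexp (- (t * w)))" and Gi: "integrable lborel G"
  shows "(CLINT t|lborel. G t * iexp (t * v)) = of_real (2 * pi * g v)"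
proof -
  have [measurable]: "g \<in> borel_measurable borel" "G \<in> borel_measurable borel"
    using gi Gi by auto
  define N where "N = std_normal_density"
  have [measurable]: "N \<in> borel_measurable borel" unfolding N_def by simp
  have N0: "N x \<ge> 0" for x by (simp add: N_def)
  define h where "h = (\<lambda>n. 1 / real (Suc n))"
  have h: "h n > 0" for n by (simp add: h_def)
  have h0: "h \<longlonglongrightarrow> 0" unfolding h_def by (rule LIMSEQ_Suc[OF lim_1_over_n])
  \<comment> \<open>The factor \<open>sqrt (2 * pi)\<close> makes the Gaussian equal to 1 at t =
    0.\<close>
  define I where "I = (\<lambda>n. CLINT t|lborel. G t * iexp (t * v) * of_real (sqrt (2 * pi) * N (h n * t)))"
  have Nc: "isCont N x" for x unfolding N_def std_normal_density_def by (intro continuous_intros) auto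
  have lim1: "I \<longlonglongrightarrow> (CLINT t|lborel. G t * iexp (t * v))"
    unfolding I_def
  proof (rule integral_dominated_convergence[where w = "\<lambda>t. norm (G t)"])
    show "integrable lborel (\<lambda>t. norm (G t))" using Gi by simp
    show "AE t in lborel. (\<lambda>n. G t * iexp (t * v) * of_real (sqrt (2 * pi) * N (h n * t))) \<longlonglongrightarrow> G t * iexp (t * v)"
    proof (rule AE_I2)
      fix t
      have "(\<lambda>n. h n * t) \<longlonglongrightarrow> 0 * t" by (intro tendsto_intros h0)
      hence "(\<lambda>n. N (h n * t)) \<longlonglongrightarrow> N (0 * t)" by (intro isCont_tendsto_compose[OF Nc]) auto
      hence "(\<lambda>n. G t * iexp (t * v) * of_real (sqrt (2 * pi) * N (h n * t))) \<longlonglongrightarrow> G t * iexp (t * v) * of_real (sqrt (2 * pi) * N (0 * t))"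
        by (intro tendsto_intros)
      also have "sqrt (2 * pi) * N (0 * t) = 1" by (simp add: N_def std_normal_density_def)
      finally show "(\<lambda>n. G t * iexp (t * v) * of_real (sqrt (2 * pi) * N (h n * t))) \<longlonglongrightarrow> G t * iexp (t * v)" by simp
    qed
    show "AE t in lborel. norm (G t * iexp (t * v) * of_real (sqrt (2 * pi) * N (h n * t))) \<le> norm (G t)" for n
    proof (rule AE_I2)
      fix t
      have "sqrt (2 * pi) * N (h n * t) = exp (- (h n * t)\<^sup>2 / 2)" by (simp add: N_def std_normal_density_def)
      hence "\<bar>sqrt (2 * pi) * N (h n * t)\<bar> \<le> 1" by simp
      hence "norm (G t) * \<bar>sqrt (2 * pi) * N (h n * t)\<bar> \<le> norm (G t) * 1" by (intro mult_left_mono) auto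
      thus "norm (G t * iexp (t * v) * of_real (sqrt (2 * pi) * N (h n * t))) \<le> norm (G t)"
        by (simp only: norm_mult norm_iexp norm_of_real mult_1_right)
    qed
  qed measurable
  have eq: "I n = 2 * pi * (CLINT z|lborel. of_real (g (v + h n * z) * N z))" for n
  proof -
    define F where "F = (\<lambda>t w. of_real (g w) * iexp (- (t * w)) * (iexp (t * v) * of_real (sqrt (2 * pi) * N (h n * t))) :: complex)"
    have Nint: "integrable lborel (\<lambda>t. N (h n * t))"
      using lborel_integrable_real_affine[of N "h n" 0] h[of n] unfolding N_def by simp
    have nF: "norm (F t w) = \<bar>g w\<bar> * (sqrt (2 * pi) * N (h n * t))" for t w
      unfolding F_def norm_mult norm_iexp norm_of_real using N0 by (simp add: abs_mult)
    have Fi: "integrable (lborel \<Otimes>\<^sub>M lborel) (case_prod F)"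
    proof (rule lborel_pair.Fubini_integrable)
      show "case_prod F \<in> borel_measurable (lborel \<Otimes>\<^sub>M lborel)" unfolding F_def by measurable
      have "integrable lborel (\<lambda>t. (LINT w|lborel. \<bar>g w\<bar>) * (sqrt (2 * pi) * N (h n * t)))"
        by (intro integrable_mult_right Nint)
      thus "integrable lborel (\<lambda>t. LINT w|lborel. norm (case (t, w) of (t, w) \<Rightarrow> F t w))"
        by (simp add: nF)
      show "AE t in lborel. integrable lborel (\<lambda>w. case (t, w) of (t, w) \<Rightarrow> F t w)"
      proof (rule AE_I2, unfold prod.case)
        fix t
        have "integrable lborel (\<lambda>w. \<bar>g w\<bar> * (sqrt (2 * pi) * N (h n * t)))" using gi by (intro integrable_mult_left integrable_abs)
        thus "integrable lborel (F t)"
          by (rule Bochner_Integration.integrable_bound) (auto simp: F_def[symmetric] nF N0 abs_mult, simp add: F_def)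
      qed
    qed
    have "I n = (CLINT t|lborel. CLINT w|lborel. F t w)"
      unfolding I_def
    proof (rule Bochner_Integration.integral_cong[OF refl])
      fix t
      show "G t * iexp (t * v) * of_real (sqrt (2 * pi) * N (h n * t)) = (CLINT w|lborel. F t w)"
        unfolding mult.assoc[of "G t"] unfolding G F_def by (rule integral_mult_left_zero[symmetric])
    qed
    also have "\<dots> = (CLINT w|lborel. CLINT t|lborel. F t w)" by (rule lborel_pair.Fubini_integral[OF Fi, symmetric])
    also have "\<dots> = (CLINT w|lborel. of_real (g w * (2 * pi / h n * N ((v - w) / h n))))"
    proof (rule Bochner_Integration.integral_cong[OF refl])
      fix w
      have "F t w = of_real (g w * sqrt (2 * pi)) * (iexp ((v - w) * t) * of_real (N (h n * t)))" for t
      proof -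
        have "iexp (- (t * w)) * iexp (t * v) = iexp ((v - w) * t)"
          unfolding iexp_add[symmetric] by (simp add: algebra_simps)
        moreover have "x * A * (B * (y * z)) = (x * y) * ((A * B) * z)" for x y z A B :: complex
          by (simp only: mult_ac)
        ultimately show ?thesis unfolding F_def of_real_mult by metis
      qed
      hence "(CLINT t|lborel. F t w) = of_real (g w * sqrt (2 * pi)) * (CLINT t|lborel. iexp ((v - w) * t) * of_real (N (h n * t)))"
        by simp
      also have "\<dots> = of_real (g w * sqrt (2 * pi)) * of_real (sqrt (2 * pi) / h n * N ((v - w) / h n))"
        unfolding N_def fourier_normal_scaled[OF h] ..
      also have "\<dots> = of_real (g w * ((sqrt (2 * pi) * sqrt (2 * pi)) / h n * N ((v - w) / h n)))"
        unfolding of_real_mult[symmetric] by (simp only: times_divide_eq_left times_divide_eq_right mult_ac)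
      also have "sqrt (2 * pi) * sqrt (2 * pi) = 2 * pi" by simp
      finally show "(CLINT t|lborel. F t w) = of_real (g w * (2 * pi / h n * N ((v - w) / h n)))" .
    qed
    also have "\<dots> = \<bar>h n\<bar> *\<^sub>R (CLINT z|lborel. of_real (g (v + h n * z) * (2 * pi / h n * N ((v - (v + h n * z)) / h n))))"
      using h[of n] by (intro lborel_integral_real_affine) auto
    also have "(\<lambda>z. complex_of_real (g (v + h n * z) * (2 * pi / h n * N ((v - (v + h n * z)) / h n)))) =
        (\<lambda>z. of_real (2 * pi / h n) * of_real (g (v + h n * z) * N z))"
    proof
      fix z
      have "(v - (v + h n * z)) / h n = - z" using h[of n] by simp
      thus "complex_of_real (g (v + h n * z) * (2 * pi / h n * N ((v - (v + h n * z)) / h n))) =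
        of_real (2 * pi / h n) * of_real (g (v + h n * z) * N z)"
        using std_normal_density_even[of z] by (simp add: N_def)
    qed
    also have "\<bar>h n\<bar> *\<^sub>R (CLINT z|lborel. of_real (2 * pi / h n) * of_real (g (v + h n * z) * N z)) =
       2 * pi * (CLINT z|lborel. of_real (g (v + h n * z) * N z))"
      using h[of n] by (simp add: scaleR_conv_of_real del: of_real_mult)
    finally show ?thesis .
  qed
  have "(\<lambda>n. CLINT z|lborel. of_real (g (v + h n * z) * N z)) \<longlonglongrightarrow> (CLINT z|lborel. of_real (g v * N z))"
  proof (rule integral_dominated_convergence[where w = "\<lambda>z. B * N z"])
    show "integrable lborel (\<lambda>z. B * N z)" unfolding N_def by simp
    show "AE z in lborel. (\<lambda>n. complex_of_real (g (v + h n * z) * N z)) \<longlonglongrightarrow> of_real (g v * N z)"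
    proof (rule AE_I2)
      fix z
      have "(\<lambda>n. v + h n * z) \<longlonglongrightarrow> v + 0 * z" by (intro tendsto_intros h0)
      hence "(\<lambda>n. g (v + h n * z)) \<longlonglongrightarrow> g v" by (intro isCont_tendsto_compose[OF gc]) auto
      thus "(\<lambda>n. complex_of_real (g (v + h n * z) * N z)) \<longlonglongrightarrow> of_real (g v * N z)"
        by (intro tendsto_intros)
    qed
    show "AE z in lborel. norm (complex_of_real (g (v + h n * z) * N z)) \<le> B * N z" for n
      using gB N0 by (intro AE_I2) (simp only: norm_of_real abs_mult abs_of_nonneg mult_right_mono)
  qed measurable
  hence "(\<lambda>n. 2 * pi * (CLINT z|lborel. of_real (g (v + h n * z) * N z))) \<longlonglongrightarrow> 2 * pi * (CLINT z|lborel. of_real (g v * N z))"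
    by (rule tendsto_mult_left)
  also have "(CLINT z|lborel. of_real (g v * N z)) = complex_of_real (g v)"
    unfolding integral_complex_of_real by (simp add: N_def)
  finally have "I \<longlonglongrightarrow> of_real (2 * pi) * of_real (g v)" unfolding eq[abs_def] .
  from LIMSEQ_unique[OF lim1 this] show ?thesis by simp
qed

text \<open>At w = log(x/n) the product of n^(-\<sigma>) with this kernel is x^(-\<sigma>) log(x/n)
  for n \<le> x and 0 beyond. The factor w makes the kernel continuous and its transform 1/(\<sigma>
  + it)^2 integrable.\<close>

definition pkern :: "real \<Rightarrow> real \<Rightarrow> real" where
  "pkern \<sigma> w = (if w \<ge> 0 then w * exp (- \<sigma> * w) else 0)"

lemma pkern_max: "pkern \<sigma> w = max w 0 * exp (- \<sigma> * w)"
  by (simp add: pkern_def max_def)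

lemma isCont_pkern: "isCont (pkern \<sigma>) x"
  unfolding pkern_max[abs_def] by (intro continuous_intros)

lemma pkern_bounds: "\<sigma> \<ge> 1 \<Longrightarrow> 0 \<le> pkern \<sigma> w" "\<sigma> \<ge> 1 \<Longrightarrow> pkern \<sigma> w \<le> 1"
proof -
  assume s: "\<sigma> \<ge> 1"
  show "0 \<le> pkern \<sigma> w" by (simp add: pkern_def)
  show "pkern \<sigma> w \<le> 1"
  proof (cases "w \<ge> 0")
    case True
    have "w \<le> exp w" using exp_ge_add_one_self[of w] by linarith
    also have "\<dots> \<le> exp (\<sigma> * w)" using True s mult_right_mono[of 1 \<sigma> w] by simp
    finally have "w * exp (- \<sigma> * w) \<le> exp (\<sigma> * w) * exp (- \<sigma> * w)" by (intro mult_right_mono) auto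
    thus ?thesis using True by (simp add: pkern_def exp_add[symmetric])
  qed (simp add: pkern_def)
qed

lemma pkern_antideriv:
  fixes s :: complex assumes "s \<noteq> 0"
  shows "((\<lambda>w. - exp (- s * of_real w) * (of_real w / s + 1 / s^2)) has_vector_derivative
     (of_real w * exp (- s * of_real w))) (at w within A)"
proof -
  have "((\<lambda>w. - exp (- s * w) * (w / s + 1 / s^2)) has_field_derivative (z * exp (- s * z))) (at z within B)" for z B
    using assms by (auto intro!: derivative_eq_intros simp: field_simps power2_eq_square)
  from field_vector_diff_chain_within[OF has_vector_derivative_of_real[OF DERIV_ident] this, of w A]
  show ?thesis by (simp add: o_def)
qed

lemma integrable_pkern:
  assumes \<sigma>: "\<sigma> > 0"
  shows "integrable lborel (pkern \<sigma>)"
proof -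
  have meas: "(\<lambda>w. w * exp (- \<sigma> * w)) \<in> borel_measurable borel" by measurable
  have "(\<integral>\<^sup>+w. ennreal (w * exp (- \<sigma> * w)) * indicator {0..} w \<partial>lborel) =
     ennreal (0 - (- exp (- \<sigma> * 0) * (0 / \<sigma> + 1 / \<sigma>^2)))"
  proof (rule nn_integral_FTC_atLeast[OF meas])
    show "((\<lambda>w. - exp (- \<sigma> * w) * (w / \<sigma> + 1 / \<sigma>^2)) has_real_derivative (w * exp (- \<sigma> * w))) (at w)" for w
      using \<sigma> by (auto intro!: derivative_eq_intros simp: field_simps power2_eq_square)
    show "((\<lambda>w. - exp (- \<sigma> * w) * (w / \<sigma> + 1 / \<sigma>^2)) \<longlongrightarrow> 0) at_top"
      using \<sigma> by real_asymp
  qed auto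
  also have "(\<lambda>w. ennreal (w * exp (- \<sigma> * w)) * indicator {0..} w) = (\<lambda>w. ennreal (norm (pkern \<sigma> w)))"
    by (auto simp: pkern_def indicator_def)
  finally have "(\<integral>\<^sup>+w. ennreal (norm (pkern \<sigma> w)) \<partial>lborel) < \<infinity>" by simp
  moreover have "pkern \<sigma> \<in> borel_measurable lborel" unfolding pkern_def[abs_def] by measurable
  ultimately show ?thesis by (intro integrableI_bounded) auto
qed

lemma fourier_pkern:
  assumes \<sigma>: "\<sigma> > 0"
  shows "(CLINT w|lborel. of_real (pkern \<sigma> w) * iexp (- (t * w))) = 1 / (Complex \<sigma> t)^2"
proof -
  define s where "s = Complex \<sigma> t"
  have s0: "s \<noteq> 0" using \<sigma> by (auto simp: s_def complex_eq_iff)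
  have [measurable]: "pkern \<sigma> \<in> borel_measurable borel" unfolding pkern_def[abs_def] by measurable
  define f where "f = (\<lambda>w. of_real (pkern \<sigma> w) * iexp (- (t * w)))"
  have fe: "f w = of_real w * exp (- s * of_real w)" if "w \<ge> 0" for w
  proof -
    have "- s * of_real w = of_real (- \<sigma> * w) + \<i> * of_real (- (t * w))" by (simp add: s_def complex_eq_iff)
    hence "exp (- s * of_real w) = of_real (exp (- \<sigma> * w)) * iexp (- (t * w))" by (simp only: exp_add exp_of_real)
    thus ?thesis using that by (simp add: f_def pkern_def)
  qed
  define A where "A = (\<lambda>w. - exp (- s * of_real w) * (of_real w / s + 1 / s^2))"
  have "(\<lambda>n. CLINT w|lborel. indicator {0..real n} w *\<^sub>R f w) \<longlonglongrightarrow> (CLINT w|lborel. f w)"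
  proof (rule integral_dominated_convergence[where w = "pkern \<sigma>"])
    show "integrable lborel (pkern \<sigma>)" by (rule integrable_pkern[OF \<sigma>])
    show "f \<in> borel_measurable lborel" "(\<lambda>w. indicator {0..real n} w *\<^sub>R f w) \<in> borel_measurable lborel" for n
      unfolding f_def by measurable
    have "norm (f w) = pkern \<sigma> w" for w
      unfolding f_def norm_mult norm_iexp norm_of_real by (simp add: pkern_def)
    thus "AE w in lborel. norm (indicator {0..real n} w *\<^sub>R f w) \<le> pkern \<sigma> w" for n
      by (intro AE_I2) (auto simp: indicator_def pkern_def)
    show "AE w in lborel. (\<lambda>n. indicator {0..real n} w *\<^sub>R f w) \<longlonglongrightarrow> f w"
    proof (rule AE_I2)
      fix w
      have "eventually (\<lambda>n. indicator {0..real n} w *\<^sub>R f w = f w) sequentially"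
        using eventually_ge_at_top[of "nat \<lceil>w\<rceil>"]
      proof eventually_elim
        case (elim n)
        hence "w \<le> real n" by linarith
        thus ?case by (cases "w \<ge> 0") (auto simp: f_def pkern_def)
      qed
      thus "(\<lambda>n. indicator {0..real n} w *\<^sub>R f w) \<longlonglongrightarrow> f w" by (rule tendsto_eventually)
    qed
  qed
  moreover have "(CLINT w|lborel. indicator {0..real n} w *\<^sub>R f w) = A (real n) - A 0" for n
  proof -
    have "(CLINT w|lborel. indicator {0..real n} w *\<^sub>R f w) = (CLINT w|lborel. indicator {0..real n} w *\<^sub>R (of_real w * exp (- s * of_real w)))"
      by (intro Bochner_Integration.integral_cong) (auto simp: fe indicator_def)
    also have "\<dots> = A (real n) - A 0" unfolding A_def
    proof (rule integral_FTC_atLeastAtMost)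
      show "continuous_on {0..real n} (\<lambda>w. of_real w * exp (- s * of_real w))" by (intro continuous_intros)
    qed (use pkern_antideriv[OF s0] in auto)
    finally show ?thesis .
  qed
  moreover have "(\<lambda>n. A (real n) - A 0) \<longlonglongrightarrow> 0 - A 0"
  proof (intro tendsto_diff tendsto_const)
    show "(\<lambda>n. A (real n)) \<longlonglongrightarrow> 0"
    proof (rule tendsto_norm_zero_cancel, rule Lim_null_comparison)
      show "\<forall>\<^sub>F n in sequentially. norm (norm (A (real n))) \<le> exp (- \<sigma> * real n) * (real n / norm s + 1 / norm s ^ 2)"
      proof (intro always_eventually allI)
        fix n
        have "norm (exp (- s * of_real (real n))) = exp (- \<sigma> * real n)" by (simp add: norm_exp_eq_Re s_def)
        moreover have "norm (of_real (real n) / s + 1 / s^2) \<le> real n / norm s + 1 / norm s ^ 2"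
          using norm_triangle_ineq[of "of_real (real n) / s" "1 / s^2"] by (simp add: norm_divide norm_power)
        ultimately show "norm (norm (A (real n))) \<le> exp (- \<sigma> * real n) * (real n / norm s + 1 / norm s ^ 2)"
          unfolding A_def by (simp only: norm_mult norm_minus_cancel real_norm_def abs_mult abs_norm_cancel) (intro mult_mono, auto)
      qed
      have "(\<lambda>n. exp (- \<sigma> * real n) * real n) \<longlonglongrightarrow> 0" "(\<lambda>n. exp (- \<sigma> * real n)) \<longlonglongrightarrow> 0"
        using \<sigma> by real_asymp+
      hence "(\<lambda>n. exp (- \<sigma> * real n) * real n * (1 / norm s) + exp (- \<sigma> * real n) * (1 / norm s ^ 2)) \<longlonglongrightarrow>
         0 * (1 / norm s) + 0 * (1 / norm s ^ 2)"
        by (intro tendsto_intros)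
      thus "(\<lambda>n. exp (- \<sigma> * real n) * (real n / norm s + 1 / norm s ^ 2)) \<longlonglongrightarrow> 0"
        by (simp add: algebra_simps)
    qed
  qed
  ultimately have "(CLINT w|lborel. f w) = 0 - A 0" using LIMSEQ_unique by fastforce
  thus ?thesis unfolding f_def A_def s_def[symmetric] by simp
qed

text \<open>The exponent is 1/2 - 2: growth of the Dirichlet series against decay of the kernel's
  transform.\<close>

lemma integrable_decay: "integrable lborel (\<lambda>t::real. (\<bar>t\<bar> + 2) powr (-3/2))"
proof -
  define u where "u = (\<lambda>t::real. (t + 2) powr (-3/2) * indicator {0..} t)"
  have [measurable]: "u \<in> borel_measurable borel" unfolding u_def by measurable
  have "(\<integral>\<^sup>+t. ennreal ((t + 2) powr (-3/2)) * indicator {0..} t \<partial>lborel) = ennreal (0 - (- 2 * (0 + 2) powr (-1/2)))"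
  proof (rule nn_integral_FTC_atLeast)
    show "((\<lambda>t. - 2 * (t + 2) powr (-1/2)) has_real_derivative ((t + 2) powr (-3/2))) (at t)" if "0 \<le> t" for t
      using that by (auto intro!: derivative_eq_intros)
    show "((\<lambda>t::real. - 2 * (t + 2) powr (-1/2)) \<longlongrightarrow> 0) at_top" by real_asymp
  qed auto
  also have "(\<lambda>t. ennreal ((t + 2) powr (-3/2)) * indicator {0..} t) = (\<lambda>t. ennreal (norm (u t)))"
    by (auto simp: u_def indicator_def)
  finally have "(\<integral>\<^sup>+t. ennreal (norm (u t)) \<partial>lborel) < \<infinity>" by simp
  hence u: "integrable lborel u" by (intro integrableI_bounded) auto
  have "integrable lborel (\<lambda>t. u (0 + (-1) * t))" by (rule lborel_integrable_real_affine[OF u]) auto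
  hence "integrable lborel (\<lambda>t. u t + u (-t))" using u by simp
  thus ?thesis
    by (rule Bochner_Integration.integrable_bound) (auto intro!: AE_I2 simp: u_def indicator_def)
qed

lemma decay_bound:
  fixes t \<sigma> :: real assumes "\<sigma> \<ge> 1"
  shows "(\<bar>t\<bar> + 2) powr (1/2) / norm (Complex \<sigma> t) ^ 2 \<le> 8 * (\<bar>t\<bar> + 2) powr (-3/2)"
proof -
  have "1 \<le> \<sigma>^2" using assms by simp
  hence n: "1 + t^2 \<le> norm (Complex \<sigma> t) ^ 2" unfolding cmod_power2 by simp
  define a where "a = \<bar>t\<bar>"
  have "0 \<le> 4 + 7 * a^2 - 4 * a"
  proof -
    have e: "4 + 7 * a^2 - 4 * a = 2 * (a - 1)^2 + 2 + 5 * a^2" by (simp add: power2_eq_square algebra_simps)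
    show ?thesis unfolding e by (intro add_nonneg_nonneg) auto
  qed
  hence "(a + 2)^2 \<le> 8 * (1 + a^2)" by (simp add: power2_eq_square algebra_simps)
  hence "(\<bar>t\<bar> + 2)^2 \<le> 8 * (1 + t^2)" by (simp add: a_def)
  also have "\<dots> \<le> 8 * norm (Complex \<sigma> t) ^ 2" using n by simp
  finally have sq: "(\<bar>t\<bar> + 2)^2 \<le> 8 * norm (Complex \<sigma> t) ^ 2" .
  have "(\<bar>t\<bar> + 2) powr (1/2) = (\<bar>t\<bar> + 2) powr (-3/2) * (\<bar>t\<bar> + 2) powr 2" by (simp only: powr_add[symmetric]) simp
  also have "(\<bar>t\<bar> + 2) powr 2 = (\<bar>t\<bar> + 2)^2" by simp
  also have "(\<bar>t\<bar> + 2) powr (-3/2) * (\<bar>t\<bar> + 2)^2 \<le> (\<bar>t\<bar> + 2) powr (-3/2) * (8 * norm (Complex \<sigma> t) ^ 2)"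
    using sq by (intro mult_left_mono) auto
  finally show ?thesis using n by (subst pos_divide_le_eq) (auto simp: mult_ac intro: less_le_trans[of 0 "1 + t^2"] add_pos_nonneg)
qed

text \<open>Integrate DS a (\<sigma> + it) x^(it) / (\<sigma> + it)^2 over t. Absolute convergence
  allows exchanging sum and integral, and \<open>fourier_inversion\<close> evaluates each term; the
  growth exponent 1/2 keeps the integral finite.\<close>

lemma smoothed_sum_bound:
  obtains C where "C > 0" "\<And>a \<sigma> M x. abs_conv a \<Longrightarrow> 1 < \<sigma> \<Longrightarrow> x \<ge> 1 \<Longrightarrow> M \<ge> 0 \<Longrightarrow>
     (\<And>t. norm (DS a (Complex \<sigma> t)) \<le> M * (\<bar>t\<bar> + 2) powr (1/2)) \<Longrightarrow>
     norm (\<Sum>n | 1 \<le> n \<and> real n \<le> x. a n * of_real (ln (x / real n))) \<le> C * M * x powr \<sigma>"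
proof -
  define dk where "dk = (\<lambda>t::real. (\<bar>t\<bar> + 2) powr (-3/2))"
  have dk: "integrable lborel dk" unfolding dk_def by (rule integrable_decay)
  define D where "D = (LINT t|lborel. dk t)"
  have D: "D \<ge> 0" unfolding D_def dk_def by (intro Bochner_Integration.integral_nonneg) auto
  show ?thesis
  proof (rule that[of "8 * D / (2 * pi) + 1"])
    show "8 * D / (2 * pi) + 1 > 0" using D by (intro add_nonneg_pos divide_nonneg_nonneg) auto
    fix a \<sigma> M x assume a: "abs_conv a" and \<sigma>: "1 < (\<sigma>::real)" and x: "x \<ge> (1::real)" and M: "M \<ge> (0::real)"
      and bd: "\<And>t. norm (DS a (Complex \<sigma> t)) \<le> M * (\<bar>t\<bar> + 2) powr (1/2)"
    define G where "G = (\<lambda>t. 1 / (Complex \<sigma> t)^2)"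
    have Cx: "Complex \<sigma> t = of_real \<sigma> + \<i> * of_real t" for t by (simp add: complex_eq_iff)
    have Cnz: "Complex \<sigma> t \<noteq> 0" for t using \<sigma> by (simp add: complex_eq_iff)
    have "continuous_on UNIV G" unfolding G_def using Cnz unfolding Cx
      by (intro continuous_intros) auto
    hence Gm [measurable]: "G \<in> borel_measurable borel" by (rule borel_measurable_continuous_onI)
    have Gd: "(\<bar>t\<bar> + 2) powr (1/2) * norm (G t) \<le> 8 * dk t" for t
      using decay_bound[of \<sigma> t] \<sigma> by (simp add: G_def dk_def norm_divide norm_power)
    have Gb: "norm (G t) \<le> 8 * dk t" for t
    proof -
      have "1 * norm (G t) \<le> (\<bar>t\<bar> + 2) powr (1/2) * norm (G t)"
        by (intro mult_right_mono ge_one_powr_ge_zero) auto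
      thus ?thesis using Gd[of t] by simp
    qed
    have Gi: "integrable lborel G"
      by (rule Bochner_Integration.integrable_bound[OF integrable_mult_right[OF dk, of 8]])
         (use Gb in \<open>auto intro!: AE_I2 order_trans[OF Gb]\<close>)
    have inv: "(CLINT t|lborel. G t * iexp (t * w)) = of_real (2 * pi * pkern \<sigma> w)" for w
    proof (rule fourier_inversion)
      show "integrable lborel (pkern \<sigma>)" using \<sigma> by (intro integrable_pkern) auto
      show "isCont (pkern \<sigma>) y" for y by (rule isCont_pkern)
      show "\<bar>pkern \<sigma> y\<bar> \<le> 1" for y using pkern_bounds[of \<sigma> y] \<sigma> by simp
      show "G t = (CLINT w|lborel. of_real (pkern \<sigma> w) * iexp (- (t * w)))" for t
        unfolding G_def using \<sigma> by (intro fourier_pkern[symmetric]) auto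
    qed (rule Gi)
    define v where "v = ln x"
    define f where "f = (\<lambda>n t. a n * nps n (Complex \<sigma> t) * (G t * iexp (t * v)))"
    have fe: "f n t = a n * nps n (of_real \<sigma>) * (G t * iexp (t * (v - ln (real n))))" for n t
    proof (cases "n = 0")
      case False
      have "nps n (Complex \<sigma> t) = nps n (of_real \<sigma>) * nps n (\<i> * of_real t)"
        using False by (simp add: Cx nps_add)
      also have "nps n (\<i> * of_real t) = iexp (- (t * ln (real n)))"
        using False by (simp add: nps_exp algebra_simps)
      finally have "f n t = a n * nps n (of_real \<sigma>) * (G t * (iexp (- (t * ln (real n))) * iexp (t * v)))"
        by (simp only: f_def mult_ac)
      also have "iexp (- (t * ln (real n))) * iexp (t * v) = iexp (t * (v - ln (real n)))"
        unfolding iexp_add[symmetric] by (simp add: algebra_simps)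
      finally show ?thesis .
    qed (simp add: f_def)
    have Gie: "integrable lborel (\<lambda>t. G t * iexp (t * w))" for w
      by (rule Bochner_Integration.integrable_bound[OF Gi]) (auto intro!: AE_I2 simp: norm_mult)
    have fi: "integrable lborel (f n)" for n
      unfolding fe[abs_def] by (intro integrable_mult_right Gie)
    have nf: "norm (f n t) = norm (a n) * real n powr (-\<sigma>) * norm (G t)" for n t
      unfolding fe norm_mult norm_nps norm_iexp by simp
    have sm: "summable (\<lambda>n. norm (a n) * real n powr (-\<sigma>))" using a \<sigma> unfolding abs_conv_def by blast
    have int: "integral\<^sup>L lborel (f n) = a n * nps n (of_real \<sigma>) * of_real (2 * pi * pkern \<sigma> (v - ln (real n)))" for n
      unfolding fe[abs_def] by (simp add: inv del: of_real_mult)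
    have "(CLINT t|lborel. (\<Sum>n. f n t)) = (\<Sum>n. integral\<^sup>L lborel (f n))"
    proof (rule integral_suminf[OF fi])
      show "AE t in lborel. summable (\<lambda>n. norm (f n t))"
        unfolding nf by (intro AE_I2 summable_mult2 sm)
      show "summable (\<lambda>n. LINT t|lborel. norm (f n t))"
        unfolding nf using summable_mult2[OF sm] by simp
    qed
    also have "(\<lambda>t. \<Sum>n. f n t) = (\<lambda>t. DS a (Complex \<sigma> t) * (G t * iexp (t * v)))"
      unfolding f_def DS_def using abs_conv_summable[OF a] \<sigma> by (intro ext suminf_mult2[symmetric]) auto
    finally have eq: "(\<Sum>n. integral\<^sup>L lborel (f n)) = (CLINT t|lborel. DS a (Complex \<sigma> t) * (G t * iexp (t * v)))" ..
    have nle: "norm (CLINT t|lborel. DS a (Complex \<sigma> t) * (G t * iexp (t * v))) \<le> (LINT t|lborel. 8 * M * dk t)"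
    proof (rule Bochner_Integration.integral_norm_bound_integral)
      show "integrable lborel (\<lambda>t. 8 * M * dk t)" by (intro integrable_mult_right dk)
      fix t
      have "norm (DS a (Complex \<sigma> t) * (G t * iexp (t * v))) \<le> M * (\<bar>t\<bar> + 2) powr (1/2) * norm (G t)"
        unfolding norm_mult norm_iexp using bd[of t] by (simp add: mult_right_mono)
      also have "\<dots> = M * ((\<bar>t\<bar> + 2) powr (1/2) * norm (G t))" by simp
      also have "\<dots> \<le> M * (8 * dk t)" using Gd[of t] M by (intro mult_left_mono) auto
      finally show le: "norm (DS a (Complex \<sigma> t) * (G t * iexp (t * v))) \<le> 8 * M * dk t" by simp
    next
      have "continuous_on UNIV (\<lambda>t. DS a (Complex \<sigma> t))" unfolding Cx
      proof (rule continuous_on_compose2[OF holomorphic_on_imp_continuous_on[OF DS_holomorphic[OF a]]])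
        show "continuous_on UNIV (\<lambda>t. complex_of_real \<sigma> + \<i> * complex_of_real t)" by (intro continuous_intros)
      qed (use \<sigma> in auto)
      hence [measurable]: "(\<lambda>t. DS a (Complex \<sigma> t)) \<in> borel_measurable borel" by (rule borel_measurable_continuous_onI)
      have "norm (DS a (Complex \<sigma> t) * (G t * iexp (t * v))) \<le> norm (8 * M * dk t)" for t
      proof -
        have "norm (DS a (Complex \<sigma> t) * (G t * iexp (t * v))) \<le> M * (\<bar>t\<bar> + 2) powr (1/2) * norm (G t)"
          unfolding norm_mult norm_iexp using bd[of t] by (simp add: mult_right_mono)
        also have "\<dots> = M * ((\<bar>t\<bar> + 2) powr (1/2) * norm (G t))" by simp
        also have "\<dots> \<le> M * (8 * dk t)" using Gd[of t] M by (intro mult_left_mono) auto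
        also have "\<dots> \<le> norm (8 * M * dk t)" by (simp add: mult_ac)
        finally show ?thesis .
      qed
      thus "integrable lborel (\<lambda>t. DS a (Complex \<sigma> t) * (G t * iexp (t * v)))"
        by (intro Bochner_Integration.integrable_bound[OF integrable_mult_right[OF dk, of "8 * M"]] AE_I2) measurable
    qed
    define S where "S = {n. 1 \<le> n \<and> real n \<le> x}"
    have Sf: "finite S"
    proof (rule finite_subset)
      show "S \<subseteq> {..nat \<lfloor>x\<rfloor>}" by (auto simp: S_def le_nat_floor)
    qed auto
    have tm: "a n * nps n (of_real \<sigma>) * of_real (2 * pi * pkern \<sigma> (v - ln (real n))) =
       (if n \<in> S then of_real (2 * pi * x powr (-\<sigma>)) * (a n * of_real (ln (x / real n))) else 0)" for n
    proof (cases "n \<in> S")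
      case True
      hence n: "n > 0" "real n \<le> x" by (auto simp: S_def)
      have lx: "v - ln (real n) = ln (x / real n)" using n x by (simp add: v_def ln_div)
      have "ln (x / real n) \<ge> 0" using n by simp
      hence "pkern \<sigma> (v - ln (real n)) = ln (x / real n) * exp (- \<sigma> * (v - ln (real n)))"
        by (simp add: pkern_def lx)
      moreover have "real n powr (-\<sigma>) * exp (- \<sigma> * (v - ln (real n))) = x powr (-\<sigma>)"
        using n x by (simp add: powr_def v_def exp_add[symmetric] algebra_simps)
      ultimately have "real n powr (-\<sigma>) * (2 * pi * pkern \<sigma> (v - ln (real n))) = 2 * pi * x powr (-\<sigma>) * ln (x / real n)"
        by (metis (no_types, opaque_lifting) mult.assoc mult.commute)
      hence "complex_of_real (real n powr (-\<sigma>)) * of_real (2 * pi * pkern \<sigma> (v - ln (real n))) =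
          of_real (2 * pi * x powr (-\<sigma>)) * of_real (ln (x / real n))"
        by (metis of_real_mult)
      thus ?thesis using True unfolding nps_of_real by (simp only: if_True mult.assoc mult.left_commute)
    next
      case False
      show ?thesis
      proof (cases "n = 0")
        case nz: False
        hence "real n > x" using False by (auto simp: S_def)
        hence "v < ln (real n)" using x by (simp add: v_def)
        thus ?thesis using False by (simp add: pkern_def)
      qed (use False in simp)
    qed
    have "(\<Sum>n. integral\<^sup>L lborel (f n)) = (\<Sum>n\<in>S. of_real (2 * pi * x powr (-\<sigma>)) * (a n * of_real (ln (x / real n))))"
      unfolding int tm by (subst suminf_finite[OF Sf]) auto
    also have "\<dots> = of_real (2 * pi * x powr (-\<sigma>)) * (\<Sum>n\<in>S. a n * of_real (ln (x / real n)))"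
      by (simp only: sum_distrib_left)
    finally have "norm (complex_of_real (2 * pi * x powr (-\<sigma>)) * (\<Sum>n\<in>S. a n * of_real (ln (x / real n)))) \<le> (LINT t|lborel. 8 * M * dk t)"
      using nle eq by simp
    also have "(LINT t|lborel. 8 * M * dk t) = 8 * M * D" by (simp add: D_def)
    finally have "2 * pi * x powr (-\<sigma>) * norm (\<Sum>n\<in>S. a n * of_real (ln (x / real n))) \<le> 8 * M * D"
      unfolding norm_mult norm_of_real by simp
    hence "x powr \<sigma> * (2 * pi * x powr (-\<sigma>) * norm (\<Sum>n\<in>S. a n * of_real (ln (x / real n)))) \<le> x powr \<sigma> * (8 * M * D)"
      by (intro mult_left_mono) auto
    also have "x powr \<sigma> * (2 * pi * x powr (-\<sigma>) * norm (\<Sum>n\<in>S. a n * of_real (ln (x / real n)))) =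
        (x powr \<sigma> * x powr (-\<sigma>)) * (2 * pi * norm (\<Sum>n\<in>S. a n * of_real (ln (x / real n))))"
      by (simp only: mult_ac)
    also have "x powr \<sigma> * x powr (-\<sigma>) = 1" using x by (simp add: powr_add[symmetric])
    finally have "2 * pi * norm (\<Sum>n\<in>S. a n * of_real (ln (x / real n))) \<le> x powr \<sigma> * (8 * M * D)" by simp
    hence "norm (\<Sum>n\<in>S. a n * of_real (ln (x / real n))) \<le> 8 * D / (2 * pi) * M * x powr \<sigma>"
      by (simp add: field_simps)
    also have "\<dots> \<le> (8 * D / (2 * pi) + 1) * M * x powr \<sigma>" using M by (intro mult_right_mono) auto
    finally show "norm (\<Sum>n | 1 \<le> n \<and> real n \<le> x. a n * of_real (ln (x / real n))) \<le> (8 * D / (2 * pi) + 1) * M * x powr \<sigma>"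
      by (simp only: S_def)
  qed
qed

section \<open>Primes in the progression \<open>1 (mod q)\<close>\<close>

text \<open>The sum of \<chi>(n) \<Lambda>(n) over all characters modulo q with the principal one
  replaced by the constant 1; the second summand is the correction at n not prime to q. The pole is
  then exactly that of zeta, removed by subtracting 1, and the coefficients stay
  nonnegative.\<close>

definition bcoef :: "nat \<Rightarrow> nat \<Rightarrow> real" where
  "bcoef q n = (if [n = 1] (mod q) then real (totient q) * mangoldt n else 0) + (if coprime n q then 0 else mangoldt n)"

lemma bcoef_nonneg: "bcoef q n \<ge> 0"
  by (auto simp: bcoef_def intro!: mult_nonneg_nonneg mangoldt_nonneg add_nonneg_nonneg)

lemma bcoef_eq_sum:
  assumes q: "q > 0"
  shows "complex_of_real (bcoef q n) = mangoldt n + (\<Sum>\<phi> | npchar q \<phi>. \<phi> n * mangoldt n)"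
proof -
  have fin: "finite {\<phi>. dchar q \<phi>}" by (rule finite_dchars)
  have split: "{\<phi>. dchar q \<phi>} = insert (principal_char q) {\<phi>. npchar q \<phi>}"
    using dchar_principal[OF q] by (auto simp: npchar_def)
  have "(\<Sum>\<phi> | dchar q \<phi>. \<phi> n) = principal_char q n + (\<Sum>\<phi> | npchar q \<phi>. \<phi> n)"
    unfolding split by (rule sum.insert) (use fin[unfolded split] in \<open>auto simp: npchar_def\<close>)
  hence e: "(\<Sum>\<phi> | npchar q \<phi>. \<phi> n) = (if [n = 1] (mod q) then of_nat (totient q) else 0) - principal_char q n"
    unfolding sum_over_dchars[OF q] by simp
  show ?thesis
    unfolding sum_distrib_right[symmetric] e by (auto simp: bcoef_def principal_char_def algebra_simps)
qed

text \<open>At most q characters, each costing q^(1/2) \<le> q, give q^2.\<close>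

lemma DS_bcoef_bound:
  obtains C where "C > 0" "\<And>q s. q > 0 \<Longrightarrow> 1 < Re s \<Longrightarrow> Re s \<le> 2 \<Longrightarrow>
     norm (DS (\<lambda>n. of_real ((bcoef q n - 1) * ln (real n) ^ k)) s) \<le> C * real q ^ 2 * (\<bar>Im s\<bar> + 2) powr (1/2)"
proof -
  obtain C1 where C1: "C1 > 0" "\<And>q \<phi> s. npchar q \<phi> \<Longrightarrow> 1 < Re s \<Longrightarrow> Re s \<le> 2 \<Longrightarrow>
     norm (DS (\<lambda>n. of_real (ln (real n)) ^ k * (\<phi> n * mangoldt n)) s) \<le> C1 * (real q * (\<bar>Im s\<bar> + 2)) powr (1/2)"
    using npchar_mangoldt_bound[of k] by blast
  obtain C2 where C2: "C2 > 0" "\<And>s. 1 < Re s \<Longrightarrow> Re s \<le> 2 \<Longrightarrow>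
     norm (DS (\<lambda>n. of_real (ln (real n)) ^ k * (mangoldt n - 1)) s) \<le> C2 * (\<bar>Im s\<bar> + 2) powr (1/2)"
    using zeta_mangoldt_bound[of k] by blast
  show ?thesis
  proof (rule that[of "C2 + C1"])
    show "C2 + C1 > 0" using C1 C2 by simp
    fix q :: nat and s :: complex assume q: "q > 0" and s: "1 < Re s" "Re s \<le> 2"
    define X where "X = (\<bar>Im s\<bar> + 2) powr (1/2)"
    have q1: "real q \<ge> 1" using q by simp
    define P where "P = {\<phi>. npchar q \<phi>}"
    have Pd: "P \<subseteq> {\<phi>. dchar q \<phi>}" by (auto simp: P_def npchar_def)
    hence Pc: "card P \<le> q"
      using card_mono[OF finite_dchars Pd] card_dchars[OF q] totient_le[of q] by simp
    have e: "complex_of_real ((bcoef q n - 1) * ln (real n) ^ k) =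
        of_real (ln (real n)) ^ k * (mangoldt n - 1) + (\<Sum>\<phi>\<in>P. of_real (ln (real n)) ^ k * (\<phi> n * mangoldt n))" for n
      unfolding sum_distrib_left[symmetric] P_def of_real_mult of_real_diff bcoef_eq_sum[OF q]
      by (simp add: algebra_simps)
    have ac: "abs_conv (\<lambda>n. of_real (ln (real n)) ^ k * (\<phi> n * mangoldt n))" if "\<phi> \<in> P" for \<phi>
    proof (rule abs_conv_ln_power[OF abs_conv_mangoldt])
      show "norm (\<phi> n) \<le> 1" for n using that norm_dchar_le[of q \<phi>] by (simp add: P_def npchar_def)
    qed
    have az: "abs_conv (\<lambda>n. of_real (ln (real n)) ^ k * (mangoldt n - 1))"
      using abs_conv_ln_power[OF abs_conv_diff[OF abs_conv_mangoldt[of "\<lambda>_. 1" 1] abs_conv_1], of k] by simp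
    have eqD: "DS (\<lambda>n. of_real ((bcoef q n - 1) * ln (real n) ^ k)) s =
       DS (\<lambda>n. of_real (ln (real n)) ^ k * (mangoldt n - 1)) s +
       (\<Sum>\<phi>\<in>P. DS (\<lambda>n. of_real (ln (real n)) ^ k * (\<phi> n * mangoldt n)) s)"
      unfolding e using DS_add[OF az abs_conv_sum[OF ac] s(1), of P] DS_sum[OF ac s(1), of P] by simp
    have "norm (DS (\<lambda>n. of_real ((bcoef q n - 1) * ln (real n) ^ k)) s) \<le>
       norm (DS (\<lambda>n. of_real (ln (real n)) ^ k * (mangoldt n - 1)) s) +
       norm (\<Sum>\<phi>\<in>P. DS (\<lambda>n. of_real (ln (real n)) ^ k * (\<phi> n * mangoldt n)) s)"
      unfolding eqD by (rule norm_triangle_ineq)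
    moreover have "norm (DS (\<lambda>n. of_real (ln (real n)) ^ k * (mangoldt n - 1)) s) \<le> C2 * real q ^ 2 * X"
    proof -
      have "norm (DS (\<lambda>n. of_real (ln (real n)) ^ k * (mangoldt n - 1)) s) \<le> C2 * X" unfolding X_def by (rule C2(2)[OF s])
      also have "\<dots> \<le> (C2 * real q ^ 2) * X" using C2 q1 by (intro mult_right_mono) (auto simp: X_def)
      finally show ?thesis .
    qed
    moreover have "norm (\<Sum>\<phi>\<in>P. DS (\<lambda>n. of_real (ln (real n)) ^ k * (\<phi> n * mangoldt n)) s) \<le> C1 * real q ^ 2 * X"
    proof -
      have "norm (\<Sum>\<phi>\<in>P. DS (\<lambda>n. of_real (ln (real n)) ^ k * (\<phi> n * mangoldt n)) s) \<le> (\<Sum>\<phi>\<in>P. C1 * (real q * X))"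
      proof (rule sum_norm_le)
        fix \<phi> assume "\<phi> \<in> P"
        hence "norm (DS (\<lambda>n. of_real (ln (real n)) ^ k * (\<phi> n * mangoldt n)) s) \<le> C1 * (real q * (\<bar>Im s\<bar> + 2)) powr (1/2)"
          by (intro C1(2) s) (auto simp: P_def)
        also have "(real q * (\<bar>Im s\<bar> + 2)) powr (1/2) = real q powr (1/2) * X" by (simp add: powr_mult X_def)
        also have "C1 * (real q powr (1/2) * X) \<le> C1 * (real q powr 1 * X)"
          using C1 q1 by (intro mult_left_mono mult_right_mono powr_mono) (auto simp: X_def)
        finally show "norm (DS (\<lambda>n. of_real (ln (real n)) ^ k * (\<phi> n * mangoldt n)) s) \<le> C1 * (real q * X)"
          using q1 by simp
      qed
      also have "\<dots> = real (card P) * (C1 * (real q * X))" by simp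
      also have "\<dots> \<le> real q * (C1 * (real q * X))" using Pc C1 by (intro mult_right_mono) (auto simp: X_def)
      also have "\<dots> = C1 * real q ^ 2 * X" by (simp add: power2_eq_square)
      finally show ?thesis .
    qed
    ultimately show "norm (DS (\<lambda>n. of_real ((bcoef q n - 1) * ln (real n) ^ k)) s) \<le> (C2 + C1) * real q ^ 2 * (\<bar>Im s\<bar> + 2) powr (1/2)"
      unfolding X_def[symmetric] distrib_right by linarith
  qed
qed

lemma abs_conv_bcoef: "q > 0 \<Longrightarrow> abs_conv (\<lambda>n. of_real ((bcoef q n - 1) * ln (real n) ^ k))"
proof -
  assume q: "q > 0"
  define c where "c = (\<lambda>n. (if [n = 1] (mod q) then of_nat (totient q) else 0) + (if coprime n q then 0 else 1) :: complex)"
  have "norm (c n) \<le> real (totient q) + 1" for n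
    unfolding c_def by (rule order_trans[OF norm_triangle_ineq]) auto
  hence "abs_conv (\<lambda>n. c n * mangoldt n)" by (rule abs_conv_mangoldt)
  hence "abs_conv (\<lambda>n. of_real (ln (real n)) ^ k * (c n * mangoldt n - 1))"
    by (intro abs_conv_ln_power abs_conv_diff abs_conv_1)
  also have "(\<lambda>n. of_real (ln (real n)) ^ k * (c n * mangoldt n - 1)) = (\<lambda>n. complex_of_real ((bcoef q n - 1) * ln (real n) ^ k))"
    by (auto simp: c_def bcoef_def algebra_simps)
  finally show ?thesis .
qed

lemma smoothed_bcoef_bound:
  obtains C where "C > 0" "\<And>q x. q > 0 \<Longrightarrow> x \<ge> 1 \<Longrightarrow>
     \<bar>\<Sum>n | 1 \<le> n \<and> real n \<le> x. (bcoef q n - 1) * ln (real n) ^ k * ln (x / real n)\<bar> \<le> C * real q ^ 2 * x"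
proof -
  obtain C1 where C1: "C1 > 0" "\<And>a \<sigma> M x. abs_conv a \<Longrightarrow> 1 < \<sigma> \<Longrightarrow> x \<ge> 1 \<Longrightarrow> M \<ge> 0 \<Longrightarrow>
     (\<And>t. norm (DS a (Complex \<sigma> t)) \<le> M * (\<bar>t\<bar> + 2) powr (1/2)) \<Longrightarrow>
     norm (\<Sum>n | 1 \<le> n \<and> real n \<le> x. a n * of_real (ln (x / real n))) \<le> C1 * M * x powr \<sigma>"
    using smoothed_sum_bound by blast
  obtain C2 where C2: "C2 > 0" "\<And>q s. q > 0 \<Longrightarrow> 1 < Re s \<Longrightarrow> Re s \<le> 2 \<Longrightarrow>
     norm (DS (\<lambda>n. of_real ((bcoef q n - 1) * ln (real n) ^ k)) s) \<le> C2 * real q ^ 2 * (\<bar>Im s\<bar> + 2) powr (1/2)"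
    using DS_bcoef_bound[of k] by blast
  show ?thesis
  proof (rule that[of "C1 * C2 * exp 1"])
    show "C1 * C2 * exp 1 > 0" using C1 C2 by simp
    fix q :: nat and x :: real assume q: "q > 0" and x: "x \<ge> 1"
    \<comment> \<open>Then x^\<sigma> \<le> e x, and the 1 in the denominator keeps \<sigma> \<le> 2
      for x near 1.\<close>
    define \<sigma> where "\<sigma> = 1 + 1 / (1 + ln x)"
    have lx: "ln x \<ge> 0" using x by simp
    have \<sigma>: "1 < \<sigma>" "\<sigma> \<le> 2" using lx by (auto simp: \<sigma>_def field_simps)
    have xs: "x powr \<sigma> \<le> x * exp 1"
    proof -
      have "x powr \<sigma> = x * x powr (1 / (1 + ln x))" using x by (simp add: \<sigma>_def powr_add)
      also have "x powr (1 / (1 + ln x)) = exp (ln x / (1 + ln x))" using x by (simp add: powr_def)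
      also have "\<dots> \<le> exp 1" using lx by simp
      finally show ?thesis using x by simp
    qed
    define a where "a = (\<lambda>n. complex_of_real ((bcoef q n - 1) * ln (real n) ^ k))"
    have "norm (\<Sum>n | 1 \<le> n \<and> real n \<le> x. a n * of_real (ln (x / real n))) \<le> C1 * (C2 * real q ^ 2) * x powr \<sigma>"
    proof (rule C1(2)[OF _ \<sigma>(1) x])
      show "abs_conv a" unfolding a_def by (rule abs_conv_bcoef[OF q])
      show "C2 * real q ^ 2 \<ge> 0" using C2 by simp
      show "norm (DS a (Complex \<sigma> t)) \<le> C2 * real q ^ 2 * (\<bar>t\<bar> + 2) powr (1/2)" for t
        unfolding a_def using C2(2)[OF q, of "Complex \<sigma> t"] \<sigma> by simp
    qed
    also have "\<dots> \<le> C1 * (C2 * real q ^ 2) * (x * exp 1)" using xs C1 C2 by (intro mult_left_mono) auto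
    also have "(\<Sum>n | 1 \<le> n \<and> real n \<le> x. a n * of_real (ln (x / real n))) =
       of_real (\<Sum>n | 1 \<le> n \<and> real n \<le> x. (bcoef q n - 1) * ln (real n) ^ k * ln (x / real n))"
      by (simp add: a_def)
    finally show "\<bar>\<Sum>n | 1 \<le> n \<and> real n \<le> x. (bcoef q n - 1) * ln (real n) ^ k * ln (x / real n)\<bar> \<le> C1 * C2 * exp 1 * real q ^ 2 * x"
      unfolding norm_of_real by (simp add: mult_ac)
  qed
qed

section \<open>Removing the smoothing and the logarithmic weights\<close>

lemma finite_upto: "finite {n::nat. 1 \<le> n \<and> real n \<le> x}"
  by (rule finite_subset[of _ "{..nat \<lfloor>x\<rfloor>}"]) (auto simp: le_nat_floor)

lemma card_between_le:
  fixes x y :: real assumes "0 \<le> x" "x \<le> y"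
  shows "real (card {n::nat. x < real n \<and> real n \<le> y}) \<le> y - x + 1"
proof -
  have "{n::nat. x < real n \<and> real n \<le> y} \<subseteq> {nat \<lfloor>x\<rfloor> <.. nat \<lfloor>y\<rfloor>}"
  proof safe
    fix n :: nat assume n: "x < real n" "real n \<le> y"
    show "n \<in> {nat \<lfloor>x\<rfloor> <.. nat \<lfloor>y\<rfloor>}" using n assms by (auto simp: le_nat_floor) linarith
  qed
  hence "card {n::nat. x < real n \<and> real n \<le> y} \<le> card {nat \<lfloor>x\<rfloor> <.. nat \<lfloor>y\<rfloor>}" by (intro card_mono) auto
  also have "\<dots> = nat \<lfloor>y\<rfloor> - nat \<lfloor>x\<rfloor>" by simp
  finally have "real (card {n::nat. x < real n \<and> real n \<le> y}) \<le> real (nat \<lfloor>y\<rfloor> - nat \<lfloor>x\<rfloor>)" by simp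
  also have "\<dots> \<le> y - x + 1" using assms by linarith
  finally show ?thesis .
qed

lemma ln_one_plus_ge_half:
  fixes \<delta> :: real assumes "0 \<le> \<delta>" "\<delta> \<le> 1"
  shows "ln (1 + \<delta>) \<ge> \<delta> / 2"
proof -
  have "ln (1 / (1 + \<delta>)) \<le> 1 / (1 + \<delta>) - 1" using assms by (intro ln_le_minus_one) auto
  hence "ln (1 + \<delta>) \<ge> 1 - 1 / (1 + \<delta>)" using assms by (simp add: ln_div)
  also have "1 - 1 / (1 + \<delta>) = \<delta> / (1 + \<delta>)" using assms by (simp add: field_simps)
  also have "\<delta> / (1 + \<delta>) \<ge> \<delta> / 2" using assms by (intro divide_left_mono) auto
  finally show ?thesis .
qed

text \<open>Differencing the smoothed sums over \<open>[x, (1+\<delta>)x]\<close> and \<open>[x/(1+\<delta>), x]\<close>; only the one-sided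
  bound \<open>a n \<ge> - w\<close> on the short interval is needed.\<close>

lemma unsmooth:
  fixes a :: "nat \<Rightarrow> real"
  defines "T \<equiv> \<lambda>x. \<Sum>n | 1 \<le> n \<and> real n \<le> x. a n * ln (x / real n)"
  assumes x: "x \<ge> 1" and \<delta>: "0 < \<delta>" "\<delta> \<le> 1" and w: "\<And>n. 1 \<le> n \<Longrightarrow> real n \<le> 2 * x \<Longrightarrow> a n \<ge> - w" "w \<ge> 0"
    and T: "\<And>y. 0 < y \<Longrightarrow> y \<le> 2 * x \<Longrightarrow> \<bar>T y\<bar> \<le> B"
  shows "\<bar>\<Sum>n | 1 \<le> n \<and> real n \<le> x. a n\<bar> \<le> 4 * B / \<delta> + (\<delta> * x + 1) * w"
proof -
  define L where "L = ln (1 + \<delta>)"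
  have L: "L \<ge> \<delta> / 2" "L > 0" using ln_one_plus_ge_half[of \<delta>] \<delta> by (auto simp: L_def)
  define A where "A = (\<Sum>n | 1 \<le> n \<and> real n \<le> x. a n)"
  have up: "A * L \<le> 2 * B + (\<delta> * x + 1) * w * L"
  proof -
    define y where "y = x * (1 + \<delta>)"
    define S D where "S = {n::nat. 1 \<le> n \<and> real n \<le> x}" and "D = {n::nat. x < real n \<and> real n \<le> y}"
    have xy: "x \<le> y" "y \<le> 2 * x" using x \<delta> by (auto simp: y_def algebra_simps)
    have un: "{n::nat. 1 \<le> n \<and> real n \<le> y} = S \<union> D" "S \<inter> D = {}" using xy x by (auto simp: S_def D_def)
    have fin: "finite S" "finite D" using finite_upto[of y] unfolding un(1) by auto
    have "T y = (\<Sum>n\<in>S. a n * ln (y / real n)) + (\<Sum>n\<in>D. a n * ln (y / real n))"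
      unfolding T_def un(1) by (rule sum.union_disjoint[OF fin un(2)])
    also have "(\<Sum>n\<in>S. a n * ln (y / real n)) = (\<Sum>n\<in>S. a n * ln (x / real n) + a n * L)"
    proof (rule sum.cong[OF refl])
      fix n assume "n \<in> S"
      hence n: "real n > 0" by (auto simp: S_def)
      have "ln (y / real n) = ln (x / real n) + L" using n x \<delta> by (simp add: y_def L_def ln_mult ln_div)
      thus "a n * ln (y / real n) = a n * ln (x / real n) + a n * L" by (simp add: distrib_left)
    qed
    also have "\<dots> = T x + A * L" by (simp add: sum.distrib T_def A_def S_def sum_distrib_right)
    finally have "A * L = T y - T x - (\<Sum>n\<in>D. a n * ln (y / real n))" by simp
    moreover have "(\<Sum>n\<in>D. a n * ln (y / real n)) \<ge> (\<Sum>n\<in>D. - (w * L))"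
    proof (rule sum_mono)
      fix n assume n: "n \<in> D"
      hence n': "real n > x" "real n \<le> y" by (auto simp: D_def)
      have l: "0 \<le> ln (y / real n)" "ln (y / real n) \<le> L"
      proof -
        show "0 \<le> ln (y / real n)" using n' x by simp
        have "y / real n \<le> y / x" using n' x xy by (intro divide_left_mono) auto
        also have "y / x = 1 + \<delta>" using x by (simp add: y_def)
        finally show "ln (y / real n) \<le> L" unfolding L_def using n' x xy \<delta> by (subst ln_le_cancel_iff) auto
      qed
      have "a n \<ge> - w" using n' x xy by (intro w) auto
      hence "a n * ln (y / real n) \<ge> (- w) * ln (y / real n)" using l by (intro mult_right_mono) auto
      moreover have "w * ln (y / real n) \<le> w * L" using l w(2) by (intro mult_left_mono) auto
      ultimately show "- (w * L) \<le> a n * ln (y / real n)" by simp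
    qed
    moreover have "(\<Sum>n\<in>D. - (w * L)) \<ge> - ((\<delta> * x + 1) * w * L)"
    proof -
      have "real (card D) \<le> y - x + 1" unfolding D_def using x xy by (intro card_between_le) auto
      also have "\<dots> = \<delta> * x + 1" by (simp add: y_def algebra_simps)
      finally have "real (card D) * (w * L) \<le> (\<delta> * x + 1) * (w * L)" using w(2) L by (intro mult_right_mono) auto
      thus ?thesis by (simp add: mult.assoc)
    qed
    moreover have "\<bar>T y\<bar> \<le> B" "\<bar>T x\<bar> \<le> B" using T[of y] T[of x] x xy by auto
    ultimately show ?thesis by linarith
  qed
  have lo: "A * L \<ge> - (2 * B + (\<delta> * x + 1) * w * L)"
  proof -
    define y where "y = x / (1 + \<delta>)"
    define S D where "S = {n::nat. 1 \<le> n \<and> real n \<le> y}" and "D = {n::nat. 1 \<le> n \<and> y < real n \<and> real n \<le> x}"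
    have y0: "y > 0" using x \<delta> by (simp add: y_def)
    have xy: "y \<le> x" "x \<le> 2 * x" using x \<delta> by (auto simp: y_def field_simps)
    have un: "{n::nat. 1 \<le> n \<and> real n \<le> x} = S \<union> D" "S \<inter> D = {}" using xy x by (auto simp: S_def D_def)
    have fin: "finite S" "finite D" using finite_upto[of x] unfolding un(1) by auto
    have Ae: "A = (\<Sum>n\<in>S. a n) + (\<Sum>n\<in>D. a n)" unfolding A_def un(1) by (rule sum.union_disjoint[OF fin un(2)])
    have "T x = (\<Sum>n\<in>S. a n * ln (x / real n)) + (\<Sum>n\<in>D. a n * ln (x / real n))"
      unfolding T_def un(1) by (rule sum.union_disjoint[OF fin un(2)])
    also have "(\<Sum>n\<in>S. a n * ln (x / real n)) = (\<Sum>n\<in>S. a n * ln (y / real n) + a n * L)"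
    proof (rule sum.cong[OF refl])
      fix n assume "n \<in> S"
      hence n: "real n > 0" by (auto simp: S_def)
      have "ln (x / real n) = ln (y / real n) + L" using n x \<delta> by (simp add: y_def L_def ln_mult ln_div)
      thus "a n * ln (x / real n) = a n * ln (y / real n) + a n * L" by (simp add: distrib_left)
    qed
    also have "\<dots> = T y + (\<Sum>n\<in>S. a n) * L" by (simp add: sum.distrib T_def S_def sum_distrib_right)
    \<comment> \<open>Here the short interval enters with the complementary weight L - ln(x/n),
      again between 0 and L, so the same one-sided bound yields the opposite inequality.\<close>
    finally have "A * L = T x - T y + (\<Sum>n\<in>D. a n * (L - ln (x / real n)))"
      unfolding Ae by (simp add: distrib_right sum_distrib_right right_diff_distrib sum_subtractf)
    moreover have "(\<Sum>n\<in>D. a n * (L - ln (x / real n))) \<ge> (\<Sum>n\<in>D. - (w * L))"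
    proof (rule sum_mono)
      fix n assume n: "n \<in> D"
      hence n': "1 \<le> n" "real n > y" "real n \<le> x" by (auto simp: D_def)
      have l: "0 \<le> L - ln (x / real n)" "L - ln (x / real n) \<le> L"
      proof -
        have "0 \<le> ln (x / real n)" using n' x by simp
        thus "L - ln (x / real n) \<le> L" by simp
        have "x / real n \<le> x / y" using n' x xy y0 by (intro divide_left_mono) auto
        also have "x / y = 1 + \<delta>" using x \<delta> by (simp add: y_def)
        finally have "ln (x / real n) \<le> ln (1 + \<delta>)" using n' x \<delta> by (subst ln_le_cancel_iff) auto
        thus "0 \<le> L - ln (x / real n)" unfolding L_def by simp
      qed
      have "a n \<ge> - w" using n' x xy by (intro w) auto
      hence "a n * (L - ln (x / real n)) \<ge> (- w) * (L - ln (x / real n))" using l by (intro mult_right_mono) auto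
      moreover have "w * (L - ln (x / real n)) \<le> w * L" using l w(2) by (intro mult_left_mono) auto
      ultimately show "- (w * L) \<le> a n * (L - ln (x / real n))" by simp
    qed
    moreover have "(\<Sum>n\<in>D. - (w * L)) \<ge> - ((\<delta> * x + 1) * w * L)"
    proof -
      have "real (card D) \<le> real (card {n::nat. y < real n \<and> real n \<le> x})"
        unfolding of_nat_le_iff D_def
        by (rule card_mono[OF finite_subset[OF _ finite_upto[of x]]]) (use y0 in auto)
      also have "\<dots> \<le> x - y + 1" using y0 xy by (intro card_between_le) auto
      also have "x - y \<le> \<delta> * x"
      proof -
        have "x * (1 - \<delta>) \<le> y"
        proof -
          have "x * (1 - \<delta>) * (1 + \<delta>) = x * (1 - \<delta>^2)" by (simp add: power2_eq_square algebra_simps)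
          also have "\<dots> \<le> x * 1" using x by (intro mult_left_mono) auto
          finally show ?thesis using \<delta> by (simp add: y_def pos_le_divide_eq)
        qed
        thus ?thesis by (simp add: algebra_simps)
      qed
      finally have "real (card D) \<le> \<delta> * x + 1" by simp
      hence "real (card D) * (w * L) \<le> (\<delta> * x + 1) * (w * L)" using w(2) L by (intro mult_right_mono) auto
      thus ?thesis by (simp add: mult.assoc)
    qed
    moreover have "\<bar>T y\<bar> \<le> B" "\<bar>T x\<bar> \<le> B" using T[of y] T[of x] x xy y0 by auto
    ultimately show ?thesis by linarith
  qed
  have B: "B \<ge> 0" using T[of x] x by auto
  have "\<bar>A\<bar> * L \<le> 2 * B + (\<delta> * x + 1) * w * L" using up lo L by (simp add: abs_if)
  hence "\<bar>A\<bar> \<le> (2 * B + (\<delta> * x + 1) * w * L) / L" using L by (simp add: pos_le_divide_eq)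
  also have "\<dots> = 2 * B / L + (\<delta> * x + 1) * w" using L by (simp add: add_divide_distrib)
  also have "2 * B / L \<le> 2 * B / (\<delta> / 2)" using L \<delta> B by (intro divide_left_mono mult_pos_pos) auto
  finally show ?thesis unfolding A_def by simp
qed

lemma ln_power_le:
  fixes x :: real assumes "x \<ge> 1"
  shows "(1 + ln x) ^ m \<le> (1 + real m) ^ m * x"
proof (cases "m = 0")
  case False
  have "ln x \<le> x powr (1 / real m) / (1 / real m)" using False assms by (intro ln_le_powr) auto
  moreover have "1 \<le> x powr (1 / real m)" using assms by (intro ge_one_powr_ge_zero) auto
  ultimately have "1 + ln x \<le> (1 + real m) * x powr (1 / real m)" by (simp add: algebra_simps)
  hence "(1 + ln x) ^ m \<le> ((1 + real m) * x powr (1 / real m)) ^ m" using assms by (intro power_mono) auto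
  also have "\<dots> = (1 + real m) ^ m * (x powr (1 / real m)) ^ m" by (rule power_mult_distrib)
  also have "(x powr (1 / real m)) ^ m = x" using False assms by (simp add: powr_power)
  finally show ?thesis .
qed (use assms in auto)

text \<open>The trivial size is x log^(2m) x, so m powers of the logarithm are saved. In
  \<open>unsmooth\<close> the choice \<delta> = (1 + log x)^(-m) balances x/\<delta> against
  \<delta> x log^(2m) x, and \<open>bcoef_nonneg\<close> supplies the one-sided bound.\<close>

lemma bcoef_sum_bound:
  obtains C where "C > 0" "\<And>q x. q > 0 \<Longrightarrow> x \<ge> 1 \<Longrightarrow>
     \<bar>\<Sum>n | 1 \<le> n \<and> real n \<le> x. (bcoef q n - 1) * ln (real n) ^ (2 * m)\<bar> \<le> C * real q ^ 2 * x * (1 + ln x) ^ m"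
proof -
  obtain C1 where C1: "C1 > 0" "\<And>q x. q > 0 \<Longrightarrow> x \<ge> 1 \<Longrightarrow>
     \<bar>\<Sum>n | 1 \<le> n \<and> real n \<le> x. (bcoef q n - 1) * ln (real n) ^ (2 * m) * ln (x / real n)\<bar> \<le> C1 * real q ^ 2 * x"
    using smoothed_bcoef_bound[of "2 * m"] by blast
  define K where "K = (1 + real m) ^ m"
  have K: "K > 0" by (auto simp: K_def intro!: zero_less_power add_pos_nonneg)
  show ?thesis
  proof (rule that[of "8 * C1 + (1 + K)"])
    show "8 * C1 + (1 + K) > 0" using C1 K by simp
    fix q :: nat and x :: real assume q: "q > 0" and x: "x \<ge> 1"
    define l where "l = 1 + ln x"
    have l: "l \<ge> 1" using x by (simp add: l_def)
    have lp: "l ^ m \<ge> 1" using l by simp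
    define \<delta> where "\<delta> = 1 / l ^ m"
    have \<delta>: "0 < \<delta>" "\<delta> \<le> 1" using lp by (auto simp: \<delta>_def)
    have q1: "real q ^ 2 \<ge> 1" using q by simp
    define a where "a = (\<lambda>n. (bcoef q n - 1) * ln (real n) ^ (2 * m))"
    have "\<bar>\<Sum>n | 1 \<le> n \<and> real n \<le> x. a n\<bar> \<le> 4 * (C1 * real q ^ 2 * (2 * x)) / \<delta> + (\<delta> * x + 1) * l ^ (2 * m)"
    proof (rule unsmooth[OF x \<delta>])
      fix n :: nat assume n: "1 \<le> n" "real n \<le> 2 * x"
      \<comment> \<open>The interval reaches up to 2x, and l = 1 + ln x dominates ln(2x) because ln
        2 < 1.\<close>
      have "ln (real n) \<le> ln (2 * x)" using n by simp
      also have "\<dots> = ln 2 + ln x" using x by (simp add: ln_mult)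
      also have "\<dots> \<le> l" using ln_2_less_1 by (simp add: l_def)
      finally have "ln (real n) ^ (2 * m) \<le> l ^ (2 * m)" using n by (intro power_mono) auto
      moreover have "(-1) * ln (real n) ^ (2 * m) \<le> a n"
        unfolding a_def using bcoef_nonneg[of q n] n by (intro mult_right_mono) auto
      ultimately show "a n \<ge> - (l ^ (2 * m))" by linarith
    next
      show "0 \<le> l ^ (2 * m)" using l by simp
      fix y :: real assume y: "0 < y" "y \<le> 2 * x"
      show "\<bar>\<Sum>n | 1 \<le> n \<and> real n \<le> y. a n * ln (y / real n)\<bar> \<le> C1 * real q ^ 2 * (2 * x)"
      proof (cases "y \<ge> 1")
        case True
        have "\<bar>\<Sum>n | 1 \<le> n \<and> real n \<le> y. a n * ln (y / real n)\<bar> \<le> C1 * real q ^ 2 * y"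
          unfolding a_def by (rule C1(2)[OF q True])
        also have "\<dots> \<le> C1 * real q ^ 2 * (2 * x)" using y C1 by (intro mult_left_mono) auto
        finally show ?thesis .
      next
        case False
        hence "{n::nat. 1 \<le> n \<and> real n \<le> y} = {}" by auto
        thus ?thesis using C1(1) x by (simp only: sum.empty) simp
      qed
    qed
    also have "4 * (C1 * real q ^ 2 * (2 * x)) / \<delta> = 8 * C1 * (real q ^ 2 * x * l ^ m)" by (simp add: \<delta>_def)
    also have "(\<delta> * x + 1) * l ^ (2 * m) = x * l ^ m + l ^ m * l ^ m"
      using lp unfolding mult_2 power_add by (simp add: \<delta>_def field_simps)
    also have "l ^ m * l ^ m \<le> K * x * l ^ m"
      using ln_power_le[OF x, of m] lp unfolding l_def[symmetric] K_def by (intro mult_right_mono) auto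
    also have "x * l ^ m + K * x * l ^ m = (1 + K) * (1 * (x * l ^ m))" by (simp add: algebra_simps)
    also have "\<dots> \<le> (1 + K) * (real q ^ 2 * (x * l ^ m))"
      using K q1 x lp by (intro mult_left_mono mult_right_mono) auto
    finally show "\<bar>\<Sum>n | 1 \<le> n \<and> real n \<le> x. (bcoef q n - 1) * ln (real n) ^ (2 * m)\<bar> \<le>
        (8 * C1 + (1 + K)) * real q ^ 2 * x * (1 + ln x) ^ m"
      by (simp add: a_def l_def algebra_simps)
  qed
qed

lemma abel_inequality:
  fixes c w :: "nat \<Rightarrow> real"
  assumes ab: "a \<le> b" and w0: "\<And>n. a \<le> n \<Longrightarrow> n \<le> b \<Longrightarrow> w n \<ge> 0"
    and dec: "\<And>n. a \<le> n \<Longrightarrow> n < b \<Longrightarrow> w (Suc n) \<le> w n"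
    and B: "\<And>j. a \<le> j \<Longrightarrow> j \<le> b \<Longrightarrow> \<bar>\<Sum>n=a..j. c n\<bar> \<le> B"
  shows "\<bar>\<Sum>n=a..b. c n * w n\<bar> \<le> B * w a"
proof -
  have id: "(\<Sum>n=a..j. c n * w n) = (\<Sum>n=a..j. c n) * w j + (\<Sum>n=a..<j. (\<Sum>i=a..n. c i) * (w n - w (Suc n)))"
    if "a \<le> j" for j
    using that
  proof (induction j rule: dec_induct)
    case (step j)
    thus ?case by (simp add: algebra_simps)
  qed auto
  have tel: "(\<Sum>n=a..<b. w n - w (Suc n)) = w a - w b" using sum_Suc_diff'[OF ab, of "\<lambda>n. - w n"] by simp
  have B0: "B \<ge> 0" using B[of a] ab by (meson abs_ge_zero order_refl order_trans)
  have "\<bar>\<Sum>n=a..b. c n * w n\<bar> \<le> \<bar>(\<Sum>n=a..b. c n) * w b\<bar> + \<bar>\<Sum>n=a..<b. (\<Sum>i=a..n. c i) * (w n - w (Suc n))\<bar>"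
    unfolding id[OF ab] by (rule abs_triangle_ineq)
  also have "\<bar>(\<Sum>n=a..b. c n) * w b\<bar> \<le> B * w b"
    unfolding abs_mult using B[of b] w0[of b] ab B0 by (intro mult_mono) auto
  also have "\<bar>\<Sum>n=a..<b. (\<Sum>i=a..n. c i) * (w n - w (Suc n))\<bar> \<le> (\<Sum>n=a..<b. B * (w n - w (Suc n)))"
  proof (rule order_trans[OF sum_abs], rule sum_mono)
    fix n assume n: "n \<in> {a..<b}"
    show "\<bar>(\<Sum>i=a..n. c i) * (w n - w (Suc n))\<bar> \<le> B * (w n - w (Suc n))"
      unfolding abs_mult using B[of n] dec[of n] n B0 by (intro mult_mono) auto
  qed
  also have "\<dots> = B * (w a - w b)" unfolding sum_distrib_left[symmetric] tel ..
  finally show ?thesis by (simp add: algebra_simps)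
qed

lemma sqrt_mult_ln_power_le:
  fixes x :: real assumes x: "x \<ge> 1"
  shows "sqrt x * (1 + ln x) ^ m \<le> (2 * (1 + real m)) ^ m * x"
proof -
  have "(1 + ln x) ^ m \<le> (2 * (1 + ln (sqrt x))) ^ m" using x by (intro power_mono) (auto simp: ln_sqrt)
  also have "\<dots> \<le> 2 ^ m * ((1 + real m) ^ m * sqrt x)"
    unfolding power_mult_distrib using x by (intro mult_left_mono ln_power_le) auto
  finally have "sqrt x * (1 + ln x) ^ m \<le> sqrt x * (2 ^ m * ((1 + real m) ^ m * sqrt x))"
    using x by (intro mult_left_mono) auto
  also have "\<dots> = 2 ^ m * (1 + real m) ^ m * (sqrt x * sqrt x)" by (simp only: mult_ac)
  finally show ?thesis using x unfolding power_mult_distrib by simp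
qed

lemma ln_ge_1: "x \<ge> 4 \<Longrightarrow> ln x \<ge> (1::real)"
  using exp_le by (subst ln_ge_iff) auto

text \<open>Partial summation against 1/log^(2m+1) n. Above sqrt x the weight is at most (2/log
  x)^(2m+1), which against log^m x leaves a saving of at least m powers; below sqrt x the sum itself
  is small enough.\<close>

lemma bcoef_div_ln_bound:
  assumes m: "m > 0"
  obtains C where "C > 0" "\<And>q x. q > 0 \<Longrightarrow> x \<ge> 4 \<Longrightarrow>
     \<bar>\<Sum>n=2..nat \<lfloor>x\<rfloor>. (bcoef q n - 1) / ln (real n)\<bar> \<le> C * real q ^ 2 * x / ln x ^ m"
proof -
  obtain C where C: "C > 0" "\<And>q x. q > 0 \<Longrightarrow> x \<ge> 1 \<Longrightarrow>
     \<bar>\<Sum>n | 1 \<le> n \<and> real n \<le> x. (bcoef q n - 1) * ln (real n) ^ (2 * m)\<bar> \<le> C * real q ^ 2 * x * (1 + ln x) ^ m"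
    using bcoef_sum_bound by blast
  define W where "W = 1 / ln 2 ^ (2 * m + 1) * (2 * (1 + real (2 * m))) ^ (2 * m)"
  define V where "V = (2::real) * 2 ^ m * 2 ^ (2 * m + 1)"
  have W: "W > 0" unfolding W_def by (intro mult_pos_pos divide_pos_pos zero_less_power) auto
  have V: "V > 0" by (simp add: V_def)
  show ?thesis
  proof (rule that[of "C * (W + V)"])
    show "C * (W + V) > 0" using C W V by (intro mult_pos_pos) auto
    fix q :: nat and x :: real assume q: "q > 0" and x: "x \<ge> 4"
    define c w where "c = (\<lambda>n. (bcoef q n - 1) * ln (real n) ^ (2 * m))" and "w = (\<lambda>n. 1 / ln (real n) ^ (2 * m + 1))"
    define l where "l = ln x"
    have l: "l \<ge> 1" using ln_ge_1[OF x] by (simp add: l_def)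
    define K where "K = (\<lambda>y. C * real q ^ 2 * y * (1 + l) ^ m)"
    have F: "\<bar>\<Sum>n=2..j. c n\<bar> \<le> K (real j)" if j: "1 \<le> j" "real j \<le> x" for j
    proof -
      have "{n. 1 \<le> n \<and> real n \<le> real j} = insert 1 {2..j}" using j by auto
      hence "(\<Sum>n | 1 \<le> n \<and> real n \<le> real j. c n) = c 1 + (\<Sum>n=2..j. c n)" by simp
      also have "c 1 = 0" using m by (simp add: c_def)
      finally have "\<bar>\<Sum>n=2..j. c n\<bar> \<le> C * real q ^ 2 * real j * (1 + ln (real j)) ^ m"
        using C(2)[OF q, of "real j"] j unfolding c_def by simp
      also have "\<dots> \<le> K (real j)" unfolding K_def l_def
        using C(1) j by (intro mult_left_mono power_mono) auto
      finally show ?thesis .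
    qed
    have Kmono: "K a \<le> K b" if "a \<le> b" for a b
      unfolding K_def using C(1) l that by (intro mult_right_mono mult_left_mono) auto
    define N M where "N = nat \<lfloor>x\<rfloor>" and "M = nat \<lfloor>sqrt x\<rfloor>"
    have s2: "sqrt x \<ge> 2" using x by (intro real_le_rsqrt) auto
    have sx: "sqrt x * sqrt x = x" using x by simp
    have M: "2 \<le> M" "real M \<le> sqrt x" "real (M + 1) \<ge> sqrt x"
      using s2 unfolding M_def by (auto simp: le_nat_floor) linarith+
    have N: "real N \<le> x" using x unfolding N_def by linarith
    have MN: "M + 1 \<le> N"
    proof -
      have "real (M + 1) \<le> 2 * real M" using M by simp
      also have "\<dots> \<le> sqrt x * sqrt x" using M s2 x by (intro mult_mono) auto
      finally show ?thesis unfolding N_def sx using le_nat_floor by blast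
    qed
    have wdec: "w (Suc n) \<le> w n" if "n \<ge> 2" for n
      unfolding w_def using that by (intro divide_left_mono power_mono mult_pos_pos zero_less_power) auto
    have w0: "w n \<ge> 0" if "n \<ge> 2" for n unfolding w_def using that by simp
    have cw: "(bcoef q n - 1) / ln (real n) = c n * w n" if "n \<ge> 2" for n
      using that by (simp add: c_def w_def)
    have "(\<Sum>n=2..N. (bcoef q n - 1) / ln (real n)) = (\<Sum>n=2..N. c n * w n)"
      by (rule sum.cong) (auto simp: cw)
    also have "\<dots> = (\<Sum>n\<in>{2..M} \<union> {M+1..N}. c n * w n)" using M MN by (intro sum.cong) auto
    also have "\<dots> = (\<Sum>n=2..M. c n * w n) + (\<Sum>n=M+1..N. c n * w n)" by (rule sum.union_disjoint) auto
    finally have eN: "(\<Sum>n=2..N. (bcoef q n - 1) / ln (real n)) = (\<Sum>n=2..M. c n * w n) + (\<Sum>n=M+1..N. c n * w n)" .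
    have "\<bar>\<Sum>n=2..N. (bcoef q n - 1) / ln (real n)\<bar> \<le> \<bar>\<Sum>n=2..M. c n * w n\<bar> + \<bar>\<Sum>n=M+1..N. c n * w n\<bar>"
      unfolding eN by (rule abs_triangle_ineq)
    also have "\<bar>\<Sum>n=2..M. c n * w n\<bar> \<le> K (sqrt x) * w 2"
    proof (rule abel_inequality)
      fix j assume j: "2 \<le> j" "j \<le> M"
      have "real j \<le> sqrt x" using j M by linarith
      moreover have "real j \<le> x" using j MN N by linarith
      ultimately show "\<bar>\<Sum>n=2..j. c n\<bar> \<le> K (sqrt x)" using F[of j] Kmono[of "real j" "sqrt x"] j by linarith
    qed (use M w0 wdec in auto)
    also have "\<bar>\<Sum>n=M+1..N. c n * w n\<bar> \<le> (2 * K x) * w (M + 1)"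
    proof (rule abel_inequality[OF MN])
      fix j assume j: "M + 1 \<le> j" "j \<le> N"
      have "{2..j} = {2..M} \<union> {M+1..j}" using M j by auto
      hence "(\<Sum>n=2..j. c n) = (\<Sum>n=2..M. c n) + (\<Sum>n=M+1..j. c n)" by (metis sum.union_disjoint finite_atLeastAtMost ivl_disj_int_two(8) Suc_eq_plus1 atLeastSucAtMost_greaterThanAtMost)
      moreover have "\<bar>\<Sum>n=2..j. c n\<bar> \<le> K x" using F[of j] Kmono[of "real j" x] j N M by linarith
      moreover have "\<bar>\<Sum>n=2..M. c n\<bar> \<le> K x" using F[of M] Kmono[of "real M" x] j N M by linarith
      ultimately show "\<bar>\<Sum>n=M+1..j. c n\<bar> \<le> 2 * K x" by linarith
    qed (use M w0 wdec in auto)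
    also have "K (sqrt x) * w 2 \<le> C * real q ^ 2 * (W * (x / l ^ m))"
    proof -
      have "sqrt x * (1 + l) ^ m * l ^ m \<le> sqrt x * (1 + l) ^ m * (1 + l) ^ m"
        using l x by (intro mult_left_mono power_mono) auto
      also have "\<dots> = sqrt x * (1 + ln x) ^ (2 * m)" by (simp add: l_def mult_2 power_add)
      also have "\<dots> \<le> (2 * (1 + real (2 * m))) ^ (2 * m) * x" using x by (intro sqrt_mult_ln_power_le) auto
      finally have "sqrt x * (1 + l) ^ m \<le> (2 * (1 + real (2 * m))) ^ (2 * m) * x / l ^ m"
        using l by (subst pos_le_divide_eq) auto
      hence "w 2 * (sqrt x * (1 + l) ^ m) \<le> w 2 * ((2 * (1 + real (2 * m))) ^ (2 * m) * x / l ^ m)"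
        using w0[of 2] by (intro mult_left_mono) auto
      also have "\<dots> = W * (x / l ^ m)" by (simp add: W_def w_def)
      finally have "C * real q ^ 2 * (w 2 * (sqrt x * (1 + l) ^ m)) \<le> C * real q ^ 2 * (W * (x / l ^ m))"
        using C(1) by (intro mult_left_mono) auto
      thus ?thesis unfolding K_def by (simp only: mult_ac)
    qed
    also have "(2 * K x) * w (M + 1) \<le> C * real q ^ 2 * (V * (x / l ^ m))"
    proof -
      have "l / 2 = ln (sqrt x)" using x by (simp add: ln_sqrt l_def)
      also have "\<dots> \<le> ln (real (M + 1))" using M s2 x by (subst ln_le_cancel_iff) auto
      finally have "w (M + 1) \<le> 1 / (l / 2) ^ (2 * m + 1)"
        unfolding w_def using l M by (intro divide_left_mono power_mono mult_pos_pos zero_less_power) auto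
      also have "\<dots> = 2 ^ (2 * m + 1) / (l ^ m * (l ^ m * l))" unfolding power_divide mult_2 power_add by simp
      also have "\<dots> \<le> 2 ^ (2 * m + 1) / (l ^ m * (l ^ m * 1))"
        using l by (intro divide_left_mono mult_left_mono mult_pos_pos zero_less_power) auto
      finally have w: "w (M + 1) \<le> 2 ^ (2 * m + 1) / (l ^ m * l ^ m)" by simp
      have "(1 + l) ^ m \<le> (2 * l) ^ m" using l by (intro power_mono) auto
      hence "(1 + l) ^ m * w (M + 1) \<le> (2 * l) ^ m * (2 ^ (2 * m + 1) / (l ^ m * l ^ m))"
        using l w w0[of "M+1"] M by (intro mult_mono) auto
      also have "\<dots> = 2 ^ m * 2 ^ (2 * m + 1) / l ^ m" using l by (simp add: power_mult_distrib)
      finally have "2 * C * real q ^ 2 * x * ((1 + l) ^ m * w (M + 1)) \<le> 2 * C * real q ^ 2 * x * (2 ^ m * 2 ^ (2 * m + 1) / l ^ m)"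
        using C(1) x by (intro mult_left_mono) auto
      also have "\<dots> = C * real q ^ 2 * (V * (x / l ^ m))" by (simp add: V_def)
      finally show ?thesis unfolding K_def by (simp only: mult_ac)
    qed
    finally show "\<bar>\<Sum>n=2..nat \<lfloor>x\<rfloor>. (bcoef q n - 1) / ln (real n)\<bar> \<le> C * (W + V) * real q ^ 2 * x / ln x ^ m"
      unfolding N_def l_def by (simp add: algebra_simps add_divide_distrib)
  qed
qed

section \<open>From prime powers to primes, and comparison with Li\<close>

lemma Li_increment:
  assumes "2 \<le> a" "a \<le> b"
  shows "(b - a) / ln b \<le> Li b - Li a" "Li b - Li a \<le> (b - a) / ln a"
proof -
  have i: "(\<lambda>t. 1 / ln t) integrable_on {u..v}" if "u \<ge> 2" for u v :: real
    using that by (intro integrable_continuous_interval continuous_intros) auto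
  have "Li a + integral {a..b} (\<lambda>t. 1 / ln t) = Li b"
    unfolding Li_def using assms by (intro Henstock_Kurzweil_Integration.integral_combine i) auto
  moreover have "integral {a..b} (\<lambda>t. 1 / ln b) \<le> integral {a..b} (\<lambda>t. 1 / ln t)"
    using assms by (intro integral_le i integrable_const_ivl divide_left_mono) auto
  moreover have "integral {a..b} (\<lambda>t. 1 / ln t) \<le> integral {a..b} (\<lambda>t. 1 / ln a)"
    using assms by (intro integral_le i integrable_const_ivl divide_left_mono) auto
  ultimately show "(b - a) / ln b \<le> Li b - Li a" "Li b - Li a \<le> (b - a) / ln a" using assms by simp_all
qed

lemma Li_2: "Li 2 = 0" by (simp add: Li_def)

lemma inverse_ln_le_2: "x \<ge> 2 \<Longrightarrow> 1 / ln x \<le> (2::real)"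
proof -
  assume x: "x \<ge> 2"
  have "1 / 2 \<le> ln (2::real)" using ln_one_plus_ge_half[of 1] by simp
  also have "\<dots> \<le> ln x" using x by simp
  finally show ?thesis by (simp add: field_simps)
qed

lemma Li_bounds: assumes "x \<ge> 2" shows "0 \<le> Li x" "Li x \<le> 2 * x"
proof -
  have "0 \<le> (x - 2) / ln x" using assms by simp
  thus "0 \<le> Li x" using Li_increment(1)[of 2 x] assms Li_2 by linarith
  have "Li x \<le> (x - 2) * (1 / ln 2)" using Li_increment(2)[of 2 x] assms Li_2 by simp
  also have "\<dots> \<le> (x - 2) * 2" using assms inverse_ln_le_2[of 2] by (intro mult_left_mono) auto
  finally show "Li x \<le> 2 * x" by simp
qed

text \<open>Each step adds 1/log(N+1) and subtracts an integral between 1/log(N+1) and 1/log N. So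
  the difference decreases but never falls below 1/log N, and the induction carries both
  bounds.\<close>

lemma sum_inverse_ln_minus_Li:
  assumes x: "x \<ge> 2"
  shows "\<bar>(\<Sum>n=2..nat \<lfloor>x\<rfloor>. 1 / ln (real n)) - Li x\<bar> \<le> 2"
proof -
  define D where "D = (\<lambda>N. (\<Sum>n=2..N. 1 / ln (real n)) - Li (real N))"
  have D: "1 / ln (real N) \<le> D N \<and> D N \<le> 1 / ln 2" if "N \<ge> 2" for N
    using that
  proof (induction N rule: dec_induct)
    case base show ?case by (simp add: D_def Li_2)
  next
    case (step N)
    have "D (Suc N) = D N + 1 / ln (real (Suc N)) - (Li (real (Suc N)) - Li (real N))"
      using step by (simp add: D_def)
    moreover have "1 / ln (real (Suc N)) \<le> Li (real (Suc N)) - Li (real N)" "Li (real (Suc N)) - Li (real N) \<le> 1 / ln (real N)"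
      using Li_increment[of "real N" "real (Suc N)"] step by auto
    ultimately show ?case using step by linarith
  qed
  define N where "N = nat \<lfloor>x\<rfloor>"
  have N: "N \<ge> 2" "real N \<le> x" "x \<le> real N + 1" using x unfolding N_def by (auto simp: le_nat_floor)
  have "(x - real N) / ln x \<ge> 0" "(x - real N) / ln (real N) \<le> 1 / ln (real N)"
    using N by (auto intro!: divide_right_mono)
  hence "0 \<le> Li x - Li (real N)" "Li x - Li (real N) \<le> 1 / ln (real N)"
    using Li_increment[of "real N" x] N by linarith+
  moreover have "1 / ln (2::real) \<le> 2" by (rule inverse_ln_le_2) simp
  ultimately show ?thesis using D[OF N(1)] unfolding D_def N_def[symmetric] by linarith
qed

text \<open>Such an n is p^j with j \<ge> 2, so p \<le> sqrt x, and 2^j \<le> x gives j \<le> 2 log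
  x.\<close>

lemma card_proper_prime_powers_le:
  fixes x :: real assumes x: "x \<ge> 1"
  shows "real (card {n. 2 \<le> n \<and> real n \<le> x \<and> primepow n \<and> \<not> prime n}) \<le> 6 * (sqrt x * (1 + ln x))"
proof -
  define M J where "M = nat \<lfloor>sqrt x\<rfloor>" and "J = nat \<lfloor>2 * ln x\<rfloor>"
  have "{n. 2 \<le> n \<and> real n \<le> x \<and> primepow n \<and> \<not> prime n} \<subseteq> (\<lambda>(p,j). p ^ j) ` ({..M} \<times> {..J})"
  proof safe
    fix n :: nat assume n: "2 \<le> n" "real n \<le> x" "primepow n" "\<not> prime n"
    then obtain p j where pj: "prime p" "j > 0" "n = p ^ j" by (auto simp: primepow_def)
    have "j \<noteq> 1" using n pj by auto
    hence j2: "j \<ge> 2" using pj by simp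
    have p2: "real p \<ge> 2" using prime_ge_2_nat[OF pj(1)] by simp
    have "real p ^ 2 \<le> real p ^ j" using p2 j2 by (intro power_increasing) auto
    also have "\<dots> \<le> x" using n pj by simp
    finally have "p \<in> {..M}" unfolding M_def by (auto intro!: le_nat_floor real_le_rsqrt)
    moreover have "j \<in> {..J}"
    proof -
      have "real j * (1 / 2) \<le> real j * ln (real p)"
        using order_trans[OF ln_one_plus_ge_half[of 1], of "ln (real p)"] p2 by (intro mult_left_mono) auto
      also have "\<dots> = ln (real n)" using pj p2 by (simp add: ln_realpow)
      also have "\<dots> \<le> ln x" using n by simp
      finally show ?thesis unfolding J_def by (auto intro!: le_nat_floor)
    qed
    ultimately show "n \<in> (\<lambda>(p,j). p ^ j) ` ({..M} \<times> {..J})" using pj by auto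
  qed
  hence "card {n. 2 \<le> n \<and> real n \<le> x \<and> primepow n \<and> \<not> prime n} \<le> card ({..M} \<times> {..J})"
    by (rule surj_card_le[rotated]) auto
  also have "\<dots> = (M + 1) * (J + 1)" by simp
  finally have "real (card {n. 2 \<le> n \<and> real n \<le> x \<and> primepow n \<and> \<not> prime n}) \<le> real (M + 1) * real (J + 1)"
    unfolding of_nat_mult[symmetric] of_nat_le_iff .
  also have "\<dots> \<le> (2 * sqrt x) * (3 * (1 + ln x))"
  proof (intro mult_mono)
    have "real M \<le> sqrt x" unfolding M_def using x by simp
    moreover have "1 \<le> sqrt x" using x by simp
    ultimately show "real (M + 1) \<le> 2 * sqrt x" by linarith
    have l: "ln x \<ge> 0" using x by simp
    hence "real J \<le> 2 * ln x" unfolding J_def by simp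
    thus "real (J + 1) \<le> 3 * (1 + ln x)" using l by simp
  qed (use x in auto)
  also have "\<dots> = 6 * (sqrt x * (1 + ln x))" by simp
  finally show ?thesis .
qed

text \<open>At the primes counted, \<open>bcoef q n / ln (real n)\<close> is the totient of q.
  Elsewhere it is a nonnegative error supported on proper prime powers and primes dividing q, of
  which there are few.\<close>

theorem primes_1_mod:
  obtains C where "C > 0" "\<And>q x. q > 0 \<Longrightarrow> x \<ge> 4 \<Longrightarrow>
     \<bar>real (card {p. prime p \<and> real p \<le> x \<and> [p = 1] (mod q)}) - Li x / real (totient q)\<bar> \<le> C * real q ^ 2 * (x / ln x ^ m)"
proof -
  \<comment> \<open>\<open>bcoef_div_ln_bound\<close> asks for m > 0; an arbitrary m follows from m
    + 1 because ln x \<ge> 1.\<close>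
  have main: thesis if m: "m > 0" and thesis: "\<And>C. C > 0 \<Longrightarrow> (\<And>q x. q > 0 \<Longrightarrow> x \<ge> 4 \<Longrightarrow>
     \<bar>real (card {p. prime p \<and> real p \<le> x \<and> [p = 1] (mod q)}) - Li x / real (totient q)\<bar> \<le> C * real q ^ 2 * (x / ln x ^ m)) \<Longrightarrow> thesis"
    for m thesis
  proof -
    obtain C where C: "C > 0" "\<And>q x. q > 0 \<Longrightarrow> x \<ge> 4 \<Longrightarrow>
       \<bar>\<Sum>n=2..nat \<lfloor>x\<rfloor>. (bcoef q n - 1) / ln (real n)\<bar> \<le> C * real q ^ 2 * x / ln x ^ m"
      using bcoef_div_ln_bound[OF m] by blast
    define B where "B = (2 * (1 + real (m + 1))) ^ (m + 1)"
    define B' where "B' = (1 + real m) ^ m"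
    have B: "B > 0" "B' > 0" unfolding B_def B'_def by (auto intro!: zero_less_power)
    show thesis
    proof (rule thesis[of "C + 12 * B + 3 * B'"])
      show "C + 12 * B + 3 * B' > 0" using C B by simp
      fix q :: nat and x :: real assume q: "q > 0" and x: "x \<ge> 4"
      define l X where "l = ln x" and "X = x / l ^ m"
      have l: "l \<ge> 1" using ln_ge_1[OF x] by (simp add: l_def)
      have X0: "X > 0" using x l by (simp add: X_def)
      \<comment> \<open>X = x / l^m is bounded below by a positive constant, so bounded errors are
        absorbed into it.\<close>
      have X1: "1 \<le> B' * X"
      proof -
        have "l ^ m \<le> (1 + ln x) ^ m" unfolding l_def[symmetric] using l by (intro power_mono) auto
        also have "\<dots> \<le> B' * x" unfolding B'_def using x by (intro ln_power_le) auto
        finally show ?thesis using l by (simp add: X_def pos_le_divide_eq)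
      qed
      define N where "N = nat \<lfloor>x\<rfloor>"
      have N: "real n \<le> x \<longleftrightarrow> n \<le> N" for n unfolding N_def using x by (simp add: le_nat_iff le_floor_iff)
      define P where "P = {p. prime p \<and> real p \<le> x \<and> [p = 1] (mod q)}"
      define PP where "PP = {n. 2 \<le> n \<and> real n \<le> x \<and> primepow n \<and> \<not> prime n}"
      define Q where "Q = {p. prime p \<and> p dvd q}"
      have PP: "real (card PP) \<le> 6 * B * X"
      proof -
        have "sqrt x * (1 + ln x) * l ^ m \<le> sqrt x * (1 + ln x) * (1 + ln x) ^ m"
          unfolding l_def[symmetric] using x l by (intro mult_left_mono power_mono) auto
        also have "\<dots> = sqrt x * (1 + ln x) ^ (m + 1)" by simp
        also have "\<dots> \<le> B * x" unfolding B_def using x by (intro sqrt_mult_ln_power_le) auto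
        finally have "sqrt x * (1 + ln x) \<le> B * X" using l by (simp add: X_def pos_le_divide_eq)
        thus ?thesis using card_proper_prime_powers_le[of x] x unfolding PP_def by simp
      qed
      have Qf: "Q \<subseteq> {1..q}" using q by (auto simp: Q_def dvd_imp_le prime_gt_0_nat Suc_leI)
      have Q: "real (card Q) \<le> real q" "finite Q"
        using card_mono[OF _ Qf] finite_subset[OF Qf] by auto
      define \<phi> where "\<phi> = real (totient q)"
      have \<phi>: "1 \<le> \<phi>" "\<phi> \<le> real q" using q totient_le[of q] by (auto simp: \<phi>_def Suc_leI)
      define r where "r = (\<lambda>n. bcoef q n / ln (real n) - (if n \<in> P then \<phi> else 0))"
      have r: "0 \<le> r n \<and> r n \<le> (if n \<in> PP then \<phi> + 1 else 0) + (if n \<in> Q then 1 else 0)" if n: "n \<in> {2..N}" for n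
      proof (cases "prime n")
        case True
        have l0: "ln (real n) > 0" using n by simp
        have co: "coprime n q" if "[n = 1] (mod q)"
          using that cong_imp_coprime[of 1 n q] by (auto simp: cong_sym)
        have "coprime n q \<longleftrightarrow> \<not> n dvd q" using True
          using coprime_absorb_left not_prime_unit prime_imp_coprime by blast
        thus ?thesis using True n N l0 co
          by (auto simp: r_def P_def Q_def PP_def bcoef_def \<phi>_def)
      next
        case False
        define v where "v = mangoldt n / ln (real n)"
        have v: "0 \<le> v" "v \<le> 1" "v = 0 \<or> n \<in> PP"
          using mangoldt_over_ln[of n] False n N by (auto simp: v_def PP_def mangoldt_def)
        have rn: "r n = (if [n = 1] (mod q) then \<phi> * v else 0) + (if coprime n q then 0 else v)"
          using False by (simp add: r_def P_def bcoef_def \<phi>_def v_def add_divide_distrib)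
        define u where "u = \<phi> * v"
        have "u \<le> \<phi>" "0 \<le> u" "v = 0 \<longrightarrow> u = 0" using v \<phi> by (auto simp: mult_left_le u_def)
        thus ?thesis unfolding rn u_def[symmetric] using v \<phi> by auto
      qed
      have sub: "P \<subseteq> {2..N}" "PP \<subseteq> {2..N}" using N by (auto simp: P_def PP_def prime_ge_2_nat)
      have R0: "0 \<le> (\<Sum>n=2..N. r n)" using r by (intro sum_nonneg) auto
      have "(\<Sum>n=2..N. r n) \<le> (\<Sum>n=2..N. (if n \<in> PP then \<phi> + 1 else 0) + (if n \<in> Q then 1 else 0))"
        using r by (intro sum_mono) auto
      also have "\<dots> = (\<phi> + 1) * real (card PP) + real (card ({2..N} \<inter> Q))"
        using Int_absorb1[OF sub(2)] by (simp add: sum.distrib sum.If_cases)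
      also have "\<dots> \<le> (\<phi> + 1) * (6 * B * X) + real q"
      proof (intro add_mono mult_left_mono PP)
        have "card ({2..N} \<inter> Q) \<le> card Q" using Q by (intro card_mono) auto
        thus "real (card ({2..N} \<inter> Q)) \<le> real q" using Q by linarith
      qed (use \<phi> in auto)
      finally have R1: "(\<Sum>n=2..N. r n) \<le> (\<phi> + 1) * (6 * B * X) + real q" .
      have eq: "\<phi> * real (card P) - Li x = (\<Sum>n=2..N. (bcoef q n - 1) / ln (real n)) + ((\<Sum>n=2..N. 1 / ln (real n)) - Li x) - (\<Sum>n=2..N. r n)"
        using sub by (simp add: r_def sum_subtractf diff_divide_distrib sum.If_cases Int_absorb1)
      have b1: "\<bar>\<Sum>n=2..N. (bcoef q n - 1) / ln (real n)\<bar> \<le> C * real q ^ 2 * X"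
        using C(2)[OF q x] unfolding N_def X_def l_def by simp
      have b2: "\<bar>(\<Sum>n=2..N. 1 / ln (real n)) - Li x\<bar> \<le> 2" unfolding N_def using x by (intro sum_inverse_ln_minus_Li) auto
      have q1: "1 \<le> real q ^ 2" "real q \<le> real q ^ 2" 
        using q one_le_power[of "real q" 2] power_increasing[of 1 2 "real q"] by auto
      have b3: "(\<phi> + 1) * (6 * B * X) \<le> (2 * real q ^ 2) * (6 * B * X)"
      proof (rule mult_right_mono)
        show "\<phi> + 1 \<le> 2 * real q ^ 2" using \<phi> q1 by linarith
      qed (use B X0 in auto)
      have b4: "real q ^ 2 * 1 \<le> real q ^ 2 * (B' * X)" using X1 by (intro mult_left_mono) auto
      have "\<bar>\<phi> * real (card P) - Li x\<bar> \<le> C * real q ^ 2 * X + 2 + ((\<phi> + 1) * (6 * B * X) + real q)"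
        using eq b1 b2 R0 R1 by linarith
      also have "\<dots> \<le> C * real q ^ 2 * X + (2 * real q ^ 2) * (6 * B * X) + 3 * (real q ^ 2 * (B' * X))"
        using b3 b4 q1 by linarith
      also have "\<dots> = (C + 12 * B + 3 * B') * real q ^ 2 * X" by (simp add: algebra_simps)
      finally have "\<bar>\<phi> * real (card P) - Li x\<bar> \<le> (C + 12 * B + 3 * B') * real q ^ 2 * X" .
      moreover have "\<bar>real (card P) - Li x / \<phi>\<bar> = \<bar>\<phi> * real (card P) - Li x\<bar> / \<phi>"
      proof -
        have "real (card P) - Li x / \<phi> = (\<phi> * real (card P) - Li x) / \<phi>" using \<phi> by (simp add: field_simps)
        thus ?thesis using \<phi> by simp
      qed
      moreover have "\<bar>\<phi> * real (card P) - Li x\<bar> / \<phi> \<le> \<bar>\<phi> * real (card P) - Li x\<bar> / 1"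
        using \<phi> by (intro divide_left_mono) auto
      ultimately show "\<bar>real (card {p. prime p \<and> real p \<le> x \<and> [p = 1] (mod q)}) - Li x / real (totient q)\<bar> \<le> (C + 12 * B + 3 * B') * real q ^ 2 * (x / ln x ^ m)"
        unfolding P_def \<phi>_def X_def l_def by simp
    qed
  qed
  show ?thesis
  proof (rule main[of "Suc m"])
    fix C :: real assume C: "C > 0" and b: "\<And>q x. q > 0 \<Longrightarrow> x \<ge> 4 \<Longrightarrow>
     \<bar>real (card {p. prime p \<and> real p \<le> x \<and> [p = 1] (mod q)}) - Li x / real (totient q)\<bar> \<le> C * real q ^ 2 * (x / ln x ^ Suc m)"
    show thesis
    proof (rule that[OF C])
      fix q :: nat and x :: real assume q: "q > 0" and x: "x \<ge> 4"
      have l: "ln x \<ge> 1" by (rule ln_ge_1[OF x])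
      have "x / ln x ^ Suc m \<le> x / ln x ^ m"
        using l x by (intro divide_left_mono power_increasing mult_pos_pos zero_less_power) auto
      hence "C * real q ^ 2 * (x / ln x ^ Suc m) \<le> C * real q ^ 2 * (x / ln x ^ m)"
        using C by (intro mult_left_mono) auto
      thus "\<bar>real (card {p. prime p \<and> real p \<le> x \<and> [p = 1] (mod q)}) - Li x / real (totient q)\<bar> \<le> C * real q ^ 2 * (x / ln x ^ m)"
        using b[OF q x] by linarith
    qed
  qed simp
qed

section \<open>Ramanujan sums as divisor sums\<close>

text \<open>A divisor of n is a choice of an exponent j \<le> \<open>multiplicity p n\<close> for
  each prime factor p. As f p 0 = 1, primes absent from d may be included, and the sum over choices
  factors.\<close>

lemma sum_divisors_prod_prime_factors:
  fixes f :: "nat \<Rightarrow> nat \<Rightarrow> 'a :: comm_semiring_1"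
  assumes n: "n > 0" and f0: "\<And>p. f p 0 = 1"
  shows "(\<Sum>d | d dvd n. \<Prod>p\<in>prime_factors d. f p (multiplicity p d)) =
         (\<Prod>p\<in>prime_factors n. \<Sum>j\<le>multiplicity p n. f p j)"
proof -
  define S where "S = prime_factors n"
  have S: "finite S" "\<And>p. p \<in> S \<Longrightarrow> prime p" by (auto simp: S_def)
  define E where "E = PiE S (\<lambda>p. {..multiplicity p n})"
  have mult: "multiplicity p (\<Prod>p\<in>S. p ^ g p) = (if p \<in> S then g p else 0)" if "prime p" for p g
    using S that by (rule multiplicity_prod_prime_powers)
  have sub: "prime_factors d \<subseteq> S" if "d dvd n" for d
    using that n by (auto simp: S_def dvd_prime_factors)
  have m0: "multiplicity p d = 0" if "p \<in> S - prime_factors d" "d dvd n" for p d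
    using that n S(2)[of p] by (auto simp: prime_factors_multiplicity)
  have pe: "(\<Prod>p\<in>S. p ^ multiplicity p d) = d" if d: "d dvd n" for d
  proof -
    have "d > 0" using d n by (auto intro: Nat.gr0I)
    hence "d = (\<Prod>p\<in>prime_factors d. p ^ multiplicity p d)" by (rule prime_factorization_nat)
    also have "\<dots> = (\<Prod>p\<in>S. p ^ multiplicity p d)"
      by (rule prod.mono_neutral_left[OF S(1) sub[OF d]]) (auto simp: m0[OF _ d])
    finally show ?thesis ..
  qed
  have "(\<Sum>d | d dvd n. \<Prod>p\<in>prime_factors d. f p (multiplicity p d)) = (\<Sum>d | d dvd n. \<Prod>p\<in>S. f p (multiplicity p d))"
    by (intro sum.cong refl prod.mono_neutral_left[OF S(1) sub]) (auto simp: m0 f0)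
  also have "\<dots> = (\<Sum>g\<in>E. \<Prod>p\<in>S. f p (g p))"
  proof (rule sum.reindex_bij_witness[of _ "\<lambda>g. \<Prod>p\<in>S. p ^ g p" "\<lambda>d. restrict (\<lambda>p. multiplicity p d) S"])
    fix d assume d: "d \<in> {d. d dvd n}"
    show "(\<Prod>p\<in>S. p ^ restrict (\<lambda>p. multiplicity p d) S p) = d" using pe[of d] d by simp
    show "restrict (\<lambda>p. multiplicity p d) S \<in> E" using d n by (auto simp: E_def intro: dvd_imp_multiplicity_le)
    show "(\<Prod>p\<in>S. f p (restrict (\<lambda>p. multiplicity p d) S p)) = (\<Prod>p\<in>S. f p (multiplicity p d))" by simp
  next
    fix g assume g: "g \<in> E"
    show "restrict (\<lambda>p. multiplicity p (\<Prod>p\<in>S. p ^ g p)) S = g"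
    proof (rule ext)
      fix p show "restrict (\<lambda>p. multiplicity p (\<Prod>p\<in>S. p ^ g p)) S p = g p"
      proof (cases "p \<in> S")
        case True thus ?thesis using mult[OF S(2)[OF True], of g] by simp
      next
        case False thus ?thesis using PiE_arb[OF g[unfolded E_def] False] by simp
      qed
    qed
    have "(\<Prod>p\<in>S. p ^ g p) dvd n"
    proof (rule multiplicity_le_imp_dvd)
      show "(\<Prod>p\<in>S. p ^ g p) \<noteq> 0" using S(2) by (auto simp: prod_zero_iff[OF S(1)] dest!: S(2))
      fix p :: nat assume "prime p"
      thus "multiplicity p (\<Prod>p\<in>S. p ^ g p) \<le> multiplicity p n" unfolding mult[OF \<open>prime p\<close>]
        using g by (auto simp: E_def)
    qed
    thus "(\<Prod>p\<in>S. p ^ g p) \<in> {d. d dvd n}" by simp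
  qed
  also have "\<dots> = (\<Prod>p\<in>S. \<Sum>j\<le>multiplicity p n. f p j)"
    unfolding E_def by (rule prod_sum_PiE[symmetric]) (use S in auto)
  finally show ?thesis by (simp add: S_def)
qed

lemma sum_roots_of_unity:
  assumes n: "n > 0"
  shows "(\<Sum>j=1..n. exp (2 * of_real pi * \<i> * of_nat j * of_nat k / of_nat n)) = (if n dvd k then of_nat n else 0)"
proof -
  define z where "z = exp (2 * of_real pi * \<i> * of_nat k / of_nat n)"
  have zj: "exp (2 * of_real pi * \<i> * of_nat j * of_nat k / of_nat n) = z ^ j" for j
    unfolding z_def exp_of_nat_mult[symmetric] by (simp add: mult_ac)
  have z1: "z = 1 \<longleftrightarrow> n dvd k"
  proof
    assume "z = 1"
    then obtain m :: int where "2 * pi * real k / real n = of_int (2 * m) * pi"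
      unfolding z_def exp_eq_1 by (auto simp: mult_ac)
    hence "real k = of_int m * real n" using n by (simp add: field_simps)
    hence "int k = m * int n" by (metis of_int_eq_iff of_int_mult of_int_of_nat_eq)
    thus "n dvd k" by (metis dvd_triv_right int_dvd_int_iff)
  next
    assume "n dvd k"
    then obtain m where "k = n * m" by blast
    thus "z = 1" unfolding z_def exp_eq_1 using n by (auto intro!: exI[of _ "int m"])
  qed
  have zn: "z ^ n = 1"
  proof -
    have "z ^ n = exp (of_nat n * (2 * of_real pi * \<i> * of_nat k / of_nat n))" unfolding z_def exp_of_nat_mult ..
    also have "of_nat n * (2 * of_real pi * \<i> * of_nat k / of_nat n) = 2 * of_real pi * \<i> * of_nat k" using n by simp
    also have "exp \<dots> = 1" unfolding exp_eq_1 by (auto intro!: exI[of _ "int k"])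
    finally show ?thesis .
  qed
  have "(\<Sum>j=1..n. z ^ j) = z * (\<Sum>j<n. z ^ j)"
    unfolding sum_distrib_left by (rule sum.reindex_bij_witness[of _ Suc "\<lambda>j. j - 1"]) (auto simp flip: power_Suc)
  also have "\<dots> = (if n dvd k then of_nat n else 0)"
  proof (cases "z = 1")
    case False
    thus ?thesis using z1 zn by (simp add: geometric_sum)
  qed (use z1 in auto)
  finally show ?thesis by (simp add: zj)
qed

text \<open>Sorting the fractions j/n by their denominator in lowest terms turns the sum over d | n
  into the full sum over the n-th roots of unity.\<close>

lemma ramanujan_sum_divisors:
  assumes n: "n > 0"
  shows "(\<Sum>d | d dvd n. ramanujan_sum d k) = (if n dvd k then of_nat n else 0)"
proof -
  define w where "w = (\<lambda>j n. exp (2 * of_real pi * \<i> * of_nat j * of_nat k / of_nat n) :: complex)"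
  define R where "R = (\<lambda>d::nat. {j. 1 \<le> j \<and> j \<le> d \<and> coprime j d})"
  have "(\<Sum>d | d dvd n. ramanujan_sum d k) = (\<Sum>(d, j)\<in>Sigma {d. d dvd n} R. w j d)"
    unfolding ramanujan_sum_def w_def R_def using n by (intro sum.Sigma) auto
  also have "\<dots> = (\<Sum>j=1..n. w j n)"
  proof (rule sum.reindex_bij_witness[of _ "\<lambda>j. (n div gcd j n, j div gcd j n)" "\<lambda>(d, j). j * (n div d)"])
    fix x assume "x \<in> Sigma {d. d dvd n} R"
    then obtain d j where x: "x = (d, j)" "d dvd n" "1 \<le> j" "j \<le> d" "coprime j d" by (auto simp: R_def)
    obtain e where e: "n = d * e" using x by blast
    have de: "d > 0" "e > 0" using n e by auto
    have g: "gcd (j * e) (d * e) = e"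
      unfolding mult.commute[of _ e] gcd_mult_distrib_nat[symmetric] using x(5) by simp
    show "(\<lambda>j. (n div gcd j n, j div gcd j n)) (case x of (d, j) \<Rightarrow> j * (n div d)) = x"
      using de g by (simp add: x(1) e)
    show "(case x of (d, j) \<Rightarrow> j * (n div d)) \<in> {1..n}" using x de by (auto simp: e)
    show "w (case x of (d, j) \<Rightarrow> j * (n div d)) n = (case x of (d, j) \<Rightarrow> w j d)"
      using de by (simp add: x(1) e w_def mult_ac)
  next
    fix j assume j: "j \<in> {1..n}"
    define g where "g = gcd j n"
    have g: "g > 0" "g dvd j" "g dvd n" using n by (auto simp: g_def)
    obtain a b where ab: "j = g * a" "n = g * b" using g by (auto elim!: dvdE)
    have "coprime (j div g) (n div g)" unfolding g_def using n by (intro div_gcd_coprime) auto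
    moreover have "j div g = a" "n div g = b" using g(1) by (simp_all add: ab)
    ultimately have cop: "coprime a b" by simp
    show "(\<lambda>(d, j). j * (n div d)) (n div gcd j n, j div gcd j n) = j"
      unfolding g_def[symmetric] using g ab n by simp
    show "(n div gcd j n, j div gcd j n) \<in> Sigma {d. d dvd n} R"
      unfolding g_def[symmetric] using g ab n j cop by (auto simp: R_def intro: Nat.gr0I)
  qed
  finally show ?thesis unfolding w_def using sum_roots_of_unity[OF n, of k] by simp
qed

text \<open>The local factor \<open>c\<^bsub>p\<^sup>j\<^esub>(k)\<close> and its absolute value.\<close>

definition rloc :: "nat \<Rightarrow> nat \<Rightarrow> nat \<Rightarrow> real" where
  "rloc k p j = (if j \<le> multiplicity p k then real p ^ j else 0) -
     (if j = 0 \<or> j - 1 > multiplicity p k then 0 else real p ^ (j - 1))"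

definition rabs :: "nat \<Rightarrow> nat \<Rightarrow> nat \<Rightarrow> real" where
  "rabs k p j = (if j \<le> multiplicity p k then real (totient (p ^ j))
     else if j = multiplicity p k + 1 then real p ^ multiplicity p k else 0)"

lemma abs_rloc:
  assumes p: "prime p"
  shows "\<bar>rloc k p j\<bar> = rabs k p j"
proof (cases j)
  case (Suc i)
  have "real (totient (p ^ Suc i)) = real p ^ Suc i - real p ^ i"
    unfolding totient_prime_power_Suc[OF p] using prime_gt_0_nat[OF p] by (simp add: of_nat_diff algebra_simps)
  moreover have "real p ^ i \<le> real p ^ Suc i" using prime_gt_0_nat[OF p] by (intro power_increasing) auto
  ultimately show ?thesis using Suc by (auto simp: rloc_def rabs_def)
qed (simp add: rloc_def rabs_def)

lemma sum_rloc: "(\<Sum>j\<le>n. rloc k p j) = (if n \<le> multiplicity p k then real p ^ n else 0)"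
  by (induction n) (auto simp: rloc_def)

text \<open>Both sides have the same sum over the divisors of every n, namely n if n | k and 0
  otherwise; strong induction on n inverts this relation.\<close>

lemma ramanujan_sum_eq_prod:
  assumes k: "k > 0" and n: "n > 0"
  shows "ramanujan_sum n k = of_real (\<Prod>p\<in>prime_factors n. rloc k p (multiplicity p n))"
  using n
proof (induction n rule: less_induct)
  case (less n)
  define F where "F = (\<lambda>n. \<Prod>p\<in>prime_factors n. rloc k p (multiplicity p n))"
  have "(\<Sum>d | d dvd n. F d) = (\<Prod>p\<in>prime_factors n. \<Sum>j\<le>multiplicity p n. rloc k p j)"
    unfolding F_def using less.prems by (intro sum_divisors_prod_prime_factors) (auto simp: rloc_def)
  also have "\<dots> = (if n dvd k then real n else 0)"
  proof (cases "n dvd k")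
    case True
    have "(\<Prod>p\<in>prime_factors n. \<Sum>j\<le>multiplicity p n. rloc k p j) = (\<Prod>p\<in>prime_factors n. real p ^ multiplicity p n)"
      unfolding sum_rloc using dvd_imp_multiplicity_le[OF True] k by (intro prod.cong) auto
    also have "\<dots> = real (\<Prod>p\<in>prime_factors n. p ^ multiplicity p n)" by simp
    finally show ?thesis using True prime_factorization_nat[OF less.prems] by simp
  next
    case False
    then obtain p where p: "prime p" "multiplicity p n > multiplicity p k"
      using multiplicity_le_imp_dvd[of n k] less.prems by (metis not_le_imp_less neq0_conv)
    hence "p \<in> prime_factors n" by (auto simp: prime_factors_multiplicity)
    thus ?thesis unfolding sum_rloc using p False by (subst prod_zero) (auto intro!: bexI[of _ p])
  qed
  finally have F: "(\<Sum>d | d dvd n. complex_of_real (F d)) = (if n dvd k then of_nat n else 0)"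
    unfolding of_real_sum[symmetric] by simp
  have fin: "finite {d. d dvd n}" using less.prems by simp
  have split: "(\<Sum>d | d dvd n. f d) = f n + (\<Sum>d | d dvd n \<and> d \<noteq> n. f d)" for f :: "nat \<Rightarrow> complex"
  proof -
    have "{d. d dvd n} = insert n {d. d dvd n \<and> d \<noteq> n}" by auto
    thus ?thesis using fin by (subst \<open>{d. d dvd n} = _\<close>, subst sum.insert) auto
  qed
  have "(\<Sum>d | d dvd n \<and> d \<noteq> n. ramanujan_sum d k) = (\<Sum>d | d dvd n \<and> d \<noteq> n. of_real (F d))"
  proof (rule sum.cong[OF refl])
    fix d assume d: "d \<in> {d. d dvd n \<and> d \<noteq> n}"
    hence "d < n" "d > 0" using less.prems dvd_imp_le[of d n] by (auto intro: Nat.gr0I)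
    thus "ramanujan_sum d k = of_real (F d)" unfolding F_def by (rule less.IH)
  qed
  hence "ramanujan_sum n k + (\<Sum>d | d dvd n \<and> d \<noteq> n. of_real (F d)) = of_real (F n) + (\<Sum>d | d dvd n \<and> d \<noteq> n. of_real (F d))"
    using trans[OF ramanujan_sum_divisors[OF less.prems, of k] F[symmetric]] unfolding split by (simp only:)
  thus ?case unfolding F_def by (simp only: add_right_cancel)
qed

text \<open>The Moebius transform at a single prime: summing over exponents up to n recovers
  \<open>rabs k p n\<close>.\<close>

definition rdiff :: "nat \<Rightarrow> nat \<Rightarrow> nat \<Rightarrow> real" where
  "rdiff k p j = rabs k p j - (if j = 0 then 0 else rabs k p (j - 1))"

text \<open>The Moebius transform of \<open>n \<mapsto> |c\<^sub>n(k)|\<close>.\<close>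

definition rmob :: "nat \<Rightarrow> nat \<Rightarrow> real" where
  "rmob k d = (if d = 0 then 0 else \<Prod>p\<in>prime_factors d. rdiff k p (multiplicity p d))"

lemma rdiff_0 [simp]: "rdiff k p 0 = 1" by (simp add: rdiff_def rabs_def)

lemma sum_rdiff: "(\<Sum>j\<le>n. rdiff k p j) = rabs k p n"
  by (induction n) (auto simp: rdiff_def)

lemma norm_ramanujan_sum:
  assumes k: "k > 0" and n: "n > 0"
  shows "cmod (ramanujan_sum n k) = (\<Sum>d | d dvd n. rmob k d)"
proof -
  have "cmod (ramanujan_sum n k) = (\<Prod>p\<in>prime_factors n. rabs k p (multiplicity p n))"
    unfolding ramanujan_sum_eq_prod[OF k n] norm_of_real abs_prod by (intro prod.cong refl abs_rloc) auto
  also have "\<dots> = (\<Sum>d | d dvd n. \<Prod>p\<in>prime_factors d. rdiff k p (multiplicity p d))"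
    unfolding sum_rdiff[symmetric] by (rule sum_divisors_prod_prime_factors[symmetric, OF n]) simp
  also have "\<dots> = (\<Sum>d | d dvd n. rmob k d)" using n by (intro sum.cong refl) (auto simp: rmob_def)
  finally show ?thesis .
qed

text \<open>N!^T is divisible by every d \<le> N and by p^T for every prime p \<le> N. Its divisors
  therefore exhaust sums over all d as N grows, while each such sum is a finite product of complete
  local factors.\<close>

lemma sum_divisors_fact_power:
  fixes f :: "nat \<Rightarrow> nat \<Rightarrow> 'a :: comm_semiring_1"
  assumes f0: "\<And>p. f p 0 = 1" and f: "\<And>p j. prime p \<Longrightarrow> j > T \<Longrightarrow> f p j = 0" and T: "T > 0"
  shows "(\<Sum>d | d dvd fact N ^ T. \<Prod>p\<in>prime_factors d. f p (multiplicity p d)) =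
         (\<Prod>p | prime p \<and> p \<le> N. \<Sum>j\<le>T. f p j)"
proof -
  define n :: nat where "n = fact N ^ T"
  have n: "n > 0" by (simp add: n_def)
  have pf: "prime_factors n = {p. prime p \<and> p \<le> N}"
    using T by (auto simp: in_prime_factors_iff n_def prime_dvd_power_iff prime_dvd_fact_iff)
  have "(\<Sum>d | d dvd n. \<Prod>p\<in>prime_factors d. f p (multiplicity p d)) =
         (\<Prod>p\<in>prime_factors n. \<Sum>j\<le>multiplicity p n. f p j)"
    using f0 by (intro sum_divisors_prod_prime_factors[OF n])
  also have "\<dots> = (\<Prod>p | prime p \<and> p \<le> N. \<Sum>j\<le>T. f p j)"
  proof (rule prod.cong[OF pf])
    fix p assume "p \<in> {p. prime p \<and> p \<le> N}"
    hence p: "prime p" "p \<le> N" by auto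
    have "p ^ T dvd n" unfolding n_def using p by (intro dvd_power_same) (auto simp: prime_dvd_fact_iff)
    hence "T \<le> multiplicity p n" using n p by (intro multiplicity_geI) auto
    thus "(\<Sum>j\<le>multiplicity p n. f p j) = (\<Sum>j\<le>T. f p j)"
      by (intro sum.mono_neutral_right) (auto simp: f[OF p(1)])
  qed
  finally show ?thesis by (simp add: n_def)
qed

lemma multiplicity_lt:
  fixes p k :: nat
  assumes p: "prime p" and k: "k > 0"
  shows "multiplicity p k < k"
proof -
  have "multiplicity p k < p ^ multiplicity p k" using power_gt_expt[of p] prime_gt_1_nat[OF p] by simp
  also have "\<dots> \<le> k" using k by (intro dvd_imp_le multiplicity_dvd)
  finally show ?thesis .
qed

text \<open>\<open>rabs k p\<close> vanishes beyond the multiplicity plus 1, and the multiplicity is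
  below k, so one bound serves all primes.\<close>

lemma rdiff_eq_0:
  assumes "prime p" "k > 0" "j > k + 2"
  shows "rdiff k p j = 0"
  using multiplicity_lt[of p k] assms by (auto simp: rdiff_def rabs_def)

text \<open>For p not dividing k the values \<open>rabs k p j\<close> are 1, 1, 0, 0, and so on, so
  the differences live on j = 0 and j = 2. This sparseness gives the convergence below.\<close>

lemma rdiff_coprime:
  assumes "\<not> p dvd k"
  shows "rdiff k p j = (if j = 0 then 1 else if j = 2 then -1 else 0)"
proof -
  have m: "multiplicity p k = 0" using assms by (rule not_dvd_imp_multiplicity_0)
  consider "j = 0" | "j = 1" | "j = 2" | "j > 2" by linarith
  thus ?thesis by cases (auto simp: rdiff_def rabs_def m)
qed

lemma rmob_prod:
  assumes d: "d > 0"
  shows "\<bar>rmob k d\<bar> * real d powr s = (\<Prod>p\<in>prime_factors d. \<bar>rdiff k p (multiplicity p d)\<bar> * real (p ^ multiplicity p d) powr s)"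
    and "rmob k d / real (totient d) = (\<Prod>p\<in>prime_factors d. rdiff k p (multiplicity p d) / real (totient (p ^ multiplicity p d)))"
proof -
  have "real d = real (\<Prod>p\<in>prime_factors d. p ^ multiplicity p d)" using prime_factorization_nat[OF d] by simp
  also have "\<dots> = (\<Prod>p\<in>prime_factors d. real (p ^ multiplicity p d))" by (rule of_nat_prod)
  finally have "real d powr s = (\<Prod>p\<in>prime_factors d. real (p ^ multiplicity p d) powr s)"
    by (simp only: prod_powr_distrib)
  thus "\<bar>rmob k d\<bar> * real d powr s = (\<Prod>p\<in>prime_factors d. \<bar>rdiff k p (multiplicity p d)\<bar> * real (p ^ multiplicity p d) powr s)"
    unfolding prod.distrib using d by (simp add: rmob_def abs_prod)
  have "totient d = (\<Prod>p\<in>prime_factors d. totient (p ^ multiplicity p d))"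
    unfolding totient_formula1[OF d]
    by (intro prod.cong refl totient_prime_power[symmetric]) (auto simp: prime_factors_multiplicity)
  thus "rmob k d / real (totient d) = (\<Prod>p\<in>prime_factors d. rdiff k p (multiplicity p d) / real (totient (p ^ multiplicity p d)))"
    using d by (simp add: rmob_def prod_dividef)
qed

lemma dvd_fact_power: "1 \<le> d \<Longrightarrow> d \<le> N \<Longrightarrow> T > 0 \<Longrightarrow> (d::nat) dvd fact N ^ T"
  by (rule dvd_trans[OF dvd_fact dvd_power]) auto

text \<open>Partial sums are bounded by Euler products over p \<le> N. Outside k the local factor is
  1 + p^(-4/3), coming from d = p^2, and 4/3 > 1; the finitely many primes dividing k contribute a
  constant.\<close>

lemma summable_rmob:
  assumes k: "k > 0"
  shows "summable (\<lambda>d. \<bar>rmob k d\<bar> * real d powr (-2/3))"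
proof -
  define T where "T = k + 2"
  have T0: "T > 0" by (simp add: T_def)
  define f where "f = (\<lambda>p j. \<bar>rdiff k p j\<bar> * real (p ^ j) powr (-2/3))"
  define b where "b = (\<lambda>p. \<Sum>j\<le>T. f p j)"
  define Q where "Q = {p. prime p \<and> p dvd k}"
  have Q: "finite Q" unfolding Q_def using k by (intro finite_subset[OF _ finite_divisors_nat[of k]]) auto
  have f_nn: "f p j \<ge> 0" for p j by (simp add: f_def)
  have b1: "b p \<ge> 1" for p
  proof -
    have "f p 0 \<le> b p" unfolding b_def by (rule member_le_sum) (auto simp: f_nn)
    thus ?thesis by (simp add: f_def)
  qed
  have b: "b p = 1 + real p powr (-4/3)" if "\<not> p dvd k" for p
  proof -
    have "b p = (\<Sum>j\<in>{0,2}. f p j)" unfolding b_def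
      by (rule sum.mono_neutral_right) (auto simp: T_def f_def rdiff_coprime[OF that])
    also have "\<dots> = 1 + real (p ^ 2) powr (-2/3)" by (simp add: f_def rdiff_coprime[OF that])
    also have "real (p ^ 2) powr (-2/3) = real p powr (-4/3)"
      by (cases "p = 0") (auto simp: powr_powr simp flip: powr_numeral)
    finally show ?thesis .
  qed
  have sm: "summable (\<lambda>n. real n powr (-4/3))" by (simp add: summable_real_powr_iff)
  define B where "B = exp (\<Sum>n. real n powr (-4/3)) * (\<Prod>p\<in>Q. b p)"
  have bd: "(\<Sum>d<N. \<bar>rmob k d\<bar> * real d powr (-2/3)) \<le> B" for N
  proof -
    define PN where "PN = {p. prime p \<and> p \<le> N}"
    have PN: "finite PN" by (simp add: PN_def)
    have "(\<Sum>d<N. \<bar>rmob k d\<bar> * real d powr (-2/3)) = (\<Sum>d\<in>{1..<N}. \<bar>rmob k d\<bar> * real d powr (-2/3))"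
      by (rule sum.mono_neutral_right) auto
    also have "\<dots> \<le> (\<Sum>d | d dvd fact N ^ T. \<bar>rmob k d\<bar> * real d powr (-2/3))"
      by (rule sum_mono2) (auto simp: T0 intro!: dvd_fact_power)
    also have "\<dots> = (\<Sum>d | d dvd fact N ^ T. \<Prod>p\<in>prime_factors d. f p (multiplicity p d))"
    proof (rule sum.cong[OF refl])
      fix d :: nat assume "d \<in> {d. d dvd fact N ^ T}"
      hence "d > 0" by (auto intro: Nat.gr0I)
      thus "\<bar>rmob k d\<bar> * real d powr (-2/3) = (\<Prod>p\<in>prime_factors d. f p (multiplicity p d))"
        unfolding f_def by (rule rmob_prod(1))
    qed
    also have "\<dots> = (\<Prod>p\<in>PN. b p)" unfolding PN_def b_def
      by (rule sum_divisors_fact_power) (auto simp: f_def T_def rdiff_eq_0[OF _ k])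
    also have "\<dots> \<le> (\<Prod>p\<in>PN. exp (real p powr (-4/3)) * (if p \<in> Q then b p else 1))"
    proof (rule prod_mono)
      fix p assume p: "p \<in> PN"
      have e: "1 + real p powr (-4/3) \<le> exp (real p powr (-4/3))" by (rule exp_ge_add_one_self)
      have "1 * b p \<le> exp (real p powr (-4/3)) * b p" using b1[of p] by (intro mult_right_mono) auto
      thus "0 \<le> b p \<and> b p \<le> exp (real p powr (-4/3)) * (if p \<in> Q then b p else 1)"
        using b1[of p] b[of p] e p by (auto simp: Q_def PN_def)
    qed
    also have "\<dots> = exp (\<Sum>p\<in>PN. real p powr (-4/3)) * (\<Prod>p\<in>PN \<inter> Q. b p)"
      using PN by (simp add: prod.distrib exp_sum prod.If_cases)
    also have "\<dots> \<le> B" unfolding B_def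
    proof (intro mult_mono)
      have "(\<Sum>p\<in>PN. real p powr (-4/3)) \<le> (\<Sum>n. real n powr (-4/3))"
        using sm PN by (intro sum_le_suminf) auto
      thus "exp (\<Sum>p\<in>PN. real p powr (-4/3)) \<le> exp (\<Sum>n. real n powr (-4/3))" by simp
      show "(\<Prod>p\<in>PN \<inter> Q. b p) \<le> (\<Prod>p\<in>Q. b p)" using Q b1 order_trans[OF zero_le_one b1] by (intro prod_mono2) auto
      show "0 \<le> (\<Prod>p\<in>PN \<inter> Q. b p)" using order_trans[OF zero_le_one b1] by (intro prod_nonneg) auto
    qed auto
    finally show ?thesis .
  qed
  show ?thesis by (rule summableI_nonneg_bounded[OF _ bd]) auto
qed

text \<open>The i-th smallest element is at least i + 1, so the product is at least a telescoping
  one; the induction adds the largest element last.\<close>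

lemma prod_one_minus_inverse_ge:
  assumes "finite S" "\<And>p. p \<in> S \<Longrightarrow> p \<ge> 2"
  shows "(\<Prod>p\<in>S. 1 - 1 / real p) \<ge> 1 / (real (card S) + 1)"
  using assms
proof (induction S rule: finite_linorder_max_induct)
  case (insert b A)
  have "A \<subseteq> {2..<b}" using insert by auto
  hence "card A \<le> card {2..<b}" by (intro card_mono) auto
  moreover have "b \<ge> 2" using insert by auto
  ultimately have c: "real b \<ge> real (card A) + 2" by simp
  have "1 / (real (card A) + 2) = (1 - 1 / (real (card A) + 2)) * (1 / (real (card A) + 1))" by (simp add: field_simps)
  also have "\<dots> \<le> (1 - 1 / real b) * (\<Prod>p\<in>A. 1 - 1 / real p)"
  proof (intro mult_mono)
    show "1 - 1 / (real (card A) + 2) \<le> 1 - 1 / real b" using c by (intro diff_left_mono divide_left_mono) auto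
    show "1 / (real (card A) + 1) \<le> (\<Prod>p\<in>A. 1 - 1 / real p)" using insert by auto
  qed (use c in auto)
  finally show ?case using insert by (auto simp: add_ac)
qed auto

text \<open>If d has w prime factors, then 2^w \<le> d, so w/2 \<le> log d \<le> 4 d^(1/4) and w + 1
  \<le> 9 d^(1/4). The product of 1 - 1/p is at least 1/(w + 1).\<close>

lemma totient_ge:
  assumes d: "d > 0"
  shows "real (totient d) \<ge> real d powr (3/4) / 9"
proof -
  define w where "w = card (prime_factors d)"
  have d1: "real d \<ge> 1" using d by simp
  have "(2::nat) ^ w = (\<Prod>p\<in>prime_factors d. 2)" by (simp add: w_def)
  also have "\<dots> \<le> (\<Prod>p\<in>prime_factors d. p ^ multiplicity p d)"
  proof (rule prod_mono)
    fix p assume p: "p \<in> prime_factors d"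
    hence "p \<ge> 2" "multiplicity p d \<ge> 1" by (auto simp: prime_factors_multiplicity prime_ge_2_nat)
    hence "p ^ 1 \<le> p ^ multiplicity p d" by (intro power_increasing) auto
    thus "0 \<le> (2::nat) \<and> 2 \<le> p ^ multiplicity p d" using \<open>p \<ge> 2\<close> by simp
  qed
  also have "\<dots> = d" using prime_factorization_nat[OF d] by simp
  finally have "(2::real) ^ w \<le> real d" by (metis of_nat_le_iff of_nat_numeral of_nat_power)
  hence "ln ((2::real) ^ w) \<le> ln (real d)" using d by (subst ln_le_cancel_iff) auto
  hence "real w * ln 2 \<le> ln (real d)" by (simp add: ln_realpow)
  moreover have "real w * (1/2) \<le> real w * ln 2" using ln_one_plus_ge_half[of 1] by (intro mult_left_mono) auto
  moreover have "ln (real d) \<le> real d powr (1/4) / (1/4)" using d1 by (intro ln_le_powr) auto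
  moreover have "1 \<le> real d powr (1/4)" using d1 by (intro ge_one_powr_ge_zero) auto
  ultimately have w: "real w + 1 \<le> 9 * real d powr (1/4)" by simp
  have "real d powr (3/4) / 9 = real d * (1 / (9 * real d powr (1/4)))"
  proof -
    have "real d powr (3/4) * real d powr (1/4) = real d" unfolding powr_add[symmetric] using d by simp
    thus ?thesis using d by (simp add: field_simps)
  qed
  also have "\<dots> \<le> real d * (1 / (real w + 1))" using w d by (intro mult_left_mono divide_left_mono) auto
  also have "\<dots> \<le> real d * (\<Prod>p\<in>prime_factors d. 1 - 1 / real p)"
    unfolding w_def by (intro mult_left_mono prod_one_minus_inverse_ge) (auto intro!: prime_ge_2_nat)
  finally show ?thesis unfolding totient_formula2 .
qed

text \<open>Rankin's trick: d > D lets the excess exponents 3/4 - 2/3 = 1/12 and 1 - 2/3 = 1/3 be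
  spent on D, leaving the convergent series.\<close>

lemma rmob_tail:
  fixes D :: real
  defines "S \<equiv> \<lambda>k. \<Sum>d. \<bar>rmob k d\<bar> * real d powr (-2/3)"
  assumes k: "k > 0" and A: "finite A" "\<And>d. d \<in> A \<Longrightarrow> D < real d" and D: "D \<ge> 1"
  shows "(\<Sum>d\<in>A. \<bar>rmob k d\<bar> / real (totient d)) \<le> 9 * S k * D powr (-1/12)"
    and "(\<Sum>d\<in>A. \<bar>rmob k d\<bar> / real d) \<le> S k * D powr (-1/3)"
proof -
  define t where "t = (\<lambda>d. \<bar>rmob k d\<bar> * real d powr (-2/3))"
  have tA: "(\<Sum>d\<in>A. t d) \<le> S k" unfolding S_def t_def using A by (intro sum_le_suminf summable_rmob k) auto
  have "(\<Sum>d\<in>A. \<bar>rmob k d\<bar> / real (totient d)) \<le> (\<Sum>d\<in>A. t d * (9 * D powr (-1/12)))"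
  proof (rule sum_mono)
    fix d assume "d \<in> A"
    hence d: "real d > D" "d > 0" using A D by force+
    have "\<bar>rmob k d\<bar> / real (totient d) \<le> \<bar>rmob k d\<bar> / (real d powr (3/4) / 9)"
      using d totient_ge[OF d(2)] by (intro divide_left_mono mult_pos_pos) auto
    also have "\<dots> = \<bar>rmob k d\<bar> * 9 * real d powr (-3/4)" using d by (simp add: powr_minus field_simps)
    also have "real d powr (-3/4) = real d powr (-2/3) * real d powr (-1/12)" by (simp flip: powr_add)
    also have "\<bar>rmob k d\<bar> * 9 * (real d powr (-2/3) * real d powr (-1/12)) \<le> \<bar>rmob k d\<bar> * 9 * (real d powr (-2/3) * D powr (-1/12))"
      using d D by (intro mult_left_mono powr_mono2') auto
    finally show "\<bar>rmob k d\<bar> / real (totient d) \<le> t d * (9 * D powr (-1/12))" by (simp add: t_def mult_ac)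
  qed
  also have "\<dots> = (\<Sum>d\<in>A. t d) * (9 * D powr (-1/12))" by (simp only: sum_distrib_right)
  also have "\<dots> \<le> S k * (9 * D powr (-1/12))" using tA by (intro mult_right_mono) auto
  finally show "(\<Sum>d\<in>A. \<bar>rmob k d\<bar> / real (totient d)) \<le> 9 * S k * D powr (-1/12)" by (simp add: mult_ac)
  have "(\<Sum>d\<in>A. \<bar>rmob k d\<bar> / real d) \<le> (\<Sum>d\<in>A. t d * D powr (-1/3))"
  proof (rule sum_mono)
    fix d assume "d \<in> A"
    hence d: "real d > D" "d > 0" using A D by force+
    have "\<bar>rmob k d\<bar> / real d = \<bar>rmob k d\<bar> * real d powr (-1)" using d by (simp add: powr_minus field_simps)
    also have "real d powr (-1) = real d powr (-2/3) * real d powr (-1/3)" by (simp flip: powr_add)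
    also have "\<bar>rmob k d\<bar> * (real d powr (-2/3) * real d powr (-1/3)) \<le> \<bar>rmob k d\<bar> * (real d powr (-2/3) * D powr (-1/3))"
      using d D by (intro mult_left_mono powr_mono2') auto
    finally show "\<bar>rmob k d\<bar> / real d \<le> t d * D powr (-1/3)" by (simp add: t_def mult_ac)
  qed
  also have "\<dots> = (\<Sum>d\<in>A. t d) * D powr (-1/3)" by (simp only: sum_distrib_right)
  also have "\<dots> \<le> S k * D powr (-1/3)" using tA by (intro mult_right_mono) auto
  finally show "(\<Sum>d\<in>A. \<bar>rmob k d\<bar> / real d) \<le> S k * D powr (-1/3)" .
qed

text \<open>Summation by parts moves the difference from \<open>rabs\<close> to 1/totient(p^j). With
  a the multiplicity, each j from 1 to a then contributes 1 - 1/p, the term j = a + 1 contributes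
  1/p, and all later terms vanish.\<close>

lemma sum_rdiff_totient:
  assumes p: "prime p" and k: "k > 0"
  shows "(\<Sum>j\<le>k+2. rdiff k p j / real (totient (p ^ j))) =
         1 - 1 / (real p * (real p - 1)) + real (multiplicity p k) * (real p - 1) / real p"
proof -
  define a v where "a = multiplicity p k" and "v = (\<lambda>j. 1 / real (totient (p ^ j)))"
  have p2: "real p \<ge> 2" using prime_ge_2_nat[OF p] by simp
  have pf: "1 / (real p - 1) - 1 / (real p * (real p - 1)) = 1 / real p"
  proof -
    define c where "c = real p - 1"
    have c: "c > 0" "real p = c + 1" using p2 by (auto simp: c_def)
    have "1 / c - 1 / ((c + 1) * c) = ((c + 1) - 1) / ((c + 1) * c)" using c by (subst diff_divide_distrib) auto
    also have "\<dots> = 1 / (c + 1)" using c by simp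
    finally show ?thesis using c by simp
  qed
  have tot: "real (totient (p ^ Suc j)) = real p ^ j * (real p - 1)" for j
    unfolding totient_prime_power_Suc[OF p] using p2 by (simp add: of_nat_diff)
  have abel: "(\<Sum>j\<le>n. rdiff k p j * v j) = (\<Sum>j\<le>n. rabs k p j * (v j - v (Suc j))) + rabs k p n * v (Suc n)" for n
    by (induction n) (auto simp: rdiff_def algebra_simps)
  have ak: "a < k" unfolding a_def using p k by (rule multiplicity_lt)
  have "(\<Sum>j\<le>k+2. rdiff k p j / real (totient (p ^ j))) = (\<Sum>j\<le>k+2. rdiff k p j * v j)" by (simp add: v_def)
  also have "\<dots> = (\<Sum>j\<le>k+2. rabs k p j * (v j - v (Suc j)))"
    unfolding abel using ak by (simp add: rabs_def a_def)
  also have "\<dots> = (\<Sum>j\<le>Suc a. rabs k p j * (v j - v (Suc j)))"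
    using ak by (intro sum.mono_neutral_right) (auto simp: rabs_def a_def)
  also have "\<dots> = (\<Sum>j\<le>a. rabs k p j * (v j - v (Suc j))) + rabs k p (Suc a) * (v (Suc a) - v (Suc (Suc a)))" by simp
  also have "(\<Sum>j\<le>a. rabs k p j * (v j - v (Suc j))) = (\<Sum>j\<le>a. real (totient (p ^ j)) * (v j - v (Suc j)))"
    by (intro sum.cong refl) (simp add: rabs_def a_def)
  also have "(\<Sum>j\<le>n. real (totient (p ^ j)) * (v j - v (Suc j))) = 1 - 1 / (real p - 1) + real n * (1 - 1 / real p)" for n
  proof (induction n)
    case 0
    show ?case using tot[of 0] by (simp add: v_def)
  next
    case (Suc n)
    have "real (totient (p ^ Suc n)) * (v (Suc n) - v (Suc (Suc n))) = 1 - 1 / real p"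
    proof -
      define A where "A = real p ^ n * (real p - 1)"
      have "A > 0" using p2 by (simp add: A_def)
      hence "A * (1 / A - 1 / (real p * A)) = 1 - 1 / real p" using p2 by (simp add: field_simps)
      moreover have e: "real p ^ Suc n * (real p - 1) = real p * A" by (simp add: A_def)
      ultimately show ?thesis unfolding v_def tot e A_def[symmetric] by simp
    qed
    hence "(\<Sum>j\<le>Suc n. real (totient (p ^ j)) * (v j - v (Suc j))) = 1 - 1 / (real p - 1) + real n * (1 - 1 / real p) + (1 - 1 / real p)"
      unfolding sum.atMost_Suc Suc.IH by (simp only:)
    thus ?case by (simp only: of_nat_Suc distrib_right mult_1_left add_ac)
  qed
  also have "rabs k p (Suc a) * (v (Suc a) - v (Suc (Suc a))) = 1 / real p"
  proof -
    have "rabs k p (Suc a) = real p ^ a" by (simp add: rabs_def a_def)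
    moreover have "real p ^ a * (1 / (real p ^ a * (real p - 1)) - 1 / (real p ^ Suc a * (real p - 1))) = 1 / (real p - 1) - 1 / (real p * (real p - 1))"
    proof -
      have "B * (1 / (B * c) - 1 / (real p * B * c)) = 1 / c - 1 / (real p * c)" if "B > 0" "c > 0" for B c :: real
        using p2 that by (simp add: field_simps)
      from this[of "real p ^ a" "real p - 1"] show ?thesis using p2 by simp
    qed
    ultimately show ?thesis unfolding v_def tot pf by simp
  qed
  also have "1 - 1 / (real p - 1) + real a * (1 - 1 / real p) + 1 / real p =
     1 - 1 / (real p * (real p - 1)) + real a * (real p - 1) / real p"
  proof -
    have "1 - 1 / real p = (real p - 1) / real p" using p2 by (simp add: diff_divide_distrib)
    thus ?thesis using pf by simp
  qed
  finally show ?thesis by (simp add: a_def)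
qed

text \<open>The ratio of the local factor at q of the Euler product to Artin's factor 1 -
  1/(q(q-1)).\<close>

definition beta :: "nat \<Rightarrow> nat \<Rightarrow> real" where
  "beta k q = 1 + real (multiplicity q k) * (real q - 1)^2 / ((real q)^2 - real q - 1)"

lemma tendsto_artin:
  "(\<lambda>N. \<Prod>p | prime p \<and> p \<le> N. 1 - 1 / (real p * (real p - 1))) \<longlonglongrightarrow> artin_constant"
proof -
  define z where "z = (\<lambda>p::nat. if prime p then - 1 / (real p * (real p - 1)) else 0)"
  have zb: "\<bar>z p\<bar> \<le> 2 * real p powr (-2)" for p
  proof (cases "prime p")
    case True
    hence p: "real p \<ge> 2" using prime_ge_2_nat by force
    have "\<bar>z p\<bar> = 1 / (real p * (real p - 1))" using p True by (simp add: z_def abs_if)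
    also have "\<dots> \<le> 1 / (real p * (real p / 2))" using p by (intro divide_left_mono mult_left_mono mult_pos_pos) auto
    also have "\<dots> = 2 * real p powr (-2)" using p by (simp add: powr_minus field_simps power2_eq_square)
    finally show ?thesis .
  qed (simp add: z_def)
  have "summable (\<lambda>p. \<bar>z p\<bar>)"
    by (rule summable_comparison_test'[of "\<lambda>p. 2 * real p powr (-2)" 0])
       (use zb in \<open>auto intro!: summable_mult simp: summable_real_powr_iff\<close>)
  moreover have "z p \<noteq> -1" for p
  proof (cases "prime p")
    case True
    hence p: "real p \<ge> 2" using prime_ge_2_nat by force
    have "2 * 1 \<le> real p * (real p - 1)" using p by (intro mult_mono) auto
    thus ?thesis using True by (simp add: z_def)
  qed (simp add: z_def)
  ultimately have "convergent_prod (\<lambda>p. 1 + z p)" by (rule summable_imp_convergent_prod_real)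
  hence "(\<lambda>N. \<Prod>p\<le>N. 1 + z p) \<longlonglongrightarrow> prodinf (\<lambda>p. 1 + z p)" by (rule convergent_prod_LIMSEQ)
  also have "(\<lambda>p. 1 + z p) = (\<lambda>p. if prime p then 1 - 1 / (real p * (real p - 1)) else 1)" by (auto simp: z_def)
  also have "prodinf \<dots> = artin_constant" by (simp add: artin_constant_def)
  finally show ?thesis
    by (simp add: prod.If_cases Collect_conj_eq Int_commute atMost_def)
qed

text \<open>The finite Euler products P N are sums over the divisors of a power of N!. For N \<ge> D
  these include all d \<le> D, so P N differs from the truncated sum by a tail that
  \<open>rmob_tail\<close> bounds uniformly in N.\<close>

lemma rmob_totient_sum:
  fixes D :: real
  defines "S \<equiv> \<lambda>k. \<Sum>d. \<bar>rmob k d\<bar> * real d powr (-2/3)"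
  assumes k: "k > 0" and D: "D \<ge> 1"
  shows "\<bar>(\<Sum>d | 1 \<le> d \<and> real d \<le> D. rmob k d / real (totient d)) - artin_constant * (\<Prod>q | prime q \<and> q dvd k. beta k q)\<bar> \<le> 9 * S k * D powr (-1/12)"
proof -
  define T where "T = k + 2"
  have T0: "T > 0" by (simp add: T_def)
  define s where "s = (\<Sum>d | 1 \<le> d \<and> real d \<le> D. rmob k d / real (totient d))"
  define P where "P = (\<lambda>N. \<Prod>p | prime p \<and> p \<le> N. \<Sum>j\<le>k+2. rdiff k p j / real (totient (p ^ j)))"
  have P: "P \<longlonglongrightarrow> artin_constant * (\<Prod>q | prime q \<and> q dvd k. beta k q)"
  proof -
    have Peq: "P N = (\<Prod>p | prime p \<and> p \<le> N. 1 - 1 / (real p * (real p - 1))) * (\<Prod>p | prime p \<and> p \<le> N. beta k p)" for N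
      unfolding P_def prod.distrib[symmetric]
    proof (rule prod.cong[OF refl])
      fix p assume "p \<in> {p. prime p \<and> p \<le> N}"
      hence p: "prime p" by simp
      hence p2: "real p \<ge> 2" using prime_ge_2_nat by force
      have "2 * 1 \<le> real p * (real p - 1)" using p2 by (intro mult_mono) auto
      hence q: "real p ^ 2 - real p - 1 > 0" by (simp add: power2_eq_square algebra_simps)
      have "1 - 1 / (real p * (real p - 1)) = (real p ^ 2 - real p - 1) / (real p * (real p - 1))"
        using p2 by (simp add: field_simps power2_eq_square)
      hence "(1 - 1 / (real p * (real p - 1))) * beta k p = 1 - 1 / (real p * (real p - 1)) + real (multiplicity p k) * (real p - 1)^2 / (real p * (real p - 1))"
        unfolding beta_def distrib_left using q by simp
      also have "real (multiplicity p k) * (real p - 1)^2 / (real p * (real p - 1)) = real (multiplicity p k) * (real p - 1) / real p"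
        using p2 by (simp add: power2_eq_square)
      finally show "(\<Sum>j\<le>k+2. rdiff k p j / real (totient (p ^ j))) = (1 - 1 / (real p * (real p - 1))) * beta k p"
        unfolding sum_rdiff_totient[OF p k] ..
    qed
    \<comment> \<open>\<open>beta k p\<close> is 1 for p not dividing k, so this product is constant
      once N \<ge> k.\<close>
    have bq: "(\<Prod>p | prime p \<and> p \<le> N. beta k p) = (\<Prod>q | prime q \<and> q dvd k. beta k q)" if "N \<ge> k" for N
      by (rule prod.mono_neutral_right)
         (use that k in \<open>auto simp: beta_def not_dvd_imp_multiplicity_0 dest: dvd_imp_le\<close>)
    have "eventually (\<lambda>N. (\<Prod>q | prime q \<and> q dvd k. beta k q) = (\<Prod>p | prime p \<and> p \<le> N. beta k p)) sequentially"
      using eventually_ge_at_top[of k] by eventually_elim (simp add: bq)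
    hence bl: "(\<lambda>N. \<Prod>p | prime p \<and> p \<le> N. beta k p) \<longlonglongrightarrow> (\<Prod>q | prime q \<and> q dvd k. beta k q)"
      by (rule Lim_transform_eventually[OF tendsto_const])
    show ?thesis unfolding Peq[abs_def] by (rule tendsto_mult[OF tendsto_artin bl])
  qed
  have le: "\<bar>P N - s\<bar> \<le> 9 * S k * D powr (-1/12)" if N: "real N \<ge> D" for N
  proof -
    define n :: nat where "n = fact N ^ T"
    have n: "n > 0" by (simp add: n_def)
    have "P N = (\<Sum>d | d dvd n. \<Prod>p\<in>prime_factors d. rdiff k p (multiplicity p d) / real (totient (p ^ multiplicity p d)))"
      unfolding P_def n_def T_def by (rule sum_divisors_fact_power[symmetric]) (auto simp: rdiff_eq_0[OF _ k])
    also have "\<dots> = (\<Sum>d | d dvd n. rmob k d / real (totient d))"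
      using n by (intro sum.cong refl rmob_prod(2)[symmetric]) (auto intro: Nat.gr0I)
    also have "{d. d dvd n} = {d. 1 \<le> d \<and> real d \<le> D} \<union> {d. d dvd n \<and> D < real d}"
    proof (intro equalityI subsetI)
      fix d assume "d \<in> {d. d dvd n}"
      thus "d \<in> {d. 1 \<le> d \<and> real d \<le> D} \<union> {d. d dvd n \<and> D < real d}" using n by (cases d) auto
    next
      fix d assume "d \<in> {d. 1 \<le> d \<and> real d \<le> D} \<union> {d. d dvd n \<and> D < real d}"
      thus "d \<in> {d. d dvd n}" using N T0 by (auto simp: n_def intro!: dvd_fact_power)
    qed
    also have "(\<Sum>d\<in>\<dots>. rmob k d / real (totient d)) = s + (\<Sum>d | d dvd n \<and> D < real d. rmob k d / real (totient d))"
      unfolding s_def by (rule sum.union_disjoint) (use n finite_upto[of D] in auto)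
    finally have "\<bar>P N - s\<bar> = \<bar>\<Sum>d | d dvd n \<and> D < real d. rmob k d / real (totient d)\<bar>" by simp
    also have "\<dots> \<le> (\<Sum>d | d dvd n \<and> D < real d. \<bar>rmob k d / real (totient d)\<bar>)" by (rule sum_abs)
    also have "\<dots> = (\<Sum>d | d dvd n \<and> D < real d. \<bar>rmob k d\<bar> / real (totient d))" by simp
    also have "\<dots> \<le> 9 * S k * D powr (-1/12)" unfolding S_def using n k D by (intro rmob_tail(1)) auto
    finally show ?thesis .
  qed
  have "\<bar>artin_constant * (\<Prod>q | prime q \<and> q dvd k. beta k q) - s\<bar> \<le> 9 * S k * D powr (-1/12)"
  proof (rule tendsto_upperbound)
    show "(\<lambda>N. \<bar>P N - s\<bar>) \<longlonglongrightarrow> \<bar>artin_constant * (\<Prod>q | prime q \<and> q dvd k. beta k q) - s\<bar>"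
      by (intro tendsto_intros P)
    have "eventually (\<lambda>N. real N \<ge> D) sequentially" by real_asymp
    thus "eventually (\<lambda>N. \<bar>P N - s\<bar> \<le> 9 * S k * D powr (-1/12)) sequentially"
      by eventually_elim (rule le)
  qed simp
  thus ?thesis unfolding s_def by (simp add: abs_minus_commute)
qed

section \<open>Splitting the divisors and the final estimate\<close>

lemma card_primes_1_mod_le:
  assumes d: "d > 0" and x: "x \<ge> 0"
  shows "real (card {p. prime p \<and> real p \<le> x \<and> [p = 1] (mod d)}) \<le> x / real d"
proof -
  have "{p. prime p \<and> real p \<le> x \<and> [p = 1] (mod d)} \<subseteq> (\<lambda>m. 1 + d * m) ` {1..nat \<lfloor>x / real d\<rfloor>}"
  proof safe
    fix p :: nat assume p: "prime p" "real p \<le> x" "[p = 1] (mod d)"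
    have p1: "p > 1" by (rule prime_gt_1_nat[OF p(1)])
    hence "d dvd p - 1" using p(3) by (simp add: cong_altdef_nat)
    then obtain m where m: "p - 1 = d * m" by blast
    hence pm: "p = 1 + d * m" using p1 by simp
    have "m \<ge> 1" using m p1 by (cases m) auto
    moreover have "real d * real m \<le> x" using p(2) pm by simp
    hence "real m \<le> x / real d" using d by (simp add: pos_le_divide_eq mult.commute)
    ultimately show "p \<in> (\<lambda>m. 1 + d * m) ` {1..nat \<lfloor>x / real d\<rfloor>}" using pm by (auto simp: le_nat_floor)
  qed
  hence "card {p. prime p \<and> real p \<le> x \<and> [p = 1] (mod d)} \<le> card {1..nat \<lfloor>x / real d\<rfloor>}"
    by (rule surj_card_le[rotated]) auto
  hence "real (card {p. prime p \<and> real p \<le> x \<and> [p = 1] (mod d)}) \<le> real (nat \<lfloor>x / real d\<rfloor>)" by simp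
  also have "\<dots> \<le> x / real d" using x by simp
  finally show ?thesis .
qed

text \<open>Z may reach beyond x, where no prime up to x is 1 modulo d; this covers the case in
  which the cut-off D exceeds x.\<close>

lemma sum_norm_ramanujan_primes:
  assumes k: "k > 0" and Z: "finite Z" "\<And>d. d \<in> Z \<Longrightarrow> d > 0" "\<And>d. d > 0 \<Longrightarrow> real d \<le> x \<Longrightarrow> d \<in> Z"
  shows "(\<Sum>p | prime p \<and> real p \<le> x. cmod (ramanujan_sum (p - 1) k)) =
         (\<Sum>d\<in>Z. rmob k d * real (card {p. prime p \<and> real p \<le> x \<and> [p = 1] (mod d)}))"
proof -
  define Pr where "Pr = {p. prime p \<and> real p \<le> x}"
  have Pr: "finite Pr" unfolding Pr_def
    by (rule finite_subset[OF _ finite_upto[of x]]) (auto dest: prime_gt_0_nat)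
  have p1: "p > 1" if "p \<in> Pr" for p using that prime_gt_1_nat by (auto simp: Pr_def)
  have "(\<Sum>p\<in>Pr. cmod (ramanujan_sum (p - 1) k)) = (\<Sum>p\<in>Pr. \<Sum>d\<in>Z. if d dvd p - 1 then rmob k d else 0)"
  proof (rule sum.cong[OF refl])
    fix p assume p: "p \<in> Pr"
    have "cmod (ramanujan_sum (p - 1) k) = (\<Sum>d | d dvd p - 1. rmob k d)"
      using p1[OF p] k by (intro norm_ramanujan_sum) auto
    also have "{d. d dvd p - 1} = Z \<inter> {d. d dvd p - 1}"
    proof safe
      fix d assume d: "d dvd p - 1"
      hence "d \<le> p - 1" using p1[OF p] by (intro dvd_imp_le) auto
      moreover have "d > 0" using d p1[OF p] by (auto intro: Nat.gr0I)
      ultimately show "d \<in> Z" using p by (intro Z(3)) (auto simp: Pr_def)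
    qed
    finally show "cmod (ramanujan_sum (p - 1) k) = (\<Sum>d\<in>Z. if d dvd p - 1 then rmob k d else 0)"
      using Z(1) by (simp add: sum.If_cases)
  qed
  also have "\<dots> = (\<Sum>d\<in>Z. \<Sum>p\<in>Pr. if d dvd p - 1 then rmob k d else 0)" by (rule sum.swap)
  also have "\<dots> = (\<Sum>d\<in>Z. rmob k d * real (card {p. prime p \<and> real p \<le> x \<and> [p = 1] (mod d)}))"
  proof (rule sum.cong[OF refl])
    fix d
    have "d dvd p - 1 \<longleftrightarrow> [p = 1] (mod d)" if "p \<in> Pr" for p using p1[OF that] by (simp add: cong_altdef_nat)
    hence "Pr \<inter> {p. d dvd p - 1} = Pr \<inter> {p. [p = 1] (mod d)}" by blast
    also have "\<dots> = {p. prime p \<and> real p \<le> x \<and> [p = 1] (mod d)}" by (auto simp: Pr_def)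
    finally show "(\<Sum>p\<in>Pr. if d dvd p - 1 then rmob k d else 0) = rmob k d * real (card {p. prime p \<and> real p \<le> x \<and> [p = 1] (mod d)})"
      using Pr by (simp add: sum.If_cases)
  qed
  finally show ?thesis by (simp add: Pr_def)
qed

theorem theorem6:
  fixes k :: nat and H :: real
  assumes "k > 0" and "H > 0"
  shows "(\<lambda>x::real.
            (\<Sum>p | prime p \<and> real p \<le> x. cmod (ramanujan_sum (p - 1) k))
            - artin_constant
              * (\<Prod>q | prime q \<and> q dvd k.
                   1 + real (multiplicity q k) * (real q - 1)^2
                       / ((real q)^2 - real q - 1))
              * Li x)
         \<in> O[at_top](\<lambda>x. x / ln x powr H)"
proof -
  note k = assms(1) and H = assms(2)
  define K where "K = artin_constant * (\<Prod>q | prime q \<and> q dvd k. beta k q)"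
  define S where "S = (\<Sum>d. \<bar>rmob k d\<bar> * real d powr (-2/3))"
  have S0: "S \<ge> 0" unfolding S_def by (intro suminf_nonneg summable_rmob k) auto
  \<comment> \<open>The range d \<le> D loses D^(8/3) = (log x)^(32H), so m \<ge> 33H still leaves
    the factor (log x)^(-H).\<close>
  define m where "m = nat \<lceil>33 * H\<rceil>"
  have m: "real m \<ge> 33 * H" unfolding m_def by linarith
  obtain C where C: "C > 0" "\<And>q x. q > 0 \<Longrightarrow> x \<ge> 4 \<Longrightarrow>
     \<bar>real (card {p. prime p \<and> real p \<le> x \<and> [p = 1] (mod q)}) - Li x / real (totient q)\<bar> \<le> C * real q ^ 2 * (x / ln x ^ m)"
    using primes_1_mod by blast
  have main: "\<bar>(\<Sum>p | prime p \<and> real p \<le> x. cmod (ramanujan_sum (p - 1) k)) - K * Li x\<bar> \<le> (C * S + S + 18 * S) * (x / ln x powr H)"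
    if x: "x \<ge> 4" for x
  proof -
    \<comment> \<open>With D = l^(12H) the weakest saving, D^(-1/12) from the totient tail, is
      exactly l^(-H).\<close>
    define l D where "l = ln x" and "D = l powr (12 * H)"
    have l: "l \<ge> 1" unfolding l_def by (rule ln_ge_1[OF x])
    have D: "D \<ge> 1" unfolding D_def using l H by (intro ge_one_powr_ge_zero) auto
    define \<pi> where "\<pi> = (\<lambda>d. real (card {p. prime p \<and> real p \<le> x \<and> [p = 1] (mod d)}))"
    define Z1 Z2 where "Z1 = {d::nat. 1 \<le> d \<and> real d \<le> D}" and "Z2 = {d::nat. 1 \<le> d \<and> D < real d \<and> real d \<le> x}"
    have fin: "finite Z1" unfolding Z1_def by (rule finite_upto)
    have fin2: "finite Z2" unfolding Z2_def by (rule finite_subset[OF _ finite_upto[of x]]) auto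
    have "(\<Sum>p | prime p \<and> real p \<le> x. cmod (ramanujan_sum (p - 1) k)) = (\<Sum>d\<in>Z1 \<union> Z2. rmob k d * \<pi> d)"
      unfolding \<pi>_def using fin fin2 by (intro sum_norm_ramanujan_primes[OF k]) (auto simp: Z1_def Z2_def)
    also have "\<dots> = (\<Sum>d\<in>Z1. rmob k d * \<pi> d) + (\<Sum>d\<in>Z2. rmob k d * \<pi> d)"
      using fin fin2 by (intro sum.union_disjoint) (auto simp: Z1_def Z2_def)
    also have "(\<Sum>d\<in>Z1. rmob k d * \<pi> d) = (\<Sum>d\<in>Z1. rmob k d * (\<pi> d - Li x / real (totient d))) + Li x * (\<Sum>d\<in>Z1. rmob k d / real (totient d))"
      by (simp add: right_diff_distrib sum_subtractf sum_distrib_left mult_ac)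
    finally have eq: "(\<Sum>p | prime p \<and> real p \<le> x. cmod (ramanujan_sum (p - 1) k)) - K * Li x =
       (\<Sum>d\<in>Z1. rmob k d * (\<pi> d - Li x / real (totient d))) + (\<Sum>d\<in>Z2. rmob k d * \<pi> d) +
       Li x * ((\<Sum>d\<in>Z1. rmob k d / real (totient d)) - K)" by (simp add: algebra_simps)
    have lH: "l powr (- (c * H)) \<le> l powr (- H)" if "c \<ge> 1" for c
      using l H that by (intro powr_mono) auto
    have b1: "\<bar>\<Sum>d\<in>Z1. rmob k d * (\<pi> d - Li x / real (totient d))\<bar> \<le> C * S * (x * l powr (-H))"
    proof -
      have "\<bar>\<Sum>d\<in>Z1. rmob k d * (\<pi> d - Li x / real (totient d))\<bar> \<le> (\<Sum>d\<in>Z1. (\<bar>rmob k d\<bar> * real d powr (-2/3)) * (C * (D powr (8/3)) * (x / l ^ m)))"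
      proof (rule order_trans[OF sum_abs], rule sum_mono)
        fix d assume "d \<in> Z1"
        hence d: "d > 0" "real d \<le> D" by (auto simp: Z1_def)
        have "\<bar>rmob k d * (\<pi> d - Li x / real (totient d))\<bar> \<le> \<bar>rmob k d\<bar> * (C * real d ^ 2 * (x / l ^ m))"
          unfolding abs_mult \<pi>_def l_def by (intro mult_left_mono C(2) d x) auto
        \<comment> \<open>The part d^(-2/3) goes into the convergent series S, and the excess
          d^(8/3) is bounded by the power of D.\<close>
        also have "real d ^ 2 = real d powr (-2/3) * real d powr (8/3)"
          using d by (simp flip: powr_add powr_numeral)
        also have "\<bar>rmob k d\<bar> * (C * (real d powr (-2/3) * real d powr (8/3)) * (x / l ^ m)) \<le>
            \<bar>rmob k d\<bar> * (C * (real d powr (-2/3) * D powr (8/3)) * (x / l ^ m))"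
          using d C(1) x l by (intro mult_left_mono mult_right_mono powr_mono2) auto
        finally show "\<bar>rmob k d * (\<pi> d - Li x / real (totient d))\<bar> \<le> (\<bar>rmob k d\<bar> * real d powr (-2/3)) * (C * (D powr (8/3)) * (x / l ^ m))"
          by (simp only: mult_ac)
      qed
      also have "\<dots> = (\<Sum>d\<in>Z1. \<bar>rmob k d\<bar> * real d powr (-2/3)) * (C * (D powr (8/3)) * (x / l ^ m))"
        by (simp only: sum_distrib_right)
      also have "\<dots> \<le> S * (C * (D powr (8/3)) * (x / l ^ m))"
        using C(1) x l fin unfolding S_def by (intro mult_right_mono sum_le_suminf summable_rmob k) auto
      also have "D powr (8/3) = l powr (32 * H)" unfolding D_def powr_powr by simp
      also have "S * (C * l powr (32 * H) * (x / l ^ m)) = C * S * (x * (l powr (32 * H) / l powr real m))"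
        using l by (simp add: powr_realpow)
      also have "l powr (32 * H) / l powr real m = l powr (32 * H - real m)" by (simp add: powr_diff)
      also have "C * S * (x * l powr (32 * H - real m)) \<le> C * S * (x * l powr (-H))"
        using C(1) S0 x l m by (intro mult_left_mono powr_mono) auto
      finally show ?thesis .
    qed
    have b2: "\<bar>\<Sum>d\<in>Z2. rmob k d * \<pi> d\<bar> \<le> S * (x * l powr (-H))"
    proof -
      have "\<bar>\<Sum>d\<in>Z2. rmob k d * \<pi> d\<bar> \<le> (\<Sum>d\<in>Z2. x * (\<bar>rmob k d\<bar> / real d))"
      proof (rule order_trans[OF sum_abs], rule sum_mono)
        fix d assume "d \<in> Z2"
        hence "\<bar>rmob k d * \<pi> d\<bar> \<le> \<bar>rmob k d\<bar> * (x / real d)"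
          unfolding abs_mult using card_primes_1_mod_le[of d x] x by (intro mult_left_mono) (auto simp: Z2_def \<pi>_def)
        thus "\<bar>rmob k d * \<pi> d\<bar> \<le> x * (\<bar>rmob k d\<bar> / real d)" by (simp add: mult_ac)
      qed
      also have "\<dots> = x * (\<Sum>d\<in>Z2. \<bar>rmob k d\<bar> / real d)" by (simp only: sum_distrib_left)
      also have "\<dots> \<le> x * (S * D powr (-1/3))"
        unfolding S_def using x fin2 D by (intro mult_left_mono rmob_tail(2) k) (auto simp: Z2_def)
      also have "D powr (-1/3) = l powr (- (4 * H))" unfolding D_def powr_powr by simp
      also have "x * (S * l powr (- (4 * H))) \<le> x * (S * l powr (-H))"
        using x S0 by (intro mult_left_mono lH) auto
      finally show ?thesis by (simp only: mult_ac)
    qed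
    have b3: "\<bar>Li x * ((\<Sum>d\<in>Z1. rmob k d / real (totient d)) - K)\<bar> \<le> 18 * S * (x * l powr (-H))"
    proof -
      have "\<bar>(\<Sum>d\<in>Z1. rmob k d / real (totient d)) - K\<bar> \<le> 9 * S * D powr (-1/12)"
        unfolding Z1_def K_def S_def by (rule rmob_totient_sum[OF k D])
      moreover have "D powr (-1/12) = l powr (-H)" unfolding D_def powr_powr by simp
      moreover have "\<bar>Li x\<bar> \<le> 2 * x" using Li_bounds[of x] x by simp
      ultimately have "\<bar>Li x * ((\<Sum>d\<in>Z1. rmob k d / real (totient d)) - K)\<bar> \<le> (2 * x) * (9 * S * l powr (-H))"
        unfolding abs_mult using x by (intro mult_mono) auto
      thus ?thesis by (simp add: mult_ac)
    qed
    have X: "x * l powr (-H) = x / ln x powr H" by (simp add: powr_minus field_simps l_def)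
    show ?thesis unfolding eq distrib_right X[symmetric] using b1 b2 b3 by linarith
  qed
  have "(\<lambda>x. (\<Sum>p | prime p \<and> real p \<le> x. cmod (ramanujan_sum (p - 1) k)) - K * Li x) \<in> O[at_top](\<lambda>x. x / ln x powr H)"
  proof (rule bigoI[of _ "C * S + S + 18 * S"])
    show "eventually (\<lambda>x. norm ((\<Sum>p | prime p \<and> real p \<le> x. cmod (ramanujan_sum (p - 1) k)) - K * Li x) \<le>
        (C * S + S + 18 * S) * norm (x / ln x powr H)) at_top"
      using eventually_ge_at_top[of 4]
    proof eventually_elim
      case (elim x)
      thus ?case using main[of x] by simp
    qed
  qed
  thus ?thesis unfolding K_def beta_def .
qed

end
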